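(* Let $(R,\mathfrak m)$ be a Cohen-Macaulay local ring with $R/\mathfrak m=k$ infinite. Let $\mathcal F=\{I_n\}_{n\in\mathbb N}$ be an equimultiple good filtration such that $\operatorname{grade}\operatorname{gr}_{\mathcal F}(R)_+\ge l(\mathcal F)=r$ and $F(\mathcal F)$ is Cohen-Macaulay. Suppose $\mu(I_n)<\binom{n+r}{r}$ for some $n\ge1$. Then there exist $r$ general elements $x_1,\dots,x_r\in I_1$ such that $I_m=(x_1,\dots,x_r)I_{m-1}$ for all $m\ge n$.
   Context: $\mathbb N=\{0,1,2,\dots\}$. A filtration $\mathcal F=\{I_n\}_{n\in\mathbb N}$ is a family of ideals of $R$ with $I_0=R$, $I_{n+1}\subseteq I_n$ and $I_nI_m\subseteq I_{n+m}$ for all $n,m$. It is good if the Rees algebra $\mathcal R(\mathcal F)=\bigoplus_{n\ge0}I_nt^n$ is a finite module over $\bigoplus_{n\ge0}I_1^nt^n$. Associated graded ring: $\operatorname{gr}_{\mathcal F}(R)=\bigoplus_{n\ge0}I_n/I_{n+1}$, and $\operatorname{gr}_{\mathcal F}(R)_+=\bigoplus_{n\ge1}I_n/I_{n+1}$. Fiber cone: $F(\mathcal F)=\bigoplus_{n\ge0}I_n/\mathfrak mI_n$. Analytic spread: $l(\mathcal F)=\dim F(\mathcal F)$ (Krull dimension). $\mathcal F$ is equimultiple if $l(\mathcal F)=\operatorname{ht}I_1$. $\mu(I)$ is the minimal number of generators of $I$. General elements: "there exist $r$ general elements $x_1,\dots,x_r\in I_1$ such that $\mathcal P$ holds" means that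 there is a non-empty Zariski-open subset $U$ of $(I_1/\mathfrak mI_1)^r$ such that $\mathcal P$ holds for all $x_1,\dots,x_r\in I_1$ with $(x_1+\mathfrak mI_1,\dots,x_r+\mathfrak mI_1)\in U$. Here a finite-dimensional $k$-vector space is identified with $k^N$ by choosing a basis, and a non-empty Zariski-open subset is a non-empty finite union of sets $\{w:f(w)\ne0\}$ with $f$ a non-zero polynomial. *)

theory Defs
  imports
    "HOL-Algebra.Ring_Divisibility"
    "HOL-Algebra.Ideal_Product"
    "HOL-Algebra.QuotRing"
    "HOL-Algebra.UnivPoly"
    "HOL-Algebra.Indexed_Polynomials"
    "HOL-Library.Extended_Nat"
begin

section \<open>Dimension, height, grade\<close>

definition prime_chain :: "('a, 'b) ring_scheme \<Rightarrow> nat \<Rightarrow> (nat \<Rightarrow> 'a set) \<Rightarrow> bool" where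
  "prime_chain S n P \<longleftrightarrow> (\<forall>i\<le>n. primeideal (P i) S) \<and> (\<forall>i<n. P i \<subset> P (Suc i))"

text \<open>On the zero ring this gives \<open>0\<close> (the supremum of the empty set in \<^typ>\<open>enat\<close>).\<close>

definition krull_dim :: "('a, 'b) ring_scheme \<Rightarrow> enat" where
  "krull_dim S = Sup {enat n | n P. prime_chain S n P}"

definition prime_height :: "('a, 'b) ring_scheme \<Rightarrow> 'a set \<Rightarrow> enat" where
  "prime_height S P = Sup {enat n | n Q. prime_chain S n Q \<and> Q n = P}"

text \<open>The unit ideal has height \<open>\<infinity>\<close>.\<close>

definition height :: "('a, 'b) ring_scheme \<Rightarrow> 'a set \<Rightarrow> enat" where
  "height S J = Inf {prime_height S P | P. primeideal P S \<and> J \<subseteq> P}"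

text \<open>The middle condition says that \<open>x\<^sub>i\<close> is a nonzerodivisor modulo \<open>(x\<^sub>1, \<dots>, x\<^bsub>i-1\<^esub>)\<close>.\<close>

definition regular_sequence :: "('a, 'b) ring_scheme \<Rightarrow> 'a list \<Rightarrow> bool" where
  "regular_sequence S xs \<longleftrightarrow>
     set xs \<subseteq> carrier S \<and>
     (\<forall>i<length xs. \<forall>a\<in>carrier S.
        xs ! i \<otimes>\<^bsub>S\<^esub> a \<in> Idl\<^bsub>S\<^esub> (set (take i xs)) \<longrightarrow> a \<in> Idl\<^bsub>S\<^esub> (set (take i xs))) \<and>
     Idl\<^bsub>S\<^esub> (set xs) \<noteq> carrier S"

text \<open>The supremum of the lengths of regular sequences in \<open>J\<close>; the unit ideal has grade \<open>\<infinity>\<close>.\<close>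

definition grade :: "('a, 'b) ring_scheme \<Rightarrow> 'a set \<Rightarrow> enat" where
  "grade S J =
     (if J = carrier S then \<infinity>
      else Sup {enat (length xs) | xs. regular_sequence S xs \<and> set xs \<subseteq> J})"


section \<open>Cohen-Macaulay rings\<close>

text \<open>Local rings are Noetherian.\<close>

definition local_ring :: "('a, 'b) ring_scheme \<Rightarrow> 'a set \<Rightarrow> bool" where
  "local_ring S \<mm> \<longleftrightarrow> cring S \<and> noetherian_ring S \<and> (\<forall>M. maximalideal M S \<longleftrightarrow> M = \<mm>)"

definition cohen_macaulay_local :: "('a, 'b) ring_scheme \<Rightarrow> 'a set \<Rightarrow> bool" where
  "cohen_macaulay_local S \<mm> \<longleftrightarrow> local_ring S \<mm> \<and> grade S \<mm> = krull_dim S"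

definition fraction_rel ::
    "('a, 'b) ring_scheme \<Rightarrow> 'a set \<Rightarrow> (('a \<times> 'a) \<times> ('a \<times> 'a)) set" where
  "fraction_rel S P =
     {((a, s), (b, t)). a \<in> carrier S \<and> b \<in> carrier S \<and> s \<in> carrier S - P \<and> t \<in> carrier S - P \<and>
        (\<exists>u\<in>carrier S - P. u \<otimes>\<^bsub>S\<^esub> (a \<otimes>\<^bsub>S\<^esub> t) = u \<otimes>\<^bsub>S\<^esub> (b \<otimes>\<^bsub>S\<^esub> s))}"

text \<open>The localization of \<open>S\<close> at the prime ideal \<open>P\<close>; its elements are the classes \<open>a/s\<close>.\<close>

definition localization :: "('a, 'b) ring_scheme \<Rightarrow> 'a set \<Rightarrow> ('a \<times> 'a) set ring" where
  "localization S P =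
     \<lparr>carrier = (carrier S \<times> (carrier S - P)) // fraction_rel S P,
      monoid.mult = (\<lambda>x y. \<Union>(a, s)\<in>x. \<Union>(b, t)\<in>y.
                fraction_rel S P `` {(a \<otimes>\<^bsub>S\<^esub> b, s \<otimes>\<^bsub>S\<^esub> t)}),
      one = fraction_rel S P `` {(\<one>\<^bsub>S\<^esub>, \<one>\<^bsub>S\<^esub>)},
      zero = fraction_rel S P `` {(\<zero>\<^bsub>S\<^esub>, \<one>\<^bsub>S\<^esub>)},
      add = (\<lambda>x y. \<Union>(a, s)\<in>x. \<Union>(b, t)\<in>y.
                fraction_rel S P `` {(a \<otimes>\<^bsub>S\<^esub> t \<oplus>\<^bsub>S\<^esub> b \<otimes>\<^bsub>S\<^esub> s, s \<otimes>\<^bsub>S\<^esub> t)})\<rparr>"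

definition cohen_macaulay :: "('a, 'b) ring_scheme \<Rightarrow> bool" where
  "cohen_macaulay S \<longleftrightarrow>
     cring S \<and> noetherian_ring S \<and>
     (\<forall>M. maximalideal M S \<longrightarrow> (\<exists>\<nn>. cohen_macaulay_local (localization S M) \<nn>))"


section \<open>Filtrations and their blowup algebras\<close>

definition filtration :: "('a, 'b) ring_scheme \<Rightarrow> (nat \<Rightarrow> 'a set) \<Rightarrow> bool" where
  "filtration R I \<longleftrightarrow>
     (\<forall>n. ideal (I n) R) \<and> I 0 = carrier R \<and> (\<forall>n. I (Suc n) \<subseteq> I n) \<and>
     (\<forall>n m. I n \<cdot>\<^bsub>R\<^esub> I m \<subseteq> I (n + m))"

text \<open>\<open>\<Oplus>\<^sub>n I\<^sub>n t\<^sup>n\<close> as a subring of the polynomial ring \<open>R[t]\<close>.\<close>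

definition rees_algebra :: "('a, 'b) ring_scheme \<Rightarrow> (nat \<Rightarrow> 'a set) \<Rightarrow> ('a, nat \<Rightarrow> 'a) up_ring" where
  "rees_algebra R I =
     (UP R)\<lparr>carrier := {p \<in> carrier (UP R). \<forall>n. coeff (UP R) p n \<in> I n}\<rparr>"

definition finite_over :: "('a, 'b) ring_scheme \<Rightarrow> 'a set \<Rightarrow> bool" where
  "finite_over S A \<longleftrightarrow>
     (\<exists>G\<subseteq>carrier S. finite G \<and> carrier S = {\<Oplus>\<^bsub>S\<^esub>g\<in>G. c g \<otimes>\<^bsub>S\<^esub> g | c. c \<in> G \<rightarrow> A})"

definition good_filtration :: "('a, 'b) ring_scheme \<Rightarrow> (nat \<Rightarrow> 'a set) \<Rightarrow> bool" where
  "good_filtration R I \<longleftrightarrow>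
     filtration R I \<and>
     finite_over (rees_algebra R I) (carrier (rees_algebra R (\<lambda>n. I 1 [^]\<^bsub>ideals_set R\<^esub> n)))"

text \<open>
  The graded ring \<open>\<Oplus>\<^sub>n I\<^sub>n/K\<^sub>n\<close>, for ideals \<open>K\<^sub>n \<subseteq> I\<^sub>n\<close> with \<open>I\<^sub>m I\<^sub>n \<subseteq> I\<^bsub>m+n\<^esub>\<close> and
  \<open>I\<^sub>m K\<^sub>n \<subseteq> K\<^bsub>m+n\<^esub>\<close>. An element is the finitely supported family of its homogeneous components
  \<open>f n \<in> I\<^sub>n/K\<^sub>n\<close>; the product is computed on representatives \<open>a i\<close>, \<open>b i\<close> of the components.
\<close>

definition graded_quotient ::
    "('a, 'b) ring_scheme \<Rightarrow> (nat \<Rightarrow> 'a set) \<Rightarrow> (nat \<Rightarrow> 'a set) \<Rightarrow> (nat \<Rightarrow> 'a set) ring" where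
  "graded_quotient R I K =
     \<lparr>carrier = {f. (\<forall>n. \<exists>a\<in>I n. f n = K n +>\<^bsub>R\<^esub> a) \<and> finite {n. f n \<noteq> K n}},
      monoid.mult = (\<lambda>f g n. \<Union>a\<in>{a. \<forall>i. a i \<in> f i}. \<Union>b\<in>{b. \<forall>i. b i \<in> g i}.
                K n +>\<^bsub>R\<^esub> (\<Oplus>\<^bsub>R\<^esub>i\<in>{..n}. a i \<otimes>\<^bsub>R\<^esub> b (n - i))),
      one = (\<lambda>n. if n = 0 then K 0 +>\<^bsub>R\<^esub> \<one>\<^bsub>R\<^esub> else K n),
      zero = K,
      add = (\<lambda>f g n. f n <+>\<^bsub>R\<^esub> g n)\<rparr>"

definition associated_graded ::
    "('a, 'b) ring_scheme \<Rightarrow> (nat \<Rightarrow> 'a set) \<Rightarrow> (nat \<Rightarrow> 'a set) ring" where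
  "associated_graded R I = graded_quotient R I (\<lambda>n. I (Suc n))"

definition associated_graded_plus ::
    "('a, 'b) ring_scheme \<Rightarrow> (nat \<Rightarrow> 'a set) \<Rightarrow> (nat \<Rightarrow> 'a set) set" where
  "associated_graded_plus R I =
     {f \<in> carrier (associated_graded R I). f 0 = \<zero>\<^bsub>associated_graded R I\<^esub> 0}"

definition fiber_cone ::
    "('a, 'b) ring_scheme \<Rightarrow> 'a set \<Rightarrow> (nat \<Rightarrow> 'a set) \<Rightarrow> (nat \<Rightarrow> 'a set) ring" where
  "fiber_cone R \<mm> I = graded_quotient R I (\<lambda>n. \<mm> \<cdot>\<^bsub>R\<^esub> I n)"

definition analytic_spread ::
    "('a, 'b) ring_scheme \<Rightarrow> 'a set \<Rightarrow> (nat \<Rightarrow> 'a set) \<Rightarrow> enat" where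
  "analytic_spread R \<mm> I = krull_dim (fiber_cone R \<mm> I)"

definition equimultiple :: "('a, 'b) ring_scheme \<Rightarrow> 'a set \<Rightarrow> (nat \<Rightarrow> 'a set) \<Rightarrow> bool" where
  "equimultiple R \<mm> I \<longleftrightarrow> analytic_spread R \<mm> I = height R (I 1)"

definition min_generators :: "('a, 'b) ring_scheme \<Rightarrow> 'a set \<Rightarrow> nat" where
  "min_generators R J = (LEAST k. \<exists>A\<subseteq>carrier R. finite A \<and> card A = k \<and> J = Idl\<^bsub>R\<^esub> A)"


section \<open>General elements\<close>

text \<open>
  \<open>J/\<mm>J\<close> as a vector space over \<open>R/\<mm>\<close>. The ring fields \<open>mult\<close> and \<open>one\<close> of the record
  \<^typ>\<open>('a, 'b) module\<close> play no role for modules and are left undefined, here and below.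
\<close>

definition fiber_space ::
    "('a, 'b) ring_scheme \<Rightarrow> 'a set \<Rightarrow> 'a set \<Rightarrow> ('a set, 'a set) module" where
  "fiber_space R \<mm> J =
     \<lparr>carrier = {\<mm> \<cdot>\<^bsub>R\<^esub> J +>\<^bsub>R\<^esub> x | x. x \<in> J}, monoid.mult = undefined, one = undefined,
      zero = \<mm> \<cdot>\<^bsub>R\<^esub> J, add = set_add R,
      smult = (\<lambda>\<alpha> v. \<Union>a\<in>\<alpha>. \<Union>x\<in>v. \<mm> \<cdot>\<^bsub>R\<^esub> J +>\<^bsub>R\<^esub> (a \<otimes>\<^bsub>R\<^esub> x))\<rparr>"

definition module_power :: "('k, 'v) module \<Rightarrow> nat \<Rightarrow> ('k, nat \<Rightarrow> 'v) module" where
  "module_power V r =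
     \<lparr>carrier = {..<r} \<rightarrow>\<^sub>E carrier V, monoid.mult = undefined, one = undefined,
      zero = (\<lambda>i\<in>{..<r}. \<zero>\<^bsub>V\<^esub>), add = (\<lambda>v w. \<lambda>i\<in>{..<r}. v i \<oplus>\<^bsub>V\<^esub> w i),
      smult = (\<lambda>\<alpha> v. \<lambda>i\<in>{..<r}. \<alpha> \<odot>\<^bsub>V\<^esub> v i)\<rparr>"

definition lin_comb ::
    "('k, 'w) module \<Rightarrow> 'w set \<Rightarrow> ('w \<Rightarrow> 'k) \<Rightarrow> 'w" where
  "lin_comb W B c = (\<Oplus>\<^bsub>W\<^esub>b\<in>B. c b \<odot>\<^bsub>W\<^esub> b)"

definition module_basis :: "('k, 'c) ring_scheme \<Rightarrow> ('k, 'w) module \<Rightarrow> 'w set \<Rightarrow> bool" where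
  "module_basis k W B \<longleftrightarrow>
     finite B \<and> B \<subseteq> carrier W \<and>
     (\<forall>w\<in>carrier W. \<exists>!c. c \<in> B \<rightarrow>\<^sub>E carrier k \<and> w = lin_comb W B c)"

definition coordinates ::
    "('k, 'c) ring_scheme \<Rightarrow> ('k, 'w) module \<Rightarrow> 'w set \<Rightarrow> 'w \<Rightarrow> ('w \<Rightarrow> 'k)" where
  "coordinates k W B w = (THE c. c \<in> B \<rightarrow>\<^sub>E carrier k \<and> w = lin_comb W B c)"

text \<open>
  Polynomials in several variables are those of \<^theory>\<open>HOL-Algebra.Indexed_Polynomials\<close>:
  a monomial is a multiset of variables, a polynomial its coefficient function on monomials.
\<close>

definition poly_eval ::
    "('k, 'c) ring_scheme \<Rightarrow> ('v multiset \<Rightarrow> 'k) \<Rightarrow> ('v \<Rightarrow> 'k) \<Rightarrow> 'k" where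
  "poly_eval k f c =
     (\<Oplus>\<^bsub>k\<^esub>M\<in>{M. f M \<noteq> \<zero>\<^bsub>k\<^esub>}. f M \<otimes>\<^bsub>k\<^esub> (\<Otimes>\<^bsub>k\<^esub>v\<in>set_mset M. c v [^]\<^bsub>k\<^esub> count M v))"

text \<open>
  \<open>U\<close> is a non-empty Zariski-open subset of the vector space \<open>W\<close> over the (infinite) field \<open>k\<close>:
  a union of finitely many, and at least one, sets \<open>{w. f w \<noteq> 0}\<close>, where \<open>f\<close> is a non-zero polynomial
  in the coordinates with respect to a basis \<open>B\<close>; the variables are indexed by \<open>B\<close>.
\<close>

definition nonempty_zariski_open ::
    "('k, 'c) ring_scheme \<Rightarrow> ('k, 'w) module \<Rightarrow> 'w set \<Rightarrow> bool" where
  "nonempty_zariski_open k W U \<longleftrightarrow>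
     (\<exists>B F. module_basis k W B \<and> finite F \<and> F \<noteq> {} \<and>
        F \<subseteq> ring.indexed_pset k B (carrier k) - {\<lambda>M. \<zero>\<^bsub>k\<^esub>} \<and>
        U = (\<Union>f\<in>F. {w \<in> carrier W. poly_eval k f (coordinates k W B w) \<noteq> \<zero>\<^bsub>k\<^esub>}))"

text \<open>
  ``There exist \<open>r\<close> general elements \<open>x\<^sub>0, \<dots>, x\<^bsub>r-1\<^esub> \<in> J\<close> such that \<open>Q x\<close> holds'', for a property
  \<open>Q\<close> of the values of \<open>x\<close> on \<open>{..<r}\<close>.
\<close>

definition general_elements ::
    "('a, 'b) ring_scheme \<Rightarrow> 'a set \<Rightarrow> 'a set \<Rightarrow> nat \<Rightarrow> ((nat \<Rightarrow> 'a) \<Rightarrow> bool) \<Rightarrow> bool" where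
  "general_elements R \<mm> J r Q \<longleftrightarrow>
     (\<exists>U. nonempty_zariski_open (R Quot \<mm>) (module_power (fiber_space R \<mm> J) r) U \<and>
        (\<forall>x. (\<forall>i<r. x i \<in> J) \<and> (\<lambda>i\<in>{..<r}. \<mm> \<cdot>\<^bsub>R\<^esub> J +>\<^bsub>R\<^esub> x i) \<in> U \<longrightarrow> Q x))"

end

(* Write F for the fiber cone and G for the associated graded ring. A Vandermonde argument over the
   infinite residue field yields s elements of I_1 whose images generate an ideal of F containing all
   large degrees, where s is the length of a longest chain of homogeneous primes of F. Counting
   monomials shows that s such elements force dim F <= s, so s = r, and generating all large degrees
   modulo m is an open condition on the coordinates of r elements x of I_1. Fix such an x. As F is
   Cohen-Macaulay at its homogeneous maximal ideal and grade G_+ >= r, the Koszul complexes of x over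
   F and over G are exact in homological degree 1; by induction on the degree, x is a regular sequence
   on F and on G. If for every d <= n there were e_d in I_d outside (x) I_(d-1) + m I_d, regularity on
   F would make the (n + r choose r) products of a monomial of degree k <= n in x with e_(n-k)
   independent modulo m I_n, against the bound on mu(I_n). So I_d = (x) I_(d-1) + m I_d for some
   1 <= d <= n, and Nakayama's lemma gives I_m <= I_d <= (x) for m >= n. The Valabrega-Valla identity,
   (x) meet I_m = (x) I_(m-1), which follows from regularity on G, concludes.
   To avoid carrier sets, the rings of HOL-Algebra are presented as quotients of rings of class
   comm_ring_1, and the computations take place there modulo ideals. *)

theory Submission
  imports Defs "HOL-Computational_Algebra.Polynomial" "HOL-Library.FuncSet"
begin

section \<open>Koszul complexes\<close>

text \<open>The regular sequences supplied by the hypotheses are unrelated to x: in general they are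
  neither homogeneous nor of degree 1, and for F they exist only after localizing. The link is that
  x generates all large degrees, so some power of each of their elements lies in (x); the depth
  sensitivity of the Koszul complex asks for no more. Denominators are carried along as multipliers
  from a set W, the complement of the homogeneous maximal ideal for F and {1} for G. Their constant
  terms are invertible, so taking a homogeneous coefficient removes them at the end. A second
  mismatch concerns dimension: the Krull dimension counts arbitrary primes, while elements of degree
  1 are found by avoiding homogeneous ones. Growth reconciles the two, since t strict inclusions of
  primes force about n^t independent elements of degree at most D n. The same comparison yields r
  strict inclusions of homogeneous primes; these lie below the homogeneous maximal ideal, so
  localizing F there does not lower its dimension. Equimultiplicity enters through I_1 /= R, which
  makes G_+ a proper ideal.\<close>

definition subring :: "'q::comm_ring_1 set \<Rightarrow> bool" where
  "subring T \<longleftrightarrow> 0 \<in> T \<and> 1 \<in> T \<and> (\<forall>a\<in>T. \<forall>b\<in>T. a + b \<in> T \<and> a * b \<in> T \<and> - a \<in> T)"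

definition ideal_of :: "'q::comm_ring_1 set \<Rightarrow> 'q set \<Rightarrow> bool" where
  "ideal_of T A \<longleftrightarrow> A \<subseteq> T \<and> 0 \<in> A \<and> (\<forall>a\<in>A. \<forall>b\<in>A. a + b \<in> A) \<and> (\<forall>c\<in>T. \<forall>a\<in>A. c * a \<in> A)"

lemma subringD:
  assumes "subring T"
  shows "0 \<in> T" "1 \<in> T" "a \<in> T \<Longrightarrow> b \<in> T \<Longrightarrow> a + b \<in> T"
    "a \<in> T \<Longrightarrow> b \<in> T \<Longrightarrow> a * b \<in> T" "a \<in> T \<Longrightarrow> - a \<in> T"
    "a \<in> T \<Longrightarrow> b \<in> T \<Longrightarrow> a - b \<in> T"
  using assms unfolding subring_def by (auto, metis add_uminus_conv_diff)

lemma subring_sum: "subring T \<Longrightarrow> (\<And>i. i \<in> A \<Longrightarrow> f i \<in> T) \<Longrightarrow> sum f A \<in> T"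
  by (induction A rule: infinite_finite_induct) (auto simp: subringD)

lemma subring_power: "subring T \<Longrightarrow> a \<in> T \<Longrightarrow> a ^ n \<in> T"
  by (induction n) (auto simp: subringD)

lemma subring_UNIV [simp]: "subring UNIV"
  by (simp add: subring_def)

lemma ideal_ofD:
  assumes "ideal_of T A"
  shows "A \<subseteq> T" "0 \<in> A" "a \<in> A \<Longrightarrow> b \<in> A \<Longrightarrow> a + b \<in> A" "c \<in> T \<Longrightarrow> a \<in> A \<Longrightarrow> c * a \<in> A"
    "c \<in> T \<Longrightarrow> a \<in> A \<Longrightarrow> a * c \<in> A"
  using assms unfolding ideal_of_def by (auto simp: mult.commute)

lemma ideal_of_uminus: "subring T \<Longrightarrow> ideal_of T A \<Longrightarrow> a \<in> A \<Longrightarrow> - a \<in> A"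
  using ideal_ofD(4)[of T A "- 1" a] subringD(2,5)[of T] by simp

lemma ideal_of_diff: "subring T \<Longrightarrow> ideal_of T A \<Longrightarrow> a \<in> A \<Longrightarrow> b \<in> A \<Longrightarrow> a - b \<in> A"
  using ideal_ofD(3)[of T A a "- b"] ideal_of_uminus[of T A b] by simp

lemma ideal_of_sum: "ideal_of T A \<Longrightarrow> (\<And>i. i \<in> S \<Longrightarrow> f i \<in> A) \<Longrightarrow> sum f S \<in> A"
  by (induction S rule: infinite_finite_induct) (auto simp: ideal_ofD)

lemma ideal_of_add_cancel:
  assumes "subring T" "ideal_of T A" "b \<in> A"
  shows "a + b \<in> A \<longleftrightarrow> a \<in> A"
  using assms ideal_ofD(3)[of T A a b] ideal_of_diff[of T A "a + b" b] by auto

section \<open>Koszul chains, their boundary and the contracting homotopy\<close>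

text \<open>A Koszul \<open>p\<close>-chain is a function on the \<open>p\<close>-element subsets of \<open>{..<r}\<close>. Exterior
  multiplication by \<open>y\<close> is a homotopy between \<open>0\<close> and multiplication by \<open>\<Sum>\<^sub>i y\<^sub>i x\<^sub>i\<close>.\<close>

definition koszul_sign :: "nat \<Rightarrow> nat set \<Rightarrow> 'q::comm_ring_1" where
  "koszul_sign i A = (- 1) ^ card {j \<in> A. j < i}"

definition koszul_bd :: "nat \<Rightarrow> (nat \<Rightarrow> 'q::comm_ring_1) \<Rightarrow> (nat set \<Rightarrow> 'q) \<Rightarrow> nat set \<Rightarrow> 'q" where
  "koszul_bd r x c A = (if A \<subseteq> {..<r} then \<Sum>i\<in>{..<r} - A. koszul_sign i A * x i * c (insert i A) else 0)"

definition koszul_htpy :: "nat \<Rightarrow> (nat \<Rightarrow> 'q::comm_ring_1) \<Rightarrow> (nat set \<Rightarrow> 'q) \<Rightarrow> nat set \<Rightarrow> 'q" where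
  "koszul_htpy r y c A = (if A \<subseteq> {..<r} then \<Sum>j\<in>A. koszul_sign j (A - {j}) * y j * c (A - {j}) else 0)"

definition koszul_chain :: "nat \<Rightarrow> 'q::comm_ring_1 set \<Rightarrow> nat \<Rightarrow> (nat set \<Rightarrow> 'q) \<Rightarrow> bool" where
  "koszul_chain r T p c \<longleftrightarrow> (\<forall>A. c A \<in> T \<and> (c A \<noteq> 0 \<longrightarrow> A \<subseteq> {..<r} \<and> card A = p))"

lemma koszul_sign_square [simp]: "koszul_sign i A * koszul_sign i A = (1::'q::comm_ring_1)"
  by (simp add: koszul_sign_def flip: power_mult_distrib)

lemma koszul_sign_in: "subring T \<Longrightarrow> koszul_sign i A \<in> T"
  by (simp add: koszul_sign_def subring_power subringD)

text \<open>For i < j, inserting i raises by one the count that defines the sign of j, while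
  inserting j does not affect that of i.\<close>

lemma koszul_sign_swap:
  assumes "i \<noteq> j" "i \<notin> A" "j \<notin> A" "finite A"
  shows "koszul_sign i A * koszul_sign j (insert i A) = - (koszul_sign j A * koszul_sign i (insert j A) :: 'q::comm_ring_1)"
proof -
  have *: "koszul_sign i A * koszul_sign j (insert i A) = - (koszul_sign j A * koszul_sign i (insert j A) :: 'q)"
    if "i < j" "i \<notin> A" "j \<notin> A" for i j
  proof -
    have "{k \<in> insert i A. k < j} = insert i {k \<in> A. k < j}" "{k \<in> insert j A. k < i} = {k \<in> A. k < i}"
      using that by auto
    moreover have "i \<notin> {k \<in> A. k < j}" using that by auto
    ultimately show ?thesis using \<open>finite A\<close> by (simp add: koszul_sign_def)
  qed
  consider "i < j" | "j < i" using assms by linarith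
  then show ?thesis using *[of i j] *[of j i] assms by cases auto
qed

text \<open>As 2 may be a zero divisor, it is not enough that the sum equals its negative; the pairs
  with i < j are matched with those with j < i instead.\<close>

lemma sum_antisym_zero:
  fixes f :: "nat \<Rightarrow> nat \<Rightarrow> 'q::comm_ring_1"
  assumes "finite S" and "\<And>i j. i \<in> S \<Longrightarrow> j \<in> S \<Longrightarrow> i \<noteq> j \<Longrightarrow> f i j = - f j i"
  shows "(\<Sum>i\<in>S. \<Sum>j\<in>S - {i}. f i j) = 0"
proof -
  have sp: "(\<Sum>j\<in>S - {i}. f i j) = (\<Sum>j\<in>{j\<in>S. j < i}. f i j) + (\<Sum>j\<in>{j\<in>S. i < j}. f i j)"
    if "i \<in> S" for i
  proof -
    have "S - {i} = {j\<in>S. j < i} \<union> {j\<in>S. i < j}" by auto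
    then show ?thesis using \<open>finite S\<close> by (simp add: sum.union_disjoint disjoint_iff)
  qed
  have "(\<Sum>i\<in>S. \<Sum>j\<in>{j\<in>S. i < j}. f i j) = (\<Sum>j\<in>S. \<Sum>i\<in>{i\<in>S. i < j}. f i j)"
    using \<open>finite S\<close> by (rule sum.swap_restrict) (rule \<open>finite S\<close>)
  also have "\<dots> = - (\<Sum>j\<in>S. \<Sum>i\<in>{i\<in>S. i < j}. f j i)"
    unfolding sum_negf[symmetric] by (intro sum.cong refl assms(2)) auto
  finally show ?thesis by (simp add: sp sum.distrib)
qed

lemma koszul_bd_kbd:
  fixes x :: "nat \<Rightarrow> 'q::comm_ring_1"
  shows "koszul_bd r x (koszul_bd r x c) A = 0"
proof (cases "A \<subseteq> {..<r}")
  case True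
  then have fin: "finite A" using finite_subset by blast
  define f where "f i j = koszul_sign i A * x i * (koszul_sign j (insert i A) * x j * c (insert j (insert i A)))" for i j
  have "koszul_bd r x (koszul_bd r x c) A = (\<Sum>i\<in>{..<r} - A. \<Sum>j\<in>({..<r} - A) - {i}. f i j)"
    unfolding koszul_bd_def[of r x "koszul_bd r x c"] if_P[OF True]
  proof (intro sum.cong refl)
    fix i assume i: "i \<in> {..<r} - A"
    then have sub: "insert i A \<subseteq> {..<r}" and eq: "{..<r} - insert i A = ({..<r} - A) - {i}" using True by auto
    show "koszul_sign i A * x i * koszul_bd r x c (insert i A) = (\<Sum>j\<in>({..<r} - A) - {i}. f i j)"
      unfolding koszul_bd_def if_P[OF sub] eq sum_distrib_left f_def ..
  qed
  also have "\<dots> = 0"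
  proof (rule sum_antisym_zero)
    fix i j assume ij: "i \<in> {..<r} - A" "j \<in> {..<r} - A" "i \<noteq> j"
    have "f i j = (koszul_sign i A * koszul_sign j (insert i A)) * (x i * x j * c (insert j (insert i A)))"
      by (simp add: f_def mult_ac)
    also have "\<dots> = - (koszul_sign j A * koszul_sign i (insert j A)) * (x i * x j * c (insert i (insert j A)))"
      using ij fin by (subst koszul_sign_swap) (auto simp: insert_commute)
    finally show "f i j = - f j i" by (simp add: f_def mult_ac)
  qed auto
  finally show ?thesis .
qed (simp add: koszul_bd_def)

lemma koszul_htpy_kbd:
  fixes x :: "nat \<Rightarrow> 'q::comm_ring_1"
  assumes A: "A \<subseteq> {..<r}"
  shows "koszul_bd r x (koszul_htpy r y c) A + koszul_htpy r y (koszul_bd r x c) A = (\<Sum>i<r. y i * x i) * c A"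
proof -
  have fin: "finite A" using A finite_subset by blast
  \<comment> \<open>The mixed term that removes j from A and inserts i. Both composites contain it,
    with opposite signs, so only diagonal terms survive: those with index outside A from the first
    composite, those with index in A from the second.\<close>
  define g where "g i j = koszul_sign i A * koszul_sign j (insert i (A - {j})) * x i * y j * c (insert i (A - {j}))" for i j
  have ins: "insert i A - {j} = insert i (A - {j})" if "i \<notin> A" "j \<in> A" for i j using that by auto
  have "koszul_bd r x (koszul_htpy r y c) A =
      (\<Sum>i\<in>{..<r} - A. koszul_sign i A * x i * (koszul_sign i A * y i * c A +
          (\<Sum>j\<in>A. koszul_sign j (insert i A - {j}) * y j * c (insert i A - {j}))))"
    unfolding koszul_bd_def if_P[OF A]
  proof (intro sum.cong refl arg_cong2[where f = times])
    fix i assume i: "i \<in> {..<r} - A"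
    then have sub: "insert i A \<subseteq> {..<r}" and ni: "insert i A - {i} = A" using A by auto
    show "koszul_htpy r y c (insert i A) = koszul_sign i A * y i * c A +
        (\<Sum>j\<in>A. koszul_sign j (insert i A - {j}) * y j * c (insert i A - {j}))"
      unfolding koszul_htpy_def if_P[OF sub] using i fin by (subst sum.insert) (auto simp: ni)
  qed
  also have "\<dots> = (\<Sum>i\<in>{..<r} - A. y i * x i * c A + (\<Sum>j\<in>A. g i j))"
  proof (intro sum.cong refl)
    fix i assume i: "i \<in> {..<r} - A"
    have "koszul_sign i A * x i * (koszul_sign i A * y i * c A) = (koszul_sign i A * koszul_sign i A) * (y i * x i * c A)"
      by (simp only: mult_ac)
    then have "koszul_sign i A * x i * (koszul_sign i A * y i * c A) = y i * x i * c A" by simp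
    moreover have "koszul_sign i A * x i * (\<Sum>j\<in>A. koszul_sign j (insert i A - {j}) * y j * c (insert i A - {j})) = (\<Sum>j\<in>A. g i j)"
      unfolding sum_distrib_left using i by (intro sum.cong refl) (auto simp: ins g_def mult_ac)
    ultimately show "koszul_sign i A * x i * (koszul_sign i A * y i * c A +
          (\<Sum>j\<in>A. koszul_sign j (insert i A - {j}) * y j * c (insert i A - {j}))) = y i * x i * c A + (\<Sum>j\<in>A. g i j)"
      by (simp add: distrib_left)
  qed
  finally have 1: "koszul_bd r x (koszul_htpy r y c) A = (\<Sum>i\<in>{..<r} - A. y i * x i * c A) + (\<Sum>i\<in>{..<r} - A. \<Sum>j\<in>A. g i j)"
    by (simp add: sum.distrib)
  have "koszul_htpy r y (koszul_bd r x c) A = (\<Sum>j\<in>A. y j * x j * c A - (\<Sum>i\<in>{..<r} - A. g i j))"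
    unfolding koszul_htpy_def if_P[OF A]
  proof (intro sum.cong refl)
    fix j assume j: "j \<in> A"
    then have sub: "A - {j} \<subseteq> {..<r}" and eq: "{..<r} - (A - {j}) = insert j ({..<r} - A)" using A by auto
    have "koszul_bd r x c (A - {j}) = koszul_sign j (A - {j}) * x j * c A +
        (\<Sum>i\<in>{..<r} - A. koszul_sign i (A - {j}) * x i * c (insert i (A - {j})))"
      using j unfolding koszul_bd_def if_P[OF sub] eq by (simp add: insert_absorb)
    then have "koszul_sign j (A - {j}) * y j * koszul_bd r x c (A - {j}) =
        (koszul_sign j (A - {j}) * koszul_sign j (A - {j})) * (y j * x j * c A) +
        (\<Sum>i\<in>{..<r} - A. koszul_sign j (A - {j}) * y j * (koszul_sign i (A - {j}) * x i * c (insert i (A - {j}))))"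
      by (simp only: distrib_left sum_distrib_left mult_ac)
    also have "(\<Sum>i\<in>{..<r} - A. koszul_sign j (A - {j}) * y j * (koszul_sign i (A - {j}) * x i * c (insert i (A - {j})))) =
        (\<Sum>i\<in>{..<r} - A. - g i j)"
    proof (intro sum.cong refl)
      fix i assume i: "i \<in> {..<r} - A"
      let ?C = "A - {j}"
      have sw: "koszul_sign i ?C * koszul_sign j (insert i ?C) = - (koszul_sign j ?C * koszul_sign i (insert j ?C) :: 'q)"
        using i j fin by (intro koszul_sign_swap) auto
      have "insert j ?C = A" using j by auto
      \<comment> \<open>The square of \<open>koszul_sign i A\<close>, which is 1, is inserted
        because A is \<open>insert j ?C\<close>: this creates the product that \<open>sw\<close>
        rewrites.\<close>
      have "koszul_sign j ?C * koszul_sign i ?C = (koszul_sign j ?C * koszul_sign i ?C) * (koszul_sign i A * koszul_sign i A :: 'q)" by simp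
      also have "\<dots> = koszul_sign i ?C * koszul_sign i A * (koszul_sign j ?C * koszul_sign i (insert j ?C))"
        using \<open>insert j ?C = A\<close> by (simp only: mult_ac)
      also have "\<dots> = - (koszul_sign i ?C * koszul_sign i A * (koszul_sign i ?C * koszul_sign j (insert i ?C)))"
        using sw by simp
      also have "\<dots> = - ((koszul_sign i ?C * koszul_sign i ?C) * (koszul_sign i A * koszul_sign j (insert i ?C)))"
        by (simp only: mult_ac)
      finally have e: "koszul_sign j ?C * koszul_sign i ?C = - (koszul_sign i A * koszul_sign j (insert i ?C) :: 'q)" by simp
      have "koszul_sign j ?C * y j * (koszul_sign i ?C * x i * c (insert i ?C)) =
          (koszul_sign j ?C * koszul_sign i ?C) * (y j * x i * c (insert i ?C))" by (simp only: mult_ac)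
      then show "koszul_sign j ?C * y j * (koszul_sign i ?C * x i * c (insert i ?C)) = - g i j"
        unfolding e g_def by (simp add: mult_ac)
    qed
    finally show "koszul_sign j (A - {j}) * y j * koszul_bd r x c (A - {j}) = y j * x j * c A - (\<Sum>i\<in>{..<r} - A. g i j)"
      by (simp add: sum_negf)
  qed
  then have 2: "koszul_htpy r y (koszul_bd r x c) A = (\<Sum>j\<in>A. y j * x j * c A) - (\<Sum>i\<in>{..<r} - A. \<Sum>j\<in>A. g i j)"
    by (simp add: sum_subtractf sum.swap[of _ "{..<r} - A" A])
  have "(\<Sum>i\<in>{..<r} - A. y i * x i * c A) + (\<Sum>j\<in>A. y j * x j * c A) = (\<Sum>i<r. y i * x i * c A)"
    using A by (simp add: sum.subset_diff)
  then show ?thesis unfolding 1 2 by (simp add: sum_distrib_right)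
qed

lemma koszul_bd_linear:
  "koszul_bd r x (\<lambda>B. u * c B + v * d B) A = u * koszul_bd r x c A + v * koszul_bd r x d A"
  by (simp add: koszul_bd_def sum_distrib_left sum.distrib[symmetric] algebra_simps)

lemma koszul_bd_in: "ideal_of T J \<Longrightarrow> subring T \<Longrightarrow> \<forall>i<r. x i \<in> T \<Longrightarrow> (\<And>B. c B \<in> J) \<Longrightarrow> koszul_bd r x c A \<in> J"
  unfolding koszul_bd_def by (auto intro!: ideal_of_sum ideal_ofD(4)[of T J] subringD[of T] koszul_sign_in ideal_ofD(2)[of T J])

lemma koszul_htpy_in: "ideal_of T J \<Longrightarrow> subring T \<Longrightarrow> \<forall>i<r. y i \<in> T \<Longrightarrow> (\<And>B. c B \<in> J) \<Longrightarrow> koszul_htpy r y c A \<in> J"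
  unfolding koszul_htpy_def by (auto intro!: ideal_of_sum ideal_ofD(4)[of T J] subringD[of T] koszul_sign_in ideal_ofD(2)[of T J])

lemma ideal_of_self: "subring T \<Longrightarrow> ideal_of T T"
  by (simp add: ideal_of_def subringD)

lemma koszul_chainD: "koszul_chain r T p c \<Longrightarrow> c A \<in> T" "koszul_chain r T p c \<Longrightarrow> c A \<noteq> 0 \<Longrightarrow> A \<subseteq> {..<r} \<and> card A = p"
  by (auto simp: koszul_chain_def)

lemma koszul_chain_kbd:
  assumes "koszul_chain r T (Suc p) c" "subring T" "\<forall>i<r. x i \<in> T"
  shows "koszul_chain r T p (koszul_bd r x c)"
  unfolding koszul_chain_def
proof (intro allI conjI impI)
  fix A
  show "koszul_bd r x c A \<in> T" using assms koszul_bd_in[OF ideal_of_self] koszul_chainD by blast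
  assume ne: "koszul_bd r x c A \<noteq> 0"
  then show sub: "A \<subseteq> {..<r}" by (auto simp: koszul_bd_def split: if_splits)
  from ne have "\<exists>i\<in>{..<r} - A. koszul_sign i A * x i * c (insert i A) \<noteq> 0"
    unfolding koszul_bd_def if_P[OF sub] by (meson sum.neutral)
  then obtain i where i: "i \<in> {..<r} - A" "c (insert i A) \<noteq> 0" by (metis mult_zero_right)
  with koszul_chainD(2)[OF assms(1) i(2)] show "card A = p"
    using finite_subset[OF sub] by auto
qed

lemma koszul_chain_khom:
  assumes "koszul_chain r T p c" "subring T" "\<forall>i<r. y i \<in> T"
  shows "koszul_chain r T (Suc p) (koszul_htpy r y c)"
  unfolding koszul_chain_def
proof (intro allI conjI impI)
  fix A
  show "koszul_htpy r y c A \<in> T" using assms koszul_htpy_in[OF ideal_of_self] koszul_chainD by blast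
  assume ne: "koszul_htpy r y c A \<noteq> 0"
  then show sub: "A \<subseteq> {..<r}" by (auto simp: koszul_htpy_def split: if_splits)
  from ne have "\<exists>i\<in>A. koszul_sign i (A - {i}) * y i * c (A - {i}) \<noteq> 0"
    unfolding koszul_htpy_def if_P[OF sub] by (meson sum.neutral)
  then obtain i where i: "i \<in> A" "c (A - {i}) \<noteq> 0" by (metis mult_zero_right)
  with koszul_chainD(2)[OF assms(1) i(2)] show "card A = Suc p"
    using finite_subset[OF sub] by (metis card_Suc_Diff1 finite_lessThan)
qed

section \<open>Vanishing of Koszul homology\<close>

text \<open>Stands in for working in the localization at W: finitely many statements that hold after
  multiplication hold with one multiplier, the product of the individual ones.\<close>

lemma common_multiplier:
  assumes "finite S" and W: "1 \<in> W" "\<And>u v. u \<in> W \<Longrightarrow> v \<in> W \<Longrightarrow> u * v \<in> W" "W \<subseteq> T"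
    and "\<And>s. s \<in> S \<Longrightarrow> \<exists>u\<in>W. P s u"
    and mult: "\<And>s u v. P s u \<Longrightarrow> v \<in> T \<Longrightarrow> P s (v * u)"
  shows "\<exists>u\<in>W. \<forall>s\<in>S. P s (u::'q::comm_ring_1)"
  using assms(1,5)
proof (induction S)
  case (insert s S)
  then obtain u v where "u \<in> W" "\<forall>t\<in>S. P t u" "v \<in> W" "P s v" by blast
  then have "u * v \<in> W \<and> (\<forall>t\<in>insert s S. P t (u * v))"
    using mult[of _ u v] mult[of s v u] W by (auto simp: mult.commute)
  then show ?case by blast
qed (use W in auto)

text \<open>Depth sensitivity in elementary terms: modulo \<open>J i\<close> and up to multipliers
  from W, the homology of x vanishes in degrees p > r - (g - i). In the step, multiplication by
  \<open>a i\<close> on T modulo \<open>J i\<close> is injective with cokernel, up to W, T modulo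
  \<open>J (Suc i)\<close>. As the induction covers degree p + 1 over \<open>J (Suc i)\<close>, the
  long exact sequence makes \<open>a i\<close> injective on the homology in degree p over
  \<open>J i\<close>; but a power of \<open>a i\<close> lies in (x) + \<open>J i\<close> and acts as
  zero by the homotopy.\<close>

lemma koszul_vanish:
  fixes x a :: "nat \<Rightarrow> 'q::comm_ring_1" and J :: "nat \<Rightarrow> 'q set"
  assumes T: "subring T" and W: "1 \<in> W" "\<And>u v. u \<in> W \<Longrightarrow> v \<in> W \<Longrightarrow> u * v \<in> W" "W \<subseteq> T"
    and x: "\<And>i. i < r \<Longrightarrow> x i \<in> T"
    and J: "\<And>i. i \<le> g \<Longrightarrow> ideal_of T (J i)"
    and mono: "\<And>i. i < g \<Longrightarrow> J i \<subseteq> J (Suc i)"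
    and a: "\<And>i. i < g \<Longrightarrow> a i \<in> T" "\<And>i. i < g \<Longrightarrow> a i \<in> J (Suc i)"
    and reg: "\<And>i b. i < g \<Longrightarrow> b \<in> T \<Longrightarrow> a i * b \<in> J i \<Longrightarrow> b \<in> J i"
    and gen: "\<And>i b. i < g \<Longrightarrow> b \<in> J (Suc i) \<Longrightarrow> \<exists>u\<in>W. \<exists>f\<in>T. u * b - a i * f \<in> J i"
    and pow: "\<And>i. i < g \<Longrightarrow> \<exists>N y. (\<forall>j<r. y j \<in> T) \<and> a i ^ N - (\<Sum>j<r. y j * x j) \<in> J i"
    and ig: "i \<le> g"
  shows "r + i < p + g \<Longrightarrow> koszul_chain r T p c \<Longrightarrow> (\<And>A. koszul_bd r x c A \<in> J i) \<Longrightarrow>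
    \<exists>b u. koszul_chain r T (Suc p) b \<and> u \<in> W \<and> (\<forall>A. u * c A - koszul_bd r x b A \<in> J i)"
  using ig
proof (induction i arbitrary: p c rule: inc_induct)
  case base
  \<comment> \<open>Here p > r, so \<open>{..<r}\<close> has no subset with p elements.\<close>
  have "c A = 0" for A
    using base koszul_chainD(2)[of r T p c A] card_mono[of "{..<r}" A] by fastforce
  then show ?case using W ideal_ofD(2)[OF J, of g] T
    by (intro exI[of _ "\<lambda>A. 0"] exI[of _ 1]) (auto simp: koszul_chain_def subringD koszul_bd_def)
next
  case (step i)
  note Ji = J[OF less_imp_le[OF step.hyps(2)]]
  note [simp] = step.hyps(2)
  have xT: "\<forall>i<r. x i \<in> T" using x by blast
  have JS: "ideal_of T (J (Suc i))" by (rule J[OF Suc_leI[OF step.hyps(2)]])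
  note closed = subringD[OF T]
  obtain N y where y: "\<forall>j<r. y j \<in> T" and aN: "a i ^ N - (\<Sum>j<r. y j * x j) \<in> J i"
    using pow[of i] by auto
  have WT: "u \<in> W \<Longrightarrow> u \<in> T" for u using W by auto
  note cT = koszul_chainD(1)[OF step.prems(2)]
  note IH = step.IH and outer = step.prems
  \<comment> \<open>The downward induction on n removes the factors \<open>a i\<close> one at a
    time: n = N is the homotopy, n = 0 the claim.\<close>
  have main: "\<exists>b u. koszul_chain r T (Suc p) b \<and> u \<in> W \<and> (\<forall>A. u * (a i ^ n * c A) - koszul_bd r x b A \<in> J i)" if "n \<le> N" for n
    using that
  proof (induction n rule: inc_induct)
    case base
    have "1 * (a i ^ N * c A) - koszul_bd r x (koszul_htpy r y c) A \<in> J i" for A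
    proof (cases "A \<subseteq> {..<r}")
      case True
      have "1 * (a i ^ N * c A) - koszul_bd r x (koszul_htpy r y c) A =
          (a i ^ N - (\<Sum>j<r. y j * x j)) * c A + koszul_htpy r y (koszul_bd r x c) A"
        using koszul_htpy_kbd[OF True, of x y c] by (simp add: algebra_simps)
      also have "\<dots> \<in> J i"
        by (intro ideal_ofD(3)[OF Ji] ideal_ofD(5)[OF Ji] aN cT koszul_htpy_in[OF Ji T] y step.prems)
      finally show ?thesis .
    next
      case False
      then have "c A = 0" using koszul_chainD(2)[OF step.prems(2)] by blast
      with False show ?thesis using ideal_ofD(2)[OF Ji] by (simp add: koszul_bd_def)
    qed
    moreover have "koszul_chain r T (Suc p) (koszul_htpy r y c)"
      by (rule koszul_chain_khom[OF step.prems(2) T y])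
    ultimately show ?case using W(1) by blast
  next
    case (step n)
    then obtain b u where b: "koszul_chain r T (Suc p) b" and u: "u \<in> W"
      and bu: "\<And>A. u * (a i ^ Suc n * c A) - koszul_bd r x b A \<in> J i" by blast
    let ?c = "\<lambda>A. u * (a i ^ n * c A)"
    have c'T: "?c A \<in> T" for A using WT[OF u] cT a(1)[of i] by (auto intro!: closed subring_power T)
    \<comment> \<open>Since \<open>a i\<close> lies in \<open>J (Suc i)\<close>, b is a cycle modulo
      \<open>J (Suc i)\<close>, and the outer induction applies to it in degree p + 1.\<close>
    have "koszul_bd r x b A \<in> J (Suc i)" for A
    proof -
      have "koszul_bd r x b A = a i * ?c A - (u * (a i ^ Suc n * c A) - koszul_bd r x b A)"
        by (simp add: algebra_simps)
      also have "\<dots> \<in> J (Suc i)"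
      proof (rule ideal_of_diff[OF T JS])
        show "a i * ?c A \<in> J (Suc i)" using c'T a(2)[of i] by (intro ideal_ofD(5)[OF JS]) auto
        show "u * (a i ^ Suc n * c A) - koszul_bd r x b A \<in> J (Suc i)" using bu[of A] mono[of i] by auto
      qed
      finally show ?thesis .
    qed
    moreover have "r + Suc i < Suc p + g" using outer(1) by simp
    ultimately obtain e v where e: "koszul_chain r T (Suc (Suc p)) e" and v: "v \<in> W"
      and ev: "\<And>A. v * b A - koszul_bd r x e A \<in> J (Suc i)"
      using IH[OF _ b] by blast
    let ?z = "\<lambda>A. v * b A - koszul_bd r x e A"
    have zT: "?z A \<in> T" for A using ideal_ofD(1)[OF JS] ev by blast
    have "\<exists>w\<in>W. \<forall>A\<in>Pow {..<r}. \<exists>f\<in>T. w * ?z A - a i * f \<in> J i"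
    proof (rule common_multiplier[where T = T, OF _ W])
      show "\<exists>w\<in>W. \<exists>f\<in>T. w * ?z A - a i * f \<in> J i" for A using gen[OF _ ev[of A]] by simp
      fix A w t assume "\<exists>f\<in>T. w * ?z A - a i * f \<in> J i" "t \<in> T"
      then obtain f where "f \<in> T" "w * ?z A - a i * f \<in> J i" by blast
      then have "t * f \<in> T \<and> (t * w) * ?z A - a i * (t * f) \<in> J i"
        using ideal_ofD(4)[OF Ji \<open>t \<in> T\<close>, of "w * ?z A - a i * f"] \<open>t \<in> T\<close>
        by (auto simp: algebra_simps intro: closed)
      then show "\<exists>f\<in>T. (t * w) * ?z A - a i * f \<in> J i" by blast
    qed auto
    then obtain w where w: "w \<in> W" and "\<forall>A\<in>Pow {..<r}. \<exists>f\<in>T. w * ?z A - a i * f \<in> J i" by blast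
    then have "\<exists>f. \<forall>A\<in>Pow {..<r}. f A \<in> T \<and> w * ?z A - a i * f A \<in> J i" by metis
    then obtain f0 where f0: "\<And>A. A \<subseteq> {..<r} \<Longrightarrow> f0 A \<in> T \<and> w * ?z A - a i * f0 A \<in> J i" by auto
    \<comment> \<open>\<open>f0\<close> is cut down to the subsets of size p + 1, as a chain must
      be; elsewhere \<open>?z\<close> is zero, so nothing is lost.\<close>
    define f where "f A = (if A \<subseteq> {..<r} \<and> card A = Suc p then f0 A else 0)" for A
    have z0: "?z A = 0" if "\<not> (A \<subseteq> {..<r} \<and> card A = Suc p)" for A
      using koszul_chainD(2)[OF b, of A] koszul_chainD(2)[OF koszul_chain_kbd[OF e T xT], of A] that by force
    have f: "koszul_chain r T (Suc p) f" using f0 closed by (auto simp: koszul_chain_def f_def)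
    have fz: "w * ?z A - a i * f A \<in> J i" for A
      using f0[of A] z0[of A] ideal_ofD(2)[OF Ji] by (auto simp: f_def)
    have "(w * v * u) * (a i ^ n * c A) - koszul_bd r x f A \<in> J i" for A
    proof (rule reg)
      show "(w * v * u) * (a i ^ n * c A) - koszul_bd r x f A \<in> T"
        using w v u WT cT a(1)[of i] koszul_chainD(1)[OF koszul_chain_kbd[OF f T xT]]
        by (auto intro!: closed subring_power T)
      \<comment> \<open>The boundary of \<open>?h\<close> loses the part that comes from e. Combined
        with \<open>bu\<close> it leaves \<open>a i\<close> times the wanted difference modulo
        \<open>J i\<close>, where \<open>a i\<close> can be cancelled.\<close>
      let ?h = "\<lambda>A. w * ?z A + (- a i) * f A"
      have "koszul_bd r x ?h A \<in> J i" using fz by (intro koszul_bd_in[OF Ji T xT]) auto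
      also have "koszul_bd r x ?h A = w * koszul_bd r x ?z A - a i * koszul_bd r x f A"
        unfolding koszul_bd_linear by simp
      also have "koszul_bd r x ?z A = v * koszul_bd r x b A"
        using koszul_bd_linear[of r x v b "- 1" "koszul_bd r x e" A] by (simp add: koszul_bd_kbd)
      finally have "w * (v * koszul_bd r x b A) - a i * koszul_bd r x f A \<in> J i" .
      moreover have "w * v * (u * (a i ^ Suc n * c A) - koszul_bd r x b A) \<in> J i"
        using bu w v WT by (intro ideal_ofD(4)[OF Ji]) (auto intro: closed)
      ultimately have "(w * (v * koszul_bd r x b A) - a i * koszul_bd r x f A) + w * v * (u * (a i ^ Suc n * c A) - koszul_bd r x b A) \<in> J i"
        by (rule ideal_ofD(3)[OF Ji])
      then show "a i * ((w * v * u) * (a i ^ n * c A) - koszul_bd r x f A) \<in> J i"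
        by (simp add: algebra_simps)
    qed simp
    then show ?case using f w v u W(2) by blast
  qed
  from main[of 0] show ?case by simp
qed

text \<open>The vanishing of the first Koszul homology, spelled out in terms of syzygies.\<close>

lemma koszul_syzygies:
  fixes x a :: "nat \<Rightarrow> 'q::comm_ring_1" and J :: "nat \<Rightarrow> 'q set"
  assumes T: "subring T" and W: "1 \<in> W" "\<And>u v. u \<in> W \<Longrightarrow> v \<in> W \<Longrightarrow> u * v \<in> W" "W \<subseteq> T"
    and x: "\<And>i. i < r \<Longrightarrow> x i \<in> T"
    and J: "\<And>i. i \<le> r \<Longrightarrow> ideal_of T (J i)"
    and mono: "\<And>i. i < r \<Longrightarrow> J i \<subseteq> J (Suc i)"
    and a: "\<And>i. i < r \<Longrightarrow> a i \<in> T" "\<And>i. i < r \<Longrightarrow> a i \<in> J (Suc i)"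
    and reg: "\<And>i b. i < r \<Longrightarrow> b \<in> T \<Longrightarrow> a i * b \<in> J i \<Longrightarrow> b \<in> J i"
    and gen: "\<And>i b. i < r \<Longrightarrow> b \<in> J (Suc i) \<Longrightarrow> \<exists>u\<in>W. \<exists>f\<in>T. u * b - a i * f \<in> J i"
    and pow: "\<And>i. i < r \<Longrightarrow> \<exists>N y. (\<forall>j<r. y j \<in> T) \<and> a i ^ N - (\<Sum>j<r. y j * x j) \<in> J i"
    and c: "\<And>i. i < r \<Longrightarrow> c i \<in> T" and syz: "(\<Sum>i<r. c i * x i) \<in> J 0"
  obtains s u where "u \<in> W" "\<And>i j. s i j \<in> T" "\<And>i j. s i j = - s j i" "\<And>i. s i i = 0"
    "\<And>i. i < r \<Longrightarrow> u * c i - (\<Sum>j<r. s i j * x j) \<in> J 0"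
proof -
  \<comment> \<open>The coefficients c as a 1-chain, whose boundary at the empty set is the given
    combination of the \<open>x i\<close>.\<close>
  define d where "d A = (if \<exists>i<r. A = {i} then c (THE i. A = {i}) else 0)" for A
  have d1: "d {i} = c i" if "i < r" for i
  proof -
    have "(THE k. {i} = {k}) = i" by (rule the_equality) auto
    with that show ?thesis by (auto simp: d_def)
  qed
  have d2: "d A = 0" if "\<nexists>i. i < r \<and> A = {i}" for A using that by (auto simp: d_def)
  have dch: "koszul_chain r T 1 d"
    unfolding koszul_chain_def
  proof (intro allI conjI impI)
    fix A
    show "d A \<in> T" using c d1 d2[of A] subringD(1)[OF T] by (cases "\<exists>i. i < r \<and> A = {i}") auto
    assume "d A \<noteq> 0"
    then obtain i where "i < r" "A = {i}" using d2[of A] by auto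
    then show "A \<subseteq> {..<r}" "card A = 1" by auto
  qed
  have bd: "koszul_bd r x d A \<in> J 0" for A
  proof (cases "A = {}")
    case True
    have "koszul_bd r x d {} = (\<Sum>i<r. c i * x i)"
      unfolding koszul_bd_def by (auto simp: d1 koszul_sign_def mult.commute intro!: sum.cong)
    then show ?thesis using syz True by simp
  next
    case False
    then have "d (insert i A) = 0" if "i \<notin> A" for i
      using that False by (intro d2 notI) (elim exE conjE, blast)
    then have "koszul_bd r x d A = 0" by (auto simp: koszul_bd_def intro!: sum.neutral)
    then show ?thesis using ideal_ofD(2)[OF J] by simp
  qed
  \<comment> \<open>With g = r and i = 0 the vanishing range starts at p = 1.\<close>
  have "\<exists>b u. koszul_chain r T (Suc 1) b \<and> u \<in> W \<and> (\<forall>A. u * d A - koszul_bd r x b A \<in> J 0)"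
    by (rule koszul_vanish[where T = T and W = W and r = r and g = r and i = 0 and p = 1 and J = J and a = a and x = x and c = d])
      (fact T W x J mono a reg gen pow dch bd | simp only: le0 add_0_right add.commute[of r] zero_less_one less_add_same_cancel2)+
  then obtain b u where b: "koszul_chain r T (Suc 1) b" and u: "u \<in> W" and bu: "\<And>A. u * d A - koszul_bd r x b A \<in> J 0"
    by blast
  \<comment> \<open>The coefficient of the 2-chain at \<open>{i, j}\<close>, with a sign that is -1
    exactly for i < j; this makes s alternating.\<close>
  define s where "s i j = (if i = j then 0 else koszul_sign j {i} * b {i, j})" for i j
  have s1: "s i j = - s j i" for i j
    by (cases i j rule: linorder_cases) (auto simp: s_def koszul_sign_def insert_commute Collect_conv_if)
  have s2: "s i j \<in> T" for i j
    using koszul_chainD(1)[OF b] by (auto simp: s_def intro!: subringD[OF T] koszul_sign_in[OF T])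
  have s3: "u * c i - (\<Sum>j<r. s i j * x j) \<in> J 0" if "i < r" for i
  proof -
    have "koszul_bd r x b {i} = (\<Sum>j\<in>{..<r} - {i}. s i j * x j)"
      unfolding koszul_bd_def using that by (auto simp: s_def insert_commute mult_ac intro!: sum.cong)
    also have "\<dots> = (\<Sum>j<r. s i j * x j)"
      by (rule sum.mono_neutral_left) (auto simp: s_def)
    finally show ?thesis using bu[of "{i}"] d1[OF that] by simp
  qed
  show thesis by (rule that[OF u s2 s1 _ s3]) (simp_all add: s_def)
qed

section \<open>Regular sequences in associated graded rings\<close>

definition maximal_set :: "'p::comm_ring_1 set \<Rightarrow> bool" where
  "maximal_set m \<longleftrightarrow> ideal_of UNIV m \<and> 1 \<notin> m \<and> (\<forall>u. u \<notin> m \<longrightarrow> (\<exists>v. v * u - 1 \<in> m))"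

lemma maximal_setD:
  assumes "maximal_set m"
  shows "ideal_of UNIV m" "1 \<notin> m" "u \<notin> m \<Longrightarrow> \<exists>v. v * u - 1 \<in> m"
  using assms by (auto simp: maximal_set_def)

lemma maximal_set_prime:
  assumes "maximal_set m" "a * b \<in> m"
  shows "a \<in> m \<or> b \<in> m"
proof (rule ccontr)
  note I = maximal_setD(1)[OF assms(1)]
  assume n: "\<not> (a \<in> m \<or> b \<in> m)"
  then obtain v where v: "v * a - 1 \<in> m" using maximal_setD(3)[OF assms(1)] by blast
  have "v * (a * b) - (v * a - 1) * b \<in> m"
    by (intro ideal_of_diff[OF subring_UNIV I] ideal_ofD(4,5)[OF I] v assms(2) UNIV_I)
  also have "v * (a * b) - (v * a - 1) * b = b" by (simp add: algebra_simps)
  finally show False using n by blast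
qed

text \<open>More vectors than coordinates over the field modulo m. Elimination multiplies crosswise
  by the pivot, so no inverse is chosen; as m is prime and the pivot lies outside m, a coefficient
  outside m stays outside.\<close>

lemma linear_dependence:
  fixes A :: "'j \<Rightarrow> 'l \<Rightarrow> 'p::comm_ring_1"
  assumes m: "maximal_set m" and "finite L" "finite J" "card L < card J"
  shows "\<exists>c. (\<exists>j\<in>J. c j \<notin> m) \<and> (\<forall>l\<in>L. (\<Sum>j\<in>J. c j * A j l) \<in> m)"
  using assms(2-)
proof (induction L arbitrary: J A)
  case empty
  then obtain j where "j \<in> J" by force
  then show ?case using maximal_setD(2)[OF m] by (intro exI[of _ "\<lambda>_. 1"]) auto
next
  case (insert l0 L)
  note I = maximal_setD(1)[OF m]
  show ?case
  proof (cases "\<forall>j\<in>J. A j l0 \<in> m")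
    case True
    obtain c where "\<exists>j\<in>J. c j \<notin> m" "\<forall>l\<in>L. (\<Sum>j\<in>J. c j * A j l) \<in> m"
      using insert.IH[of J A] insert.prems insert.hyps by auto
    moreover have "(\<Sum>j\<in>J. c j * A j l0) \<in> m"
      using True by (intro ideal_of_sum[OF I] ideal_ofD(4)[OF I]) auto
    ultimately show ?thesis by blast
  next
    case False
    then obtain j0 where j0: "j0 \<in> J" "A j0 l0 \<notin> m" by blast
    have cL: "card L < card (J - {j0})" using insert.prems insert.hyps j0(1) by simp
    define B where "B j l = A j0 l0 * A j l - A j l0 * A j0 l" for j l
    obtain c where c: "\<exists>j\<in>J - {j0}. c j \<notin> m" "\<forall>l\<in>L. (\<Sum>j\<in>J - {j0}. c j * B j l) \<in> m"
      using insert.IH[of "J - {j0}" B] insert.prems(1) cL by blast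
    \<comment> \<open>The coefficient of the pivot row makes coordinate \<open>l0\<close> cancel
      exactly in the ring, not just modulo m.\<close>
    define d where "d j = (if j = j0 then - (\<Sum>j\<in>J - {j0}. c j * A j l0) else c j * A j0 l0)" for j
    have eq: "(\<Sum>j\<in>J. d j * A j l) = (\<Sum>j\<in>J - {j0}. c j * B j l)" for l
    proof -
      have "(\<Sum>j\<in>J. d j * A j l) = d j0 * A j0 l + (\<Sum>j\<in>J - {j0}. d j * A j l)"
        using insert.prems j0 by (simp add: sum.remove)
      also have "(\<Sum>j\<in>J - {j0}. d j * A j l) = (\<Sum>j\<in>J - {j0}. c j * A j0 l0 * A j l)"
        by (intro sum.cong) (auto simp: d_def)
      also have "d j0 * A j0 l = (\<Sum>j\<in>J - {j0}. - (c j * A j l0 * A j0 l))"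
        by (simp add: d_def sum_distrib_right sum_negf)
      finally show ?thesis
        by (simp add: B_def sum.distrib[symmetric] algebra_simps)
    qed
    have "(\<Sum>j\<in>J. d j * A j l0) = 0" unfolding eq by (simp add: B_def mult.commute)
    then have "\<forall>l\<in>insert l0 L. (\<Sum>j\<in>J. d j * A j l) \<in> m"
      using c(2) ideal_ofD(2)[OF I] by (simp add: eq)
    moreover have "\<exists>j\<in>J. d j \<notin> m"
      using c(1) j0(2) maximal_set_prime[OF m] by (auto simp: d_def)
    ultimately show ?thesis by blast
  qed
qed

section \<open>Graded rings of a filtration, Koszul exactness and regularity\<close>

text \<open>The graded ring \<open>\<Oplus>\<^sub>n I\<^sub>n/K\<^sub>n\<close> is the associated graded ring for \<open>K\<^sub>n = I\<^bsub>n+1\<^esub>\<close> and the fiber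
  cone for \<open>K\<^sub>n = \<mm>I\<^sub>n\<close>.\<close>

locale filt =
  fixes I K :: "nat \<Rightarrow> 'p::comm_ring_1 set"
  assumes I: "ideal_of UNIV (I n)" and K: "ideal_of UNIV (K n)" and KI: "K n \<subseteq> I n" and I0: "I 0 = UNIV"
    and I_mult: "a \<in> I i \<Longrightarrow> b \<in> I j \<Longrightarrow> a * b \<in> I (i + j)"
    and K_mult: "a \<in> I i \<Longrightarrow> b \<in> K j \<Longrightarrow> a * b \<in> K (i + j)"
begin

lemmas Icl = ideal_ofD(2)[OF I] ideal_ofD(3)[OF I] ideal_of_uminus[OF subring_UNIV I]
  ideal_of_diff[OF subring_UNIV I] ideal_ofD(4)[OF I UNIV_I] ideal_ofD(5)[OF I UNIV_I]

lemmas Kcl = ideal_ofD(2)[OF K] ideal_ofD(3)[OF K] ideal_of_uminus[OF subring_UNIV K]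
  ideal_of_diff[OF subring_UNIV K] ideal_ofD(4)[OF K UNIV_I] ideal_ofD(5)[OF K UNIV_I]

lemmas Isum = ideal_of_sum[OF I]
lemmas Ksum = ideal_of_sum[OF K]

text \<open>\<open>Ipred j\<close> is \<open>I\<^bsub>j-1\<^esub>\<close>, with \<open>I\<^bsub>-1\<^esub> = 0\<close>.\<close>

definition Ipred :: "nat \<Rightarrow> 'p set" where
  "Ipred j = (case j of 0 \<Rightarrow> {0} | Suc k \<Rightarrow> I k)"

lemma Ipred_0 [simp]: "Ipred 0 = {0}" and Ipred_Suc [simp]: "Ipred (Suc k) = I k"
  by (auto simp: Ipred_def)

lemma Ipred_ideal: "ideal_of UNIV (Ipred j)"
  by (cases j) (auto simp: I, simp add: ideal_of_def)

lemma Ipred_mult: "a \<in> Ipred j \<Longrightarrow> b \<in> I 1 \<Longrightarrow> a * b \<in> I j" "a \<in> Ipred j \<Longrightarrow> b \<in> I 1 \<Longrightarrow> b * a \<in> I j"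
  using I_mult[of a "j - 1" b 1] by (cases j; auto simp: Icl mult.commute)+

text \<open>Exactness of the Koszul complex of \<open>x\<^sub>0, \<dots>, x\<^bsub>i-1\<^esub>\<close> over \<open>\<Oplus>\<^sub>j I\<^sub>j/K\<^sub>j\<close> in homological degree 1 and
  internal degree \<open>j\<close>: modulo \<open>K\<close>, each syzygy comes from an alternating matrix \<open>s\<close>.\<close>

definition syz :: "(nat \<Rightarrow> 'p) \<Rightarrow> nat \<Rightarrow> nat \<Rightarrow> bool" where
  "syz x i j \<longleftrightarrow> (\<forall>a. (\<forall>l<i. a l \<in> I j) \<longrightarrow> (\<Sum>l<i. a l * x l) \<in> K (Suc j) \<longrightarrow>
     (\<exists>s. (\<forall>l k. s l k \<in> Ipred j \<and> s l k + s k l = 0) \<and> (\<forall>l. s l l = 0) \<and>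
        (\<forall>l<i. a l - (\<Sum>k<i. s l k * x k) \<in> K j)))"

text \<open>The images of \<open>x\<^sub>0, \<dots>, x\<^bsub>r-1\<^esub>\<close> in degree 1 form a regular sequence on \<open>\<Oplus>\<^sub>j I\<^sub>j/K\<^sub>j\<close>.\<close>

definition regseq :: "(nat \<Rightarrow> 'p) \<Rightarrow> nat \<Rightarrow> bool" where
  "regseq x r \<longleftrightarrow> (\<forall>i<r. \<forall>j a b. a \<in> I j \<longrightarrow> (\<forall>l<i. b l \<in> I j) \<longrightarrow>
     x i * a - (\<Sum>l<i. b l * x l) \<in> K (Suc j) \<longrightarrow>
     (\<exists>c. (\<forall>l<i. c l \<in> Ipred j) \<and> a - (\<Sum>l<i. c l * x l) \<in> K j))"

text \<open>The first Koszul homology of the shorter sequence, taken modulo \<open>x i\<close>,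
  embeds in that of the longer one, so it equals \<open>x i\<close> times itself. As
  \<open>x i\<close> has degree 1, the graded form of Nakayama's lemma makes it zero; this is the
  induction on j.\<close>

lemma syz_Suc:
  assumes x: "x i \<in> I 1" and S: "\<And>j. syz x (Suc i) j"
  shows "syz x i j"
proof (induction j)
  case 0
  show ?case
    unfolding syz_def
  proof (intro allI impI)
    fix a assume a: "\<forall>l<i. a l \<in> I 0" "(\<Sum>l<i. a l * x l) \<in> K (Suc 0)"
    \<comment> \<open>The syzygy of the shorter sequence, padded by a zero coefficient at
      \<open>x i\<close>.\<close>
    define a' where "a' = a(i := 0)"
    have "(\<Sum>l<Suc i. a' l * x l) = (\<Sum>l<i. a l * x l)" by (simp add: a'_def)
    then have "\<exists>s. (\<forall>l k. s l k \<in> Ipred 0 \<and> s l k + s k l = 0) \<and> (\<forall>l. s l l = 0) \<and>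
        (\<forall>l<Suc i. a' l - (\<Sum>k<Suc i. s l k * x k) \<in> K 0)"
      using S[of 0] a unfolding syz_def by (auto simp: a'_def I0)
    then obtain s where s: "\<forall>l k. s l k \<in> Ipred 0" "\<forall>l<Suc i. a' l - (\<Sum>k<Suc i. s l k * x k) \<in> K 0" by blast
    have "s l k = 0" for l k using s(1) by simp
    with s(2) have "a l \<in> K 0" if "l < i" for l using that by (auto simp: a'_def less_Suc_eq)
    then show "\<exists>s. (\<forall>l k. s l k \<in> Ipred 0 \<and> s l k + s k l = 0) \<and> (\<forall>l. s l l = 0) \<and>
        (\<forall>l<i. a l - (\<Sum>k<i. s l k * x k) \<in> K 0)"
      by (intro exI[of _ "\<lambda>_ _. 0"]) auto
  qed
next
  case (Suc j)
  show ?case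
    unfolding syz_def
  proof (intro allI impI)
    fix a assume a: "\<forall>l<i. a l \<in> I (Suc j)" "(\<Sum>l<i. a l * x l) \<in> K (Suc (Suc j))"
    define a' where "a' = a(i := 0)"
    have "(\<Sum>l<Suc i. a' l * x l) = (\<Sum>l<i. a l * x l)" by (simp add: a'_def)
    then have a'K: "(\<Sum>l<Suc i. a' l * x l) \<in> K (Suc (Suc j))" using a(2) by metis
    have a'I: "\<forall>l<Suc i. a' l \<in> I (Suc j)" using a(1) Icl(1) by (auto simp: a'_def less_Suc_eq)
    have "syz x (Suc i) (Suc j)" by (rule S)
    then have "\<exists>s. (\<forall>l k. s l k \<in> Ipred (Suc j) \<and> s l k + s k l = 0) \<and> (\<forall>l. s l l = 0) \<and>
        (\<forall>l<Suc i. a' l - (\<Sum>k<Suc i. s l k * x k) \<in> K (Suc j))"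
      using a'K a'I unfolding syz_def by (elim allE[of _ a'] impE) auto
    then obtain s where s: "\<And>l k. s l k \<in> I j" "\<And>l k. s l k + s k l = 0" "\<And>l. s l l = 0"
      and sa: "\<And>l. l < Suc i \<Longrightarrow> a' l - (\<Sum>k<Suc i. s l k * x k) \<in> K (Suc j)"
      unfolding Ipred_Suc by blast
    \<comment> \<open>Because \<open>a' i\<close> is zero, row i of s is itself a syzygy of the
      shorter sequence, one degree lower.\<close>
    have "- (\<Sum>k<i. s i k * x k) \<in> K (Suc j)" using sa[of i] s(3)[of i] by (simp add: a'_def)
    then have "(\<Sum>k<i. s i k * x k) \<in> K (Suc j)" using Kcl(3) by fastforce
    then obtain t where t: "\<And>l k. t l k \<in> Ipred j" "\<And>l k. t l k + t k l = 0" "\<And>l. t l l = 0"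
      and st: "\<And>l. l < i \<Longrightarrow> s i l - (\<Sum>k<i. t l k * x k) \<in> K j"
      using Suc[unfolded syz_def, rule_format, of "s i"] s(1) by metis
    \<comment> \<open>By antisymmetry, \<open>s l i\<close> is modulo K minus the combination of the
      \<open>x k\<close> with coefficients \<open>t l k\<close>; its product with \<open>x i\<close>
      is absorbed into the matrix.\<close>
    define q where "q l k = s l k - t l k * x i" for l k
    have "q l k \<in> Ipred (Suc j)" for l k
      using s(1)[of l k] Ipred_mult(1)[OF t(1) x, of l k] by (auto simp: q_def Icl)
    moreover have "q l k + q k l = 0" for l k
      proof -
      have "q l k + q k l = (s l k + s k l) - (t l k + t k l) * x i" by (simp add: q_def algebra_simps)
      then show ?thesis by (simp only: s(2) t(2)) simp
    qed
    moreover have "q l l = 0" for l by (simp add: q_def s t)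
    moreover have "a l - (\<Sum>k<i. q l k * x k) \<in> K (Suc j)" if l: "l < i" for l
    proof -
      have 1: "(a l - (\<Sum>k<i. s l k * x k)) - s l i * x i \<in> K (Suc j)"
        using sa[of l] l by (simp add: a'_def algebra_simps)
      have 2: "x i * (s i l - (\<Sum>k<i. t l k * x k)) \<in> K (Suc j)"
        using K_mult[OF x st[OF l]] by simp
      have "s l i = - s i l" using s(2)[of l i] by (rule minus_unique[symmetric, OF trans[OF add.commute]])
      then have "a l - (\<Sum>k<i. q l k * x k) =
          ((a l - (\<Sum>k<i. s l k * x k)) - s l i * x i) - x i * (s i l - (\<Sum>k<i. t l k * x k))"
        by (simp add: q_def left_diff_distrib sum_subtractf right_diff_distrib sum_distrib_left mult_ac)
      also have "\<dots> \<in> K (Suc j)" using 1 2 by (rule Kcl(4))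
      finally show ?thesis .
    qed
    ultimately show "\<exists>s. (\<forall>l k. s l k \<in> Ipred (Suc j) \<and> s l k + s k l = 0) \<and> (\<forall>l. s l l = 0) \<and>
        (\<forall>l<i. a l - (\<Sum>k<i. s l k * x k) \<in> K (Suc j))"
      by blast
  qed
qed

text \<open>A relation that places \<open>x i * a\<close> in the ideal of the earlier elements is a
  syzygy with coefficient a at \<open>x i\<close>. As the matrix has zero diagonal, its row i writes
  a in terms of the earlier elements.\<close>

lemma regseq_if_syz:
  assumes x: "\<forall>i<r. x i \<in> I 1" and S: "\<And>j. syz x r j"
  shows "regseq x r"
proof -
  have syz: "syz x i j" if "i \<le> r" for i j
    using that
  proof (induction i arbitrary: j rule: inc_induct)
    case (step i)
    then show ?case using syz_Suc[of x i j] x by auto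
  qed (rule S)
  show ?thesis
    unfolding regseq_def
  proof (intro allI impI)
    fix i j a b
    assume i: "i < r" and a: "a \<in> I j" and b: "\<forall>l<i. b l \<in> I j" and ab: "x i * a - (\<Sum>l<i. b l * x l) \<in> K (Suc j)"
    define d where "d l = (if l = i then a else - b l)" for l
    have "(\<Sum>l<Suc i. d l * x l) = x i * a - (\<Sum>l<i. b l * x l)"
      by (simp add: d_def sum_negf mult.commute)
    moreover have "\<forall>l<Suc i. d l \<in> I j" using a b Icl(3) by (auto simp: d_def less_Suc_eq)
    ultimately have "\<exists>s. (\<forall>l k. s l k \<in> Ipred j \<and> s l k + s k l = 0) \<and> (\<forall>l. s l l = 0) \<and>
        (\<forall>l<Suc i. d l - (\<Sum>k<Suc i. s l k * x k) \<in> K j)"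
      using syz[of "Suc i" j] i ab unfolding syz_def by force
    then obtain s where s: "\<And>l k. s l k \<in> Ipred j" "\<And>l. s l l = 0"
      "\<And>l. l < Suc i \<Longrightarrow> d l - (\<Sum>k<Suc i. s l k * x k) \<in> K j" by blast
    show "\<exists>c. (\<forall>l<i. c l \<in> Ipred j) \<and> a - (\<Sum>l<i. c l * x l) \<in> K j"
      using s(3)[of i] s(1) by (intro exI[of _ "s i"]) (auto simp: d_def s(2))
  qed
qed

end

text \<open>If the coefficients lie in I_j with j < m, the sum lies deeper than they account for.
  Regularity writes the last coefficient as a combination of the earlier \<open>x i\<close> plus an
  element of I_(j+1). Moving that combination to the other coefficients leaves a shorter sum, to
  which the induction on l applies; so the coefficients can be pushed deeper until j = m.\<close>

lemma (in filt) valabrega_valla: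
  assumes KS: "\<And>n. K n = I (Suc n)"
    and x: "\<forall>i<r. x i \<in> I 1" and reg: "regseq x r"
  shows "l \<le> r \<Longrightarrow> (\<Sum>i<l. a i * x i) \<in> I (Suc m) \<Longrightarrow>
    \<exists>b. (\<forall>i<l. b i \<in> I m) \<and> (\<Sum>i<l. a i * x i) = (\<Sum>i<l. b i * x i)"
proof (induction l arbitrary: a m)
  case (Suc l)
  note IH = Suc.IH
  have dec: "I (Suc n) \<subseteq> I n" for n using KI[of n] by (simp add: KS)
  have dec': "i \<le> j \<Longrightarrow> I j \<subseteq> I i" for i j using lift_Suc_antimono_le[of I] dec by blast
  have xl: "x l \<in> I 1" using x Suc.prems by simp
  have "\<exists>b. (\<forall>i<Suc l. b i \<in> I j) \<and> (\<Sum>i<Suc l. a i * x i) = (\<Sum>i<Suc l. b i * x i)" if "j \<le> m" for j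
    using that
  proof (induction j)
    case 0
    then show ?case by (auto simp: I0)
  next
    case (Suc j)
    then obtain b where b: "\<forall>i<Suc l. b i \<in> I j" and ab: "(\<Sum>i<Suc l. a i * x i) = (\<Sum>i<Suc l. b i * x i)"
      by auto
    have tot: "(\<Sum>i<Suc l. b i * x i) \<in> I (Suc (Suc j))"
      using \<open>(\<Sum>i<Suc l. a i * x i) \<in> I (Suc m)\<close> dec'[of "Suc (Suc j)" "Suc m"] Suc.prems ab by auto
    have "x l * b l - (\<Sum>i<l. (- b i) * x i) = (\<Sum>i<Suc l. b i * x i)" by (simp add: sum_negf mult.commute)
    then have "x l * b l - (\<Sum>i<l. (- b i) * x i) \<in> K (Suc j)" using tot by (simp only: KS)
    moreover have "\<forall>i<l. - b i \<in> I j" "b l \<in> I j" using b Icl(3) by (simp_all add: less_Suc_eq)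
    ultimately obtain c where c: "\<forall>i<l. c i \<in> Ipred j" and bc: "b l - (\<Sum>i<l. c i * x i) \<in> K j"
      using reg[unfolded regseq_def, rule_format, of l "b l" j "\<lambda>i. - b i"] \<open>Suc l \<le> r\<close> by auto
    define d where "d = b l - (\<Sum>i<l. c i * x i)"
    have d: "d \<in> I (Suc j)" using bc by (simp add: d_def KS)
    have eq: "(\<Sum>i<l. (b i + c i * x l) * x i) = (\<Sum>i<Suc l. b i * x i) - d * x l"
      by (simp add: d_def algebra_simps sum.distrib sum_distrib_right sum_distrib_left)
    have "(\<Sum>i<l. (b i + c i * x l) * x i) \<in> I (Suc (Suc j))"
      unfolding eq using I_mult[OF d xl] tot by (intro Icl(4)) auto
    then obtain e where e: "\<forall>i<l. e i \<in> I (Suc j)" "(\<Sum>i<l. (b i + c i * x l) * x i) = (\<Sum>i<l. e i * x i)"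
      using Suc.prems \<open>Suc l \<le> r\<close> IH[of "\<lambda>i. b i + c i * x l" "Suc j"] by auto
    have "(\<Sum>i<Suc l. a i * x i) = (\<Sum>i<Suc l. (e(l := d)) i * x i)"
      using eq e(2) ab by (simp add: algebra_simps)
    moreover have "\<forall>i<Suc l. (e(l := d)) i \<in> I (Suc j)" using e(1) d by auto
    ultimately show ?case by blast
  qed
  from this[of m] show ?case by simp
qed auto

section \<open>Monomials in a regular sequence\<close>

text \<open>A list of length \<open>t\<close> is the exponent vector of a monomial in the last \<open>t\<close> of the \<open>r\<close> variables.\<close>

fun xmon :: "nat \<Rightarrow> (nat \<Rightarrow> 'p::comm_ring_1) \<Rightarrow> nat list \<Rightarrow> 'p" where
  "xmon r x [] = 1"
| "xmon r x (k # ks) = x (r - 1 - length ks) ^ k * xmon r x ks"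

definition exps :: "nat \<Rightarrow> nat \<Rightarrow> nat list set" where
  "exps t n = {ks. length ks = t \<and> sum_list ks \<le> n}"

lemma finite_exps: "finite (exps t n)"
proof (rule finite_subset)
  show "exps t n \<subseteq> {ks. set ks \<subseteq> {..n} \<and> length ks = t}"
    using member_le_sum_list by (fastforce simp: exps_def)
qed (simp add: finite_lists_length_eq)

text \<open>Prepending the slack \<open>n - sum_list ks\<close> turns vectors with sum at most n
  into vectors with one more entry and sum exactly n.\<close>

lemma card_exps: "card (exps t n) = (n + t) choose t"
proof -
  have "bij_betw tl {ks. length ks = Suc t \<and> sum_list ks = n} (exps t n)"
  proof (rule bij_betwI[where g = "\<lambda>ks. (n - sum_list ks) # ks"])
    show "tl \<in> {ks. length ks = Suc t \<and> sum_list ks = n} \<rightarrow> exps t n"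
      by (auto simp: exps_def length_Suc_conv)
  qed (auto simp: exps_def length_Suc_conv)
  then have "card (exps t n) = card {ks :: nat list. length ks = Suc t \<and> sum_list ks = n}"
    by (simp add: bij_betw_same_card)
  also have "\<dots> = (n + Suc t - 1) choose n" by (rule card_length_sum_list)
  also have "\<dots> = (n + t) choose t" using binomial_symmetric[of n "n + t"] by simp
  finally show ?thesis .
qed

lemma exps_0: "exps 0 n = {[]}" by (auto simp: exps_def)

lemma exps_Suc_0: "exps (Suc t) 0 = (#) 0 ` exps t 0"
  by (auto simp: exps_def length_Suc_conv image_iff)

text \<open>A monomial either avoids the first of its variables or is divisible by it; the double
  induction in \<open>monomials_independent\<close> follows this split.\<close>

lemma exps_Suc_Suc:
  "exps (Suc t) (Suc n) = (#) 0 ` exps t (Suc n) \<union> (\<lambda>ks. Suc (hd ks) # tl ks) ` exps (Suc t) n" (is "_ = ?R")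
proof
  show "exps (Suc t) (Suc n) \<subseteq> ?R"
  proof
    fix ks assume "ks \<in> exps (Suc t) (Suc n)"
    then obtain k l where kl: "ks = k # l" "length l = t" "k + sum_list l \<le> Suc n"
      by (auto simp: exps_def length_Suc_conv)
    show "ks \<in> ?R"
    proof (cases k)
      case (Suc k')
      then have "k' # l \<in> exps (Suc t) n" "ks = (\<lambda>ks. Suc (hd ks) # tl ks) (k' # l)"
        using kl by (auto simp: exps_def)
      then show ?thesis by blast
    qed (use kl in \<open>auto simp: exps_def\<close>)
  qed
qed (auto simp: exps_def length_Suc_conv)

lemma (in filt) xmon_in:
  assumes x: "\<forall>i<r. x i \<in> I 1"
  shows "length ks \<le> r \<Longrightarrow> xmon r x ks \<in> I (sum_list ks)"
proof (induction ks)
  case (Cons k ks)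
  have "x (r - 1 - length ks) \<in> I 1" using Cons x by auto
  then have "x (r - 1 - length ks) ^ k \<in> I k"
    using I_mult[of _ 1] by (induction k) (auto simp: I0)
  then show ?case using Cons I_mult by auto
qed (simp add: I0)

text \<open>The variables \<open>x l\<close> with l < r - t are treated as zero. In the step, the
  combination is \<open>P0 + x i * P1\<close> with P0 free of \<open>x i\<close>. Modulo
  \<open>x i\<close> only P0 remains, so its coefficients lie in m by the induction on t, and P0
  lies in K. Then \<open>x i * P1\<close> lies in the ideal of the earlier variables, regularity
  allows division by \<open>x i\<close>, and P1 is handled by the induction on the degree.\<close>

lemma (in filt) monomials_independent:
  assumes m: "maximal_set m" and mI: "\<And>n u a. u \<in> m \<Longrightarrow> a \<in> I n \<Longrightarrow> u * a \<in> K n"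
    and x: "\<forall>i<r. x i \<in> I 1" and reg: "regseq x r"
    and e: "\<And>d. d \<le> N \<Longrightarrow> e d \<in> I d"
    and e': "\<And>d b. d \<le> N \<Longrightarrow> \<forall>i<r. b i \<in> Ipred d \<Longrightarrow> e d - (\<Sum>i<r. b i * x i) \<notin> K d"
  shows "t \<le> r \<Longrightarrow> n \<le> N \<Longrightarrow> \<forall>l<r - t. b l \<in> Ipred n \<Longrightarrow>
    (\<Sum>ks\<in>exps t n. c ks * (xmon r x ks * e (n - sum_list ks))) - (\<Sum>l<r - t. b l * x l) \<in> K n \<Longrightarrow>
    ks \<in> exps t n \<Longrightarrow> c ks \<in> m"
proof (induction t arbitrary: n b c ks)
  case 0
  show ?case
  proof (rule ccontr)
    assume "\<not> c ks \<in> m"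
    \<comment> \<open>A coefficient outside m could be inverted, which would place
      \<open>e n\<close> in the ideal of x plus \<open>K n\<close>, against
      \<open>e'\<close>.\<close>
    then obtain v where v: "v * c [] - 1 \<in> m" using maximal_setD(3)[OF m] 0 by (auto simp: exps_0)
    have "v * (c [] * e n - (\<Sum>l<r. b l * x l)) - (v * c [] - 1) * e n \<in> K n"
      using 0 by (intro Kcl(4)[OF Kcl(5) mI[OF v e]]) (auto simp: exps_0)
    also have "v * (c [] * e n - (\<Sum>l<r. b l * x l)) - (v * c [] - 1) * e n = e n - (\<Sum>l<r. (v * b l) * x l)"
      by (simp add: algebra_simps sum_distrib_left)
    finally show False
      using e'[of n "\<lambda>l. v * b l"] 0 ideal_ofD(4)[OF Ipred_ideal UNIV_I] by auto
  qed
next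
  case (Suc t)
  define i where "i = r - Suc t"
  have i: "i < r" "r - t = Suc i" "r - 1 - t = i" using Suc.prems by (auto simp: i_def)
  note IHt = Suc.IH
  have x_i: "x i \<in> I 1" using x i by blast
  have mon: "xmon r x ks * e (n - sum_list ks) \<in> I n" if "ks \<in> exps t' n" "t' \<le> r" "n \<le> N" for ks t' n
    using I_mult[OF xmon_in[OF x, of ks] e[of "n - sum_list ks"]] that by (auto simp: exps_def)
 have main: "\<forall>ks\<in>exps (Suc t) n. c ks \<in> m"
    if "n \<le> N" "\<forall>l<i. b l \<in> Ipred n"
      "(\<Sum>ks\<in>exps (Suc t) n. c ks * (xmon r x ks * e (n - sum_list ks))) - (\<Sum>l<i. b l * x l) \<in> K n" for n b c
    using that
  proof (induction n arbitrary: b c)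
    case 0
    have "(\<Sum>ks\<in>exps (Suc t) 0. c ks * (xmon r x ks * e (0 - sum_list ks))) =
        (\<Sum>ks\<in>exps t 0. c (0 # ks) * (xmon r x ks * e (0 - sum_list ks)))"
      unfolding exps_Suc_0 by (subst sum.reindex) auto
    moreover have "(\<Sum>l<r - t. (b(i := 0)) l * x l) = (\<Sum>l<i. b l * x l)" unfolding i by simp
    ultimately have a1: "(\<Sum>ks\<in>exps t 0. c (0 # ks) * (xmon r x ks * e (0 - sum_list ks))) -
        (\<Sum>l<r - t. (b(i := 0)) l * x l) \<in> K 0" using 0(3) by (simp only:)
    have a2: "\<forall>l<r - t. (b(i := 0)) l \<in> Ipred 0" using 0(2) unfolding i by (simp add: less_Suc_eq)
    have a3: "t \<le> r" using \<open>Suc t \<le> r\<close> by simp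
    have "c (0 # ks) \<in> m" if "ks \<in> exps t 0" for ks
      by (rule IHt[where n = 0 and b = "b(i := 0)" and c = "\<lambda>ks. c (0 # ks)", OF a3 le0 a2 a1 that])
    then show ?case by (auto simp: exps_Suc_0)
  next
    case (Suc n)
    let ?inc = "\<lambda>ks. Suc (hd ks) # tl ks"
    define P0 where "P0 = (\<Sum>ks\<in>exps t (Suc n). c (0 # ks) * (xmon r x ks * e (Suc n - sum_list ks)))"
    define P1 where "P1 = (\<Sum>ks\<in>exps (Suc t) n. c (?inc ks) * (xmon r x ks * e (n - sum_list ks)))"
    have inj: "inj_on ?inc (exps (Suc t) n)"
    proof (rule inj_onI)
      fix ks ls assume "ks \<in> exps (Suc t) n" "ls \<in> exps (Suc t) n" and eq: "?inc ks = ?inc ls"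
      then have "ks \<noteq> []" "ls \<noteq> []" by (auto simp: exps_def)
      with eq show "ks = ls" by (cases ks; cases ls) simp_all
    qed
    have "(\<Sum>ks\<in>exps (Suc t) (Suc n). c ks * (xmon r x ks * e (Suc n - sum_list ks))) =
        (\<Sum>ks\<in>(#) 0 ` exps t (Suc n). c ks * (xmon r x ks * e (Suc n - sum_list ks))) +
        (\<Sum>ks\<in>?inc ` exps (Suc t) n. c ks * (xmon r x ks * e (Suc n - sum_list ks)))"
      unfolding exps_Suc_Suc by (rule sum.union_disjoint) (auto simp: finite_exps)
    also have "(\<Sum>ks\<in>(#) 0 ` exps t (Suc n). c ks * (xmon r x ks * e (Suc n - sum_list ks))) = P0"
      unfolding P0_def by (subst sum.reindex) auto
    also have "(\<Sum>ks\<in>?inc ` exps (Suc t) n. c ks * (xmon r x ks * e (Suc n - sum_list ks))) = x i * P1"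
      unfolding P1_def sum_distrib_left sum.reindex[OF inj] o_def
    proof (rule sum.cong)
      fix ks assume "ks \<in> exps (Suc t) n"
      then obtain k l where "ks = k # l" "length l = t" by (auto simp: exps_def length_Suc_conv)
      then show "c (?inc ks) * (xmon r x (?inc ks) * e (Suc n - sum_list (?inc ks))) =
          x i * (c (?inc ks) * (xmon r x ks * e (n - sum_list ks)))"
        using i(3) by (simp add: mult_ac)
    qed simp
    finally have split: "(\<Sum>ks\<in>exps (Suc t) (Suc n). c ks * (xmon r x ks * e (Suc n - sum_list ks))) = P0 + x i * P1" .
    have P1: "P1 \<in> I n" unfolding P1_def using Suc.prems \<open>Suc t \<le> r\<close> by (intro Isum Icl(5) mon) auto
    have bI: "\<forall>l<i. b l \<in> I n" using Suc.prems by simp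
    have tot: "P0 + x i * P1 - (\<Sum>l<i. b l * x l) \<in> K (Suc n)" using Suc.prems split by simp
    \<comment> \<open>The term \<open>x i * P1\<close> joins the ideal part, with coefficient
      \<open>- P1\<close> at \<open>x i\<close>, so that the induction on t applies to P0
      alone.\<close>
    have "(\<Sum>l<r - t. (b(i := - P1)) l * x l) = (\<Sum>l<i. b l * x l) - x i * P1" unfolding i by (simp add: mult.commute)
    then have "P0 - (\<Sum>l<r - t. (b(i := - P1)) l * x l) = P0 + x i * P1 - (\<Sum>l<i. b l * x l)"
      by (simp only:) (simp add: algebra_simps)
    with tot have a1: "P0 - (\<Sum>l<r - t. (b(i := - P1)) l * x l) \<in> K (Suc n)" by (simp only:)
    have a2: "\<forall>l<r - t. (b(i := - P1)) l \<in> Ipred (Suc n)"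
      using bI P1 Icl(3) unfolding i by (auto simp: less_Suc_eq)
    have a3: "t \<le> r" using \<open>Suc t \<le> r\<close> by simp
    have c0: "c (0 # ks) \<in> m" if "ks \<in> exps t (Suc n)" for ks
      by (rule IHt[where n = "Suc n" and b = "b(i := - P1)" and c = "\<lambda>ks. c (0 # ks)",
            OF a3 \<open>Suc n \<le> N\<close> a2 a1[unfolded P0_def] that])
    then have "P0 \<in> K (Suc n)"
      unfolding P0_def using Suc.prems \<open>Suc t \<le> r\<close> by (intro Ksum mI mon[where t' = t]) auto
    then have "(P0 + x i * P1 - (\<Sum>l<i. b l * x l)) - P0 \<in> K (Suc n)" by (intro Kcl(4) tot)
    then have "x i * P1 - (\<Sum>l<i. b l * x l) \<in> K (Suc n)" by (simp add: algebra_simps)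
    then obtain d where d: "\<forall>l<i. d l \<in> Ipred n" "P1 - (\<Sum>l<i. d l * x l) \<in> K n"
      using reg P1 bI i(1) unfolding regseq_def by blast
    have "\<forall>ks\<in>exps (Suc t) n. c (?inc ks) \<in> m"
      by (rule Suc.IH[OF _ d(1)]) (use d(2) Suc.prems in \<open>simp_all only: P1_def Suc_leD\<close>)
    then show ?case using c0 by (auto simp: exps_Suc_Suc)
  qed
  have "\<forall>ks\<in>exps (Suc t) n. c ks \<in> m"
    by (rule main[OF \<open>n \<le> N\<close>, where b = b]) (use Suc.prems in \<open>simp_all only: i_def\<close>)
  then show ?case using \<open>ks \<in> exps (Suc t) n\<close> by (rule bspec)
qed

section \<open>Homogeneous primes and parameters\<close>

text \<open>The Vandermonde argument by repeated synthetic division: if p = (X - t0) q + p(t0), the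
  values of q at the other points lie in A because t - t0 can be cancelled modulo A.\<close>

lemma coeffs_in_ideal_if_values:
  fixes A :: "'p::comm_ring_1 set"
  assumes A: "ideal_of UNIV A"
    and d: "\<And>s t a. s \<in> S \<Longrightarrow> t \<in> S \<Longrightarrow> s \<noteq> t \<Longrightarrow> (s - t) * a \<in> A \<Longrightarrow> a \<in> A"
    and "infinite S" and "\<And>t. t \<in> S \<Longrightarrow> poly p t \<in> A"
  shows "Polynomial.coeff p k \<in> A"
  using assms(2-)
proof (induction "Polynomial.degree p" arbitrary: p k S)
  case 0
  then obtain c where c: "p = [:c:]" by (metis degree_eq_zeroE)
  obtain t where "t \<in> S" using 0 by (metis finite.emptyI ex_in_conv)
  then have "c \<in> A" using 0(4)[of t] c by simp
  then show ?case using c ideal_ofD(2)[OF A] by (cases k) simp_all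
next
  case (Suc n)
  obtain t0 where t0: "t0 \<in> S" using Suc.prems by (metis finite.emptyI ex_in_conv)
  define q where "q = synthetic_div p t0"
  have p: "p = [:- t0, 1:] * q + [:poly p t0:]" unfolding q_def by (rule synthetic_div_correct'[symmetric])
  have q: "Polynomial.coeff q k \<in> A" for k
  proof (rule Suc.hyps(1)[of q "S - {t0}"])
    show "n = Polynomial.degree q" using Suc.hyps(2) by (simp add: q_def degree_synthetic_div)
    show "infinite (S - {t0})" using Suc.prems(2) by simp
    fix t assume t: "t \<in> S - {t0}"
    have "poly p t = (t - t0) * poly q t + poly p t0"
      by (subst arg_cong[OF p, of "\<lambda>p. poly p t"]) (simp add: algebra_simps)
    then have "(t - t0) * poly q t = poly p t - poly p t0" by (simp add: algebra_simps)
    also have "\<dots> \<in> A" using t t0 Suc.prems(3) by (intro ideal_of_diff[OF subring_UNIV A]) blast+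
    finally show "poly q t \<in> A" using Suc.prems(1)[of t t0] t t0 by blast
  qed (use Suc.prems(1) in blast)
  have "Polynomial.coeff p k = (- t0) * Polynomial.coeff q k + (if k = 0 then poly p t0 else Polynomial.coeff q (k - 1))"
    by (subst arg_cong[OF p, of "\<lambda>p. Polynomial.coeff p k"]) (cases k, simp_all add: coeff_pCons)
  also have "\<dots> \<in> A"
    using q Suc.prems(3)[OF t0] by (intro ideal_ofD(3)[OF A] ideal_ofD(4)[OF A]) simp_all
  finally show ?case .
qed

section \<open>Homogeneous ideals and primes\<close>

context filt
begin

text \<open>Homogeneous ideals, primes and chains of primes of \<open>\<Oplus>\<^sub>n I\<^sub>n/K\<^sub>n\<close>, given by the preimages \<open>Q\<^sub>n\<close> of their
  graded pieces.\<close>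

definition hideal :: "(nat \<Rightarrow> 'p set) \<Rightarrow> bool" where
  "hideal Q \<longleftrightarrow> (\<forall>n. ideal_of UNIV (Q n) \<and> K n \<subseteq> Q n \<and> Q n \<subseteq> I n) \<and>
     (\<forall>i j. \<forall>a\<in>I i. \<forall>b\<in>Q j. a * b \<in> Q (i + j))"

definition hprime :: "(nat \<Rightarrow> 'p set) \<Rightarrow> bool" where
  "hprime Q \<longleftrightarrow> hideal Q \<and> 1 \<notin> Q 0 \<and>
     (\<forall>i j. \<forall>a\<in>I i. \<forall>b\<in>I j. a * b \<in> Q (i + j) \<longrightarrow> a \<in> Q i \<or> b \<in> Q j)"

lemma hidealD:
  assumes "hideal Q"
  shows "ideal_of UNIV (Q n)" "K n \<subseteq> Q n" "Q n \<subseteq> I n" "a \<in> I i \<Longrightarrow> b \<in> Q j \<Longrightarrow> a * b \<in> Q (i + j)"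
    "a \<in> Q i \<Longrightarrow> b \<in> I j \<Longrightarrow> a * b \<in> Q (i + j)"
proof -
  show "a \<in> I i \<Longrightarrow> b \<in> Q j \<Longrightarrow> a * b \<in> Q (i + j)" for a b i j using assms unfolding hideal_def by blast
  from this[of b j a i] show "a \<in> Q i \<Longrightarrow> b \<in> I j \<Longrightarrow> a * b \<in> Q (i + j)" by (simp add: ac_simps)
qed (use assms in \<open>auto simp: hideal_def\<close>)

lemma hprimeD:
  assumes "hprime Q"
  shows "hideal Q" "1 \<notin> Q 0" "a \<in> I i \<Longrightarrow> b \<in> I j \<Longrightarrow> a * b \<in> Q (i + j) \<Longrightarrow> a \<in> Q i \<or> b \<in> Q j"
  using assms unfolding hprime_def by blast+

lemma hideal_K: "hideal K"
  unfolding hideal_def using K KI K_mult by blast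

lemma hideal_improper:
  assumes "hideal Q" "1 \<in> Q 0" shows "I n \<subseteq> Q n"
  using hidealD(4)[OF assms(1) _ assms(2), of _ n] by auto

lemma hprime_power:
  assumes "hprime Q" "a \<in> I n"
  shows "a ^ k \<in> Q (n * k) \<Longrightarrow> a \<in> Q n"
proof (induction k)
  case 0
  then show ?case using hprimeD(2)[OF assms(1)] by simp
next
  case (Suc k)
  have "a ^ k \<in> I (n * k)"
    using assms(2) I_mult[OF assms(2)] by (induction k) (simp_all add: I0)
  then show ?case using Suc hprimeD(3)[OF assms(1,2), of "a ^ k" "n * k"] by auto
qed

text \<open>Degree n of the homogeneous ideal Q + (a), where a has degree i; below degree i the
  multiple of a must be zero.\<close>

definition extend :: "(nat \<Rightarrow> 'p set) \<Rightarrow> nat \<Rightarrow> 'p \<Rightarrow> nat \<Rightarrow> 'p set" where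
  "extend Q i a n = {q + c * a | q c. q \<in> Q n \<and> c \<in> (if i \<le> n then I (n - i) else {0})}"

lemma extendI: "q \<in> Q n \<Longrightarrow> i \<le> n \<Longrightarrow> c \<in> I (n - i) \<Longrightarrow> q + c * a \<in> extend Q i a n"
  by (auto simp: extend_def)

lemma shifted_ideal: "ideal_of UNIV (if i \<le> n then I (n - i) else {0})"
  using I by (simp add: ideal_of_def)

lemma shifted_mult:
  assumes "b \<in> I k" "c \<in> (if i \<le> n then I (n - i) else {0})"
  shows "b * c \<in> (if i \<le> k + n then I (k + n - i) else {0})"
  using I_mult[OF assms(1), of c "n - i"] assms(2) Icl(1) by (auto split: if_splits)

lemma hideal_extend:
  assumes Q: "hideal Q" and a: "a \<in> I i"
  shows "hideal (extend Q i a)"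
proof -
  let ?S = "\<lambda>n. if i \<le> n then I (n - i) else {0}"
  note Qi = hidealD(1)[OF Q] and S = shifted_ideal[of i]
  have "ideal_of UNIV (extend Q i a n)" for n
    unfolding ideal_of_def
  proof (intro conjI ballI)
    show "0 \<in> extend Q i a n"
      unfolding extend_def using ideal_ofD(2)[OF Qi, of n] ideal_ofD(2)[OF S, of n]
      by (intro CollectI exI[of _ 0]) simp
    fix u v assume "u \<in> extend Q i a n" "v \<in> extend Q i a n"
    then obtain q c q' c' where "u = q + c * a" "v = q' + c' * a" "q \<in> Q n" "q' \<in> Q n" "c \<in> ?S n" "c' \<in> ?S n"
      unfolding extend_def by blast
    then have "u + v = (q + q') + (c + c') * a" "q + q' \<in> Q n" "c + c' \<in> ?S n"
      using ideal_ofD(3)[OF Qi] ideal_ofD(3)[OF S] by (simp_all add: algebra_simps)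
    then show "u + v \<in> extend Q i a n" unfolding extend_def by blast
  next
    fix w u assume "u \<in> extend Q i a n"
    then obtain q c where "u = q + c * a" "q \<in> Q n" "c \<in> ?S n" unfolding extend_def by blast
    then have "w * u = w * q + (w * c) * a" "w * q \<in> Q n" "w * c \<in> ?S n"
      using ideal_ofD(4)[OF Qi UNIV_I] ideal_ofD(4)[OF S UNIV_I] by (simp_all add: algebra_simps)
    then show "w * u \<in> extend Q i a n" unfolding extend_def by blast
  qed simp
  moreover have sub: "Q n \<subseteq> extend Q i a n" for n
  proof
    fix q assume "q \<in> Q n"
    then show "q \<in> extend Q i a n" unfolding extend_def using ideal_ofD(2)[OF S, of n] by force
  qed
  moreover have "extend Q i a n \<subseteq> I n" for n
  proof
    fix u assume "u \<in> extend Q i a n"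
    then obtain q c where u: "u = q + c * a" "q \<in> Q n" "c \<in> ?S n" unfolding extend_def by blast
    have "q \<in> I n" using u(2) hidealD(3)[OF Q] by blast
    moreover have "c * a \<in> I n" using u(3) I_mult[OF _ a, of c "n - i"] Icl(1) by (auto split: if_splits)
    ultimately show "u \<in> I n" using u(1) Icl(2) by blast
  qed
  moreover have "b * u \<in> extend Q i a (k + n)" if b: "b \<in> I k" and uu: "u \<in> extend Q i a n" for b u k n
  proof -
    obtain q c where u: "u = q + c * a" "q \<in> Q n" "c \<in> ?S n" using uu unfolding extend_def by blast
    then have "b * u = b * q + (b * c) * a" "b * q \<in> Q (k + n)" "b * c \<in> ?S (k + n)"
      using hidealD(4)[OF Q b u(2)] shifted_mult[OF b u(3)] by (simp_all add: algebra_simps)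
    then show ?thesis unfolding extend_def by blast
  qed
  ultimately show ?thesis unfolding hideal_def using hidealD(2)[OF Q] by blast
qed

lemma extend_ge: "hideal Q \<Longrightarrow> Q \<le> extend Q i a"
proof (rule le_funI, rule subsetI)
  fix n q assume "hideal Q" "q \<in> Q n"
  then show "q \<in> extend Q i a n" unfolding extend_def using ideal_ofD(2)[OF shifted_ideal, of i n] by force
qed

lemma extend_self: "hideal Q \<Longrightarrow> a \<in> extend Q i a i"
  using extendI[of 0 Q i i 1 a] ideal_ofD(2)[OF hidealD(1)] by (simp add: I0)

lemma extend_le:
  assumes P: "hideal P" and "Q \<le> P" "a \<in> P i"
  shows "extend Q i a \<le> P"
proof (rule le_funI, rule subsetI)
  fix n u assume "u \<in> extend Q i a n"
  then obtain q c where u: "u = q + c * a" "q \<in> Q n" "c \<in> (if i \<le> n then I (n - i) else {0})"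
    unfolding extend_def by blast
  have "c * a \<in> P n"
    using u(3) hidealD(4)[OF P _ assms(3), of c "n - i"] ideal_ofD(2)[OF hidealD(1)[OF P]] by (auto split: if_splits)
  moreover have "q \<in> P n" using u(2) le_funD[OF assms(2)] by blast
  ultimately show "u \<in> P n" unfolding u(1) by (intro ideal_ofD(3)[OF hidealD(1)[OF P]])
qed

text \<open>The dichotomy behind the Noetherian inductions: a proper homogeneous ideal that is not
  prime has two strictly larger ones whose product lies in it.\<close>

lemma not_hprime_extend:
  assumes Q: "hideal Q" and "\<not> hprime Q" and "1 \<notin> Q 0"
  obtains i j a b where "a \<in> I i" "b \<in> I j" "a * b \<in> Q (i + j)"
    "hideal (extend Q i a)" "Q < extend Q i a" "hideal (extend Q j b)" "Q < extend Q j b"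
proof -
  obtain i j a b where ab: "a \<in> I i" "b \<in> I j" "a * b \<in> Q (i + j)" "a \<notin> Q i" "b \<notin> Q j"
    using assms unfolding hprime_def by blast
  have "Q < extend Q i a" if "a \<notin> Q i" for i a
    using extend_ge[OF Q, of i a] extend_self[OF Q, of a i] that by (auto simp: less_fun_def le_fun_def)
  then show thesis using that[OF ab(1-3)] hideal_extend[OF Q] ab by blast
qed

definition hchain :: "(nat \<Rightarrow> 'p set) \<Rightarrow> nat \<Rightarrow> bool" where
  "hchain Q s \<longleftrightarrow> (\<exists>P. (\<forall>i\<le>s. hprime (P i)) \<and> (\<forall>i<s. P i < P (Suc i)) \<and> Q \<le> P 0)"

end

section \<open>Homogeneous primes of a fiber cone\<close>

text \<open>The assumption \<open>gen\<close> says \<open>I\<^bsub>n+1\<^esub> \<subseteq> I\<^sub>1 I\<^sub>n + K\<^bsub>n+1\<^esub>\<close> for \<open>n \<ge> N0\<close>; testing against all ideals \<open>A\<close> avoids products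
  of ideals.\<close>

locale fiber_filt = filt I K for I K :: "nat \<Rightarrow> 'p::comm_ring_1 set" +
  fixes m :: "'p set" and N0 :: nat
  assumes m: "maximal_set m" and K0: "K 0 = m" and mI: "u \<in> m \<Longrightarrow> a \<in> I n \<Longrightarrow> u * a \<in> K n"
    and unit: "u \<notin> m \<Longrightarrow> \<exists>v. \<forall>n. v * u - 1 \<in> K n"
    and acc: "wf {(Q', Q). hideal Q \<and> hideal Q' \<and> Q < Q'}"
    and gen: "N0 \<le> n \<Longrightarrow> ideal_of UNIV A \<Longrightarrow> K (Suc n) \<subseteq> A \<Longrightarrow>
      (\<And>u v. u \<in> I 1 \<Longrightarrow> v \<in> I n \<Longrightarrow> u * v \<in> A) \<Longrightarrow> I (Suc n) \<subseteq> A"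
    and fin_gen: "\<exists>L g. (\<forall>j<L. g j \<in> I n) \<and> (\<forall>a\<in>I n. \<exists>c. a - (\<Sum>j<(L::nat). c j * g j) \<in> K n)"
    and residues: "\<exists>S::'p set. infinite S \<and> (\<forall>s\<in>S. \<forall>t\<in>S. s \<noteq> t \<longrightarrow> s - t \<notin> m)"
begin

text \<open>The homogeneous maximal ideal; it lies above every \<open>hprime\<close>.\<close>

definition M :: "nat \<Rightarrow> 'p set" where "M n = (if n = 0 then m else I n)"

text \<open>Iterates \<open>gen\<close>: the induction hypothesis is applied to the colon ideal of A
  by I_1.\<close>

lemma gen_add:
  assumes n: "N0 \<le> n"
  shows "ideal_of UNIV A \<Longrightarrow> K (n + j) \<subseteq> A \<Longrightarrow>
    (\<And>u v. u \<in> I j \<Longrightarrow> v \<in> I n \<Longrightarrow> u * v \<in> A) \<Longrightarrow> I (n + j) \<subseteq> A"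
proof (induction j arbitrary: A)
  case 0
  have "a \<in> A" if "a \<in> I n" for a using 0(3)[of 1 a] that by (simp add: I0)
  then show ?case by auto
next
  case (Suc j)
  define B where "B = {v. \<forall>u\<in>I 1. u * v \<in> A}"
  have "ideal_of UNIV B"
    using Suc.prems(1) unfolding ideal_of_def B_def by (auto simp: distrib_left mult.left_commute)
  moreover have "K (n + j) \<subseteq> B" using K_mult[of _ 1 _ "n + j"] Suc.prems(2) by (auto simp: B_def)
  moreover have "u * v \<in> B" if "u \<in> I j" "v \<in> I n" for u v
    unfolding B_def
  proof (intro CollectI ballI)
    fix w assume "w \<in> I 1"
    then have "w * u \<in> I (Suc j)" using I_mult[of w 1 u j] that by simp
    then have "(w * u) * v \<in> A" by (intro Suc.prems(3) that)
    then show "w * (u * v) \<in> A" by (simp add: mult.assoc)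
  qed
  ultimately have "I (n + j) \<subseteq> B" by (rule Suc.IH)
  then show ?case using gen[of "n + j" A] n Suc.prems(1,2) by (auto simp: B_def)
qed

text \<open>The degree 0 part of the graded ring is the residue field, whose only proper ideal is
  zero.\<close>

lemma hprime_0:
  assumes "hprime P" shows "P 0 = m"
proof
  note P = hidealD[OF hprimeD(1)[OF assms]]
  show "m \<subseteq> P 0" using P(2)[of 0] by (simp add: K0)
  show "P 0 \<subseteq> m"
  proof (rule subsetI, rule ccontr)
    fix u assume u: "u \<in> P 0" "u \<notin> m"
    then obtain v where v: "v * u - 1 \<in> m" using maximal_setD(3)[OF m] by blast
    have "v * u - (v * u - 1) \<in> P 0"
      by (rule ideal_of_diff[OF subring_UNIV P(1) ideal_ofD(4)[OF P(1) UNIV_I u(1)]]) (use v \<open>m \<subseteq> P 0\<close> in blast)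
    then show False using hprimeD(2)[OF assms] by simp
  qed
qed

lemma hprime_le_M: "hprime P \<Longrightarrow> P \<le> M"
  using hprime_0[of P] hidealD(3)[OF hprimeD(1), of P] by (simp add: le_fun_def M_def)

lemma hprime_M: "hprime M"
proof -
  note mm = maximal_setD[OF m]
  have 1: "ideal_of UNIV (M n)" for n using I mm by (simp add: M_def)
  have 2: "K n \<subseteq> M n" "M n \<subseteq> I n" for n using KI by (auto simp: M_def K0 I0)
  have "a * b \<in> M (i + j)" if "a \<in> I i" "b \<in> M j" for a b i j
    using that I_mult[of a i b j] 2(2)[of j] ideal_ofD(4)[OF mm(1) UNIV_I, of b a] by (auto simp: M_def split: if_splits)
  then have h: "hideal M" unfolding hideal_def using 1 2 by blast
  have "a \<in> M i \<or> b \<in> M j" if "a \<in> I i" "b \<in> I j" "a * b \<in> M (i + j)" for a b i j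
    using that maximal_set_prime[OF m, of a b] by (auto simp: M_def split: if_splits)
  with h mm(2) show ?thesis unfolding hprime_def by (simp add: M_def)
qed

lemma hprime_eq_M:
  assumes P: "hprime P" and sub: "I 1 \<subseteq> P 1" shows "P = M"
proof (rule antisym[OF hprime_le_M[OF P]], rule le_funI)
  fix n
  note Pi = hidealD[OF hprimeD(1)[OF P]]
  have big: "I (Suc k) \<subseteq> P (Suc k)" if "N0 \<le> k" for k
    using gen[OF that Pi(1) Pi(2)] Pi(5)[of _ 1 _ k] sub by auto
  show "M n \<subseteq> P n"
  proof (cases "n = 0")
    case True
    then show ?thesis using hprime_0[OF P] by (simp add: M_def)
  next
    case False
    have "a \<in> P n" if a: "a \<in> I n" for a
    proof (rule hprime_power[OF P a])
      have "a ^ k \<in> I (n * k)" for k using I_mult[OF a] by (induction k) (simp_all add: I0)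
      \<comment> \<open>As n >= 1, the power with exponent N0 + 1 has degree above N0, where P
        already contains everything.\<close>
      moreover obtain k where "n * Suc N0 = Suc k" "N0 \<le> k" using False by (cases n) auto
      ultimately show "a ^ Suc N0 \<in> P (n * Suc N0)" using big[of k] by (metis subsetD)
    qed
    then show ?thesis using False by (auto simp: M_def)
  qed
qed

text \<open>If a b lies in Q, every prime above Q contains a or b and so lies above one of two
  larger ideals; Noetherian induction collects the finitely many primes of both.\<close>

lemma finitely_many_minimal_hprimes:
  "hideal Q \<Longrightarrow> \<exists>S. finite S \<and> (\<forall>P\<in>S. hprime P \<and> Q \<le> P) \<and> (\<forall>P. hprime P \<longrightarrow> Q \<le> P \<longrightarrow> (\<exists>P'\<in>S. P' \<le> P))"
proof (induction Q rule: wf_induct_rule[OF acc])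
  case (1 Q)
  consider "hprime Q" | "1 \<in> Q 0" | "\<not> hprime Q" "1 \<notin> Q 0" by blast
  then show ?case
  proof cases
    case 1
    then show ?thesis by (intro exI[of _ "{Q}"]) simp
  next
    case 2
    have "\<not> Q \<le> P" if "hprime P" for P
      using hprimeD(2)[OF that] 2 by (auto simp: le_fun_def)
    then show ?thesis by (intro exI[of _ "{}"]) simp
  next
    case 3
    obtain i j a b where ab: "a \<in> I i" "b \<in> I j" "a * b \<in> Q (i + j)"
      and A: "hideal (extend Q i a)" "Q < extend Q i a" and B: "hideal (extend Q j b)" "Q < extend Q j b"
      by (rule not_hprime_extend[OF \<open>hideal Q\<close> 3])
    have IH: "hideal Q' \<Longrightarrow> Q < Q' \<Longrightarrow> \<exists>S. finite S \<and> (\<forall>P\<in>S. hprime P \<and> Q' \<le> P) \<and>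
        (\<forall>P. hprime P \<longrightarrow> Q' \<le> P \<longrightarrow> (\<exists>P'\<in>S. P' \<le> P))" for Q'
      by (rule "1.IH") (simp_all add: \<open>hideal Q\<close>)
    obtain S where S: "finite S" "\<forall>P\<in>S. hprime P \<and> extend Q i a \<le> P"
      "\<forall>P. hprime P \<longrightarrow> extend Q i a \<le> P \<longrightarrow> (\<exists>P'\<in>S. P' \<le> P)"
      using IH[OF A] by (elim exE conjE)
    obtain S' where S': "finite S'" "\<forall>P\<in>S'. hprime P \<and> extend Q j b \<le> P"
      "\<forall>P. hprime P \<longrightarrow> extend Q j b \<le> P \<longrightarrow> (\<exists>P'\<in>S'. P' \<le> P)"
      using IH[OF B] by (elim exE conjE)
    have "\<exists>P'\<in>S \<union> S'. P' \<le> P" if P: "hprime P" "Q \<le> P" for P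
    proof -
      have "a * b \<in> P (i + j)" using ab(3) le_funD[OF P(2)] by blast
      then have "a \<in> P i \<or> b \<in> P j" by (intro hprimeD(3)[OF P(1) ab(1,2)])
      then have "extend Q i a \<le> P \<or> extend Q j b \<le> P" using extend_le[OF hprimeD(1)[OF P(1)] P(2)] by blast
      then show ?thesis using S(3) S'(3) P(1) by blast
    qed
    moreover have "\<forall>P\<in>S \<union> S'. hprime P \<and> Q \<le> P"
      using S(2) S'(2) order_trans[OF less_imp_le[OF A(2)]] order_trans[OF less_imp_le[OF B(2)]] by blast
    ultimately show ?thesis using S(1) S'(1) by (intro exI[of _ "S \<union> S'"]) simp
  qed
qed

text \<open>If Q + (a) and Q + (b) contain all large degrees and a b lies in Q, then products of two
  elements of large degree lie in Q, and by \<open>gen_add\<close> such products fill the large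
  degrees modulo K.\<close>

lemma eventually_everything:
  "hideal Q \<Longrightarrow> (\<And>P. hprime P \<Longrightarrow> Q \<le> P \<Longrightarrow> P = M) \<Longrightarrow> \<exists>N. \<forall>n\<ge>N. I n \<subseteq> Q n"
proof (induction Q rule: wf_induct_rule[OF acc])
  case (1 Q)
  note Q = \<open>hideal Q\<close>
  consider "hprime Q" | "1 \<in> Q 0" | "\<not> hprime Q" "1 \<notin> Q 0" by blast
  then show ?case
  proof cases
    case 1
    then have "Q = M" using "1.prems"(2)[OF 1] by simp
    then show ?thesis by (intro exI[of _ 1]) (simp add: M_def)
  next
    case 2
    then show ?thesis using hideal_improper[OF Q] by blast
  next
    case 3
    obtain i j a b where ab: "a \<in> I i" "b \<in> I j" "a * b \<in> Q (i + j)"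
      and A: "hideal (extend Q i a)" "Q < extend Q i a" and B: "hideal (extend Q j b)" "Q < extend Q j b"
      by (rule not_hprime_extend[OF Q 3])
    have abv: "\<And>P. hprime P \<Longrightarrow> extend Q i a \<le> P \<Longrightarrow> P = M" "\<And>P. hprime P \<Longrightarrow> extend Q j b \<le> P \<Longrightarrow> P = M"
      using order_trans[OF less_imp_le[OF A(2)]] order_trans[OF less_imp_le[OF B(2)]] "1.prems"(2) by blast+
    obtain N1 where N1: "\<forall>n\<ge>N1. I n \<subseteq> extend Q i a n"
      using "1.IH"[OF _ A(1) abv(1)] A Q by blast
    obtain N2 where N2: "\<forall>n\<ge>N2. I n \<subseteq> extend Q j b n"
      using "1.IH"[OF _ B(1) abv(2)] B Q by blast
    \<comment> \<open>N has to reach N1, and n - N has to reach N2 and, for \<open>gen_add\<close>,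
      N0; the condition n >= N + N secures this.\<close>
    define N where "N = N0 + N1 + N2"
    have "I n \<subseteq> Q n" if n: "n \<ge> N + N" for n
    proof -
      have n': "n = (n - N) + N" using n by simp
      have "I ((n - N) + N) \<subseteq> Q ((n - N) + N)"
      proof (rule gen_add)
        show "N0 \<le> n - N" using n by (simp add: N_def)
        fix u v assume uv: "u \<in> I N" "v \<in> I (n - N)"
        have "u \<in> extend Q i a N" using uv(1) N1 subsetD[of "I N"] by (simp add: N_def)
        then obtain q c where u: "u = q + c * a" "q \<in> Q N" "c \<in> (if i \<le> N then I (N - i) else {0})"
          unfolding extend_def by blast
        have "v \<in> extend Q j b (n - N)" using uv(2) N2 n subsetD[of "I (n - N)"] by (simp add: N_def)
        then obtain q' c' where v: "v = q' + c' * b" "q' \<in> Q (n - N)" "c' \<in> (if j \<le> n - N then I (n - N - j) else {0})"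
          unfolding extend_def by blast
        have 1: "q * v \<in> Q n" using hidealD(5)[OF Q u(2) uv(2)] n by simp
        have "c * a \<in> I N" using u(3) I_mult[OF _ ab(1), of c "N - i"] Icl(1) by (auto split: if_splits)
        then have 2: "(c * a) * q' \<in> Q n" using hidealD(4)[OF Q _ v(2), of "c * a" N] n by simp
        have 3: "(c * c') * (a * b) \<in> Q n"
        proof (cases "i \<le> N \<and> j \<le> n - N")
          case True
          then have "c * c' \<in> I ((N - i) + (n - N - j))" using u(3) v(3) by (intro I_mult) auto
          moreover have "(N - i) + (n - N - j) + (i + j) = n" using True n by linarith
          ultimately show ?thesis using hidealD(4)[OF Q _ ab(3)] by metis
        next
          case False
     then have "c * c' = 0" using u(3) v(3) by (auto split: if_splits)
          then show ?thesis using ideal_ofD(2)[OF hidealD(1)[OF Q]] by simp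
        qed
        have "u * v = q * v + ((c * a) * q' + (c * c') * (a * b))" by (simp add: u(1) v(1) algebra_simps)
        also have "\<dots> \<in> Q n" using 1 2 3 by (intro ideal_ofD(3)[OF hidealD(1)[OF Q]])
        finally show "u * v \<in> Q ((n - N) + N)" using n by simp
      qed (use hidealD[OF Q] in auto)
      then show ?thesis using n' by metis
    qed
    then show ?thesis by blast
  qed
qed

text \<open>Prime avoidance inside degree 1, based on the infinite residue field: the elements
  \<open>poly G t\<close> run along the moment curve in the generators of I_1. If infinitely many t
  gave elements of one P, all generators would lie in \<open>P 1\<close>, forcing P = M.\<close>

lemma avoid_hprimes:
  assumes "finite S" "\<And>P. P \<in> S \<Longrightarrow> hprime P" "\<And>P. P \<in> S \<Longrightarrow> P \<noteq> M"
  obtains y where "y \<in> I 1" "\<And>P. P \<in> S \<Longrightarrow> y \<notin> P 1"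
proof -
  obtain R :: "'p set" where R: "infinite R" "\<forall>s\<in>R. \<forall>t\<in>R. s \<noteq> t \<longrightarrow> s - t \<notin> m" using residues by blast
  obtain L g where g: "\<forall>j<L. g j \<in> I 1" "\<forall>a\<in>I 1. \<exists>c. a - (\<Sum>j<(L::nat). c j * g j) \<in> K 1"
    using fin_gen[of 1] by blast
  define G where "G = (\<Sum>j<L. Polynomial.monom (g j) j)"
  have cG: "Polynomial.coeff G k = (if k < L then g k else 0)" for k by (simp add: G_def coeff_sum)
  have polyG: "poly G t \<in> I 1" for t
    unfolding poly_altdef
  proof (rule Isum)
    show "Polynomial.coeff G i * t ^ i \<in> I 1" for i using Icl(6)[of "Polynomial.coeff G i" 1] g(1) Icl(1) by (simp add: cG)
  qed
  have "finite {t \<in> R. poly G t \<in> P 1}" if P: "P \<in> S" for P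
  proof (rule ccontr)
    assume inf: "infinite {t \<in> R. poly G t \<in> P 1}"
    note hP = assms(2)[OF P]
    note Pi = hidealD[OF hprimeD(1)[OF hP]]
    have "Polynomial.coeff G k \<in> P 1" for k
    proof (rule coeffs_in_ideal_if_values[OF Pi(1) _ inf])
      fix s t a assume st: "s \<in> {t \<in> R. poly G t \<in> P 1}" "t \<in> {t \<in> R. poly G t \<in> P 1}" "s \<noteq> t" "(s - t) * a \<in> P 1"
      then have "s - t \<notin> m" using R(2) by auto
      then obtain v where v: "v * (s - t) - 1 \<in> K 1" using unit by blast
      have "v * ((s - t) * a) - (v * (s - t) - 1) * a \<in> P 1"
        by (rule ideal_of_diff[OF subring_UNIV Pi(1) ideal_ofD(4)[OF Pi(1) UNIV_I st(4)]])
          (use Pi(2)[of 1] Kcl(6)[OF v, of a] in blast)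
      then show "a \<in> P 1" by (simp add: algebra_simps)
    qed simp
    then have gP: "g j \<in> P 1" if "j < L" for j using that cG[of j] by metis
    have "a \<in> P 1" if "a \<in> I 1" for a
    proof -
      have "\<exists>c. a - (\<Sum>j<L. c j * g j) \<in> K 1" using g(2) that by (rule bspec)
      then obtain c where "a - (\<Sum>j<L. c j * g j) \<in> K 1" ..
      with Pi(2)[of 1] have "a - (\<Sum>j<L. c j * g j) \<in> P 1" by (rule subsetD)
      moreover have "(\<Sum>j<L. c j * g j) \<in> P 1"
        by (rule ideal_of_sum[OF Pi(1)], rule ideal_ofD(4)[OF Pi(1) UNIV_I], rule gP) simp
      ultimately have "(a - (\<Sum>j<L. c j * g j)) + (\<Sum>j<L. c j * g j) \<in> P 1" by (rule ideal_ofD(3)[OF Pi(1)])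
      then show ?thesis by simp
    qed
    then have "I 1 \<subseteq> P 1" by blast
    then show False using hprime_eq_M[OF hP] assms(3)[OF P] by blast
  qed
  then have "finite (\<Union>P\<in>S. {t \<in> R. poly G t \<in> P 1})" using assms(1) by blast
  then have "\<not> R \<subseteq> (\<Union>P\<in>S. {t \<in> R. poly G t \<in> P 1})" using R(1) finite_subset by blast
  then obtain t where "t \<in> R" "\<And>P. P \<in> S \<Longrightarrow> poly G t \<notin> P 1" by blast
  then show thesis using that[of "poly G t"] polyG by blast
qed

text \<open>Cutting by an element of degree 1 outside the minimal primes of Q shortens the chains:
  below the start of a chain above Q + (y0) there is strictly a minimal prime of Q. When no strict
  inclusion is left, every prime above Q is M and \<open>eventually_everything\<close>
  applies.\<close>

lemma parameters:
  "hideal Q \<Longrightarrow> \<not> hchain Q (Suc s) \<Longrightarrow> \<exists>y N. (\<forall>i<s. y i \<in> I 1) \<and>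
    (\<forall>n\<ge>N. \<forall>a\<in>I n. \<exists>c. (\<forall>i<s. c i \<in> Ipred n) \<and> a - (\<Sum>i<s. c i * y i) \<in> Q n)"
proof (induction s arbitrary: Q)
  case 0
  have "P = M" if P: "hprime P" "Q \<le> P" for P
  proof (rule ccontr)
    assume "P \<noteq> M"
    then have "P < M" using hprime_le_M[OF P(1)] by simp
    then have "hchain Q (Suc 0)"
      unfolding hchain_def using P hprime_M by (intro exI[of _ "\<lambda>i. if i = 0 then P else M"]) auto
    with 0(2) show False by blast
  qed
  then obtain N where "\<forall>n\<ge>N. I n \<subseteq> Q n" using eventually_everything[OF 0(1)] by blast
  then show ?case by (intro exI[of _ "\<lambda>_. 0"] exI[of _ N]) auto
next
  case (Suc s)
  obtain S where S: "finite S" "\<forall>P\<in>S. hprime P \<and> Q \<le> P" "\<forall>P. hprime P \<longrightarrow> Q \<le> P \<longrightarrow> (\<exists>P'\<in>S. P' \<le> P)"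
    using finitely_many_minimal_hprimes[OF Suc.prems(1)] by blast
  \<comment> \<open>M is left out because no element of I_1 avoids it. This is harmless: a minimal
    prime below a chain with a strict inclusion cannot be M.\<close>
  obtain y0 where y0: "y0 \<in> I 1" "\<And>P. P \<in> S - {M} \<Longrightarrow> y0 \<notin> P 1"
    using avoid_hprimes[of "S - {M}"] S(1,2) by auto
  have Q': "hideal (extend Q 1 y0)" by (rule hideal_extend[OF Suc.prems(1) y0(1)])
  have "\<not> hchain (extend Q 1 y0) (Suc s)"
  proof
    assume "hchain (extend Q 1 y0) (Suc s)"
    then obtain P where P: "\<forall>i\<le>Suc s. hprime (P i)" "\<forall>i<Suc s. P i < P (Suc i)" "extend Q 1 y0 \<le> P 0"
      unfolding hchain_def by blast
    have "Q \<le> P 0" using extend_ge[OF Suc.prems(1)] P(3) by (rule order_trans)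
    then obtain P' where P': "P' \<in> S" "P' \<le> P 0" using S(3) P(1) by blast
    have "y0 \<in> P 0 1" using extend_self[OF Suc.prems(1), of y0 1] le_funD[OF P(3), of 1] by blast
    have "P' \<noteq> M"
    proof
      assume "P' = M"
      have "P 0 < P 1" using P(2) by simp
      moreover have "P 1 \<le> M" using P(1) by (intro hprime_le_M) simp
      ultimately show False using P'(2) \<open>P' = M\<close> by (metis leD order_trans)
    qed
    then have "y0 \<notin> P' 1" using P'(1) y0(2) by blast
    then have "P' < P 0" using P'(2) \<open>y0 \<in> P 0 1\<close> by (metis order_le_less)
    define P2 where "P2 i = (case i of 0 \<Rightarrow> P' | Suc i \<Rightarrow> P i)" for i
    have "hchain Q (Suc (Suc s))"
      unfolding hchain_def
    proof (intro exI[of _ P2] conjI allI impI)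
      show "hprime (P2 i)" if "i \<le> Suc (Suc s)" for i using that P(1) P'(1) S(2) by (cases i) (auto simp: P2_def)
      show "P2 i < P2 (Suc i)" if "i < Suc (Suc s)" for i
        using that P(2) \<open>P' < P 0\<close> by (cases i) (auto simp: P2_def)
      show "Q \<le> P2 0" using S(2) P'(1) by (simp add: P2_def)
    qed
    with Suc.prems(2) show False by blast
  qed
  then obtain y N where y: "\<forall>i<s. y i \<in> I 1"
    and N: "\<forall>n\<ge>N. \<forall>a\<in>I n. \<exists>c. (\<forall>i<s. c i \<in> Ipred n) \<and> a - (\<Sum>i<s. c i * y i) \<in> extend Q 1 y0 n"
    using Suc.IH[OF Q'] by blast
  show ?case
  proof (rule exI[of _ "y(s := y0)"], rule exI[of _ N], intro conjI allI impI ballI)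
    show "(y(s := y0)) i \<in> I 1" if "i < Suc s" for i using that y y0(1) by (auto simp: less_Suc_eq)
    fix n a assume "n \<ge> N" "a \<in> I n"
    then obtain c where c: "\<forall>i<s. c i \<in> Ipred n" "a - (\<Sum>i<s. c i * y i) \<in> extend Q 1 y0 n" using N by blast
    then obtain q d where qd: "a - (\<Sum>i<s. c i * y i) = q + d * y0" "q \<in> Q n" "d \<in> (if 1 \<le> n then I (n - 1) else {0})"
      unfolding extend_def by blast
    have "d \<in> Ipred n" using qd(3) by (cases n) auto
    moreover have "a - (\<Sum>i<Suc s. (c(s := d)) i * (y(s := y0)) i) = q"
      using qd(1) by (simp add: algebra_simps)
    ultimately show "\<exists>c. (\<forall>i<Suc s. c i \<in> Ipred n) \<and> a - (\<Sum>i<Suc s. c i * (y(s := y0)) i) \<in> Q n"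
      using c(1) qd(2) by (intro exI[of _ "c(s := d)"]) (auto simp: less_Suc_eq)
  qed
qed

end

section \<open>Growth of graded rings and chains of primes\<close>

context filt
begin

text \<open>\<open>T\<close> is the Rees algebra \<open>\<Oplus>\<^sub>n I\<^sub>n t\<^sup>n\<close>, and \<open>KK\<close> its ideal \<open>\<Oplus>\<^sub>n K\<^sub>n t\<^sup>n\<close>.\<close>

definition T :: "'p poly set" where "T = {p. \<forall>n. Polynomial.coeff p n \<in> I n}"

definition KK :: "'p poly set" where "KK = {p. \<forall>n. Polynomial.coeff p n \<in> K n}"

lemma TD: "p \<in> T \<Longrightarrow> Polynomial.coeff p n \<in> I n" and KKD: "p \<in> KK \<Longrightarrow> Polynomial.coeff p n \<in> K n"
  by (simp_all add: T_def KK_def)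

lemma T_subring: "subring T"
  unfolding subring_def
proof (intro conjI ballI)
  show "0 \<in> T" by (simp add: T_def Icl)
  show "1 \<in> T" using Icl(1) by (simp add: T_def I0 one_pCons coeff_pCons split: nat.split)
  fix a b assume ab: "a \<in> T" "b \<in> T"
  show "a + b \<in> T" using ab Icl(2) by (simp add: T_def)
  show "- a \<in> T" using ab Icl(3) by (simp add: T_def)
  have "Polynomial.coeff a i * Polynomial.coeff b (n - i) \<in> I n" if "i \<le> n" for n i
    using I_mult[OF TD[OF ab(1), of i] TD[OF ab(2), of "n - i"]] that by simp
  then have "Polynomial.coeff (a * b) n \<in> I n" for n unfolding coeff_mult by (intro Isum) simp
  then show "a * b \<in> T" by (simp add: T_def)
qed

lemmas Tcl = subringD[OF T_subring]

lemma KK_ideal: "ideal_of T KK"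
  unfolding ideal_of_def
proof (intro conjI ballI)
  show "KK \<subseteq> T" using KI by (auto simp: T_def KK_def)
  show "0 \<in> KK" by (simp add: KK_def Kcl)
  fix a b assume "a \<in> KK" "b \<in> KK"
  then show "a + b \<in> KK" using Kcl(2) by (simp add: KK_def)
next
  fix a b assume ab: "a \<in> T" "b \<in> KK"
  have "Polynomial.coeff a i * Polynomial.coeff b (n - i) \<in> K n" if "i \<le> n" for n i
    using K_mult[OF TD[OF ab(1), of i] KKD[OF ab(2), of "n - i"]] that by simp
  then have "Polynomial.coeff (a * b) n \<in> K n" for n unfolding coeff_mult by (intro Ksum) simp
  then show "a * b \<in> KK" by (simp add: KK_def)
qed

lemma monom_T: "a \<in> I n \<Longrightarrow> Polynomial.monom a n \<in> T" and monom_KK: "a \<in> K n \<Longrightarrow> Polynomial.monom a n \<in> KK"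
  using Icl(1) Kcl(1) by (simp_all add: T_def KK_def)

lemma const_T: "[:c:] \<in> T"
  using monom_T[of c 0] by (simp add: I0 monom_0)

lemma smult_T: "p \<in> T \<Longrightarrow> smult c p \<in> T" and smult_KK: "p \<in> KK \<Longrightarrow> smult c p \<in> KK"
  using Icl(5) Kcl(5) by (simp_all add: T_def KK_def)

text \<open>All primes of the graded ring, homogeneous or not, lifted to T: these are the primes
  that the Krull dimension counts.\<close>

definition tprime :: "'p poly set \<Rightarrow> bool" where
  "tprime P \<longleftrightarrow> ideal_of T P \<and> KK \<subseteq> P \<and> 1 \<notin> P \<and> (\<forall>p\<in>T. \<forall>q\<in>T. p * q \<in> P \<longrightarrow> p \<in> P \<or> q \<in> P)"

lemma tprimeD:
  assumes "tprime P"
  shows "ideal_of T P" "KK \<subseteq> P" "1 \<notin> P" "p \<in> T \<Longrightarrow> q \<in> T \<Longrightarrow> p * q \<in> P \<Longrightarrow> p \<in> P \<or> q \<in> P"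
  using assms unfolding tprime_def by blast+

lemma tprime_power: "tprime P \<Longrightarrow> a \<in> T \<Longrightarrow> a \<notin> P \<Longrightarrow> a ^ i * b \<in> P \<Longrightarrow> b \<in> T \<Longrightarrow> b \<in> P"
proof (induction i)
  case (Suc i)
  have "a * (a ^ i * b) \<in> P" using Suc.prems(4) by (simp add: mult.assoc)
  then have "a ^ i * b \<in> P"
    using tprimeD(4)[OF Suc.prems(1,2), of "a ^ i * b"] Suc.prems(3,5) Tcl(4)[OF subring_power[OF T_subring Suc.prems(2)]]
    by blast
  then show ?case using Suc by blast
qed simp

text \<open>Scalars come from the ground ring and not from T, so this is a linear span for counting
  dimensions, not an ideal.\<close>

definition spanned :: "'p poly set \<Rightarrow> 'p poly set" where
  "spanned B = {p. \<exists>c. p - (\<Sum>b\<in>B. smult (c b) b) \<in> KK}"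

lemma spannedI: "p - (\<Sum>b\<in>B. smult (c b) b) \<in> KK \<Longrightarrow> p \<in> spanned B"
  by (auto simp: spanned_def)

lemma spannedE:
  assumes "p \<in> spanned B" obtains c where "p - (\<Sum>b\<in>B. smult (c b) b) \<in> KK"
  using assms unfolding spanned_def by blast

lemma smult_sum_right: "smult u (sum f A) = (\<Sum>a\<in>A. smult u (f a))"
  by (induction A rule: infinite_finite_induct) (simp_all add: smult_add_right)

lemma KKcl: "0 \<in> KK" "a \<in> KK \<Longrightarrow> b \<in> KK \<Longrightarrow> a + b \<in> KK" "a \<in> KK \<Longrightarrow> b \<in> KK \<Longrightarrow> a - b \<in> KK"
  "c \<in> T \<Longrightarrow> a \<in> KK \<Longrightarrow> c * a \<in> KK"
  using ideal_ofD(2-4)[OF KK_ideal] ideal_of_diff[OF T_subring KK_ideal] by blast+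

lemma spanned_KK: "p \<in> KK \<Longrightarrow> p \<in> spanned B"
  by (rule spannedI[where c = "\<lambda>_. 0"]) simp

lemma spanned_add:
  assumes "p \<in> spanned B" "q \<in> spanned B" shows "p + q \<in> spanned B"
proof -
  obtain c where c: "p - (\<Sum>b\<in>B. smult (c b) b) \<in> KK" using assms(1) by (rule spannedE)
  obtain d where d: "q - (\<Sum>b\<in>B. smult (d b) b) \<in> KK" using assms(2) by (rule spannedE)
  show ?thesis
    using KKcl(2)[OF c d] by (intro spannedI[where c = "\<lambda>b. c b + d b"]) (simp add: smult_add_left sum.distrib algebra_simps)
qed

lemma spanned_smult:
  assumes "p \<in> spanned B" shows "smult u p \<in> spanned B"
proof -
  obtain c where c: "p - (\<Sum>b\<in>B. smult (c b) b) \<in> KK" using assms(1) by (rule spannedE)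
  have eq: "smult u (p - (\<Sum>b\<in>B. smult (c b) b)) = smult u p - (\<Sum>b\<in>B. smult (u * c b) b)"
    by (simp add: smult_diff_right smult_sum_right)
  show ?thesis using smult_KK[OF c, of u] unfolding eq by (rule spannedI)
qed

lemma spanned_sum: "(\<And>i. i \<in> S \<Longrightarrow> f i \<in> spanned B) \<Longrightarrow> sum f S \<in> spanned B"
  by (induction S rule: infinite_finite_induct) (simp_all add: spanned_add spanned_KK KKcl(1))

lemma spanned_base:
  assumes "finite B" "b \<in> B" shows "b \<in> spanned B"
proof (rule spannedI[where c = "\<lambda>x. if x = b then 1 else 0"])
  have "(\<Sum>x\<in>B. smult (if x = b then 1 else 0) x) = (\<Sum>x\<in>B. if x = b then b else 0)"
    by (intro sum.cong) auto
  also have "\<dots> = b" using assms by simp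
  finally show "b - (\<Sum>x\<in>B. smult (if x = b then 1 else 0) x) \<in> KK" by (simp add: KKcl(1))
qed

lemma spanned_trans:
  assumes "p \<in> spanned B" "\<And>b. b \<in> B \<Longrightarrow> b \<in> spanned C" shows "p \<in> spanned C"
proof -
  obtain c where c: "p - (\<Sum>b\<in>B. smult (c b) b) \<in> KK" using assms(1) by (rule spannedE)
  have "(p - (\<Sum>b\<in>B. smult (c b) b)) + (\<Sum>b\<in>B. smult (c b) b) \<in> spanned C"
    by (intro spanned_add spanned_KK[OF c] spanned_sum spanned_smult assms(2))
  then show ?thesis by simp
qed

lemma spanned_mult:
  assumes "p \<in> spanned B" "y \<in> T" "\<And>b. b \<in> B \<Longrightarrow> y * b \<in> spanned C" shows "y * p \<in> spanned C"
proof -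
  obtain c where c: "p - (\<Sum>b\<in>B. smult (c b) b) \<in> KK" using assms(1) by (rule spannedE)
  have "y * (p - (\<Sum>b\<in>B. smult (c b) b)) + (\<Sum>b\<in>B. smult (c b) (y * b)) \<in> spanned C"
    by (intro spanned_add spanned_KK[OF KKcl(4)[OF assms(2) c]] spanned_sum spanned_smult assms(3))
  then show ?thesis by (simp add: right_diff_distrib sum_distrib_left)
qed

text \<open>Each \<open>y k\<close> enters as an element of degree 1 of the Rees algebra; bounding
  every exponent separately by n makes the count a plain power of n + 1.\<close>

fun monoms :: "(nat \<Rightarrow> 'p) \<Rightarrow> 'p poly set \<Rightarrow> nat \<Rightarrow> nat \<Rightarrow> 'p poly set" where
  "monoms y E n 0 = E"
| "monoms y E n (Suc k) = (\<lambda>(i, b). Polynomial.monom (y k) 1 ^ i * b) ` ({..n} \<times> monoms y E n k)"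

lemma finite_monoms: "finite E \<Longrightarrow> finite (monoms y E n k)"
  by (induction k) auto

lemma card_monoms: "finite E \<Longrightarrow> card (monoms y E n k) \<le> (n + 1) ^ k * card E"
proof (induction k)
  case (Suc k)
  have "card (monoms y E n (Suc k)) \<le> card ({..n} \<times> monoms y E n k)"
    unfolding monoms.simps by (rule card_image_le) (simp add: finite_monoms Suc.prems)
  also have "\<dots> = (n + 1) * card (monoms y E n k)" by (simp add: card_cartesian_product)
  also have "\<dots> \<le> (n + 1) * ((n + 1) ^ k * card E)" using Suc by (intro mult_le_mono2) simp
  finally show ?case by (simp only: power_Suc mult.assoc)
qed simp

lemma monoms_mono: "n \<le> n' \<Longrightarrow> monoms y E n k \<subseteq> monoms y E n' k"
  by (induction k) (auto intro!: image_mono)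

lemma monoms_E: "E \<subseteq> monoms y E n k"
proof (induction k)
  case (Suc k)
  have "b \<in> monoms y E n (Suc k)" if "b \<in> E" for b
    unfolding monoms.simps using that Suc by (intro image_eqI[of _ _ "(0, b)"]) auto
  then show ?case by blast
qed simp

lemma monoms_mult: "i < k \<Longrightarrow> b \<in> monoms y E n k \<Longrightarrow> Polynomial.monom (y i) 1 * b \<in> monoms y E (Suc n) k"
proof (induction k arbitrary: b)
  case (Suc k)
  then obtain j d where b: "b = Polynomial.monom (y k) 1 ^ j * d" "j \<le> n" "d \<in> monoms y E n k" by auto
  show ?case
  proof (cases "i = k")
    case True
    have "Polynomial.monom (y i) 1 * b = Polynomial.monom (y k) 1 ^ Suc j * d" using b(1) True by (simp add: mult.assoc)
    moreover have "(Suc j, d) \<in> {..Suc n} \<times> monoms y E (Suc n) k"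
      using b monoms_mono[of n "Suc n" y E k] by auto
    ultimately show ?thesis unfolding monoms.simps by (intro image_eqI[of _ _ "(Suc j, d)"]) simp_all
  next
    case False
    then have "Polynomial.monom (y i) 1 * d \<in> monoms y E (Suc n) k" using Suc b by simp
    moreover have "Polynomial.monom (y i) 1 * b = Polynomial.monom (y k) 1 ^ j * (Polynomial.monom (y i) 1 * d)"
      using b(1) by (simp only: mult.left_commute)
    ultimately show ?thesis unfolding monoms.simps using b(2)
      by (intro image_eqI[of _ _ "(j, Polynomial.monom (y i) 1 * d)"]) simp_all
  qed
qed simp

lemma monoms_T: "E \<subseteq> T \<Longrightarrow> \<forall>i<k. y i \<in> I 1 \<Longrightarrow> monoms y E n k \<subseteq> T"
proof (induction k)
  case (Suc k)
  have "Polynomial.monom (y k) 1 ^ i * b \<in> T" if "b \<in> monoms y E n k" for i b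
    using that Suc by (intro Tcl(4) subring_power[OF T_subring] monom_T) auto
  then show ?case by auto
qed simp

text \<open>Degrees below N are spanned by E. From N on, each reduction by the \<open>y i\<close>
  lowers the degree by one and adds one to an exponent, so exponents up to n suffice in degree
  n.\<close>

lemma monom_spanned:
  assumes E: "finite E" "\<And>n a. n < N \<Longrightarrow> a \<in> I n \<Longrightarrow> Polynomial.monom a n \<in> spanned E"
    and y: "\<forall>i<s. y i \<in> I 1"
    and red: "\<forall>n\<ge>N. \<forall>a\<in>I n. \<exists>c. (\<forall>i<s. c i \<in> Ipred n) \<and> a - (\<Sum>i<s. c i * y i) \<in> K n"
  shows "a \<in> I n \<Longrightarrow> Polynomial.monom a n \<in> spanned (monoms y E n s)"
proof (induction n arbitrary: a rule: less_induct)
  case (less n)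
  note fin = finite_monoms[OF E(1)]
  show ?case
  proof (cases "n < N")
    case True
    then have "Polynomial.monom a n \<in> spanned E" using E(2) less.prems by blast
    then show ?thesis
    proof (rule spanned_trans)
      fix b assume "b \<in> E"
      then have "b \<in> monoms y E n s" using monoms_E[of E] by blast
      then show "b \<in> spanned (monoms y E n s)" by (rule spanned_base[OF fin])
    qed
  next
    case False
    then have "\<exists>c. (\<forall>i<s. c i \<in> Ipred n) \<and> a - (\<Sum>i<s. c i * y i) \<in> K n" using red less.prems by simp
    then obtain c where c: "\<forall>i<s. c i \<in> Ipred n" "a - (\<Sum>i<s. c i * y i) \<in> K n" by (elim exE conjE)
    have c': "Polynomial.monom (c i * y i) n \<in> spanned (monoms y E n s)" if i: "i < s" for i
    proof (cases n)
      case 0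
      then show ?thesis using c(1) i by (simp add: spanned_KK KKcl(1))
    next
      case (Suc k)
      have "Polynomial.monom (y i) 1 * Polynomial.monom (c i) k \<in> spanned (monoms y E n s)"
      proof (rule spanned_mult)
        show "Polynomial.monom (c i) k \<in> spanned (monoms y E k s)" using less.IH[of k "c i"] Suc c(1) i by simp
        show "Polynomial.monom (y i) 1 \<in> T" using y i by (intro monom_T) simp
        show "Polynomial.monom (y i) 1 * b \<in> spanned (monoms y E n s)" if "b \<in> monoms y E k s" for b
          unfolding Suc using monoms_mult[OF i that] by (rule spanned_base[OF fin])
      qed
      then show ?thesis by (simp add: mult_monom Suc mult.commute)
    qed
    have "Polynomial.monom a n = Polynomial.monom (a - (\<Sum>i<s. c i * y i)) n + (\<Sum>i<s. Polynomial.monom (c i * y i) n)"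
      by (simp add: poly_eq_iff coeff_sum)
    also have "\<dots> \<in> spanned (monoms y E n s)"
      by (intro spanned_add spanned_KK[OF monom_KK[OF c(2)]] spanned_sum c') simp
    finally show ?thesis .
  qed
qed

end

section \<open>Chains of primes against growth\<close>

context fiber_filt
begin

lemma smult_m_KK: "u \<in> m \<Longrightarrow> p \<in> T \<Longrightarrow> smult u p \<in> KK"
  using mI[OF _ TD] by (simp add: KK_def)

lemma finite_spanning_set: "\<exists>E. finite E \<and> E \<subseteq> T \<and> (\<forall>n<N. \<forall>a\<in>I n. Polynomial.monom a n \<in> spanned E)"
proof (induction N)
  case 0
  then show ?case by (intro exI[of _ "{}"]) simp
next
  case (Suc N)
  then obtain E where E: "finite E" "E \<subseteq> T" "\<forall>n<N. \<forall>a\<in>I n. Polynomial.monom a n \<in> spanned E" by blast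
  have "\<exists>L g. (\<forall>j<L. g j \<in> I N) \<and> (\<forall>a\<in>I N. \<exists>c. a - (\<Sum>j<(L::nat). c j * g j) \<in> K N)" by (rule fin_gen)
  then obtain L g where g: "\<forall>j<L. g j \<in> I N" "\<forall>a\<in>I N. \<exists>c. a - (\<Sum>j<(L::nat). c j * g j) \<in> K N"
    by (elim exE conjE)
  define E' where "E' = E \<union> (\<lambda>j. Polynomial.monom (g j) N) ` {..<L}"
  have fin: "finite E'" using E(1) by (simp add: E'_def)
  have "Polynomial.monom a n \<in> spanned E'" if "n < Suc N" "a \<in> I n" for a n
  proof (cases "n = N")
    case False
    then have "Polynomial.monom a n \<in> spanned E" using E(3) that by simp
    then show ?thesis by (rule spanned_trans) (rule spanned_base[OF fin], simp add: E'_def)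
  next
    case True
    then have "\<exists>c. a - (\<Sum>j<L. c j * g j) \<in> K N" using g(2) that(2) by simp
    then obtain c where c: "a - (\<Sum>j<L. c j * g j) \<in> K N" ..
    have "Polynomial.monom a N = Polynomial.monom (a - (\<Sum>j<L. c j * g j)) N + (\<Sum>j<L. smult (c j) (Polynomial.monom (g j) N))"
      by (simp add: poly_eq_iff coeff_sum)
    also have "\<dots> \<in> spanned E'"
      by (intro spanned_add spanned_KK[OF monom_KK[OF c]] spanned_sum spanned_smult spanned_base[OF fin])
        (simp add: E'_def)
    finally show ?thesis by (simp add: True)
  qed
  moreover have "E' \<subseteq> T" using E(2) g(1) monom_T by (auto simp: E'_def)
  ultimately show ?case using fin by blast
qed

text \<open>With a in \<open>P 1\<close> outside \<open>P 0\<close>, the products of powers of a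
  below n with a family independent modulo \<open>P 1\<close> are independent modulo
  \<open>P 0\<close>. In a relation, let i0 be the lowest power with a coefficient outside m.
  Cancelling that power, as \<open>P 0\<close> is prime, and reducing modulo \<open>P 1\<close>,
  which contains a, leaves a relation in the family for \<open>P 1\<close>.\<close>

lemma independent_family:
  "(\<forall>i\<le>t. tprime (P i)) \<Longrightarrow> (\<forall>i<t. P i \<subset> P (Suc i)) \<Longrightarrow>
    \<exists>D. \<forall>n. \<exists>v. (\<forall>j<n ^ t. v j \<in> T \<and> Polynomial.degree (v j) \<le> D * n) \<and>
      (\<forall>c. (\<Sum>j<n ^ t. smult (c j) (v j)) \<in> P 0 \<longrightarrow> (\<forall>j<n ^ t. c j \<in> m))"
proof (induction t arbitrary: P)
  case 0
  have P: "tprime (P 0)" using 0 by simp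
  have "c \<in> m" if c: "[:c:] \<in> P 0" for c
  proof (rule ccontr)
    assume "c \<notin> m"
    then obtain u where u: "u * c - 1 \<in> K 0" using unit by blast
    have "[:u:] * [:c:] - [:u * c - 1:] \<in> P 0"
    proof (rule ideal_of_diff[OF T_subring tprimeD(1)[OF P]])
      show "[:u:] * [:c:] \<in> P 0" by (rule ideal_ofD(4)[OF tprimeD(1)[OF P] const_T c])
      show "[:u * c - 1:] \<in> P 0" using monom_KK[OF u] tprimeD(2)[OF P] by (auto simp: monom_0)
    qed
    then show False using tprimeD(3)[OF P] by (simp add: one_pCons)
  qed
  then show ?case using Tcl(2)
    by (intro exI[of _ 0] allI exI[of _ "\<lambda>_. 1"]) simp
next
  case (Suc t)
  have "\<forall>i\<le>t. tprime (P (Suc i))" "\<forall>i<t. P (Suc i) \<subset> P (Suc (Suc i))" using Suc.prems by auto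
  then obtain D where D: "\<forall>n. \<exists>v. (\<forall>j<n ^ t. v j \<in> T \<and> Polynomial.degree (v j) \<le> D * n) \<and>
      (\<forall>c. (\<Sum>j<n ^ t. smult (c j) (v j)) \<in> P (Suc 0) \<longrightarrow> (\<forall>j<n ^ t. c j \<in> m))"
    using Suc.IH[of "\<lambda>i. P (Suc i)"] by blast
  have P0: "tprime (P 0)" and P1: "tprime (P 1)" using Suc.prems(1) by auto
  have "P 0 \<subset> P 1" using Suc.prems(2) by simp
  then obtain a where a: "a \<in> P 1" "a \<notin> P 0" by blast
  have aT: "a \<in> T" using a(1) ideal_ofD(1)[OF tprimeD(1)[OF P1]] by blast
  show ?case
  proof (intro exI[of _ "D + Polynomial.degree a"] allI)
    fix n
    have "\<exists>v. (\<forall>j<n ^ t. v j \<in> T \<and> Polynomial.degree (v j) \<le> D * n) \<and>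
      (\<forall>c. (\<Sum>j<n ^ t. smult (c j) (v j)) \<in> P (Suc 0) \<longrightarrow> (\<forall>j<n ^ t. c j \<in> m))" using D by (rule spec)
    then obtain v where v: "\<forall>j<n ^ t. v j \<in> T \<and> Polynomial.degree (v j) \<le> D * n"
      and ind: "\<forall>c. (\<Sum>j<n ^ t. smult (c j) (v j)) \<in> P (Suc 0) \<longrightarrow> (\<forall>j<n ^ t. c j \<in> m)" by (elim exE conjE)
    define k where "k = n ^ t"
    \<comment> \<open>Quotient and remainder by k = n^t number the pairs of a power of a and an
      index into v.\<close>
    define w where "w j = a ^ (j div k) * v (j mod k)" for j
    have lt: "j div k < n \<and> j mod k < k" if "j < n * k" for j
      using that by (metis less_mult_imp_div_less mod_less_divisor mult_0_right not_gr_zero not_less_zero)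
    have w: "w j \<in> T \<and> Polynomial.degree (w j) \<le> (D + Polynomial.degree a) * n" if "j < n ^ Suc t" for j
    proof -
      have j: "j div k < n" "j mod k < k" using lt[of j] that by (auto simp: k_def)
      have vj: "v (j mod k) \<in> T" "Polynomial.degree (v (j mod k)) \<le> D * n" using v j(2) by (simp_all add: k_def)
      have "Polynomial.degree (w j) \<le> Polynomial.degree (a ^ (j div k)) + Polynomial.degree (v (j mod k))" unfolding w_def by (rule degree_mult_le)
      also have "\<dots> \<le> Polynomial.degree a * (j div k) + D * n" using degree_power_le[of a "j div k"] vj(2) by linarith
      also have "\<dots> \<le> Polynomial.degree a * n + D * n" using j(1) by simp
      finally have "Polynomial.degree (w j) \<le> (D + Polynomial.degree a) * n" by (simp add: algebra_simps)
      moreover have "w j \<in> T" unfolding w_def by (intro Tcl(4) subring_power[OF T_subring] aT vj(1))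
      ultimately show ?thesis by blast
    qed
    have "\<forall>j<n ^ Suc t. c j \<in> m" if c: "(\<Sum>j<n ^ Suc t. smult (c j) (w j)) \<in> P 0" for c
    proof (rule ccontr)
      define f where "f i = (\<Sum>l<k. smult (c (i * k + l)) (v l))" for i
      assume "\<not> (\<forall>j<n ^ Suc t. c j \<in> m)"
      then obtain j where j: "j < n * k" "c j \<notin> m" by (auto simp: k_def)
      then have "\<exists>i<n. \<exists>l<k. c (i * k + l) \<notin> m"
        using lt[OF j(1)] by (intro exI[of _ "j div k"] exI[of _ "j mod k"] conjI) simp_all
      then obtain i0 where i0: "i0 < n" "\<exists>l<k. c (i0 * k + l) \<notin> m"
        and least: "\<And>i. i < i0 \<Longrightarrow> \<not> (i < n \<and> (\<exists>l<k. c (i * k + l) \<notin> m))"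
        using exists_least_iff[of "\<lambda>i. i < n \<and> (\<exists>l<k. c (i * k + l) \<notin> m)"] by blast
      have fT: "f i \<in> T" for i
        unfolding f_def using v by (intro subring_sum[OF T_subring] smult_T) (simp add: k_def)
      have small: "f i \<in> KK" if "i < i0" for i
        unfolding f_def using least[OF that] that i0(1) v
        by (intro ideal_of_sum[OF KK_ideal] smult_m_KK) (auto simp: k_def)
      have "(\<Sum>j<n ^ Suc t. smult (c j) (w j)) = (\<Sum>i<n. sum (\<lambda>j. smult (c j) (w j)) {i * k..<i * k + k})"
        by (simp add: sum.nat_group k_def)
      also have "\<dots> = (\<Sum>i<n. a ^ i * f i)"
      proof (rule sum.cong)
        fix i
        have "sum (\<lambda>j. smult (c j) (w j)) {i * k..<i * k + k} = (\<Sum>l<k. smult (c (i * k + l)) (w (i * k + l)))"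
          by (rule sum.reindex_bij_witness[of _ "\<lambda>l. i * k + l" "\<lambda>j. j - i * k"]) auto
        also have "\<dots> = (\<Sum>l<k. a ^ i * smult (c (i * k + l)) (v l))"
          by (rule sum.cong) (auto simp: w_def)
        finally show "sum (\<lambda>j. smult (c j) (w j)) {i * k..<i * k + k} = a ^ i * f i"
          by (simp add: f_def sum_distrib_left)
      qed simp
      finally have tot: "(\<Sum>i<n. a ^ i * f i) \<in> P 0" using c by simp
      have split: "{..<n} = {..<i0} \<union> {i0..<n}" using i0(1) by auto
      have two: "(\<Sum>i<n. a ^ i * f i) = (\<Sum>i<i0. a ^ i * f i) + (\<Sum>i=i0..<n. a ^ i * f i)"
        unfolding split by (rule sum.union_disjoint) auto
      have lowK: "(\<Sum>i<i0. a ^ i * f i) \<in> P 0"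
      proof (rule ideal_of_sum[OF tprimeD(1)[OF P0]])
        fix i assume "i \<in> {..<i0}"
        then have "f i \<in> P 0" using small tprimeD(2)[OF P0] by blast
        then show "a ^ i * f i \<in> P 0" by (rule ideal_ofD(4)[OF tprimeD(1)[OF P0] subring_power[OF T_subring aT]])
      qed
      have hi: "(\<Sum>i=i0..<n. a ^ i * f i) \<in> P 0"
        using ideal_of_diff[OF T_subring tprimeD(1)[OF P0] tot lowK] by (simp add: two)
      define g where "g = (\<Sum>i=Suc i0..<n. a ^ (i - Suc i0) * f i)"
      have "(\<Sum>i=i0..<n. a ^ i * f i) = a ^ i0 * f i0 + (\<Sum>i=Suc i0..<n. a ^ i * f i)"
        using i0(1) by (rule sum.atLeast_Suc_lessThan)
      also have "(\<Sum>i=Suc i0..<n. a ^ i * f i) = a ^ i0 * (a * g)"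
        unfolding g_def sum_distrib_left
      proof (rule sum.cong)
        fix i assume "i \<in> {Suc i0..<n}"
        then have "i = i0 + Suc (i - Suc i0)" by simp
        then have "a ^ i = a ^ i0 * a ^ Suc (i - Suc i0)" by (metis power_add)
        then show "a ^ i * f i = a ^ i0 * (a * (a ^ (i - Suc i0) * f i))" by (simp add: mult_ac)
      qed simp
      finally have "(\<Sum>i=i0..<n. a ^ i * f i) = a ^ i0 * (f i0 + a * g)" by (simp add: distrib_left)
      with hi have "a ^ i0 * (f i0 + a * g) \<in> P 0" by simp
      moreover have gT: "g \<in> T"
        unfolding g_def by (intro subring_sum[OF T_subring] Tcl(4) subring_power[OF T_subring] aT fT)
      ultimately have "f i0 + a * g \<in> P 0"
        using tprime_power[OF P0 aT a(2)] Tcl(3)[OF fT Tcl(4)[OF aT gT]] by blast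
      then have "f i0 + a * g \<in> P 1" using \<open>P 0 \<subset> P 1\<close> by blast
      moreover have "a * g \<in> P 1" by (rule ideal_ofD(5)[OF tprimeD(1)[OF P1] gT a(1)])
      ultimately have "f i0 \<in> P 1" using ideal_of_add_cancel[OF T_subring tprimeD(1)[OF P1]] by blast
      then have "(\<Sum>j<n ^ t. smult (c (i0 * k + j)) (v j)) \<in> P (Suc 0)" by (simp add: f_def k_def)
      then have "\<forall>l<n ^ t. c (i0 * k + l) \<in> m" using ind by (elim allE[of _ "\<lambda>l. c (i0 * k + l)"]) simp
      then show False using i0(2) by (auto simp: k_def)
    qed
    then show "\<exists>v. (\<forall>j<n ^ Suc t. v j \<in> T \<and> Polynomial.degree (v j) \<le> (D + Polynomial.degree a) * n) \<and>
      (\<forall>c. (\<Sum>j<n ^ Suc t. smult (c j) (v j)) \<in> P 0 \<longrightarrow> (\<forall>j<n ^ Suc t. c j \<in> m))"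
      using w by (intro exI[of _ w]) blast
  qed
qed

lemma no_long_prime_chain:
  assumes y: "\<forall>i<s. y i \<in> I 1"
    and red: "\<forall>n\<ge>N. \<forall>a\<in>I n. \<exists>c. (\<forall>i<s. c i \<in> Ipred n) \<and> a - (\<Sum>i<s. c i * y i) \<in> K n"
    and P: "\<forall>i\<le>Suc s. tprime (P i)" "\<forall>i<Suc s. P i \<subset> P (Suc i)"
  shows False
proof -
  obtain E where E: "finite E" "E \<subseteq> T" "\<forall>n<N. \<forall>a\<in>I n. Polynomial.monom a n \<in> spanned E" using finite_spanning_set[of N] by (elim exE conjE)
  from independent_family[OF P]
  obtain D where D: "\<forall>n. \<exists>v. (\<forall>j<n ^ Suc s. v j \<in> T \<and> Polynomial.degree (v j) \<le> D * n) \<and>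
      (\<forall>c. (\<Sum>j<n ^ Suc s. smult (c j) (v j)) \<in> P 0 \<longrightarrow> (\<forall>j<n ^ Suc s. c j \<in> m))" ..
  \<comment> \<open>Chosen so that card E (D + 1)^s is n - 1: the bound ((D + 1) n)^s card E on the
    monomials becomes (n - 1) n^s, which is below the n^(s+1) independent elements.\<close>
  define n where "n = card E * (D + 1) ^ s + 1"
  have "\<exists>v. (\<forall>j<n ^ Suc s. v j \<in> T \<and> Polynomial.degree (v j) \<le> D * n) \<and>
      (\<forall>c. (\<Sum>j<n ^ Suc s. smult (c j) (v j)) \<in> P 0 \<longrightarrow> (\<forall>j<n ^ Suc s. c j \<in> m))" using D by (rule spec)
  then obtain v where v: "\<forall>j<n ^ Suc s. v j \<in> T \<and> Polynomial.degree (v j) \<le> D * n"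
    and ind: "\<forall>c. (\<Sum>j<n ^ Suc s. smult (c j) (v j)) \<in> P 0 \<longrightarrow> (\<forall>j<n ^ Suc s. c j \<in> m)" by (elim exE conjE)
  define B where "B = monoms y E (D * n) s"
  have finB: "finite B" unfolding B_def by (rule finite_monoms[OF E(1)])
  have BT: "B \<subseteq> T" unfolding B_def by (rule monoms_T[OF E(2) y])
  have "D * n + 1 \<le> (D + 1) * n" by (simp add: n_def)
  then have "(D * n + 1) ^ s \<le> ((D + 1) * n) ^ s" by (rule power_mono) simp
  then have "card B \<le> ((D + 1) * n) ^ s * card E"
    using card_monoms[OF E(1), of y "D * n" s] unfolding B_def by (meson le_trans mult_le_mono1)
  also have "\<dots> = (card E * (D + 1) ^ s) * n ^ s" by (simp only: power_mult_distrib mult_ac)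
  also have "\<dots> < n * n ^ s" unfolding n_def by (intro mult_strict_right_mono) simp_all
  finally have cardB: "card B < card {..<n ^ Suc s}" by simp
  have sp: "v j \<in> spanned B" if "j < n ^ Suc s" for j
  proof -
    have "v j = (\<Sum>i\<le>Polynomial.degree (v j). Polynomial.monom (Polynomial.coeff (v j) i) i)" by (rule poly_as_sum_of_monoms[symmetric])
    also have "\<dots> \<in> spanned B"
    proof (rule spanned_sum)
      fix i assume "i \<in> {..degree (v j)}"
      then have i: "i \<le> D * n" using v that by (meson atMost_iff le_trans)
      have "Polynomial.coeff (v j) i \<in> I i" using v that by (intro TD) simp
      then have "Polynomial.monom (Polynomial.coeff (v j) i) i \<in> spanned (monoms y E i s)"
        using monom_spanned[OF E(1) _ y red] E(3) by blast
      then show "Polynomial.monom (Polynomial.coeff (v j) i) i \<in> spanned B"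
      proof (rule spanned_trans)
        fix b assume "b \<in> monoms y E i s"
        then have "b \<in> B" unfolding B_def using monoms_mono[OF i] by blast
        then show "b \<in> spanned B" by (rule spanned_base[OF finB])
      qed
    qed
    finally show ?thesis .
  qed
  then have "\<exists>c. v j - (\<Sum>b\<in>B. smult (c b) b) \<in> KK" if "j < n ^ Suc s" for j using that by (simp add: spanned_def)
  then have "\<forall>j. \<exists>c. j < n ^ Suc s \<longrightarrow> v j - (\<Sum>b\<in>B. smult (c b) b) \<in> KK" by simp
  from choice[OF this]
  obtain A where A: "\<forall>j. j < n ^ Suc s \<longrightarrow> v j - (\<Sum>b\<in>B. smult (A j b) b) \<in> KK" ..
  have "\<exists>c. (\<exists>j\<in>{..<n ^ Suc s}. c j \<notin> m) \<and> (\<forall>b\<in>B. (\<Sum>j\<in>{..<n ^ Suc s}. c j * A j b) \<in> m)"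
    by (rule linear_dependence[OF m finB finite_lessThan cardB])
  then obtain c where c: "\<exists>j\<in>{..<n ^ Suc s}. c j \<notin> m" "\<forall>b\<in>B. (\<Sum>j\<in>{..<n ^ Suc s}. c j * A j b) \<in> m"
    by (elim exE conjE)
  have 1: "(\<Sum>j<n ^ Suc s. smult (c j) (v j - (\<Sum>b\<in>B. smult (A j b) b))) \<in> KK"
    using A by (intro ideal_of_sum[OF KK_ideal] smult_KK) simp
  have 2: "(\<Sum>b\<in>B. smult (\<Sum>j<n ^ Suc s. c j * A j b) b) \<in> KK"
    using c(2) BT by (intro ideal_of_sum[OF KK_ideal] smult_m_KK) auto
  have "(\<Sum>j<n ^ Suc s. smult (c j) (v j)) =
      (\<Sum>j<n ^ Suc s. smult (c j) (v j - (\<Sum>b\<in>B. smult (A j b) b))) + (\<Sum>j<n ^ Suc s. \<Sum>b\<in>B. smult (c j * A j b) b)"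
    by (simp add: smult_diff_right smult_sum_right sum_subtractf)
  also have "(\<Sum>j<n ^ Suc s. \<Sum>b\<in>B. smult (c j * A j b) b) = (\<Sum>b\<in>B. smult (\<Sum>j<n ^ Suc s. c j * A j b) b)"
    by (subst sum.swap) (simp add: smult_sum)
  finally have "(\<Sum>j<n ^ Suc s. smult (c j) (v j)) \<in> KK" using KKcl(2)[OF 1 2] by simp
  then have "(\<Sum>j<n ^ Suc s. smult (c j) (v j)) \<in> P 0" using tprimeD(2) P(1) by blast
  then have "\<forall>j<n ^ Suc s. c j \<in> m" using ind by (elim allE[of _ c]) simp
  with c(1) show False by blast
qed

end

section \<open>Reductions\<close>

lemma coeff_mult_monom_right: "Polynomial.coeff (p * Polynomial.monom a j) n = (if n < j then 0 else Polynomial.coeff p (n - j) * a)"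
  by (subst mult.commute) (simp add: coeff_monom_mult mult.commute[of a])

section \<open>From Koszul vanishing to graded syzygies\<close>

context filt
begin

text \<open>The constant term of p vanishes in the graded ring, so the k-th power has order at least
  k there. With \<open>high_order_in_ideal\<close> this supplies the power of \<open>a i\<close> in
  (x) that \<open>koszul_vanish\<close> asks for.\<close>

lemma power_low_order:
  assumes p: "p \<in> T" "Polynomial.coeff p 0 \<in> K 0"
  shows "\<exists>q z. q \<in> T \<and> z \<in> KK \<and> (\<forall>n<k. Polynomial.coeff q n = 0) \<and> p ^ k = q + z"
proof (induction k)
  case 0
  show ?case using Tcl(2) KKcl(1) by (intro exI[of _ 1] exI[of _ 0]) simp
next
  case (Suc k)
  then obtain q z where qz: "q \<in> T" "z \<in> KK" "\<forall>n<k. Polynomial.coeff q n = 0" "p ^ k = q + z" by blast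
  define c p' where "c = [:Polynomial.coeff p 0:]" and "p' = p - c"
  have c: "c \<in> KK" using monom_KK[OF p(2)] by (simp add: c_def monom_0)
  have p'T: "p' \<in> T" unfolding p'_def using p(1) const_T by (intro Tcl(6)) (simp_all add: c_def)
  have p'0: "Polynomial.coeff p' 0 = 0" by (simp add: p'_def c_def)
  have "Polynomial.coeff (p' * q) n = 0" if "n < Suc k" for n
    unfolding coeff_mult
  proof (rule sum.neutral, rule ballI)
    fix i assume "i \<in> {..n}"
    then show "Polynomial.coeff p' i * Polynomial.coeff q (n - i) = 0" using that qz(3) p'0 by (cases i) auto
  qed
  moreover have "p' * q \<in> T" by (rule Tcl(4)[OF p'T qz(1)])
  moreover have "q * c + p * z \<in> KK" by (intro KKcl(2) KKcl(4) qz(1,2) p(1) c)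
  moreover have "p ^ Suc k = p' * q + (q * c + p * z)" by (simp add: qz(4) p'_def algebra_simps)
  ultimately show ?case by blast
qed

lemma high_order_in_ideal:
  assumes red: "\<forall>n\<ge>N. \<forall>a\<in>I n. \<exists>c. (\<forall>i<r. c i \<in> Ipred n) \<and> a - (\<Sum>i<r. c i * x i) \<in> K n"
    and q: "q \<in> T" "\<forall>n<N. Polynomial.coeff q n = 0"
  shows "\<exists>y. (\<forall>i<r. y i \<in> T) \<and> q - (\<Sum>i<r. y i * Polynomial.monom (x i) 1) \<in> KK"
proof -
  have "\<exists>c. (\<forall>i<r. c i \<in> Ipred n) \<and> Polynomial.coeff q n - (\<Sum>i<r. c i * x i) \<in> K n" for n
  proof (cases "n < N")
    case True
    then show ?thesis using q(2) Kcl(1) ideal_ofD(2)[OF Ipred_ideal] by (intro exI[of _ "\<lambda>_. 0"]) simp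
  next
    case False
    then show ?thesis using red TD[OF q(1)] by simp
  qed
  then have "\<forall>n. \<exists>c. (\<forall>i<r. c i \<in> Ipred n) \<and> Polynomial.coeff q n - (\<Sum>i<r. c i * x i) \<in> K n" ..
  from choice[OF this]
  obtain c where c: "\<forall>n. (\<forall>i<r. c n i \<in> Ipred n) \<and> Polynomial.coeff q n - (\<Sum>i<r. c n i * x i) \<in> K n" ..
  \<comment> \<open>Coefficients move down by one degree because \<open>x i\<close> carries degree
    1; beyond the degree of q nothing is to be represented, so y is a polynomial.\<close>
  define y where "y i = (\<Sum>n<Polynomial.degree q. Polynomial.monom (c (Suc n) i) n)" for i
  have cy: "Polynomial.coeff (y i) n = (if n < Polynomial.degree q then c (Suc n) i else 0)" for i n
    by (simp add: y_def coeff_sum)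
  have "y i \<in> T" if "i < r" for i
    unfolding T_def
  proof (intro CollectI allI)
    fix n
    have "c (Suc n) i \<in> Ipred (Suc n)" using c that by blast
    then show "Polynomial.coeff (y i) n \<in> I n" using Icl(1) by (simp add: cy)
  qed
  moreover have "q - (\<Sum>i<r. y i * Polynomial.monom (x i) 1) \<in> KK"
    unfolding KK_def
  proof (intro CollectI allI)
    fix n
    show "Polynomial.coeff (q - (\<Sum>i<r. y i * Polynomial.monom (x i) 1)) n \<in> K n"
    proof (cases n)
      case 0
      have "c 0 i * x i = 0" if "i < r" for i using c[THEN spec, of 0] that by simp
      then have "(\<Sum>i<r. c 0 i * x i) = 0" by simp
      then have "Polynomial.coeff q 0 \<in> K 0" using c[THEN spec, of 0] by simp
      moreover have "Polynomial.coeff (y i * Polynomial.monom (x i) 1) 0 = 0" for i by (simp add: coeff_mult_monom_right)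
      ultimately show ?thesis by (simp add: 0 coeff_sum)
    next
      case (Suc k)
      have e: "Polynomial.coeff (y i * Polynomial.monom (x i) 1) (Suc k) = Polynomial.coeff (y i) k * x i" for i
        by (simp add: coeff_mult_monom_right)
      show ?thesis
      proof (cases "k < Polynomial.degree q")
        case True
        then show ?thesis using c[THEN spec, of n] by (simp add: Suc coeff_sum e[simplified] cy)
      next
        case False
        then have "Polynomial.coeff q (Suc k) = 0" by (intro coeff_eq_0) simp
        then show ?thesis using False Kcl(1) by (simp add: Suc coeff_sum e[simplified] cy)
      qed
    qed
  qed
  ultimately show ?thesis by blast
qed

text \<open>\<open>koszul_syzygies\<close> is applied in T to the \<open>x i\<close> placed in
  degree 1 and the \<open>c l\<close> placed in degree j. Its matrix has inhomogeneous entries and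
  involves a multiplier. Comparing coefficients in degree j leaves homogeneous entries and only the
  constant term of the multiplier, which \<open>Wunit\<close> inverts modulo K.\<close>

lemma syz_if_regular:
  assumes x: "\<forall>i<r. x i \<in> I 1"
    and red: "\<forall>n\<ge>N. \<forall>a\<in>I n. \<exists>c. (\<forall>i<r. c i \<in> Ipred n) \<and> a - (\<Sum>i<r. c i * x i) \<in> K n"
    and W: "1 \<in> W" "\<And>u v. u \<in> W \<Longrightarrow> v \<in> W \<Longrightarrow> u * v \<in> W" "W \<subseteq> T"
    and Wunit: "\<And>u. u \<in> W \<Longrightarrow> \<exists>v. \<forall>n. \<forall>a\<in>I n. (v * Polynomial.coeff u 0 - 1) * a \<in> K n"
    and J: "\<And>i. i \<le> r \<Longrightarrow> ideal_of T (J i)"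
    and mono: "\<And>i. i < r \<Longrightarrow> J i \<subseteq> J (Suc i)"
    and KKJ: "\<And>i. i \<le> r \<Longrightarrow> KK \<subseteq> J i" and J0: "\<And>b. b \<in> J 0 \<Longrightarrow> \<exists>u\<in>W. u * b \<in> KK"
    and a: "\<And>i. i < r \<Longrightarrow> a i \<in> T" "\<And>i. i < r \<Longrightarrow> a i \<in> J (Suc i)" "\<And>i. i < r \<Longrightarrow> Polynomial.coeff (a i) 0 \<in> K 0"
    and reg: "\<And>i b. i < r \<Longrightarrow> b \<in> T \<Longrightarrow> a i * b \<in> J i \<Longrightarrow> b \<in> J i"
    and gen: "\<And>i b. i < r \<Longrightarrow> b \<in> J (Suc i) \<Longrightarrow> \<exists>u\<in>W. \<exists>f\<in>T. u * b - a i * f \<in> J i"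
  shows "syz x r j"
  unfolding syz_def
proof (intro allI impI)
  fix c assume c: "\<forall>l<r. c l \<in> I j" "(\<Sum>l<r. c l * x l) \<in> K (Suc j)"
  let ?x = "\<lambda>i. Polynomial.monom (x i) 1"
  have xT: "?x i \<in> T" if "i < r" for i using x that by (intro monom_T) simp
  have pow: "\<exists>N y. (\<forall>j<r. y j \<in> T) \<and> a i ^ N - (\<Sum>j<r. y j * ?x j) \<in> J i" if i: "i < r" for i
  proof -
    obtain q z where qz: "q \<in> T" "z \<in> KK" "\<forall>n<N. Polynomial.coeff q n = 0" "a i ^ N = q + z"
      using power_low_order[OF a(1,3)[OF i], of N] by blast
    obtain y where y: "\<forall>j<r. y j \<in> T" "q - (\<Sum>j<r. y j * ?x j) \<in> KK"
      using high_order_in_ideal[OF red qz(1,3)] by blast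
    have "a i ^ N - (\<Sum>j<r. y j * ?x j) = (q - (\<Sum>j<r. y j * ?x j)) + z" by (simp add: qz(4))
    also have "\<dots> \<in> KK" by (rule KKcl(2)[OF y(2) qz(2)])
    finally show ?thesis using y(1) KKJ[of i] i by (intro exI[of _ N] exI[of _ y]) auto
  qed
  have cT: "Polynomial.monom (c l) j \<in> T" if "l < r" for l using c(1) that by (intro monom_T) simp
  have "(\<Sum>l<r. Polynomial.monom (c l) j * ?x l) = Polynomial.monom (\<Sum>l<r. c l * x l) (Suc j)"
    by (simp add: mult_monom monom_sum)
  also have "\<dots> \<in> J 0" using monom_KK[OF c(2)] KKJ[of 0] by auto
  finally have cs: "(\<Sum>l<r. Polynomial.monom (c l) j * ?x l) \<in> J 0" .
  have "\<exists>s u. u \<in> W \<and> (\<forall>i j. s i j \<in> T) \<and> (\<forall>i j. s i j = - s j i) \<and> (\<forall>i. s i i = 0) \<and>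
      (\<forall>i<r. u * Polynomial.monom (c i) j - (\<Sum>k<r. s i k * ?x k) \<in> J 0)"
  proof (rule koszul_syzygies[where T = T and W = W and r = r and J = J and a = a and x = ?x and c = "\<lambda>l. Polynomial.monom (c l) j"];
      (fact T_subring W xT J mono a reg gen pow cT cs)?)
    fix s u
    assume "u \<in> W" "\<And>i j. s i j \<in> T" "\<And>i j. s i j = - s j i" "\<And>i. s i i = 0"
      "\<And>i. i < r \<Longrightarrow> u * Polynomial.monom (c i) j - (\<Sum>k<r. s i k * ?x k) \<in> J 0"
    then show ?thesis by (intro exI[of _ s] exI[of _ u] conjI allI impI)
  qed
  then obtain s u where u: "u \<in> W" and s': "\<forall>i j. s i j \<in> T" "\<forall>i j. s i j = - s j i" "\<forall>i. s i i = 0"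
    and us: "\<forall>i<r. u * Polynomial.monom (c i) j - (\<Sum>k<r. s i k * ?x k) \<in> J 0" by (elim exE conjE)
  note s = s'[rule_format]
  have "\<exists>w\<in>W. \<forall>i\<in>{..<r}. w * (u * Polynomial.monom (c i) j - (\<Sum>k<r. s i k * ?x k)) \<in> KK"
  proof (rule common_multiplier[where T = T, OF finite_lessThan W])
    show "\<exists>w\<in>W. w * (u * Polynomial.monom (c i) j - (\<Sum>k<r. s i k * ?x k)) \<in> KK" if "i \<in> {..<r}" for i
      using J0[OF us[rule_format]] that by simp
    show "t * w * (u * Polynomial.monom (c i) j - (\<Sum>k<r. s i k * ?x k)) \<in> KK"
      if "w * (u * Polynomial.monom (c i) j - (\<Sum>k<r. s i k * ?x k)) \<in> KK" "t \<in> T" for i w t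
      using KKcl(4)[OF that(2,1)] by (simp only: mult.assoc)
  qed
  then obtain w where w: "w \<in> W" "\<And>i. i < r \<Longrightarrow> w * (u * Polynomial.monom (c i) j - (\<Sum>k<r. s i k * ?x k)) \<in> KK" by auto
  obtain v where v: "\<forall>n. \<forall>a\<in>I n. (v * Polynomial.coeff (w * u) 0 - 1) * a \<in> K n" using Wunit[OF W(2)[OF w(1) u]] by blast
  have wT: "w \<in> T" using w(1) W(3) by blast
  \<comment> \<open>For j = 0 the entries must lie in \<open>Ipred 0\<close>, hence vanish;
    otherwise degree j - 1 is taken because \<open>x k\<close> adds one.\<close>
  define q where "q i k = v * (if j = 0 then 0 else Polynomial.coeff (w * s i k) (j - 1))" for i k
  have "q i k \<in> Ipred j" for i k
    using TD[OF Tcl(4)[OF wT s(1)[of i k]], of "j - 1"] Icl(5) by (cases j) (simp_all add: q_def)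
  moreover have "q i k + q k i = 0" for i k
  proof -
    have "w * s i k + w * s k i = 0" by (subst s(2)) simp
    then have "Polynomial.coeff (w * s i k) n + Polynomial.coeff (w * s k i) n = 0" for n by (metis coeff_0 coeff_add)
    then show ?thesis by (simp add: q_def distrib_left[symmetric])
  qed
  moreover have "q i i = 0" for i by (simp add: q_def s(3))
  moreover have "c i - (\<Sum>k<r. q i k * x k) \<in> K j" if i: "i < r" for i
  proof -
    have e1: "Polynomial.coeff (w * (u * Polynomial.monom (c i) j)) j = Polynomial.coeff (w * u) 0 * c i"
      unfolding mult.assoc[symmetric] by (simp add: coeff_mult_monom_right)
    have e2: "v * Polynomial.coeff (w * (s i k * ?x k)) j = q i k * x k" for k
    proof -
      have "Polynomial.coeff (w * (s i k * ?x k)) j = Polynomial.coeff ((w * s i k) * ?x k) j" by (simp only: mult.assoc)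
      also have "\<dots> = (if j < 1 then 0 else Polynomial.coeff (w * s i k) (j - 1) * x k)" by (rule coeff_mult_monom_right)
      finally show ?thesis by (cases j) (simp_all add: q_def mult.assoc)
    qed
    have "Polynomial.coeff (w * (u * Polynomial.monom (c i) j - (\<Sum>k<r. s i k * ?x k))) j =
        Polynomial.coeff (w * u) 0 * c i - (\<Sum>k<r. Polynomial.coeff (w * (s i k * ?x k)) j)"
      by (simp only: right_diff_distrib sum_distrib_left coeff_diff coeff_sum e1)
    then have "Polynomial.coeff (w * u) 0 * c i - (\<Sum>k<r. Polynomial.coeff (w * (s i k * ?x k)) j) \<in> K j"
      using KKD[OF w(2)[OF i], of j] by simp
    then have "v * (Polynomial.coeff (w * u) 0 * c i - (\<Sum>k<r. Polynomial.coeff (w * (s i k * ?x k)) j)) \<in> K j" by (rule Kcl(5))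
    moreover have "v * (Polynomial.coeff (w * u) 0 * c i - (\<Sum>k<r. Polynomial.coeff (w * (s i k * ?x k)) j)) =
        v * (Polynomial.coeff (w * u) 0 * c i) - (\<Sum>k<r. q i k * x k)"
      by (simp only: right_diff_distrib sum_distrib_left e2)
    moreover have "(v * Polynomial.coeff (w * u) 0 - 1) * c i \<in> K j" using v c(1) i by simp
    ultimately have "(v * (Polynomial.coeff (w * u) 0 * c i) - (\<Sum>k<r. q i k * x k)) - (v * Polynomial.coeff (w * u) 0 - 1) * c i \<in> K j"
      using Kcl(4) by simp
    then show ?thesis by (simp add: algebra_simps)
  qed
  ultimately show "\<exists>s. (\<forall>l k. s l k \<in> Ipred j \<and> s l k + s k l = 0) \<and> (\<forall>l. s l l = 0) \<and>
      (\<forall>l<r. c l - (\<Sum>k<r. s l k * x k) \<in> K j)"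
    by blast
qed

end

section \<open>Nakayama's lemma\<close>

text \<open>Elimination in place of a determinant: \<open>1 - c k\<close> lies outside m and is
  invertible modulo N, so \<open>g k\<close> is a combination of the earlier generators, and
  substituting it keeps all coefficients in m.\<close>

lemma nakayama_generators:
  fixes g :: "nat \<Rightarrow> 'p::comm_ring_1"
  assumes m: "maximal_set m" and unit: "\<And>u. u \<notin> m \<Longrightarrow> \<exists>v. v * u - 1 \<in> Z"
    and N: "ideal_of UNIV N" "Z \<subseteq> N"
  shows "(\<And>j. j < k \<Longrightarrow> \<exists>c. (\<forall>l<k. c l \<in> m) \<and> g j - (\<Sum>l<k. c l * g l) \<in> N) \<Longrightarrow> j < k \<Longrightarrow> g j \<in> N"
proof (induction k arbitrary: j)
  case (Suc k)
  note mi = maximal_setD(1)[OF m]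
  note Ncl = ideal_ofD(3)[OF N(1)] ideal_of_diff[OF subring_UNIV N(1)] ideal_ofD(4)[OF N(1) UNIV_I] ideal_ofD(5)[OF N(1) UNIV_I]
  obtain c where c: "\<forall>l<Suc k. c l \<in> m" "g k - (\<Sum>l<Suc k. c l * g l) \<in> N" using Suc.prems(1)[of k] by blast
  have "1 - c k \<notin> m"
  proof
    assume "1 - c k \<in> m"
    then have "(1 - c k) + c k \<in> m" using c(1) by (intro ideal_ofD(3)[OF mi]) simp_all
    then show False using maximal_setD(2)[OF m] by simp
  qed
  then obtain v where "v * (1 - c k) - 1 \<in> Z" using unit by blast
  then have v: "v * (1 - c k) - 1 \<in> N" using N(2) by blast
  have "v * (g k - (\<Sum>l<Suc k. c l * g l)) - (v * (1 - c k) - 1) * g k \<in> N"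
    by (intro Ncl(2) Ncl(3)[OF c(2)] Ncl(4)[OF v])
  also have "v * (g k - (\<Sum>l<Suc k. c l * g l)) - (v * (1 - c k) - 1) * g k = g k - (\<Sum>l<k. v * c l * g l)"
    by (simp add: algebra_simps sum_distrib_left)
  finally have gk: "g k - (\<Sum>l<k. v * c l * g l) \<in> N" .
  have "\<exists>d. (\<forall>l<k. d l \<in> m) \<and> g j - (\<Sum>l<k. d l * g l) \<in> N" if jk: "j < k" for j
  proof -
    obtain d where d: "\<forall>l<Suc k. d l \<in> m" "g j - (\<Sum>l<Suc k. d l * g l) \<in> N" using Suc.prems(1)[OF less_SucI[OF jk]] by (elim exE conjE)
    have "(g j - (\<Sum>l<Suc k. d l * g l)) + d k * (g k - (\<Sum>l<k. v * c l * g l)) \<in> N"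
      by (intro Ncl(1) d(2) Ncl(3)[OF gk])
    also have "(g j - (\<Sum>l<Suc k. d l * g l)) + d k * (g k - (\<Sum>l<k. v * c l * g l)) =
        g j - (\<Sum>l<k. (d l + d k * (v * c l)) * g l)"
      by (simp add: algebra_simps sum.distrib sum_distrib_left)
    finally show ?thesis
      using d(1) by (intro exI[of _ "\<lambda>l. d l + d k * (v * c l)"] conjI allI impI ideal_ofD(3)[OF mi] ideal_ofD(5)[OF mi UNIV_I]) simp_all
  qed
  then have small: "g j \<in> N" if "j < k" for j using Suc.IH[of j] that by blast
  have "(g k - (\<Sum>l<k. v * c l * g l)) + (\<Sum>l<k. v * c l * g l) \<in> N"
    using small by (intro Ncl(1)[OF gk] ideal_of_sum[OF N(1)] Ncl(3)) simp
  then have "g k \<in> N" by simp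
  then show ?case using small Suc.prems(2) by (cases "j = k") (simp_all add: less_Suc_eq)
qed simp

text \<open>Here \<open>Z\<close> is the kernel of the presentation of the local ring.\<close>

locale local_filt = fiber_filt I K m N0 for I K :: "nat \<Rightarrow> 'p::comm_ring_1 set" and m N0 +
  fixes Z :: "'p set"
  assumes Z: "ideal_of UNIV Z" and ZK: "Z \<subseteq> K n"
    and unitZ: "u \<notin> m \<Longrightarrow> \<exists>v. v * u - 1 \<in> Z"
    and Kgen: "ideal_of UNIV A \<Longrightarrow> Z \<subseteq> A \<Longrightarrow> (\<And>u b. u \<in> m \<Longrightarrow> b \<in> I n \<Longrightarrow> u * b \<in> A) \<Longrightarrow> K n \<subseteq> A"
    and fin_genZ: "\<exists>L g. (\<forall>j<L. g j \<in> I n) \<and> (\<forall>a\<in>I n. \<exists>c. a - (\<Sum>j<(L::nat). c j * g j) \<in> Z)"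
    and dec: "I (Suc n) \<subseteq> I n"
begin

sublocale gr: filt I "\<lambda>n. I (Suc n)"
  by unfold_locales (use I dec I0 I_mult in auto, use I_mult in fastforce)

lemma ZI: "Z \<subseteq> I n"
  using ZK[of n] KI[of n] by blast

lemma nakayama:
  assumes N: "ideal_of UNIV N" "Z \<subseteq> N" and sub: "\<And>a. a \<in> I n \<Longrightarrow> \<exists>b\<in>N. a - b \<in> K n"
  shows "I n \<subseteq> N"
proof -
  have "\<exists>L g. (\<forall>j<L. g j \<in> I n) \<and> (\<forall>a\<in>I n. \<exists>c. a - (\<Sum>j<(L::nat). c j * g j) \<in> Z)" by (rule fin_genZ)
  then obtain L g where g: "\<forall>j<L. g j \<in> I n" "\<forall>a\<in>I n. \<exists>c. a - (\<Sum>j<(L::nat). c j * g j) \<in> Z" by (elim exE conjE)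
  note mi = maximal_setD(1)[OF m]
  note Ncl = ideal_ofD(3)[OF N(1)] ideal_of_diff[OF subring_UNIV N(1)] ideal_ofD(4)[OF N(1) UNIV_I]
  \<comment> \<open>This is N plus m times the generators of I_n; \<open>Kgen\<close> puts
    \<open>K n\<close> into it.\<close>
  define B where "B = {b. \<exists>c. (\<forall>j<L. c j \<in> m) \<and> b - (\<Sum>j<L. c j * g j) \<in> N}"
  have NB: "N \<subseteq> B"
    unfolding B_def using ideal_ofD(2)[OF mi] by (intro subsetI CollectI exI[of _ "\<lambda>_. 0"]) simp
  have "ideal_of UNIV B"
    unfolding ideal_of_def
  proof (intro conjI ballI)
    show "0 \<in> B" using NB ideal_ofD(2)[OF N(1)] by blast
    fix a b assume "a \<in> B" "b \<in> B"
    then obtain c d where c: "\<forall>j<L. c j \<in> m" "a - (\<Sum>j<L. c j * g j) \<in> N"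
      and d: "\<forall>j<L. d j \<in> m" "b - (\<Sum>j<L. d j * g j) \<in> N" unfolding B_def by (elim CollectE exE conjE)
    have "(a - (\<Sum>j<L. c j * g j)) + (b - (\<Sum>j<L. d j * g j)) = (a + b) - (\<Sum>j<L. (c j + d j) * g j)"
      by (simp add: algebra_simps sum.distrib)
    with Ncl(1)[OF c(2) d(2)] have "(a + b) - (\<Sum>j<L. (c j + d j) * g j) \<in> N" by simp
    moreover have "\<forall>j<L. c j + d j \<in> m" using c(1) d(1) ideal_ofD(3)[OF mi] by blast
    ultimately show "a + b \<in> B" unfolding B_def by (intro CollectI exI[of _ "\<lambda>j. c j + d j"] conjI)
  next
    fix u a assume "a \<in> B"
    then obtain c where c: "\<forall>j<L. c j \<in> m" "a - (\<Sum>j<L. c j * g j) \<in> N" unfolding B_def by (elim CollectE exE conjE)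
    have "u * (a - (\<Sum>j<L. c j * g j)) = u * a - (\<Sum>j<L. (u * c j) * g j)"
      by (simp add: algebra_simps sum_distrib_left)
    with Ncl(3)[OF c(2), of u] have "u * a - (\<Sum>j<L. (u * c j) * g j) \<in> N" by simp
    moreover have "\<forall>j<L. u * c j \<in> m" using c(1) ideal_ofD(4)[OF mi UNIV_I] by blast
    ultimately show "u * a \<in> B" unfolding B_def by (intro CollectI exI[of _ "\<lambda>j. u * c j"] conjI)
  qed simp
  moreover have "u * b \<in> B" if ub: "u \<in> m" "b \<in> I n" for u b
  proof -
    have "\<exists>c. b - (\<Sum>j<L. c j * g j) \<in> Z" using g(2) ub(2) by (rule bspec)
    then obtain c where c: "b - (\<Sum>j<L. c j * g j) \<in> Z" ..
    have "u * (b - (\<Sum>j<L. c j * g j)) = u * b - (\<Sum>j<L. (u * c j) * g j)"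
      by (simp add: algebra_simps sum_distrib_left)
    then have "u * b - (\<Sum>j<L. (u * c j) * g j) \<in> N" using Ncl(3)[of "b - (\<Sum>j<L. c j * g j)" u] c N(2) by auto
    moreover have "\<forall>j<L. u * c j \<in> m" using ub(1) ideal_ofD(5)[OF mi UNIV_I] by blast
    ultimately show ?thesis unfolding B_def by (intro CollectI exI[of _ "\<lambda>j. u * c j"] conjI)
  qed
  ultimately have KB: "K n \<subseteq> B" using NB N(2) by (intro Kgen) auto
  have gN: "g j \<in> N" if j: "j < L" for j
  proof (rule nakayama_generators[OF m unitZ N _ j])
    fix j assume "j < L"
    then obtain b where b: "b \<in> N" "g j - b \<in> K n" using sub g(1) by blast
    then obtain c where c: "\<forall>l<L. c l \<in> m" "(g j - b) - (\<Sum>l<L. c l * g l) \<in> N" using KB unfolding B_def by blast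
    have "((g j - b) - (\<Sum>l<L. c l * g l)) + b \<in> N" by (rule Ncl(1)[OF c(2) b(1)])
    then show "\<exists>c. (\<forall>l<L. c l \<in> m) \<and> g j - (\<Sum>l<L. c l * g l) \<in> N"
      using c(1) by (intro exI[of _ c] conjI) (simp_all add: algebra_simps)
  qed
  show ?thesis
  proof
    fix a assume "a \<in> I n"
    with g(2) have "\<exists>c. a - (\<Sum>j<L. c j * g j) \<in> Z" by (rule bspec)
    then obtain c where "a - (\<Sum>j<L. c j * g j) \<in> Z" ..
    then have "(a - (\<Sum>j<L. c j * g j)) + (\<Sum>j<L. c j * g j) \<in> N"
      using N(2) gN by (intro Ncl(1) ideal_of_sum[OF N(1)] Ncl(3)) auto
    then show "a \<in> N" by simp
  qed
qed

section \<open>From regularity to reductions\<close>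

text \<open>\<open>xI x r n\<close> is \<open>(x\<^sub>0, \<dots>, x\<^bsub>r-1\<^esub>) I\<^bsub>n-1\<^esub> + Z\<close>.\<close>

definition xI :: "(nat \<Rightarrow> 'p) \<Rightarrow> nat \<Rightarrow> nat \<Rightarrow> 'p set" where
  "xI x r n = {a. \<exists>c. (\<forall>i<r. c i \<in> Ipred n) \<and> a - (\<Sum>i<r. c i * x i) \<in> Z}"

lemma xI_ideal: "ideal_of UNIV (xI x r n)"
  unfolding ideal_of_def
proof (intro conjI ballI)
  note P = Ipred_ideal[of n]
  show "0 \<in> xI x r n"
    unfolding xI_def using ideal_ofD(2)[OF P] ideal_ofD(2)[OF Z] by (intro CollectI exI[of _ "\<lambda>_. 0"]) simp
  fix a b assume "a \<in> xI x r n" "b \<in> xI x r n"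
  then obtain c d where c: "\<forall>i<r. c i \<in> Ipred n" "a - (\<Sum>i<r. c i * x i) \<in> Z"
    and d: "\<forall>i<r. d i \<in> Ipred n" "b - (\<Sum>i<r. d i * x i) \<in> Z" unfolding xI_def by (elim CollectE exE conjE)
  have "(a - (\<Sum>i<r. c i * x i)) + (b - (\<Sum>i<r. d i * x i)) = (a + b) - (\<Sum>i<r. (c i + d i) * x i)"
    by (simp add: algebra_simps sum.distrib)
  with ideal_ofD(3)[OF Z c(2) d(2)] have "(a + b) - (\<Sum>i<r. (c i + d i) * x i) \<in> Z" by simp
  moreover have "\<forall>i<r. c i + d i \<in> Ipred n" using c(1) d(1) ideal_ofD(3)[OF P] by blast
  ultimately show "a + b \<in> xI x r n" unfolding xI_def by (intro CollectI exI[of _ "\<lambda>i. c i + d i"] conjI)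
next
  note P = Ipred_ideal[of n]
  fix u a assume "a \<in> xI x r n"
  then obtain c where c: "\<forall>i<r. c i \<in> Ipred n" "a - (\<Sum>i<r. c i * x i) \<in> Z" unfolding xI_def by (elim CollectE exE conjE)
  have "u * (a - (\<Sum>i<r. c i * x i)) = u * a - (\<Sum>i<r. (u * c i) * x i)"
    by (simp add: algebra_simps sum_distrib_left)
  with ideal_ofD(4)[OF Z UNIV_I c(2), of u] have "u * a - (\<Sum>i<r. (u * c i) * x i) \<in> Z" by simp
  moreover have "\<forall>i<r. u * c i \<in> Ipred n" using c(1) ideal_ofD(4)[OF P UNIV_I] by blast
  ultimately show "u * a \<in> xI x r n" unfolding xI_def by (intro CollectI exI[of _ "\<lambda>i. u * c i"] conjI)
qed simp

lemma xI_nakayama: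
  assumes "\<forall>a\<in>I n. \<exists>c. (\<forall>i<r. c i \<in> Ipred n) \<and> a - (\<Sum>i<r. c i * x i) \<in> K n"
  shows "I n \<subseteq> xI x r n"
proof (rule nakayama[OF xI_ideal])
  note P = ideal_ofD(2)[OF Ipred_ideal, of n]
  show "Z \<subseteq> xI x r n"
    unfolding xI_def using P by (intro subsetI CollectI exI[of _ "\<lambda>_. 0"]) simp
  fix a assume "a \<in> I n"
  then have "\<exists>c. (\<forall>i<r. c i \<in> Ipred n) \<and> a - (\<Sum>i<r. c i * x i) \<in> K n" using assms by blast
  then obtain c where c: "\<forall>i<r. c i \<in> Ipred n" "a - (\<Sum>i<r. c i * x i) \<in> K n" by (elim exE conjE)
  have "(\<Sum>i<r. c i * x i) \<in> xI x r n"
    unfolding xI_def using c(1) ideal_ofD(2)[OF Z] by (intro CollectI exI[of _ c]) simp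
  with c(2) show "\<exists>b\<in>xI x r n. a - b \<in> K n" by blast
qed

lemma xI_gr:
  assumes "I n \<subseteq> xI x r n"
  shows "\<forall>a\<in>I n. \<exists>c. (\<forall>i<r. c i \<in> gr.Ipred n) \<and> a - (\<Sum>i<r. c i * x i) \<in> I (Suc n)"
proof
  fix a assume "a \<in> I n"
  then have "a \<in> xI x r n" using assms by blast
  then obtain c where c: "\<forall>i<r. c i \<in> Ipred n" "a - (\<Sum>i<r. c i * x i) \<in> Z" unfolding xI_def by (elim CollectE exE conjE)
  have "gr.Ipred n = Ipred n" by (cases n) simp_all
  then show "\<exists>c. (\<forall>i<r. c i \<in> gr.Ipred n) \<and> a - (\<Sum>i<r. c i * x i) \<in> I (Suc n)"
    using c ZI by (intro exI[of _ c] conjI) auto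
qed

theorem reduction_from_regularity:
  assumes x: "\<forall>i<r. x i \<in> I 1"
    and reg: "regseq x r" and reg_gr: "gr.regseq x r"
    and g: "\<forall>j<L. g j \<in> I n" and few: "\<forall>a\<in>I n. \<exists>c. a - (\<Sum>j<(L::nat). c j * g j) \<in> K n" "L < (n + r) choose r"
    and k: "n \<ge> 1" "k \<ge> n"
  shows "I k \<subseteq> xI x r k"
proof -
  have "\<exists>d\<in>{1..n}. \<forall>a\<in>I d. \<exists>c. (\<forall>i<r. c i \<in> Ipred d) \<and> a - (\<Sum>i<r. c i * x i) \<in> K d"
  proof (rule ccontr)
    assume "\<not> ?thesis"
    then have "\<forall>d. \<exists>a. d \<in> {1..n} \<longrightarrow> a \<in> I d \<and> (\<forall>c. (\<forall>i<r. c i \<in> Ipred d) \<longrightarrow> a - (\<Sum>i<r. c i * x i) \<notin> K d)" by blast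
    from choice[OF this]
    obtain e0 where e0: "\<forall>d. d \<in> {1..n} \<longrightarrow> e0 d \<in> I d \<and> (\<forall>c. (\<forall>i<r. c i \<in> Ipred d) \<longrightarrow> e0 d - (\<Sum>i<r. c i * x i) \<notin> K d)" ..
    \<comment> \<open>In degree 0 the element 1 is always a witness, since \<open>Ipred 0\<close> is
      zero and 1 is not in m; so only the degrees from 1 to n come from the assumption.\<close>
    define e where "e d = (if d = 0 then 1 else e0 d)" for d
    have e: "e d \<in> I d" if "d \<le> n" for d using e0 that by (cases "d = 0") (simp_all add: e_def I0)
    have e': "e d - (\<Sum>i<r. b i * x i) \<notin> K d" if "d \<le> n" "\<forall>i<r. b i \<in> Ipred d" for d b
    proof (cases "d = 0")
      case True
      then have "(\<Sum>i<r. b i * x i) = 0" using that(2) by (intro sum.neutral) simp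
      then show ?thesis using maximal_setD(2)[OF m] True by (simp add: e_def K0)
    next
      case False
      then show ?thesis using e0 that by (simp add: e_def)
    qed
    define f where "f ks = xmon r x ks * e (n - sum_list ks)" for ks
    have "f ks \<in> I n" if "ks \<in> exps r n" for ks
      using I_mult[OF xmon_in[OF x, of ks] e[of "n - sum_list ks"]] that by (simp add: f_def exps_def)
    then have "\<forall>ks. \<exists>c. ks \<in> exps r n \<longrightarrow> f ks - (\<Sum>j<L. c j * g j) \<in> K n" using few(1) by simp
    from choice[OF this]
    obtain A where A: "\<forall>ks. ks \<in> exps r n \<longrightarrow> f ks - (\<Sum>j<L. A ks j * g j) \<in> K n" ..
    have "card {..<L} < card (exps r n)" using few(2) by (simp add: card_exps)
    then have "\<exists>c. (\<exists>ks\<in>exps r n. c ks \<notin> m) \<and> (\<forall>j\<in>{..<L}. (\<Sum>ks\<in>exps r n. c ks * A ks j) \<in> m)"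
      by (intro linear_dependence[OF m] finite_exps finite_lessThan)
    then obtain c where c: "\<exists>ks\<in>exps r n. c ks \<notin> m" "\<forall>j\<in>{..<L}. (\<Sum>ks\<in>exps r n. c ks * A ks j) \<in> m" by (elim exE conjE)
    have 1: "(\<Sum>ks\<in>exps r n. c ks * (f ks - (\<Sum>j<L. A ks j * g j))) \<in> K n"
      using A by (intro Ksum Kcl(5)) simp
    have 2: "(\<Sum>j<L. (\<Sum>ks\<in>exps r n. c ks * A ks j) * g j) \<in> K n"
      using c(2) g by (intro Ksum mI) simp_all
    have "(\<Sum>ks\<in>exps r n. c ks * (f ks - (\<Sum>j<L. A ks j * g j))) =
        (\<Sum>ks\<in>exps r n. c ks * f ks) - (\<Sum>ks\<in>exps r n. \<Sum>j<L. c ks * A ks j * g j)"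
      by (simp add: right_diff_distrib sum_subtractf sum_distrib_left mult.assoc)
    also have "(\<Sum>ks\<in>exps r n. \<Sum>j<L. c ks * A ks j * g j) = (\<Sum>j<L. (\<Sum>ks\<in>exps r n. c ks * A ks j) * g j)"
      by (subst sum.swap) (simp add: sum_distrib_right)
    finally have "(\<Sum>ks\<in>exps r n. c ks * f ks) \<in> K n" using Kcl(2)[OF 1 2] by simp
    \<comment> \<open>For t = r no variable is treated as zero, and the ideal part is an empty
      sum.\<close>
    then have 3: "(\<Sum>ks\<in>exps r n. c ks * (xmon r x ks * e (n - sum_list ks))) - (\<Sum>l<r - r. 0 * x l) \<in> K n"
      by (simp add: f_def)
    have "c ks \<in> m" if "ks \<in> exps r n" for ks
      by (rule monomials_independent[OF m mI x reg e e' order_refl order_refl _ 3 that]) (assumption | simp)+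
    with c(1) show False by blast
  qed
  then obtain d where d: "1 \<le> d" "d \<le> n" "\<forall>a\<in>I d. \<exists>c. (\<forall>i<r. c i \<in> Ipred d) \<and> a - (\<Sum>i<r. c i * x i) \<in> K d" by auto
  have sub: "I d \<subseteq> xI x r d" by (rule xI_nakayama[OF d(3)])
  obtain k' where k': "k = Suc k'" using k by (cases k) auto
  have "I k \<subseteq> I d" using lift_Suc_antimono_le[of I d k] dec d(2) k(2) by simp
  show ?thesis
  proof
    fix a assume a: "a \<in> I k"
    then have "a \<in> xI x r d" using \<open>I k \<subseteq> I d\<close> sub by blast
    then obtain c where c: "a - (\<Sum>i<r. c i * x i) \<in> Z" unfolding xI_def by (elim CollectE exE conjE)
    then have "a - (\<Sum>i<r. c i * x i) \<in> I k" using ZI by blast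
    then have "a - (a - (\<Sum>i<r. c i * x i)) \<in> I k" by (rule Icl(4)[OF a])
    \<comment> \<open>The coefficients come from I_(d-1) only; Valabrega-Valla exchanges them for
      coefficients in I_(k-1).\<close>
    then have "(\<Sum>i<r. c i * x i) \<in> I (Suc k')" by (simp add: k')
    then have "\<exists>b. (\<forall>i<r. b i \<in> I k') \<and> (\<Sum>i<r. c i * x i) = (\<Sum>i<r. b i * x i)"
      by (intro gr.valabrega_valla[OF refl x reg_gr]) simp_all
    then obtain b where b: "\<forall>i<r. b i \<in> I k'" "(\<Sum>i<r. c i * x i) = (\<Sum>i<r. b i * x i)" by (elim exE conjE)
    show "a \<in> xI x r k"
      unfolding xI_def using b c by (intro CollectI exI[of _ b]) (simp add: k')
  qed
qed

end

section \<open>Openness of the reduction condition\<close>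

inductive_set polyfuns :: "'v set \<Rightarrow> (('v \<Rightarrow> 'p::comm_ring_1) \<Rightarrow> 'p) set" for V where
  const: "(\<lambda>_. c) \<in> polyfuns V"
| var: "v \<in> V \<Longrightarrow> (\<lambda>\<xi>. \<xi> v) \<in> polyfuns V"
| add: "f \<in> polyfuns V \<Longrightarrow> g \<in> polyfuns V \<Longrightarrow> (\<lambda>\<xi>. f \<xi> + g \<xi>) \<in> polyfuns V"
| mult: "f \<in> polyfuns V \<Longrightarrow> g \<in> polyfuns V \<Longrightarrow> (\<lambda>\<xi>. f \<xi> * g \<xi>) \<in> polyfuns V"

lemma polyfuns_diff:
  assumes "f \<in> polyfuns V" "g \<in> polyfuns V" shows "(\<lambda>\<xi>. f \<xi> - g \<xi>) \<in> polyfuns V"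
proof -
  have "(\<lambda>\<xi>. f \<xi> + (- 1) * g \<xi>) \<in> polyfuns V"
    by (rule polyfuns.add[OF assms(1) polyfuns.mult[OF polyfuns.const assms(2)]])
  then show ?thesis by simp
qed

lemma polyfuns_sum: "(\<And>s. s \<in> S \<Longrightarrow> f s \<in> polyfuns V) \<Longrightarrow> (\<lambda>\<xi>. \<Sum>s\<in>S. f s \<xi>) \<in> polyfuns V"
proof (induction S rule: infinite_finite_induct)
  case (insert s S)
  then have "(\<lambda>\<xi>. f s \<xi> + (\<Sum>s\<in>S. f s \<xi>)) \<in> polyfuns V" by (intro polyfuns.add) simp_all
  then show ?case using insert.hyps by simp
qed (simp_all add: polyfuns.const)

text \<open>Gaussian elimination without division: surjectivity of a matrix of polynomials at one point
  spreads to the non-vanishing locus of the product of the pivots.\<close>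

lemma surjective_matrix_open:
  fixes A :: "'s \<Rightarrow> 'l \<Rightarrow> ('v \<Rightarrow> 'p::comm_ring_1) \<Rightarrow> 'p"
  assumes m: "maximal_set m" and S: "finite S" and "finite C"
    and A: "\<And>s l. s \<in> S \<Longrightarrow> l \<in> C \<Longrightarrow> A s l \<in> polyfuns V"
    and surj: "\<And>u. \<exists>c. \<forall>l\<in>C. u l - (\<Sum>s\<in>S. c s * A s l \<eta>) \<in> m"
  shows "\<exists>\<phi>\<in>polyfuns V. \<phi> \<eta> \<notin> m \<and> (\<forall>\<xi>. \<phi> \<xi> \<notin> m \<longrightarrow> (\<forall>u. \<exists>c. \<forall>l\<in>C. u l - (\<Sum>s\<in>S. c s * A s l \<xi>) \<in> m))"
  using assms(3-)
proof (induction C arbitrary: A)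
  case empty
  have "(\<lambda>_. 1) \<in> polyfuns V" by (rule polyfuns.const)
  then show ?case using maximal_setD(2)[OF m] by (intro bexI[of _ "\<lambda>_. 1"]) simp_all
next
  case (insert l0 C)
  note mi = maximal_setD(1)[OF m]
  note mcl = ideal_ofD(3)[OF mi] ideal_of_diff[OF subring_UNIV mi] ideal_ofD(4)[OF mi UNIV_I] ideal_ofD(5)[OF mi UNIV_I]
  have "\<exists>s0\<in>S. A s0 l0 \<eta> \<notin> m"
  proof (rule ccontr)
    assume "\<not> ?thesis"
    then have n: "A s l0 \<eta> \<in> m" if "s \<in> S" for s using that by blast
    obtain c where "1 - (\<Sum>s\<in>S. c s * A s l0 \<eta>) \<in> m" using insert.prems(2)[of "\<lambda>_. 1"] by blast
    moreover have "(\<Sum>s\<in>S. c s * A s l0 \<eta>) \<in> m" by (intro ideal_of_sum[OF mi] mcl(3) n)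
    ultimately have "(1 - (\<Sum>s\<in>S. c s * A s l0 \<eta>)) + (\<Sum>s\<in>S. c s * A s l0 \<eta>) \<in> m" by (rule mcl(1))
    then show False using maximal_setD(2)[OF m] by simp
  qed
  then obtain s0 where s0: "s0 \<in> S" "A s0 l0 \<eta> \<notin> m" by blast
  define p where "p = A s0 l0"
  \<comment> \<open>The Schur complement of the pivot, multiplied by the pivot to avoid division;
    its entries are again polynomial functions.\<close>
  define B where "B s l \<xi> = p \<xi> * A s l \<xi> - A s l0 \<xi> * A s0 l \<xi>" for s l \<xi>
  have pp: "p \<in> polyfuns V" unfolding p_def using insert.prems(1) s0(1) by simp
  have BB: "B s l \<in> polyfuns V" if "s \<in> S" "l \<in> C" for s l
    unfolding B_def using that s0(1) insert.prems(1) pp by (intro polyfuns_diff polyfuns.mult) simp_all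
  have combB: "(\<Sum>s\<in>S. d s * B s l \<xi>) = p \<xi> * (\<Sum>s\<in>S. d s * A s l \<xi>) - (\<Sum>s\<in>S. d s * A s l0 \<xi>) * A s0 l \<xi>" for d l \<xi>
    by (simp add: B_def right_diff_distrib sum_subtractf sum_distrib_left sum_distrib_right mult_ac)
  have "\<exists>c. \<forall>l\<in>C. u l - (\<Sum>s\<in>S. c s * B s l \<eta>) \<in> m" for u
  proof -
    obtain v where v: "v * p \<eta> - 1 \<in> m" using maximal_setD(3)[OF m s0(2)] by (auto simp: p_def)
    obtain c where c: "\<forall>l\<in>insert l0 C. (u(l0 := 0)) l - (\<Sum>s\<in>S. c s * A s l \<eta>) \<in> m"
      using insert.prems(2)[of "u(l0 := 0)"] by (elim exE)
    have "0 - (\<Sum>s\<in>S. c s * A s l0 \<eta>) \<in> m" using c by simp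
    then have c0: "(\<Sum>s\<in>S. c s * A s l0 \<eta>) \<in> m" using mcl(3)[of _ "- 1"] by fastforce
    have "u l - (\<Sum>s\<in>S. (v * c s) * B s l \<eta>) \<in> m" if l: "l \<in> C" for l
    proof -
      have "l \<noteq> l0" using l insert.hyps by blast
      then have cl: "u l - (\<Sum>s\<in>S. c s * A s l \<eta>) \<in> m" using c l by auto
      have "(\<Sum>s\<in>S. (v * c s) * B s l \<eta>) = v * (\<Sum>s\<in>S. c s * B s l \<eta>)" by (simp add: sum_distrib_left mult.assoc)
      then have "u l - (\<Sum>s\<in>S. (v * c s) * B s l \<eta>) =
          ((u l - (\<Sum>s\<in>S. c s * A s l \<eta>)) - (v * p \<eta> - 1) * (\<Sum>s\<in>S. c s * A s l \<eta>)) + (v * A s0 l \<eta>) * (\<Sum>s\<in>S. c s * A s l0 \<eta>)"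
        by (simp add: combB algebra_simps)
      also have "\<dots> \<in> m" by (intro mcl(1) mcl(2)[OF cl] mcl(4)[OF v] mcl(3)[OF c0])
      finally show ?thesis .
    qed
    then show ?thesis by (intro exI[of _ "\<lambda>s. v * c s"]) simp
  qed
  then have "\<exists>\<phi>\<in>polyfuns V. \<phi> \<eta> \<notin> m \<and> (\<forall>\<xi>. \<phi> \<xi> \<notin> m \<longrightarrow> (\<forall>u. \<exists>c. \<forall>l\<in>C. u l - (\<Sum>s\<in>S. c s * B s l \<xi>) \<in> m))"
    by (intro insert.IH[of B] BB)
  then obtain \<phi> where \<phi>: "\<phi> \<in> polyfuns V" "\<phi> \<eta> \<notin> m"
    "\<forall>\<xi>. \<phi> \<xi> \<notin> m \<longrightarrow> (\<forall>u. \<exists>c. \<forall>l\<in>C. u l - (\<Sum>s\<in>S. c s * B s l \<xi>) \<in> m)" by (elim bexE conjE)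
  show ?case
  proof (rule bexI[of _ "\<lambda>\<xi>. p \<xi> * \<phi> \<xi>"], intro conjI allI impI)
    show "(\<lambda>\<xi>. p \<xi> * \<phi> \<xi>) \<in> polyfuns V" by (rule polyfuns.mult[OF pp \<phi>(1)])
    show "p \<eta> * \<phi> \<eta> \<notin> m" using maximal_set_prime[OF m] s0(2) \<phi>(2) unfolding p_def by blast
    fix \<xi> u assume "p \<xi> * \<phi> \<xi> \<notin> m"
    then have nz: "p \<xi> \<notin> m" "\<phi> \<xi> \<notin> m" using mcl(3,4) by blast+
    obtain v where v: "v * p \<xi> - 1 \<in> m" using maximal_setD(3)[OF m nz(1)] by blast
    have "\<exists>c. \<forall>l\<in>C. (u l - v * u l0 * A s0 l \<xi>) - (\<Sum>s\<in>S. c s * B s l \<xi>) \<in> m"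
      using \<phi>(3)[rule_format, OF nz(2), of "\<lambda>l. u l - v * u l0 * A s0 l \<xi>"] .
    then obtain c where c: "\<forall>l\<in>C. (u l - v * u l0 * A s0 l \<xi>) - (\<Sum>s\<in>S. c s * B s l \<xi>) \<in> m" ..
    \<comment> \<open>The correction at the pivot row \<open>s0\<close>: column \<open>l0\<close>
      becomes \<open>v * p \<xi> * u l0\<close>, which is \<open>u l0\<close> modulo m, and in the
      other columns it restores the term subtracted from the target for B.\<close>
    define w where "w = v * u l0 - (\<Sum>s\<in>S. c s * A s l0 \<xi>)"
    define d where "d s = c s * p \<xi> + (if s = s0 then w else 0)" for s
    have dA: "(\<Sum>s\<in>S. d s * A s l \<xi>) = p \<xi> * (\<Sum>s\<in>S. c s * A s l \<xi>) + w * A s0 l \<xi>" for l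
    proof -
      have "(\<Sum>s\<in>S. d s * A s l \<xi>) = (\<Sum>s\<in>S. c s * p \<xi> * A s l \<xi>) + (\<Sum>s\<in>S. if s = s0 then w * A s0 l \<xi> else 0)"
        unfolding d_def sum.distrib[symmetric] by (intro sum.cong) (auto simp: algebra_simps)
      also have "(\<Sum>s\<in>S. if s = s0 then w * A s0 l \<xi> else 0) = w * A s0 l \<xi>" using S s0(1) by simp
      finally show ?thesis by (simp add: sum_distrib_left mult_ac)
    qed
    have "u l - (\<Sum>s\<in>S. d s * A s l \<xi>) \<in> m" if l: "l \<in> insert l0 C" for l
    proof (cases "l = l0")
      case True
      have "u l0 - (\<Sum>s\<in>S. d s * A s l0 \<xi>) = - 1 * ((v * p \<xi> - 1) * u l0)"
        unfolding dA w_def p_def by (simp add: algebra_simps)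
      also have "\<dots> \<in> m" by (rule mcl(3)[OF mcl(4)[OF v]])
      finally show ?thesis by (simp add: True)
    next
      case False
      have eq: "u l - (\<Sum>s\<in>S. d s * A s l \<xi>) = (u l - v * u l0 * A s0 l \<xi>) - (\<Sum>s\<in>S. c s * B s l \<xi>)"
        unfolding dA combB w_def by (simp add: algebra_simps)
      show ?thesis unfolding eq using c l False by blast
    qed
    then show "\<exists>c. \<forall>l\<in>insert l0 C. u l - (\<Sum>s\<in>S. c s * A s l \<xi>) \<in> m" by blast
  qed
qed

section \<open>Bases of graded pieces and openness of reductions\<close>

context fiber_filt
begin

text \<open>A basis of I_n/K_n over the residue field: in a relation with a coefficient outside m,
  that coefficient is inverted and its generator dropped.\<close>

lemma minimal_generators:
  obtains J :: "nat set" and g where "finite J" "\<forall>j\<in>J. g j \<in> I n"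
    "\<forall>a\<in>I n. \<exists>c. a - (\<Sum>j\<in>J. c j * g j) \<in> K n"
    "\<forall>c. (\<Sum>j\<in>J. c j * g j) \<in> K n \<longrightarrow> (\<forall>j\<in>J. c j \<in> m)"
proof -
  have "\<exists>L g. (\<forall>j<L. g j \<in> I n) \<and> (\<forall>a\<in>I n. \<exists>c. a - (\<Sum>j<(L::nat). c j * g j) \<in> K n)" by (rule fin_gen)
  then obtain L g where g: "\<forall>j<L. g j \<in> I n" "\<forall>a\<in>I n. \<exists>c. a - (\<Sum>j<(L::nat). c j * g j) \<in> K n"
    by (elim exE conjE)
  have "\<exists>J'. J' \<subseteq> J \<and> (\<forall>a\<in>I n. \<exists>c. a - (\<Sum>j\<in>J'. c j * g j) \<in> K n) \<and>
      (\<forall>c. (\<Sum>j\<in>J'. c j * g j) \<in> K n \<longrightarrow> (\<forall>j\<in>J'. c j \<in> m))"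
    if "finite J" "\<forall>a\<in>I n. \<exists>c. a - (\<Sum>j\<in>J. c j * g j) \<in> K n" for J
    using that
  proof (induction J rule: finite_psubset_induct)
    case (psubset J)
    show ?case
    proof (cases "\<forall>c. (\<Sum>j\<in>J. c j * g j) \<in> K n \<longrightarrow> (\<forall>j\<in>J. c j \<in> m)")
      case True
      then show ?thesis using psubset.prems by (intro exI[of _ J] conjI) simp_all
    next
      case False
      then obtain c j0 where c: "(\<Sum>j\<in>J. c j * g j) \<in> K n" "j0 \<in> J" "c j0 \<notin> m" by blast
      obtain v where v: "v * c j0 - 1 \<in> K n" using unit[OF c(3)] by blast
      have "\<forall>a\<in>I n. \<exists>d. a - (\<Sum>j\<in>J - {j0}. d j * g j) \<in> K n"
      proof
        fix a assume "a \<in> I n"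
        with psubset.prems have "\<exists>d. a - (\<Sum>j\<in>J. d j * g j) \<in> K n" by (rule bspec)
        then obtain d where d: "a - (\<Sum>j\<in>J. d j * g j) \<in> K n" ..
        have "(a - (\<Sum>j\<in>J. d j * g j)) + ((d j0 * v) * (\<Sum>j\<in>J. c j * g j) - (v * c j0 - 1) * (d j0 * g j0)) \<in> K n"
          by (intro Kcl(2)[OF d] Kcl(4)[OF Kcl(5)[OF c(1)]] Kcl(6)[OF v])
        also have "(a - (\<Sum>j\<in>J. d j * g j)) + ((d j0 * v) * (\<Sum>j\<in>J. c j * g j) - (v * c j0 - 1) * (d j0 * g j0)) =
            a - (\<Sum>j\<in>J - {j0}. (d j - d j0 * v * c j) * g j)"
          using psubset.hyps c(2)
          by (simp add: sum.remove[of J j0] algebra_simps sum_subtractf sum_distrib_left)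
        finally show "\<exists>d. a - (\<Sum>j\<in>J - {j0}. d j * g j) \<in> K n" by (rule exI[of _ "\<lambda>j. d j - d j0 * v * c j"])
      qed
      then have "\<exists>J'. J' \<subseteq> J - {j0} \<and> (\<forall>a\<in>I n. \<exists>c. a - (\<Sum>j\<in>J'. c j * g j) \<in> K n) \<and>
          (\<forall>c. (\<Sum>j\<in>J'. c j * g j) \<in> K n \<longrightarrow> (\<forall>j\<in>J'. c j \<in> m))"
        using c(2) by (intro psubset.IH) auto
      then obtain J' where "J' \<subseteq> J - {j0}" "\<forall>a\<in>I n. \<exists>c. a - (\<Sum>j\<in>J'. c j * g j) \<in> K n"
        "\<forall>c. (\<Sum>j\<in>J'. c j * g j) \<in> K n \<longrightarrow> (\<forall>j\<in>J'. c j \<in> m)" by (elim exE conjE)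
      then show ?thesis by (intro exI[of _ J'] conjI) auto
    qed
  qed
  from this[OF finite_lessThan g(2)]
  obtain J where "J \<subseteq> {..<L}" "\<forall>a\<in>I n. \<exists>c. a - (\<Sum>j\<in>J. c j * g j) \<in> K n"
      "\<forall>c. (\<Sum>j\<in>J. c j * g j) \<in> K n \<longrightarrow> (\<forall>j\<in>J. c j \<in> m)" by (elim exE conjE)
  moreover have "finite J" using \<open>J \<subseteq> {..<L}\<close> finite_subset by blast
  moreover have "\<forall>j\<in>J. g j \<in> I n" using \<open>J \<subseteq> {..<L}\<close> g(1) by blast
  ultimately show thesis using that[of J g] by blast
qed

text \<open>From N0 on, I_(k+1) is I_1 I_k modulo K, and a factor from I_1 can be moved into the
  coefficients of x.\<close>

lemma reduction_step:
  fixes r :: nat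
  assumes x: "\<forall>i<r. x i \<in> I 1" and n: "N0 \<le> n" "1 \<le> n"
    and red: "\<forall>a\<in>I n. \<exists>c. (\<forall>i<r. c i \<in> Ipred n) \<and> a - (\<Sum>i<r. c i * x i) \<in> K n"
  shows "k \<ge> n \<Longrightarrow> \<forall>a\<in>I k. \<exists>c. (\<forall>i<r. c i \<in> Ipred k) \<and> a - (\<Sum>i<r. c i * x i) \<in> K k"
proof (induction k rule: dec_induct)
  case base
  then show ?case by (rule red)
next
  case (step k)
  define A where "A = {a. \<exists>c. (\<forall>i<r. c i \<in> I k) \<and> a - (\<Sum>i<r. c i * x i) \<in> K (Suc k)}"
  have "I (Suc k) \<subseteq> A"
  proof (rule gen)
    show "N0 \<le> k" using step n by simp
    show "ideal_of UNIV A"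
      unfolding ideal_of_def
    proof (intro conjI ballI)
      show "0 \<in> A" unfolding A_def using Icl(1) Kcl(1) by (intro CollectI exI[of _ "\<lambda>_. 0"]) simp
      fix a b assume "a \<in> A" "b \<in> A"
      then obtain c d where c: "\<forall>i<r. c i \<in> I k" "a - (\<Sum>i<r. c i * x i) \<in> K (Suc k)"
        and d: "\<forall>i<r. d i \<in> I k" "b - (\<Sum>i<r. d i * x i) \<in> K (Suc k)" unfolding A_def by (elim CollectE exE conjE)
      have "(a - (\<Sum>i<r. c i * x i)) + (b - (\<Sum>i<r. d i * x i)) = (a + b) - (\<Sum>i<r. (c i + d i) * x i)"
        by (simp add: algebra_simps sum.distrib)
      with Kcl(2)[OF c(2) d(2)] have "(a + b) - (\<Sum>i<r. (c i + d i) * x i) \<in> K (Suc k)" by simp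
      moreover have "\<forall>i<r. c i + d i \<in> I k" using c(1) d(1) Icl(2) by blast
      ultimately show "a + b \<in> A" unfolding A_def by (intro CollectI exI[of _ "\<lambda>i. c i + d i"] conjI)
    next
      fix u a assume "a \<in> A"
      then obtain c where c: "\<forall>i<r. c i \<in> I k" "a - (\<Sum>i<r. c i * x i) \<in> K (Suc k)" unfolding A_def by (elim CollectE exE conjE)
      have "u * (a - (\<Sum>i<r. c i * x i)) = u * a - (\<Sum>i<r. (u * c i) * x i)"
        by (simp add: algebra_simps sum_distrib_left)
      with Kcl(5)[OF c(2), of u] have "u * a - (\<Sum>i<r. (u * c i) * x i) \<in> K (Suc k)" by simp
      moreover have "\<forall>i<r. u * c i \<in> I k" using c(1) Icl(5) by blast
      ultimately show "u * a \<in> A" unfolding A_def by (intro CollectI exI[of _ "\<lambda>i. u * c i"] conjI)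
    qed simp
    show "K (Suc k) \<subseteq> A" unfolding A_def using Icl(1) by (intro subsetI CollectI exI[of _ "\<lambda>_. 0"]) simp
    fix u v assume u: "u \<in> I 1" and "v \<in> I k"
    with step.IH have "\<exists>c. (\<forall>i<r. c i \<in> Ipred k) \<and> v - (\<Sum>i<r. c i * x i) \<in> K k" by blast
    then obtain c where c: "\<forall>i<r. c i \<in> Ipred k" "v - (\<Sum>i<r. c i * x i) \<in> K k" by (elim exE conjE)
    have "u * (v - (\<Sum>i<r. c i * x i)) \<in> K (Suc k)" using K_mult[OF u c(2)] by simp
    moreover have "u * (v - (\<Sum>i<r. c i * x i)) = u * v - (\<Sum>i<r. (u * c i) * x i)"
      by (simp add: algebra_simps sum_distrib_left)
    moreover have "\<forall>i<r. u * c i \<in> I k" using c(1) Ipred_mult(2)[OF _ u] by blast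
    ultimately show "u * v \<in> A" unfolding A_def by (intro CollectI exI[of _ "\<lambda>i. u * c i"] conjI) simp_all
  qed
  then show ?case unfolding A_def by auto
qed

text \<open>For n beyond both bounds, the members \<open>w l\<close> of a basis of I_n/K_n are
  combinations of the \<open>y i\<close> with coefficients \<open>c l i\<close>. Keeping these
  coefficients and varying x gives elements whose matrix A in the basis is linear in the coordinates
  of x. At y it is the identity modulo m. Wherever it is surjective, x generates degree n, and by
  \<open>reduction_step\<close> all later degrees.\<close>

lemma reduction_open:
  fixes J :: "nat set" and r :: nat
  assumes J: "finite J" "\<forall>j\<in>J. g j \<in> I 1"
    and y: "\<forall>i<r. y i \<in> I 1" "\<forall>i<r. y i - (\<Sum>t\<in>J. \<eta> (i, t) * g t) \<in> K 1"
    and red: "\<forall>n\<ge>N. \<forall>a\<in>I n. \<exists>c. (\<forall>i<r. c i \<in> Ipred n) \<and> a - (\<Sum>i<r. c i * y i) \<in> K n"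
  shows "\<exists>\<phi>\<in>polyfuns ({..<r} \<times> J). \<phi> \<eta> \<notin> m \<and>
    (\<forall>\<xi> x. \<phi> \<xi> \<notin> m \<longrightarrow> (\<forall>i<r. x i \<in> I 1) \<longrightarrow> (\<forall>i<r. x i - (\<Sum>t\<in>J. \<xi> (i, t) * g t) \<in> K 1) \<longrightarrow>
      (\<exists>N. \<forall>n\<ge>N. \<forall>a\<in>I n. \<exists>c. (\<forall>i<r. c i \<in> Ipred n) \<and> a - (\<Sum>i<r. c i * x i) \<in> K n))"
proof -
  define n where "n = Suc (max N N0)"
  define k where "k = max N N0"
  have nk: "n = Suc k" by (simp add: n_def k_def)
  obtain C :: "nat set" and w where C: "finite C" and w: "\<forall>j\<in>C. w j \<in> I n"
    and wgen: "\<forall>a\<in>I n. \<exists>c. a - (\<Sum>j\<in>C. c j * w j) \<in> K n"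
    and wind: "\<forall>c. (\<Sum>j\<in>C. c j * w j) \<in> K n \<longrightarrow> (\<forall>j\<in>C. c j \<in> m)"
    by (rule minimal_generators)
  have "\<forall>l. \<exists>c. l \<in> C \<longrightarrow> (\<forall>i<r. c i \<in> I k) \<and> w l - (\<Sum>i<r. c i * y i) \<in> K n"
  proof
    fix l
    show "\<exists>c. l \<in> C \<longrightarrow> (\<forall>i<r. c i \<in> I k) \<and> w l - (\<Sum>i<r. c i * y i) \<in> K n"
    proof (cases "l \<in> C")
      case True
      moreover have "N \<le> n" by (simp add: n_def)
      ultimately have "\<exists>c. (\<forall>i<r. c i \<in> Ipred n) \<and> w l - (\<Sum>i<r. c i * y i) \<in> K n" using red w by blast
      then show ?thesis by (simp add: nk)
    qed simp
  qed
  from choice[OF this]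
  obtain c where c: "\<forall>l. l \<in> C \<longrightarrow> (\<forall>i<r. c l i \<in> I k) \<and> w l - (\<Sum>i<r. c l i * y i) \<in> K n" ..
  have "\<exists>d. l \<in> C \<and> i < r \<and> t \<in> J \<longrightarrow> c l i * g t - (\<Sum>j\<in>C. d j * w j) \<in> K n" for l i t
  proof (cases "l \<in> C \<and> i < r \<and> t \<in> J")
    case True
    then have "c l i * g t \<in> I n" using I_mult[of "c l i" k "g t" 1] c J(2) by (simp add: nk)
    with wgen have "\<exists>d. c l i * g t - (\<Sum>j\<in>C. d j * w j) \<in> K n" by (rule bspec)
    then show ?thesis by simp
  next
    case False
    then show ?thesis by (intro exI[of _ "\<lambda>_. 0"] impI) (erule notE)
  qed
  then have "\<forall>q. \<exists>d. fst q \<in> C \<and> fst (snd q) < r \<and> snd (snd q) \<in> J \<longrightarrow>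
      c (fst q) (fst (snd q)) * g (snd (snd q)) - (\<Sum>j\<in>C. d j * w j) \<in> K n" by simp
  from choice[OF this]
  obtain \<gamma>0 where "\<forall>q. fst q \<in> C \<and> fst (snd q) < r \<and> snd (snd q) \<in> J \<longrightarrow>
      c (fst q) (fst (snd q)) * g (snd (snd q)) - (\<Sum>j\<in>C. \<gamma>0 q j * w j) \<in> K n" ..
  then have \<gamma>: "c l i * g t - (\<Sum>j\<in>C. \<gamma>0 (l, i, t) j * w j) \<in> K n" if "l \<in> C" "i < r" "t \<in> J" for l i t
    using that by (auto dest: spec[of _ "(l, i, t)"])
  define A where "A l j \<xi> = (\<Sum>i<r. \<Sum>t\<in>J. \<xi> (i, t) * \<gamma>0 (l, i, t) j)" for l j \<xi>
  have Apoly: "A l j \<in> polyfuns ({..<r} \<times> J)" for l j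
    unfolding A_def by (intro polyfuns_sum polyfuns.mult polyfuns.const polyfuns.var) simp
  define Xv :: "(nat \<times> nat \<Rightarrow> 'p) \<Rightarrow> nat \<Rightarrow> 'p" where "Xv \<xi> i = (\<Sum>t\<in>J. \<xi> (i, t) * g t)" for \<xi> i
  have vA: "(\<Sum>i<r. c l i * Xv \<xi> i) - (\<Sum>j\<in>C. A l j \<xi> * w j) \<in> K n" if l: "l \<in> C" for l \<xi>
  proof -
    have "(\<Sum>j\<in>C. A l j \<xi> * w j) = (\<Sum>i<r. \<Sum>t\<in>J. \<xi> (i, t) * (\<Sum>j\<in>C. \<gamma>0 (l, i, t) j * w j))"
    proof -
      have "(\<Sum>j\<in>C. A l j \<xi> * w j) = (\<Sum>j\<in>C. \<Sum>i<r. \<Sum>t\<in>J. \<xi> (i, t) * (\<gamma>0 (l, i, t) j * w j))"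
        by (simp add: A_def sum_distrib_right mult.assoc)
      also have "\<dots> = (\<Sum>i<r. \<Sum>j\<in>C. \<Sum>t\<in>J. \<xi> (i, t) * (\<gamma>0 (l, i, t) j * w j))" by (rule sum.swap)
      also have "\<dots> = (\<Sum>i<r. \<Sum>t\<in>J. \<Sum>j\<in>C. \<xi> (i, t) * (\<gamma>0 (l, i, t) j * w j))"
        by (rule sum.cong[OF refl], rule sum.swap)
      finally show ?thesis by (simp add: sum_distrib_left)
    qed
    moreover have "(\<Sum>i<r. c l i * Xv \<xi> i) = (\<Sum>i<r. \<Sum>t\<in>J. \<xi> (i, t) * (c l i * g t))"
      by (simp add: Xv_def sum_distrib_left mult_ac)
    ultimately have "(\<Sum>i<r. c l i * Xv \<xi> i) - (\<Sum>j\<in>C. A l j \<xi> * w j) =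
        (\<Sum>i<r. \<Sum>t\<in>J. \<xi> (i, t) * (c l i * g t - (\<Sum>j\<in>C. \<gamma>0 (l, i, t) j * w j)))"
      by (simp add: right_diff_distrib sum_subtractf)
    also have "\<dots> \<in> K n" using \<gamma>[OF l] by (intro Ksum Kcl(5)) simp
    finally show ?thesis .
  qed
  have cX: "(\<Sum>i<r. c l i * x i) - (\<Sum>i<r. c l i * Xv \<xi> i) \<in> K n"
    if "l \<in> C" "\<forall>i<r. x i - Xv \<xi> i \<in> K 1" for l \<xi> x
  proof -
    have "c l i * (x i - Xv \<xi> i) \<in> K n" if "i < r" for i
      using K_mult[of "c l i" k "x i - Xv \<xi> i" 1] that c \<open>l \<in> C\<close> \<open>\<forall>i<r. x i - Xv \<xi> i \<in> K 1\<close> by (simp add: nk)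
    then have "(\<Sum>i<r. c l i * (x i - Xv \<xi> i)) \<in> K n" by (intro Ksum) simp
    then show ?thesis by (simp add: right_diff_distrib sum_subtractf)
  qed
  have A\<eta>: "(if l = j then 1 else 0) - A l j \<eta> \<in> m" if lj: "l \<in> C" "j \<in> C" for l j
  proof -
    have "w l - (\<Sum>i<r. c l i * y i) \<in> K n" using c lj(1) by blast
    moreover have "(\<Sum>i<r. c l i * y i) - (\<Sum>i<r. c l i * Xv \<eta> i) \<in> K n"
      by (rule cX[OF lj(1)]) (use y(2) in \<open>simp add: Xv_def\<close>)
    ultimately have "(w l - (\<Sum>i<r. c l i * y i)) + (((\<Sum>i<r. c l i * y i) - (\<Sum>i<r. c l i * Xv \<eta> i)) +
        ((\<Sum>i<r. c l i * Xv \<eta> i) - (\<Sum>j\<in>C. A l j \<eta> * w j))) \<in> K n"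
      using vA[OF lj(1)] by (intro Kcl(2))
    then have "w l - (\<Sum>j\<in>C. A l j \<eta> * w j) \<in> K n" by simp
    moreover have "w l = (\<Sum>j\<in>C. (if l = j then 1 else 0) * w j)"
      using C lj(1) by (simp add: if_distrib[of "\<lambda>c. c * _"] cong: if_cong)
    ultimately have "(\<Sum>j\<in>C. ((if l = j then 1 else 0) - A l j \<eta>) * w j) \<in> K n"
      by (simp only: left_diff_distrib sum_subtractf)
    with wind show ?thesis using lj(2) by (elim allE[of _ "\<lambda>j. (if l = j then 1 else 0) - A l j \<eta>"] impE) blast+
  qed
  have surj: "\<exists>d. \<forall>j\<in>C. u j - (\<Sum>l\<in>C. d l * A l j \<eta>) \<in> m" for u
  proof (intro exI[of _ u] ballI)
    fix j assume j: "j \<in> C"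
    have "u j = (\<Sum>l\<in>C. u l * (if l = j then 1 else 0))" using C j by (simp add: if_distrib[of "\<lambda>c. _ * c"] cong: if_cong)
    then have "u j - (\<Sum>l\<in>C. u l * A l j \<eta>) = (\<Sum>l\<in>C. u l * ((if l = j then 1 else 0) - A l j \<eta>))"
      by (simp only: right_diff_distrib sum_subtractf)
    also have "\<dots> \<in> m"
      using A\<eta> j by (intro ideal_of_sum[OF maximal_setD(1)[OF m]] ideal_ofD(4)[OF maximal_setD(1)[OF m] UNIV_I]) simp
    finally show "u j - (\<Sum>l\<in>C. u l * A l j \<eta>) \<in> m" .
  qed
  have "\<exists>\<phi>\<in>polyfuns ({..<r} \<times> J). \<phi> \<eta> \<notin> m \<and>
      (\<forall>\<xi>. \<phi> \<xi> \<notin> m \<longrightarrow> (\<forall>u. \<exists>d. \<forall>j\<in>C. u j - (\<Sum>l\<in>C. d l * A l j \<xi>) \<in> m))"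
    by (rule surjective_matrix_open[OF m C C Apoly surj])
  then obtain \<phi> where \<phi>: "\<phi> \<in> polyfuns ({..<r} \<times> J)" "\<phi> \<eta> \<notin> m"
    and \<phi>s: "\<forall>\<xi>. \<phi> \<xi> \<notin> m \<longrightarrow> (\<forall>u. \<exists>d. \<forall>j\<in>C. u j - (\<Sum>l\<in>C. d l * A l j \<xi>) \<in> m)" by (elim bexE conjE)
  have "\<forall>k\<ge>n. \<forall>a\<in>I k. \<exists>c. (\<forall>i<r. c i \<in> Ipred k) \<and> a - (\<Sum>i<r. c i * x i) \<in> K k"
    if nz: "\<phi> \<xi> \<notin> m" and x: "\<forall>i<r. x i \<in> I 1" and xX: "\<forall>i<r. x i - (\<Sum>t\<in>J. \<xi> (i, t) * g t) \<in> K 1" for \<xi> x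
  proof (intro allI impI, rule reduction_step[OF x])
    show "N0 \<le> n" "1 \<le> n" by (simp_all add: n_def)
    show "\<forall>a\<in>I n. \<exists>c. (\<forall>i<r. c i \<in> Ipred n) \<and> a - (\<Sum>i<r. c i * x i) \<in> K n"
    proof
      fix a assume "a \<in> I n"
      with wgen have "\<exists>u. a - (\<Sum>j\<in>C. u j * w j) \<in> K n" by (rule bspec)
      then obtain u where u: "a - (\<Sum>j\<in>C. u j * w j) \<in> K n" ..
      have "\<exists>d. \<forall>j\<in>C. u j - (\<Sum>l\<in>C. d l * A l j \<xi>) \<in> m" using \<phi>s nz by blast
      then obtain d where d: "\<forall>j\<in>C. u j - (\<Sum>l\<in>C. d l * A l j \<xi>) \<in> m" ..
      have 1: "(\<Sum>j\<in>C. (u j - (\<Sum>l\<in>C. d l * A l j \<xi>)) * w j) \<in> K n"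
        using d w by (intro Ksum mI) simp_all
      have 2: "(\<Sum>l\<in>C. d l * ((\<Sum>i<r. c l i * x i) - (\<Sum>j\<in>C. A l j \<xi> * w j))) \<in> K n"
      proof (intro Ksum Kcl(5))
        fix l assume l: "l \<in> C"
        have "((\<Sum>i<r. c l i * x i) - (\<Sum>i<r. c l i * Xv \<xi> i)) + ((\<Sum>i<r. c l i * Xv \<xi> i) - (\<Sum>j\<in>C. A l j \<xi> * w j)) \<in> K n"
          using xX by (intro Kcl(2) cX[OF l] vA[OF l]) (simp add: Xv_def)
        then show "(\<Sum>i<r. c l i * x i) - (\<Sum>j\<in>C. A l j \<xi> * w j) \<in> K n" by simp
      qed
      have "(a - (\<Sum>j\<in>C. u j * w j)) + ((\<Sum>j\<in>C. (u j - (\<Sum>l\<in>C. d l * A l j \<xi>)) * w j) -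
          (\<Sum>l\<in>C. d l * ((\<Sum>i<r. c l i * x i) - (\<Sum>j\<in>C. A l j \<xi> * w j)))) \<in> K n"
        by (rule Kcl(2)[OF u Kcl(4)[OF 1 2]])
      moreover have "(\<Sum>j\<in>C. (\<Sum>l\<in>C. d l * A l j \<xi>) * w j) = (\<Sum>l\<in>C. d l * (\<Sum>j\<in>C. A l j \<xi> * w j))"
      proof -
        have "(\<Sum>j\<in>C. (\<Sum>l\<in>C. d l * A l j \<xi>) * w j) = (\<Sum>j\<in>C. \<Sum>l\<in>C. d l * (A l j \<xi> * w j))"
          by (simp add: sum_distrib_right mult.assoc)
        also have "\<dots> = (\<Sum>l\<in>C. \<Sum>j\<in>C. d l * (A l j \<xi> * w j))" by (rule sum.swap)
        finally show ?thesis by (simp add: sum_distrib_left)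
      qed
      moreover have "(\<Sum>i<r. (\<Sum>l\<in>C. d l * c l i) * x i) = (\<Sum>l\<in>C. d l * (\<Sum>i<r. c l i * x i))"
      proof -
        have "(\<Sum>i<r. (\<Sum>l\<in>C. d l * c l i) * x i) = (\<Sum>i<r. \<Sum>l\<in>C. d l * (c l i * x i))"
          by (simp add: sum_distrib_right mult.assoc)
        also have "\<dots> = (\<Sum>l\<in>C. \<Sum>i<r. d l * (c l i * x i))" by (rule sum.swap)
        finally show ?thesis by (simp add: sum_distrib_left)
      qed
      ultimately have "a - (\<Sum>i<r. (\<Sum>l\<in>C. d l * c l i) * x i) \<in> K n"
        by (simp add: left_diff_distrib right_diff_distrib sum_subtractf)
      moreover have "\<forall>i<r. (\<Sum>l\<in>C. d l * c l i) \<in> Ipred n"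
        unfolding nk Ipred_Suc using c by (intro allI impI Isum Icl(5)) simp
      ultimately show "\<exists>c. (\<forall>i<r. c i \<in> Ipred n) \<and> a - (\<Sum>i<r. c i * x i) \<in> K n"
        by (intro exI[of _ "\<lambda>i. \<Sum>l\<in>C. d l * c l i"] conjI)
    qed
  qed
  then have "\<forall>\<xi> x. \<phi> \<xi> \<notin> m \<longrightarrow> (\<forall>i<r. x i \<in> I 1) \<longrightarrow> (\<forall>i<r. x i - (\<Sum>t\<in>J. \<xi> (i, t) * g t) \<in> K 1) \<longrightarrow>
      (\<exists>N. \<forall>n\<ge>N. \<forall>a\<in>I n. \<exists>c. (\<forall>i<r. c i \<in> Ipred n) \<and> a - (\<Sum>i<r. c i * x i) \<in> K n)"
    by (intro allI impI exI[of _ n]) simp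
  with \<phi> show ?thesis by (intro bexI[of _ \<phi>] conjI)
qed

end

section \<open>Presentations of rings\<close>

datatype 'a ring_term = Var 'a | Zero | One | Neg "'a ring_term" | Plus "'a ring_term" "'a ring_term"
  | Times "'a ring_term" "'a ring_term"

primrec eval_term :: "('a, 'b) ring_scheme \<Rightarrow> 'a ring_term \<Rightarrow> 'a" where
  "eval_term R (Var a) = (if a \<in> carrier R then a else \<zero>\<^bsub>R\<^esub>)"
| "eval_term R Zero = \<zero>\<^bsub>R\<^esub>"
| "eval_term R One = \<one>\<^bsub>R\<^esub>"
| "eval_term R (Neg s) = \<ominus>\<^bsub>R\<^esub> eval_term R s"
| "eval_term R (Plus s t) = eval_term R s \<oplus>\<^bsub>R\<^esub> eval_term R t"
| "eval_term R (Times s t) = eval_term R s \<otimes>\<^bsub>R\<^esub> eval_term R t"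

primrec int_term :: "'a ring_term \<Rightarrow> int" where
  "int_term (Var a) = 0"
| "int_term Zero = 0"
| "int_term One = 1"
| "int_term (Neg s) = - int_term s"
| "int_term (Plus s t) = int_term s + int_term t"
| "int_term (Times s t) = int_term s * int_term t"

lemma (in cring) eval_term_closed [simp]: "eval_term R t \<in> carrier R"
  by (induction t) auto

text \<open>The evaluation in the integers ensures \<open>0 \<noteq> 1\<close>: the type \<^typ>\<open>'a\<close> may have just one element.\<close>

definition term_eq :: "'a ring_term \<Rightarrow> 'a ring_term \<Rightarrow> bool" where
  "term_eq s t \<longleftrightarrow> (\<forall>R::'a ring. cring R \<longrightarrow> eval_term R s = eval_term R t) \<and> int_term s = int_term t"

lemma term_eqI:
  "(\<And>R::'a ring. cring R \<Longrightarrow> eval_term R s = eval_term R t) \<Longrightarrow> int_term s = int_term t \<Longrightarrow> term_eq s t"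
  by (simp add: term_eq_def)

lemma (in cring) eval_term_laws:
  "eval_term R (Times (Times a b) c) = eval_term R (Times a (Times b c))"
  "eval_term R (Times a b) = eval_term R (Times b a)"
  "eval_term R (Times One a) = eval_term R a"
  "eval_term R (Plus (Plus a b) c) = eval_term R (Plus a (Plus b c))"
  "eval_term R (Plus a b) = eval_term R (Plus b a)"
  "eval_term R (Plus Zero a) = eval_term R a"
  "eval_term R (Plus (Neg a) a) = eval_term R Zero"
  "eval_term R (Times (Plus a b) c) = eval_term R (Plus (Times a c) (Times b c))"
  by (simp_all add: m_assoc a_assoc l_neg l_distr) (simp_all add: m_comm a_comm)

text \<open>Every commutative ring with carrier in \<^typ>\<open>'a\<close> is a quotient of this one, which moves
  computations from \<open>HOL-Algebra\<close> to a type of class \<^class>\<open>comm_ring_1\<close>.\<close>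

quotient_type 'a free_cring = "'a ring_term" / term_eq
  by (rule equivpI) (auto simp: reflp_def symp_def transp_def term_eq_def)

instantiation free_cring :: (type) comm_ring_1
begin

lift_definition zero_free_cring :: "'a free_cring" is Zero .
lift_definition one_free_cring :: "'a free_cring" is One .
lift_definition uminus_free_cring :: "'a free_cring \<Rightarrow> 'a free_cring" is Neg by (auto simp: term_eq_def)
lift_definition plus_free_cring :: "'a free_cring \<Rightarrow> 'a free_cring \<Rightarrow> 'a free_cring" is Plus by (auto simp: term_eq_def)
lift_definition times_free_cring :: "'a free_cring \<Rightarrow> 'a free_cring \<Rightarrow> 'a free_cring" is Times by (auto simp: term_eq_def)
definition minus_free_cring :: "'a free_cring \<Rightarrow> 'a free_cring \<Rightarrow> 'a free_cring" where "minus_free_cring a b = a + - b"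

instance
proof
  fix a b c :: "'a free_cring"
  show "a * b * c = a * (b * c)" by transfer (rule term_eqI, erule cring.eval_term_laws, simp)
  show "a * b = b * a" by transfer (rule term_eqI, erule cring.eval_term_laws, simp)
  show "1 * a = a" by transfer (rule term_eqI, erule cring.eval_term_laws, simp)
  show "a + b + c = a + (b + c)" by transfer (rule term_eqI, erule cring.eval_term_laws, simp)
  show "a + b = b + a" by transfer (rule term_eqI, erule cring.eval_term_laws, simp)
  show "0 + a = a" by transfer (rule term_eqI, erule cring.eval_term_laws, simp)
  show "- a + a = 0" by transfer (rule term_eqI, erule cring.eval_term_laws, simp)
  show "a - b = a + - b" by (rule minus_free_cring_def)
  show "(a + b) * c = a * c + b * c" by transfer (rule term_eqI, erule cring.eval_term_laws, simp add: algebra_simps)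
  show "(0 :: 'a free_cring) \<noteq> 1" by transfer (auto simp: term_eq_def)
qed

end

text \<open>\<open>term_eq\<close> compares evaluations in commutative rings only; the guard makes
  the function constant elsewhere, hence well defined.\<close>

lift_definition ev :: "'a ring \<Rightarrow> 'a free_cring \<Rightarrow> 'a" is "\<lambda>R t. if cring R then eval_term R t else undefined"
  by (auto simp: term_eq_def)

lift_definition free_var :: "'a \<Rightarrow> 'a free_cring" is Var .

lemma ev_simps:
  fixes R :: "'a ring"
  assumes "cring R"
  shows "ev R p \<in> carrier R" "a \<in> carrier R \<Longrightarrow> ev R (free_var a) = a"
    "ev R 0 = \<zero>\<^bsub>R\<^esub>" "ev R 1 = \<one>\<^bsub>R\<^esub>" "ev R (p + q) = ev R p \<oplus>\<^bsub>R\<^esub> ev R q" "ev R (p * q) = ev R p \<otimes>\<^bsub>R\<^esub> ev R q"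
  using assms by (transfer, simp add: cring.eval_term_closed)+

section \<open>Presentations and the correspondence of ideals\<close>

locale presentation =
  fixes T :: "'q::comm_ring_1 set" and S :: "('b, 'c) ring_scheme" (structure) and h :: "'q \<Rightarrow> 'b"
  assumes T: "subring T" and image: "h ` T = carrier S"
    and h_add: "p \<in> T \<Longrightarrow> q \<in> T \<Longrightarrow> h (p + q) = h p \<oplus> h q"
    and h_mult: "p \<in> T \<Longrightarrow> q \<in> T \<Longrightarrow> h (p * q) = h p \<otimes> h q"
    and h_zero: "h 0 = \<zero>" and h_one: "h 1 = \<one>"
begin

lemmas Tcl = subringD[OF T]

lemma h_closed: "p \<in> T \<Longrightarrow> h p \<in> carrier S"
  using image by blast

lemma h_onto:
  assumes "x \<in> carrier S" obtains p where "p \<in> T" "x = h p"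
  using assms image by blast

text \<open>Nothing is assumed about the structure S itself: the laws hold in T and pass along h.
  For a \<open>graded_quotient\<close> this replaces a check of the ring laws on cosets.\<close>

lemma is_cring: "cring S"
proof (rule cringI)
  show "abelian_group S"
  proof (rule abelian_groupI)
    fix x y z assume "x \<in> carrier S" "y \<in> carrier S" "z \<in> carrier S"
    then obtain p q s where e: "p \<in> T" "q \<in> T" "s \<in> T" "x = h p" "y = h q" "z = h s" by (metis h_onto)
    then show "x \<oplus> y \<oplus> z = x \<oplus> (y \<oplus> z)" by (simp add: h_add[symmetric] Tcl add.assoc)
  next
    fix x y assume "x \<in> carrier S" "y \<in> carrier S"
    then obtain p q where e: "p \<in> T" "q \<in> T" "x = h p" "y = h q" by (metis h_onto)
    then show "x \<oplus> y \<in> carrier S" "x \<oplus> y = y \<oplus> x" by (simp_all add: h_add[symmetric] h_closed Tcl add.commute)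
  next
    fix x assume "x \<in> carrier S"
    then obtain p where p: "p \<in> T" "x = h p" by (metis h_onto)
    then show "\<zero> \<oplus> x = x" by (simp add: h_zero[symmetric] h_add[symmetric] Tcl)
    have "h (- p) \<oplus> x = \<zero>" using p by (simp add: h_zero[symmetric] h_add[symmetric] Tcl)
    moreover have "h (- p) \<in> carrier S" by (intro h_closed Tcl(5) p(1))
    ultimately show "\<exists>y\<in>carrier S. y \<oplus> x = \<zero>" by (rule bexI)
  next
    show "\<zero> \<in> carrier S" using h_closed[OF Tcl(1)] unfolding h_zero .
  qed
  show "comm_monoid S"
  proof (rule comm_monoidI)
    fix x y z assume "x \<in> carrier S" "y \<in> carrier S" "z \<in> carrier S"
    then obtain p q s where e: "p \<in> T" "q \<in> T" "s \<in> T" "x = h p" "y = h q" "z = h s" by (metis h_onto)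
    then show "x \<otimes> y \<otimes> z = x \<otimes> (y \<otimes> z)" by (simp add: h_mult[symmetric] Tcl mult.assoc)
  next
    fix x y assume "x \<in> carrier S" "y \<in> carrier S"
    then obtain p q where e: "p \<in> T" "q \<in> T" "x = h p" "y = h q" by (metis h_onto)
    then show "x \<otimes> y \<in> carrier S" "x \<otimes> y = y \<otimes> x" by (simp_all add: h_mult[symmetric] h_closed Tcl mult.commute)
  next
    fix x assume "x \<in> carrier S"
    then obtain p where p: "p \<in> T" "x = h p" by (metis h_onto)
    then show "\<one> \<otimes> x = x" by (simp add: h_one[symmetric] h_mult[symmetric] Tcl)
  next
    show "\<one> \<in> carrier S" using h_closed[OF Tcl(2)] unfolding h_one .
  qed
  fix x y z assume "x \<in> carrier S" "y \<in> carrier S" "z \<in> carrier S"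
  then obtain p q s where e: "p \<in> T" "q \<in> T" "s \<in> T" "x = h p" "y = h q" "z = h s" by (metis h_onto)
  then show "(x \<oplus> y) \<otimes> z = x \<otimes> z \<oplus> y \<otimes> z"
    by (simp add: h_add[symmetric] h_mult[symmetric] Tcl distrib_right)
qed

sublocale cring S by (rule is_cring)

lemma h_uminus: "p \<in> T \<Longrightarrow> h (- p) = \<ominus> h p"
  using h_add[of "- p" p] h_closed[of p] h_closed[of "- p"] Tcl(5)[of p] by (simp add: h_zero minus_equality)

lemma h_diff: "p \<in> T \<Longrightarrow> q \<in> T \<Longrightarrow> h (p - q) = h p \<ominus> h q"
  using h_add[of p "- q"] h_uminus[of q] Tcl(5)[of q] by (simp add: a_minus_def)

lemma h_sum: "(\<And>i. i \<in> A \<Longrightarrow> f i \<in> T) \<Longrightarrow> finite A \<Longrightarrow> h (sum f A) = (\<Oplus>i\<in>A. h (f i))"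
proof (induction A rule: infinite_finite_induct)
  case (insert a A)
  then have "h (sum f (insert a A)) = h (f a) \<oplus> h (sum f A)"
    using subring_sum[OF T, of A f] by (simp add: h_add)
  also have "\<dots> = (\<Oplus>i\<in>insert a A. h (f i))"
    using insert h_closed by (subst finsum_insert) auto
  finally show ?case .
qed (simp_all add: h_zero)

definition pull :: "'b set \<Rightarrow> 'q set" where "pull A = {p \<in> T. h p \<in> A}"

lemma pull_ideal:
  assumes "ideal A S" shows "ideal_of T (pull A)"
proof -
  interpret A: ideal A S by fact
  show ?thesis
    unfolding ideal_of_def pull_def
    using Tcl A.a_closed A.zero_closed A.I_l_closed h_closed by (auto simp: h_zero h_add h_mult)
qed

lemma ker_le_pull: "ideal A S \<Longrightarrow> pull {\<zero>} \<subseteq> pull A"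
  by (auto simp: pull_def additive_subgroup.zero_closed ideal.axioms(1))

lemma image_pull: "A \<subseteq> carrier S \<Longrightarrow> h ` pull A = A"
  by (auto simp: pull_def image[symmetric])

lemma pull_image:
  assumes B: "ideal_of T B" "pull {\<zero>} \<subseteq> B" shows "pull (h ` B) = B"
proof
  show "B \<subseteq> pull (h ` B)" using ideal_ofD(1)[OF B(1)] by (auto simp: pull_def)
  show "pull (h ` B) \<subseteq> B"
  proof
    fix p assume "p \<in> pull (h ` B)"
    then obtain q where pq: "p \<in> T" "q \<in> B" "h p = h q" by (auto simp: pull_def)
    have qT: "q \<in> T" using pq(2) ideal_ofD(1)[OF B(1)] by blast
    have "p - q \<in> pull {\<zero>}" using pq qT Tcl(6) h_closed by (simp add: pull_def h_diff a_minus_def r_neg)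
    then have "(p - q) + q \<in> B" using B(2) by (intro ideal_ofD(3)[OF B(1) _ pq(2)]) blast
    then show "p \<in> B" by simp
  qed
qed

lemma image_ideal:
  assumes B: "ideal_of T B" shows "ideal (h ` B) S"
proof (rule idealI[OF ring_axioms])
  note BT = subsetD[OF ideal_ofD(1)[OF B]]
  show "subgroup (h ` B) (add_monoid S)"
  proof (rule add.subgroupI)
    show "h ` B \<subseteq> carrier S" using BT h_closed by blast
    show "h ` B \<noteq> {}" using ideal_ofD(2)[OF B] by blast
    fix x assume "x \<in> h ` B"
    then obtain p where p: "p \<in> B" "x = h p" by blast
    have "\<ominus> x = h (- p)" using p BT by (simp add: h_uminus)
    then show "\<ominus> x \<in> h ` B" using ideal_of_uminus[OF T B p(1)] by blast
  next
    fix x y assume "x \<in> h ` B" "y \<in> h ` B"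
    then obtain p q where pq: "p \<in> B" "x = h p" "q \<in> B" "y = h q" by blast
    have "x \<oplus> y = h (p + q)" using pq BT by (simp add: h_add)
    then show "x \<oplus> y \<in> h ` B" using ideal_ofD(3)[OF B pq(1,3)] by auto
  qed
  fix a x assume "a \<in> h ` B" "x \<in> carrier S"
  then obtain p q where pq: "p \<in> B" "a = h p" "q \<in> T" "x = h q" by (metis h_onto imageE)
  have "x \<otimes> a = h (q * p)" "a \<otimes> x = h (q * p)" using pq BT by (simp_all add: h_mult m_comm h_closed)
  then show "x \<otimes> a \<in> h ` B" "a \<otimes> x \<in> h ` B" using ideal_ofD(4)[OF B pq(3,1)] by auto
qed

end

lemma (in cring) mem_Idl_insert:
  assumes A: "A \<subseteq> carrier R" and x: "x \<in> carrier R" and y: "y \<in> Idl (insert x A)"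
  shows "\<exists>w\<in>carrier R. y \<ominus> x \<otimes> w \<in> Idl A"
proof -
  have iA: "ideal (Idl A) R" by (rule genideal_ideal[OF A])
  interpret iA: ideal "Idl A" R by (rule iA)
  interpret ix: ideal "PIdl x" R by (rule cgenideal_ideal[OF x])
  have "ideal (Idl A <+> PIdl x) R" by (rule add_ideals[OF iA cgenideal_ideal[OF x]])
  moreover have "insert x A \<subseteq> Idl A <+> PIdl x"
  proof
    fix z assume "z \<in> insert x A"
    then consider "z = x" | "z \<in> A" by blast
    then show "z \<in> Idl A <+> PIdl x"
    proof cases
      case 1
      have "\<zero> \<oplus> x \<in> Idl A <+> PIdl x"
        unfolding set_add_def' using cgenideal_self[OF x] iA.zero_closed by blast
      then show ?thesis using 1 x by simp
    next
      case 2
      have "z \<oplus> \<zero> \<in> Idl A <+> PIdl x"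
        unfolding set_add_def' using genideal_self[OF A] 2 ix.zero_closed by blast
      then show ?thesis using 2 A by auto
    qed
  qed
  ultimately have "y \<in> Idl A <+> PIdl x" using genideal_minimal y by blast
  then obtain z w where zw: "z \<in> Idl A" "w \<in> carrier R" "y = z \<oplus> w \<otimes> x"
    unfolding set_add_def' cgenideal_def by blast
  have "z \<in> carrier R" using zw(1) iA.Icarr by blast
  then have "y \<ominus> x \<otimes> w = z" using zw(2,3) x by (simp add: a_minus_def a_assoc r_neg m_comm)
  then show ?thesis using zw by blast
qed

lemma presentation_ev:
  fixes R :: "('a, 'b) ring_scheme"
  assumes "cring R"
  shows "\<exists>h :: 'a free_cring \<Rightarrow> 'a. presentation UNIV R h"
proof -
  interpret cring R by fact
  \<comment> \<open>\<open>ev\<close> expects a record without further fields; this is R with its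
    extension dropped.\<close>
  define R' :: "'a ring" where "R' = \<lparr>carrier = carrier R, monoid.mult = (\<otimes>\<^bsub>R\<^esub>), one = \<one>\<^bsub>R\<^esub>, zero = \<zero>\<^bsub>R\<^esub>, add = (\<oplus>\<^bsub>R\<^esub>)\<rparr>"
  have cr: "cring R'"
  proof (rule cringI)
    show "abelian_group R'"
    proof (rule abelian_groupI)
      fix x assume "x \<in> carrier R'"
      then show "\<exists>y\<in>carrier R'. y \<oplus>\<^bsub>R'\<^esub> x = \<zero>\<^bsub>R'\<^esub>"
        by (intro bexI[of _ "\<ominus>\<^bsub>R\<^esub> x"]) (simp_all add: R'_def l_neg)
    qed (simp_all add: R'_def a_ac)
    show "comm_monoid R'" by (rule comm_monoidI) (simp_all add: R'_def m_ac)
  qed (auto simp: R'_def l_distr)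
  have "presentation UNIV R (ev R')"
  proof
    have cl: "ev R' p \<in> carrier R" for p using ev_simps(1)[OF cr, of p] by (simp add: R'_def)
    have var: "ev R' (free_var a) = a" if "a \<in> carrier R" for a
      using ev_simps(2)[OF cr, of a] that by (simp add: R'_def)
    show "range (ev R') = carrier R"
    proof (intro equalityI subsetI)
      show "a \<in> range (ev R')" if "a \<in> carrier R" for a using var[OF that] by (intro range_eqI[of _ _ "free_var a"]) simp
    qed (use cl in auto)
    show "ev R' (p + q) = ev R' p \<oplus>\<^bsub>R\<^esub> ev R' q" "ev R' (p * q) = ev R' p \<otimes>\<^bsub>R\<^esub> ev R' q" for p q
      using ev_simps(5,6)[OF cr, of p q] by (simp_all add: R'_def)
    show "ev R' 0 = \<zero>\<^bsub>R\<^esub>" "ev R' 1 = \<one>\<^bsub>R\<^esub>" using ev_simps(3,4)[OF cr] by (simp_all add: R'_def)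
  qed simp
  then show ?thesis by blast
qed

section \<open>Graded quotients presented by Rees algebras\<close>

locale graded_presentation = presentation UNIV R \<pi>
  for R :: "('a, 'b) ring_scheme" (structure) and \<pi> :: "'p::comm_ring_1 \<Rightarrow> 'a" +
  fixes I K :: "nat \<Rightarrow> 'a set"
  assumes II: "ideal (I n) R" and KK': "ideal (K n) R" and KIsub: "K n \<subseteq> I n" and I_0: "I 0 = carrier R"
    and IImult: "a \<in> I i \<Longrightarrow> b \<in> I j \<Longrightarrow> a \<otimes> b \<in> I (i + j)"
    and IKmult: "a \<in> I i \<Longrightarrow> b \<in> K j \<Longrightarrow> a \<otimes> b \<in> K (i + j)"
begin

lemma pull_iff: "p \<in> pull A \<longleftrightarrow> \<pi> p \<in> A"
  by (simp add: pull_def)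

sublocale G: filt "\<lambda>n. pull (I n)" "\<lambda>n. pull (K n)"
proof
  show "ideal_of UNIV (pull (I n))" "ideal_of UNIV (pull (K n))" for n by (intro pull_ideal II KK')+
  show "pull (K n) \<subseteq> pull (I n)" for n using KIsub by (auto simp: pull_def)
  show "pull (I 0) = UNIV" using h_closed by (auto simp: pull_def I_0)
  show "a * b \<in> pull (I (i + j))" if "a \<in> pull (I i)" "b \<in> pull (I j)" for a b i j
    using that IImult by (simp add: pull_iff h_mult)
  show "a * b \<in> pull (K (i + j))" if "a \<in> pull (I i)" "b \<in> pull (K j)" for a b i j
    using that IKmult by (simp add: pull_iff h_mult)
qed

definition mk :: "'p poly \<Rightarrow> nat \<Rightarrow> 'a set" where
  "mk p n = K n +> \<pi> (Polynomial.coeff p n)"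

lemma Kcoset: "K n +> \<pi> a = K n +> \<pi> b \<longleftrightarrow> a - b \<in> pull (K n)"
  using quotient_eq_iff_same_a_r_cos[OF KK', of "\<pi> a" "\<pi> b" n] h_closed
  by (simp add: pull_iff h_diff)

lemma mem_Kcoset:
  assumes "x \<in> K n +> \<pi> a" obtains b where "x = \<pi> b" "b - a \<in> pull (K n)"
proof -
  obtain k where k: "k \<in> K n" "x = k \<oplus> \<pi> a" using assms unfolding a_r_coset_def' by blast
  interpret ideal "K n" R by (rule KK')
  obtain q where q: "k = \<pi> q" using Icarr[OF k(1)] h_onto by blast
  show thesis using that[of "q + a"] k q by (simp add: h_add pull_iff)
qed

lemma self_Kcoset: "\<pi> a \<in> K n +> \<pi> a"
  using abelian_subgroup.a_rcos_self[OF abelian_subgroupI3[OF _ is_abelian_group], of "K n" "\<pi> a"] h_closed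
    ideal.axioms(1)[OF KK'] by blast

lemma mk_eq_iff: "mk p = mk q \<longleftrightarrow> p - q \<in> G.KK"
  by (simp add: fun_eq_iff mk_def Kcoset G.KK_def)

lemma K_add_zero: "K n +> \<zero> = K n"
  using ideal.Icarr[OF KK'] by (intro a_coset_add_zero) blast

text \<open>The product of \<open>graded_quotient\<close> is a union over all choices of
  representatives. It is a single coset because changing representatives by elements of K changes
  the sum by an element of \<open>K n\<close>.\<close>

sublocale G: presentation G.T "graded_quotient R I K" mk
proof
  show "subring G.T" by (rule G.T_subring)
  show "mk ` G.T = carrier (graded_quotient R I K)"
  proof (intro equalityI subsetI)
    fix f assume "f \<in> mk ` G.T"
    then obtain p where p: "p \<in> G.T" "f = mk p" by blast
    have "{n. f n \<noteq> K n} \<subseteq> {..Polynomial.degree p}"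
    proof
      fix n assume "n \<in> {n. f n \<noteq> K n}"
      then have "Polynomial.coeff p n \<noteq> 0" by (auto simp: p(2) mk_def h_zero K_add_zero)
      then show "n \<in> {..Polynomial.degree p}" by (simp add: le_degree)
    qed
    then have "finite {n. f n \<noteq> K n}" by (rule finite_subset) simp
    moreover have "\<exists>a\<in>I n. f n = K n +> a" for n
      using G.TD[OF p(1), of n] unfolding p(2) mk_def pull_iff by (intro bexI[of _ "\<pi> (Polynomial.coeff p n)"]) (rule refl)
    ultimately show "f \<in> carrier (graded_quotient R I K)" by (simp add: graded_quotient_def)
  next
    fix f assume "f \<in> carrier (graded_quotient R I K)"
    then have f: "\<forall>n. \<exists>a\<in>I n. f n = K n +> a" "finite {n. f n \<noteq> K n}" by (simp_all add: graded_quotient_def)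
    have "\<forall>n. \<exists>q. q \<in> pull (I n) \<and> f n = K n +> \<pi> q"
    proof
      fix n
      obtain a where a: "a \<in> I n" "f n = K n +> a" using f(1) by blast
      have "a \<in> carrier R" using ideal.Icarr[OF II a(1)] .
      then obtain q where "a = \<pi> q" using h_onto by blast
      then show "\<exists>q. q \<in> pull (I n) \<and> f n = K n +> \<pi> q" using a by (auto simp: pull_iff)
    qed
    from choice[OF this] obtain q where q: "\<forall>n. q n \<in> pull (I n) \<and> f n = K n +> \<pi> (q n)" ..
    define p where "p = (\<Sum>n\<in>{n. f n \<noteq> K n}. Polynomial.monom (q n) n)"
    have cp: "Polynomial.coeff p n = (if f n \<noteq> K n then q n else 0)" for n
      using f(2) by (simp add: p_def Polynomial.coeff_sum)
    have "p \<in> G.T" using q G.Icl(1) by (simp add: G.T_def cp)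
    moreover have "f = mk p" using q by (auto simp: fun_eq_iff mk_def cp h_zero K_add_zero)
    ultimately show "f \<in> mk ` G.T" by blast
  qed
  show "mk 0 = \<zero>\<^bsub>graded_quotient R I K\<^esub>"
    by (simp add: fun_eq_iff mk_def h_zero K_add_zero graded_quotient_def)
  show "mk 1 = \<one>\<^bsub>graded_quotient R I K\<^esub>"
    by (simp add: fun_eq_iff mk_def h_zero h_one K_add_zero graded_quotient_def)
  fix p q assume pq: "p \<in> G.T" "q \<in> G.T"
  show "mk (p + q) = mk p \<oplus>\<^bsub>graded_quotient R I K\<^esub> mk q"
    using ideal.a_rcos_sum[OF KK'] h_closed by (simp add: fun_eq_iff mk_def h_add graded_quotient_def)
  show "mk (p * q) = mk p \<otimes>\<^bsub>graded_quotient R I K\<^esub> mk q"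
  proof
    fix n
    have key: "K n +> (\<Oplus>i\<in>{..n}. a i \<otimes> b (n - i)) = mk (p * q) n"
      if a: "\<forall>i. a i \<in> mk p i" and b: "\<forall>i. b i \<in> mk q i" for a b
    proof -
      have "\<forall>i. \<exists>\<alpha>. a i = \<pi> \<alpha> \<and> \<alpha> - Polynomial.coeff p i \<in> pull (K i)" using a mem_Kcoset unfolding mk_def by metis
      from choice[OF this] obtain \<alpha> where \<alpha>: "\<forall>i. a i = \<pi> (\<alpha> i) \<and> \<alpha> i - Polynomial.coeff p i \<in> pull (K i)" ..
      have "\<forall>i. \<exists>\<beta>. b i = \<pi> \<beta> \<and> \<beta> - Polynomial.coeff q i \<in> pull (K i)" using b mem_Kcoset unfolding mk_def by metis
      from choice[OF this] obtain \<beta> where \<beta>: "\<forall>i. b i = \<pi> (\<beta> i) \<and> \<beta> i - Polynomial.coeff q i \<in> pull (K i)" ..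
      have "(\<Oplus>i\<in>{..n}. a i \<otimes> b (n - i)) = \<pi> (\<Sum>i\<le>n. \<alpha> i * \<beta> (n - i))"
        using \<alpha> \<beta> by (simp add: h_sum h_mult)
      moreover have "(\<Sum>i\<le>n. \<alpha> i * \<beta> (n - i)) - Polynomial.coeff (p * q) n \<in> pull (K n)"
      proof -
        have "\<alpha> i * \<beta> (n - i) - Polynomial.coeff p i * Polynomial.coeff q (n - i) \<in> pull (K n)" if i: "i \<le> n" for i
        proof -
          have cp: "Polynomial.coeff p i \<in> pull (I i)" and cq: "Polynomial.coeff q (n - i) \<in> pull (I (n - i))" using pq by (auto intro: G.TD)
          have di: "\<alpha> i - Polynomial.coeff p i \<in> pull (K i)" and dj: "\<beta> (n - i) - Polynomial.coeff q (n - i) \<in> pull (K (n - i))"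
            using \<alpha> \<beta> by auto
          have "(\<beta> (n - i) - Polynomial.coeff q (n - i)) + Polynomial.coeff q (n - i) \<in> pull (I (n - i))"
            using dj cq G.KI by (intro G.Icl(2)) auto
          then have bI: "\<beta> (n - i) \<in> pull (I (n - i))" by simp
          have "\<beta> (n - i) * (\<alpha> i - Polynomial.coeff p i) \<in> pull (K n)" using G.K_mult[OF bI di] i by simp
          moreover have "Polynomial.coeff p i * (\<beta> (n - i) - Polynomial.coeff q (n - i)) \<in> pull (K n)" using G.K_mult[OF cp dj] i by simp
          ultimately have "\<beta> (n - i) * (\<alpha> i - Polynomial.coeff p i) + Polynomial.coeff p i * (\<beta> (n - i) - Polynomial.coeff q (n - i)) \<in> pull (K n)"
            by (rule G.Kcl(2))
          then show ?thesis by (simp add: algebra_simps)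
        qed
        then have "(\<Sum>i\<le>n. \<alpha> i * \<beta> (n - i) - Polynomial.coeff p i * Polynomial.coeff q (n - i)) \<in> pull (K n)" by (intro G.Ksum) simp
        then show ?thesis by (simp add: Polynomial.coeff_mult sum_subtractf)
      qed
      ultimately show ?thesis by (simp add: mk_def Kcoset)
    qed
    have "(\<Union>a\<in>{a. \<forall>i. a i \<in> mk p i}. \<Union>b\<in>{b. \<forall>i. b i \<in> mk q i}. K n +> (\<Oplus>i\<in>{..n}. a i \<otimes> b (n - i))) =
        (\<Union>a\<in>{a. \<forall>i. a i \<in> mk p i}. \<Union>b\<in>{b. \<forall>i. b i \<in> mk q i}. mk (p * q) n)"
      using key by (intro SUP_cong refl) auto
    also have "\<dots> = mk (p * q) n"
    proof -
      \<comment> \<open>The sets of choices are non-empty; over an empty one the union would be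
        empty instead of a coset.\<close>
      have "(\<lambda>i. \<pi> (Polynomial.coeff p i)) \<in> {a. \<forall>i. a i \<in> mk p i}" "(\<lambda>i. \<pi> (Polynomial.coeff q i)) \<in> {a. \<forall>i. a i \<in> mk q i}"
        using self_Kcoset by (auto simp: mk_def)
      then have "{a. \<forall>i. a i \<in> mk p i} \<noteq> {}" "{a. \<forall>i. a i \<in> mk q i} \<noteq> {}" by (metis empty_iff)+
      then show ?thesis by (simp only: UN_constant if_False)
    qed
    finally show "mk (p * q) n = (mk p \<otimes>\<^bsub>graded_quotient R I K\<^esub> mk q) n" by (simp add: graded_quotient_def)
  qed
qed

lemma G_ker: "G.pull {\<zero>\<^bsub>graded_quotient R I K\<^esub>} = G.KK"
proof -
  have "mk p = \<zero>\<^bsub>graded_quotient R I K\<^esub> \<longleftrightarrow> p \<in> G.KK" for p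
    using mk_eq_iff[of p 0] by (simp add: G.h_zero)
  then show ?thesis using ideal_ofD(1)[OF G.KK_ideal] by (auto simp: G.pull_def)
qed

end

section \<open>Localizations and regular sequences\<close>

lemma (in cring) cring_idealI:
  assumes "A \<subseteq> carrier R" "\<zero> \<in> A" "\<And>a b. a \<in> A \<Longrightarrow> b \<in> A \<Longrightarrow> a \<oplus> b \<in> A"
    and mult: "\<And>a x. a \<in> A \<Longrightarrow> x \<in> carrier R \<Longrightarrow> x \<otimes> a \<in> A"
  shows "ideal A R"
proof (rule idealI[OF ring_axioms])
  show "subgroup A (add_monoid R)"
  proof (rule add.subgroupI)
    fix a assume a: "a \<in> A"
    have "(\<ominus> \<one>) \<otimes> a \<in> A" using mult[OF a, of "\<ominus> \<one>"] by simp
    then show "\<ominus> a \<in> A" using a assms(1) by (simp add: l_minus subsetD)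
  qed (use assms in auto)
  show "a \<in> A \<Longrightarrow> x \<in> carrier R \<Longrightarrow> a \<otimes> x \<in> A" for a x
    using mult[of a x] assms(1) by (simp add: m_comm subsetD)
qed (use mult in auto)

text \<open>The data that \<open>koszul_syzygies\<close> needs from a regular sequence, as ideals of a presenting ring.\<close>

definition regular_chain ::
  "'q::comm_ring_1 set \<Rightarrow> 'q set \<Rightarrow> 'q set \<Rightarrow> nat \<Rightarrow> (nat \<Rightarrow> 'q) \<Rightarrow> (nat \<Rightarrow> 'q set) \<Rightarrow> bool" where
  "regular_chain T W N r a J \<longleftrightarrow>
     (\<forall>i\<le>r. ideal_of T (J i) \<and> N \<subseteq> J i) \<and> (\<forall>i<r. J i \<subseteq> J (Suc i)) \<and>
     (\<forall>b\<in>J 0. \<exists>u\<in>W. u * b \<in> N) \<and> (\<forall>i<r. a i \<in> T \<and> a i \<in> J (Suc i)) \<and>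
     (\<forall>i<r. \<forall>b\<in>T. a i * b \<in> J i \<longrightarrow> b \<in> J i) \<and>
     (\<forall>i<r. \<forall>b\<in>J (Suc i). \<exists>u\<in>W. \<exists>f\<in>T. u * b - a i * f \<in> J i)"

lemma set_take_Suc: "i < length xs \<Longrightarrow> set (take (Suc i) xs) = insert (xs ! i) (set (take i xs))"
  by (simp add: take_Suc_conv_app_nth)

context presentation
begin

text \<open>No denominators arise, hence the multiplier set {1}; the ideals of the initial segments
  are pulled back to T.\<close>

lemma regular_chain_of_regular_sequence:
  assumes xs: "regular_sequence S xs" and r: "r \<le> length xs"
    and a: "\<And>i. i < r \<Longrightarrow> a i \<in> T" "\<And>i. i < r \<Longrightarrow> h (a i) = xs ! i"
  shows "regular_chain T {1} (pull {\<zero>}) r a (\<lambda>i. pull (Idl (set (take i xs))))"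
proof -
  have sub: "set (take i xs) \<subseteq> carrier S" for i
    using xs set_take_subset[of i xs] by (auto simp: regular_sequence_def)
  note id = genideal_ideal[OF sub]
  have "pull (Idl (set (take i xs))) \<subseteq> pull (Idl (set (take (Suc i) xs)))" for i
  proof -
    have "set (take i xs) \<subseteq> Idl (set (take (Suc i) xs))"
      using genideal_self[OF sub] set_take_subset_set_take[of i "Suc i" xs] by fastforce
    then have "Idl (set (take i xs)) \<subseteq> Idl (set (take (Suc i) xs))" by (rule genideal_minimal[OF id])
    then show ?thesis by (auto simp: pull_def)
  qed
  moreover have "b \<in> pull {\<zero>}" if "b \<in> pull (Idl (set (take 0 xs)))" for b
  proof -
    have "ideal {\<zero>} S" by (rule zeroideal)
    then have "Idl {} \<subseteq> {\<zero>}" by (intro genideal_minimal) simp_all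
    then show ?thesis using that by (auto simp: pull_def)
  qed
  moreover have "a i \<in> pull (Idl (set (take (Suc i) xs)))" if "i < r" for i
  proof -
    have "xs ! i \<in> Idl (set (take (Suc i) xs))"
      using genideal_self[OF sub, of "Suc i"] set_take_Suc[of i xs] that r by auto
    then show ?thesis using a[OF that] by (simp add: pull_def)
  qed
  moreover have "b \<in> pull (Idl (set (take i xs)))"
    if "i < r" "b \<in> T" "a i * b \<in> pull (Idl (set (take i xs)))" for i b
    using xs that r a[of i] h_closed unfolding regular_sequence_def pull_def by (auto simp: h_mult)
  moreover have "\<exists>f\<in>T. 1 * b - a i * f \<in> pull (Idl (set (take i xs)))"
    if i: "i < r" and b: "b \<in> pull (Idl (set (take (Suc i) xs)))" for i b
  proof -
    have bT: "b \<in> T" and hb: "h b \<in> Idl (set (take (Suc i) xs))" using b by (simp_all add: pull_def)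
    have xi: "xs ! i \<in> carrier S" using a[OF i] h_closed by metis
    have "\<exists>w\<in>carrier S. h b \<ominus> xs ! i \<otimes> w \<in> Idl (set (take i xs))"
      using mem_Idl_insert[OF sub xi] hb i r by (simp add: set_take_Suc)
    then obtain w where w: "w \<in> carrier S" "h b \<ominus> xs ! i \<otimes> w \<in> Idl (set (take i xs))" by blast
    obtain f where f: "f \<in> T" "w = h f" using h_onto[OF w(1)] by blast
    have "h (b - a i * f) = h b \<ominus> xs ! i \<otimes> w"
      using a[OF i] f bT Tcl(4) by (simp add: h_diff h_mult)
    then show ?thesis using w(2) f(1) a(1)[OF i] bT Tcl(4,6) by (intro bexI[of _ f]) (simp_all add: pull_def)
  qed
  ultimately show ?thesis
    unfolding regular_chain_def using pull_ideal[OF id] ker_le_pull[OF id] a(1) by auto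
qed

end

section \<open>Fractions and regular sequences in a localization\<close>

text \<open>W is the preimage of the complement of P. That the localization is a ring enters as
  \<open>L_cring\<close>, which the Cohen-Macaulay property supplies.\<close>

locale loc_presentation = presentation T S h for T :: "'q::comm_ring_1 set" and S :: "('b, 'c) ring_scheme" (structure) and h +
  fixes W :: "'q set" and P :: "'b set"
  assumes WT: "W \<subseteq> T" and W1: "1 \<in> W" and Wm: "u \<in> W \<Longrightarrow> v \<in> W \<Longrightarrow> u * v \<in> W"
    and WP: "p \<in> T \<Longrightarrow> h p \<notin> P \<longleftrightarrow> p \<in> W"
    and L_cring: "cring (localization S P)"
begin

abbreviation "L \<equiv> localization S P"
abbreviation "ker \<equiv> pull {\<zero>\<^bsub>S\<^esub>}"

sublocale L: cring L by (rule L_cring)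

lemma W_T: "u \<in> W \<Longrightarrow> u \<in> T" using WT by blast

lemma ker_ideal: "ideal_of T ker" by (rule pull_ideal[OF zeroideal])

lemmas kercl = ideal_ofD(2)[OF ker_ideal] ideal_ofD(3)[OF ker_ideal] ideal_ofD(4)[OF ker_ideal]
  ideal_of_diff[OF T ker_ideal] ideal_of_uminus[OF T ker_ideal]

lemma h_eq_iff: "p \<in> T \<Longrightarrow> q \<in> T \<Longrightarrow> h p = h q \<longleftrightarrow> p - q \<in> ker"
  using Tcl(6) h_closed by (simp add: pull_def h_diff)

text \<open>Equality of the fractions p/q and p'/q', in terms of lifts to T.\<close>

definition eqv :: "'q \<Rightarrow> 'q \<Rightarrow> 'q \<Rightarrow> 'q \<Rightarrow> bool" where
  "eqv p q p' q' \<longleftrightarrow> (\<exists>u\<in>W. u * (p * q' - p' * q) \<in> ker)"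

definition frac :: "'q \<Rightarrow> 'q \<Rightarrow> ('b \<times> 'b) set" where
  "frac p q = fraction_rel S P `` {(h p, h q)}"

lemma WP_iff: "carrier S - P = h ` W"
proof (intro equalityI subsetI)
  fix x assume "x \<in> carrier S - P"
  then obtain p where "p \<in> T" "x = h p" "h p \<notin> P" using h_onto by (metis DiffD1 DiffD2)
  then show "x \<in> h ` W" using WP by blast
next
  fix x assume "x \<in> h ` W"
  then obtain u where "u \<in> W" "x = h u" by blast
  then show "x \<in> carrier S - P" using WP[of u] W_T[of u] h_closed by blast
qed

lemma rel_iff:
  assumes "p \<in> T" "q \<in> W" "p' \<in> T" "q' \<in> W"
  shows "((h p, h q), (h p', h q')) \<in> fraction_rel S P \<longleftrightarrow> eqv p q p' q'"
proof -
  have e: "h u \<otimes>\<^bsub>S\<^esub> (h p \<otimes>\<^bsub>S\<^esub> h q') = h u \<otimes>\<^bsub>S\<^esub> (h p' \<otimes>\<^bsub>S\<^esub> h q) \<longleftrightarrow> u * (p * q' - p' * q) \<in> ker" if "u \<in> W" for u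
    using assms that W_T Tcl(4) h_eq_iff[of "u * (p * q')" "u * (p' * q)"]
    by (simp add: h_mult right_diff_distrib)
  have "((h p, h q), (h p', h q')) \<in> fraction_rel S P \<longleftrightarrow>
      (\<exists>u\<in>h ` W. u \<otimes>\<^bsub>S\<^esub> (h p \<otimes>\<^bsub>S\<^esub> h q') = u \<otimes>\<^bsub>S\<^esub> (h p' \<otimes>\<^bsub>S\<^esub> h q))"
    unfolding fraction_rel_def WP_iff using assms h_closed by auto
  then show ?thesis unfolding eqv_def using e by auto
qed

lemma relE:
  assumes "(x, y) \<in> fraction_rel S P"
  obtains p q p' q' where "p \<in> T" "q \<in> W" "p' \<in> T" "q' \<in> W" "x = (h p, h q)" "y = (h p', h q')" "eqv p q p' q'"
proof -
  obtain a s b t where e: "x = (a, s)" "y = (b, t)" "a \<in> carrier S" "b \<in> carrier S" "s \<in> h ` W" "t \<in> h ` W"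
    using assms unfolding fraction_rel_def WP_iff by auto
  obtain p p' where p: "p \<in> T" "a = h p" "p' \<in> T" "b = h p'" using e(3,4) by (metis h_onto)
  obtain q q' where q: "q \<in> W" "s = h q" "q' \<in> W" "t = h q'" using e(5,6) by blast
  have "eqv p q p' q'" using rel_iff[OF p(1) q(1) p(3) q(3)] assms e p q by simp
  then show thesis using that[OF p(1) q(1) p(3) q(3)] e p q by simp
qed

lemma eqv_refl: "eqv p q p q"
  unfolding eqv_def using W1 kercl(1) by (intro bexI[of _ 1]) simp_all

lemma eqv_sym: "eqv p q p' q' \<Longrightarrow> eqv p' q' p q"
  unfolding eqv_def using kercl(5) by (metis minus_diff_eq mult_minus_right)

lemma eqv_trans:
  assumes "eqv p q p' q'" "eqv p' q' p'' q''" "q \<in> W" "q' \<in> W" "q'' \<in> W"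
  shows "eqv p q p'' q''"
proof -
  obtain u v where u: "u \<in> W" "u * (p * q' - p' * q) \<in> ker" and v: "v \<in> W" "v * (p' * q'' - p'' * q') \<in> ker"
    using assms unfolding eqv_def by blast
  \<comment> \<open>Cross-multiplication as usual: q' factors out and joins u and v in the
    multiplier.\<close>
  have "(v * q'') * (u * (p * q' - p' * q)) + (u * q) * (v * (p' * q'' - p'' * q')) \<in> ker"
    using u v assms W_T by (intro kercl(2) kercl(3)[OF Tcl(4)]) simp_all
  also have "(v * q'') * (u * (p * q' - p' * q)) + (u * q) * (v * (p' * q'' - p'' * q')) =
      (u * v * q') * (p * q'' - p'' * q)" by (simp add: algebra_simps)
  finally show ?thesis unfolding eqv_def using Wm u(1) v(1) assms(4) by blast
qed

lemma rel_equiv: "equiv (carrier S \<times> (carrier S - P)) (fraction_rel S P)"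
proof (rule equivI)
  show "fraction_rel S P \<subseteq> (carrier S \<times> (carrier S - P)) \<times> (carrier S \<times> (carrier S - P))"
    by (auto simp: fraction_rel_def)
  show "refl_on (carrier S \<times> (carrier S - P)) (fraction_rel S P)"
  proof (rule refl_onI)
    fix x assume "x \<in> carrier S \<times> (carrier S - P)"
    then obtain a b where ab: "x = (a, b)" "a \<in> carrier S" "b \<in> h ` W" unfolding WP_iff by (rule SigmaE)
    obtain p where p: "p \<in> T" "a = h p" using ab(2) by (rule h_onto)
    obtain q where q: "q \<in> W" "b = h q" using ab(3) by blast
    show "(x, x) \<in> fraction_rel S P" unfolding ab(1) p(2) q(2) rel_iff[OF p(1) q(1) p(1) q(1)] by (rule eqv_refl)
  qed
  show "sym (fraction_rel S P)"
  proof (rule symI)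
    fix x y assume "(x, y) \<in> fraction_rel S P"
    then obtain p q p' q' where e: "p \<in> T" "q \<in> W" "p' \<in> T" "q' \<in> W" "x = (h p, h q)" "y = (h p', h q')" "eqv p q p' q'"
      by (rule relE)
    show "(y, x) \<in> fraction_rel S P" unfolding e(5,6) rel_iff[OF e(3,4,1,2)] by (rule eqv_sym[OF e(7)])
  qed
  show "trans (fraction_rel S P)"
  proof (rule transI)
    fix x y z assume xy: "(x, y) \<in> fraction_rel S P" and yz: "(y, z) \<in> fraction_rel S P"
    obtain p q p' q' where 1: "p \<in> T" "q \<in> W" "p' \<in> T" "q' \<in> W" "x = (h p, h q)" "y = (h p', h q')" "eqv p q p' q'"
      using xy by (rule relE)
    obtain p2 q2 p3 q3 where 2: "p2 \<in> T" "q2 \<in> W" "p3 \<in> T" "q3 \<in> W" "y = (h p2, h q2)" "z = (h p3, h q3)" "eqv p2 q2 p3 q3"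
      using yz by (rule relE)
    have "((h p', h q'), (h p3, h q3)) \<in> fraction_rel S P" using yz 1 2 by simp
    then have "eqv p' q' p3 q3" using rel_iff[OF 1(3,4) 2(3,4)] by simp
    then have "eqv p q p3 q3" using eqv_trans[OF 1(7)] 1 2 by blast
    then show "(x, z) \<in> fraction_rel S P" using rel_iff[OF 1(1,2) 2(3,4)] 1 2 by simp
  qed
qed

lemma pair_mem: "p \<in> T \<Longrightarrow> q \<in> W \<Longrightarrow> (h p, h q) \<in> carrier S \<times> (carrier S - P)"
  unfolding WP_iff using h_closed by blast

lemma frac_eq_iff:
  assumes "p \<in> T" "q \<in> W" "p' \<in> T" "q' \<in> W"
  shows "frac p q = frac p' q' \<longleftrightarrow> eqv p q p' q'"
  unfolding frac_def using eq_equiv_class_iff[OF rel_equiv pair_mem pair_mem, OF assms] rel_iff[OF assms] by simp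

lemma frac_mem:
  assumes "z \<in> frac p q" "p \<in> T" "q \<in> W"
  obtains p' q' where "p' \<in> T" "q' \<in> W" "z = (h p', h q')" "eqv p q p' q'"
proof -
  have z: "((h p, h q), z) \<in> fraction_rel S P" using assms(1) by (simp add: frac_def)
  then obtain p0 q0 p' q' where e: "p' \<in> T" "q' \<in> W" "z = (h p', h q')" by (rule relE)
  then show thesis using that rel_iff[OF assms(2,3) e(1,2)] z by simp
qed

lemma frac_self: "p \<in> T \<Longrightarrow> q \<in> W \<Longrightarrow> (h p, h q) \<in> frac p q"
  unfolding frac_def using rel_iff eqv_refl by blast

lemma carrier_L: "carrier L = {frac p q | p q. p \<in> T \<and> q \<in> W}"
proof -
  have "carrier S \<times> (carrier S - P) = (\<lambda>(p, q). (h p, h q)) ` (T \<times> W)"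
    unfolding WP_iff by (auto simp: image[symmetric])
  then show ?thesis by (auto simp: localization_def quotient_def frac_def)
qed

lemma frac_closed: "p \<in> T \<Longrightarrow> q \<in> W \<Longrightarrow> frac p q \<in> carrier L"
  unfolding carrier_L by blast

lemma frac_onto:
  assumes "x \<in> carrier L" obtains p q where "p \<in> T" "q \<in> W" "x = frac p q"
  using assms unfolding carrier_L by blast

text \<open>Sums and products in \<open>localization\<close> are unions over representatives; this
  reduces them to independence of the choice.\<close>

lemma UN_pair_const:
  assumes "z \<in> A" "z' \<in> B" "\<And>a s b t. (a, s) \<in> A \<Longrightarrow> (b, t) \<in> B \<Longrightarrow> F a s b t = C"
  shows "(\<Union>(a, s)\<in>A. \<Union>(b, t)\<in>B. F a s b t) = C"
proof -
  have "(\<Union>(a, s)\<in>A. \<Union>(b, t)\<in>B. F a s b t) = (\<Union>x\<in>A. \<Union>y\<in>B. C)"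
    using assms(3) by (intro SUP_cong refl) auto
  also have "\<dots> = C" using assms(1,2) by auto
  finally show ?thesis .
qed

lemma frac_mult:
  assumes "p \<in> T" "q \<in> W" "p' \<in> T" "q' \<in> W"
  shows "frac p q \<otimes>\<^bsub>L\<^esub> frac p' q' = frac (p * p') (q * q')"
proof -
  have "(\<Union>(a, s)\<in>frac p q. \<Union>(b, t)\<in>frac p' q'. fraction_rel S P `` {(a \<otimes>\<^bsub>S\<^esub> b, s \<otimes>\<^bsub>S\<^esub> t)}) = frac (p * p') (q * q')"
  proof (rule UN_pair_const[OF frac_self[OF assms(1,2)] frac_self[OF assms(3,4)]])
    fix a s b t assume "(a, s) \<in> frac p q" "(b, t) \<in> frac p' q'"
    then obtain p1 q1 p2 q2 where 1: "p1 \<in> T" "q1 \<in> W" "(a, s) = (h p1, h q1)" "eqv p q p1 q1"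
      and 2: "p2 \<in> T" "q2 \<in> W" "(b, t) = (h p2, h q2)" "eqv p' q' p2 q2" by (metis frac_mem assms)
    obtain u v where u: "u \<in> W" "u * (p * q1 - p1 * q) \<in> ker" and v: "v \<in> W" "v * (p' * q2 - p2 * q') \<in> ker"
      using 1 2 unfolding eqv_def by blast
    have "(v * p' * q2) * (u * (p * q1 - p1 * q)) + (u * p1 * q) * (v * (p' * q2 - p2 * q')) \<in> ker"
      using u v 1 2 assms W_T by (intro kercl(2) kercl(3)[OF Tcl(4)] Tcl(4)) simp_all
    also have "(v * p' * q2) * (u * (p * q1 - p1 * q)) + (u * p1 * q) * (v * (p' * q2 - p2 * q')) =
        (u * v) * ((p * p') * (q1 * q2) - (p1 * p2) * (q * q'))" by (simp add: algebra_simps)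
    finally have "eqv (p * p') (q * q') (p1 * p2) (q1 * q2)" unfolding eqv_def using Wm u(1) v(1) by blast
    then have "frac (p1 * p2) (q1 * q2) = frac (p * p') (q * q')"
      using frac_eq_iff Tcl(4) Wm 1 2 assms by metis
    then show "fraction_rel S P `` {(a \<otimes>\<^bsub>S\<^esub> b, s \<otimes>\<^bsub>S\<^esub> t)} = frac (p * p') (q * q')"
      using 1 2 W_T by (simp add: frac_def h_mult)
  qed
  then show ?thesis by (simp add: localization_def)
qed

lemma frac_add:
  assumes "p \<in> T" "q \<in> W" "p' \<in> T" "q' \<in> W"
  shows "frac p q \<oplus>\<^bsub>L\<^esub> frac p' q' = frac (p * q' + p' * q) (q * q')"
proof -
  have "(\<Union>(a, s)\<in>frac p q. \<Union>(b, t)\<in>frac p' q'. fraction_rel S P `` {(a \<otimes>\<^bsub>S\<^esub> t \<oplus>\<^bsub>S\<^esub> b \<otimes>\<^bsub>S\<^esub> s, s \<otimes>\<^bsub>S\<^esub> t)}) =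
      frac (p * q' + p' * q) (q * q')"
  proof (rule UN_pair_const[OF frac_self[OF assms(1,2)] frac_self[OF assms(3,4)]])
    fix a s b t assume "(a, s) \<in> frac p q" "(b, t) \<in> frac p' q'"
    then obtain p1 q1 p2 q2 where 1: "p1 \<in> T" "q1 \<in> W" "(a, s) = (h p1, h q1)" "eqv p q p1 q1"
      and 2: "p2 \<in> T" "q2 \<in> W" "(b, t) = (h p2, h q2)" "eqv p' q' p2 q2" by (metis frac_mem assms)
    obtain u v where u: "u \<in> W" "u * (p * q1 - p1 * q) \<in> ker" and v: "v \<in> W" "v * (p' * q2 - p2 * q') \<in> ker"
      using 1 2 unfolding eqv_def by blast
    have "(v * q' * q2) * (u * (p * q1 - p1 * q)) + (u * q * q1) * (v * (p' * q2 - p2 * q')) \<in> ker"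
      using u v 1 2 assms W_T by (intro kercl(2) kercl(3)[OF Tcl(4)] Tcl(4)) simp_all
    also have "(v * q' * q2) * (u * (p * q1 - p1 * q)) + (u * q * q1) * (v * (p' * q2 - p2 * q')) =
        (u * v) * ((p * q' + p' * q) * (q1 * q2) - (p1 * q2 + p2 * q1) * (q * q'))" by (simp add: algebra_simps)
    finally have "eqv (p * q' + p' * q) (q * q') (p1 * q2 + p2 * q1) (q1 * q2)" unfolding eqv_def using Wm u(1) v(1) by blast
    moreover have "p * q' + p' * q \<in> T" "p1 * q2 + p2 * q1 \<in> T" using 1 2 assms W_T Tcl(3,4) by simp_all
    ultimately have "frac (p1 * q2 + p2 * q1) (q1 * q2) = frac (p * q' + p' * q) (q * q')"
      using frac_eq_iff Wm 1(2) 2(2) assms by metis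
    then show "fraction_rel S P `` {(a \<otimes>\<^bsub>S\<^esub> t \<oplus>\<^bsub>S\<^esub> b \<otimes>\<^bsub>S\<^esub> s, s \<otimes>\<^bsub>S\<^esub> t)} = frac (p * q' + p' * q) (q * q')"
      using 1 2 W_T Tcl(4) by (simp add: frac_def h_mult h_add)
  qed
  then show ?thesis by (simp add: localization_def)
qed

lemma L_zero: "\<zero>\<^bsub>L\<^esub> = frac 0 1" and L_one: "\<one>\<^bsub>L\<^esub> = frac 1 1"
  by (simp_all add: localization_def frac_def h_zero h_one)

lemma frac_cancel:
  assumes "p \<in> T" "q \<in> W" shows "frac (p * q) q = frac p 1" "frac p q \<otimes>\<^bsub>L\<^esub> frac q 1 = frac p 1"
proof -
  have "eqv (p * q) q p 1"
    unfolding eqv_def using W1 kercl(1) by (intro bexI[of _ 1]) simp_all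
  then show 1: "frac (p * q) q = frac p 1" using frac_eq_iff assms W_T Tcl(4) W1 by blast
  show "frac p q \<otimes>\<^bsub>L\<^esub> frac q 1 = frac p 1" using frac_mult[OF assms W_T[OF assms(2)] W1] 1 by simp
qed

lemma psi_add: "b \<in> T \<Longrightarrow> c \<in> T \<Longrightarrow> frac (b + c) 1 = frac b 1 \<oplus>\<^bsub>L\<^esub> frac c 1"
  and psi_mult: "b \<in> T \<Longrightarrow> c \<in> T \<Longrightarrow> frac (b * c) 1 = frac b 1 \<otimes>\<^bsub>L\<^esub> frac c 1"
  using frac_add[OF _ W1 _ W1] frac_mult[OF _ W1 _ W1] by simp_all

lemma psi_diff: "b \<in> T \<Longrightarrow> c \<in> T \<Longrightarrow> frac (b - c) 1 = frac b 1 \<ominus>\<^bsub>L\<^esub> frac c 1"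
proof -
  assume b: "b \<in> T" and c: "c \<in> T"
  have "frac (b - c) 1 \<oplus>\<^bsub>L\<^esub> frac c 1 = frac b 1" using psi_add[OF Tcl(6)[OF b c] c] by simp
  moreover have "frac (b - c) 1 \<in> carrier L" "frac c 1 \<in> carrier L"
    using frac_closed[OF Tcl(6)[OF b c] W1] frac_closed[OF c W1] by simp_all
  ultimately show "frac (b - c) 1 = frac b 1 \<ominus>\<^bsub>L\<^esub> frac c 1"
    by (simp add: a_minus_def L.a_assoc L.r_neg flip: \<open>frac (b - c) 1 \<oplus>\<^bsub>L\<^esub> frac c 1 = frac b 1\<close>)
qed

lemma psi_zero_iff: "b \<in> T \<Longrightarrow> frac b 1 = \<zero>\<^bsub>L\<^esub> \<longleftrightarrow> (\<exists>u\<in>W. u * b \<in> ker)"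
  using frac_eq_iff[of b 1 0 1] W1 Tcl(1) by (simp add: L_zero eqv_def)

text \<open>Contraction of an ideal of the localization along b to b/1.\<close>

definition lpull :: "('b \<times> 'b) set set \<Rightarrow> 'q set" where "lpull A = {b \<in> T. frac b 1 \<in> A}"

lemma lpull_ideal:
  assumes "ideal A L" shows "ideal_of T (lpull A)" "ker \<subseteq> lpull A"
proof -
  interpret A: ideal A L by fact
  show "ideal_of T (lpull A)"
    unfolding ideal_of_def
  proof (intro conjI ballI)
    show "lpull A \<subseteq> T" by (auto simp: lpull_def)
    show "0 \<in> lpull A" using A.zero_closed Tcl(1) by (simp add: lpull_def L_zero)
    show "a + b \<in> lpull A" if "a \<in> lpull A" "b \<in> lpull A" for a b
      using that A.a_closed Tcl(3) by (simp add: lpull_def psi_add)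
    show "c * a \<in> lpull A" if "c \<in> T" "a \<in> lpull A" for a c
      using that A.I_l_closed frac_closed[OF _ W1] Tcl(4) by (simp add: lpull_def psi_mult)
  qed
  show "ker \<subseteq> lpull A"
  proof
    fix b assume b: "b \<in> ker"
    then have "b \<in> T" using ideal_ofD(1)[OF ker_ideal] by blast
    moreover have "frac b 1 = \<zero>\<^bsub>L\<^esub>" using psi_zero_iff[OF \<open>b \<in> T\<close>] W1 b by (metis mult_1)
    ultimately show "b \<in> lpull A" using A.zero_closed by (simp add: lpull_def)
  qed
qed

text \<open>An entry p/q differs from p/1 by a unit, so the numerators may replace the entries; the
  denominators of their coefficients are absorbed by W. No \<open>a i\<close> lies in W, as
  otherwise the entry would be a unit inside the proper ideal \<nn>.\<close>

lemma regular_chain_of_localization: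
  assumes xs: "regular_sequence L xs" and r: "r \<le> length xs" and nn: "ideal \<nn> L" "\<nn> \<noteq> carrier L" "set xs \<subseteq> \<nn>"
  shows "\<exists>a. regular_chain T W ker r a (\<lambda>i. lpull (Idl\<^bsub>L\<^esub> (set (take i xs)))) \<and> (\<forall>i<r. a i \<notin> W)"
proof -
  have sub: "set (take i xs) \<subseteq> carrier L" for i
    using xs set_take_subset[of i xs] by (auto simp: regular_sequence_def)
  note id = L.genideal_ideal[OF sub]
  have xc: "xs ! i \<in> carrier L" "xs ! i \<in> \<nn>" if "i < r" for i
  proof -
    have "xs ! i \<in> set xs" using that r by simp
    moreover have "set xs \<subseteq> carrier L" using xs unfolding regular_sequence_def by blast
    ultimately show "xs ! i \<in> carrier L" "xs ! i \<in> \<nn>" using nn(3) by blast+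
  qed
  have "\<forall>i. \<exists>ps. i < r \<longrightarrow> fst ps \<in> T \<and> snd ps \<in> W \<and> xs ! i = frac (fst ps) (snd ps)"
  proof
    fix i
    show "\<exists>ps. i < r \<longrightarrow> fst ps \<in> T \<and> snd ps \<in> W \<and> xs ! i = frac (fst ps) (snd ps)"
    proof (cases "i < r")
      case True
      obtain p q where "p \<in> T" "q \<in> W" "xs ! i = frac p q" using frac_onto[OF xc(1)[OF True]] by blast
      then show ?thesis by (intro exI[of _ "(p, q)"]) simp
    qed simp
  qed
  from choice[OF this]
  obtain ps where ps: "\<forall>i. i < r \<longrightarrow> fst (ps i) \<in> T \<and> snd (ps i) \<in> W \<and> xs ! i = frac (fst (ps i)) (snd (ps i))" ..
  define a s where "a i = fst (ps i)" and "s i = snd (ps i)" for i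
  have a: "a i \<in> T" and s: "s i \<in> W" "s i \<in> T" and xi: "xs ! i = frac (a i) (s i)" if "i < r" for i
    using ps that W_T by (simp_all add: a_def s_def)
  have psi_a: "frac (a i) 1 = xs ! i \<otimes>\<^bsub>L\<^esub> frac (s i) 1" if "i < r" for i
    using frac_cancel(2)[OF a[OF that] s(1)[OF that]] xi[OF that] by simp
  have xs_a: "xs ! i = frac (a i) 1 \<otimes>\<^bsub>L\<^esub> frac 1 (s i)" if "i < r" for i
    using frac_mult[OF a[OF that] W1 Tcl(2) s(1)[OF that]] xi[OF that] by simp
  have "lpull (Idl\<^bsub>L\<^esub> (set (take i xs))) \<subseteq> lpull (Idl\<^bsub>L\<^esub> (set (take (Suc i) xs)))" for i
  proof -
    have "set (take i xs) \<subseteq> Idl\<^bsub>L\<^esub> (set (take (Suc i) xs))"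
      using L.genideal_self[OF sub] set_take_subset_set_take[of i "Suc i" xs] by fastforce
    then have "Idl\<^bsub>L\<^esub> (set (take i xs)) \<subseteq> Idl\<^bsub>L\<^esub> (set (take (Suc i) xs))" by (rule L.genideal_minimal[OF id])
    then show ?thesis by (auto simp: lpull_def)
  qed
  moreover have "\<exists>u\<in>W. u * b \<in> ker" if "b \<in> lpull (Idl\<^bsub>L\<^esub> (set (take 0 xs)))" for b
  proof -
    have "Idl\<^bsub>L\<^esub> {} \<subseteq> {\<zero>\<^bsub>L\<^esub>}" using L.zeroideal by (intro L.genideal_minimal) simp_all
    then show ?thesis using that psi_zero_iff by (auto simp: lpull_def)
  qed
  moreover have "a i \<in> lpull (Idl\<^bsub>L\<^esub> (set (take (Suc i) xs)))" if i: "i < r" for i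
  proof -
    have "xs ! i \<in> Idl\<^bsub>L\<^esub> (set (take (Suc i) xs))"
      using L.genideal_self[OF sub, of "Suc i"] set_take_Suc[of i xs] i r by auto
    then have "xs ! i \<otimes>\<^bsub>L\<^esub> frac (s i) 1 \<in> Idl\<^bsub>L\<^esub> (set (take (Suc i) xs))"
      using frac_closed[OF s(2)[OF i] W1] by (intro ideal.I_r_closed[OF id])
    then show ?thesis using a[OF i] psi_a[OF i] by (simp add: lpull_def)
  qed
  moreover have "b \<in> lpull (Idl\<^bsub>L\<^esub> (set (take i xs)))"
    if i: "i < r" and b: "b \<in> T" and ab: "a i * b \<in> lpull (Idl\<^bsub>L\<^esub> (set (take i xs)))" for i b
  proof -
    have bL: "frac b 1 \<in> carrier L" and 1: "frac 1 (s i) \<in> carrier L" and aL: "frac (a i) 1 \<in> carrier L"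
      using frac_closed W1 b s[OF i] Tcl(2) a[OF i] by blast+
    have "frac 1 (s i) \<otimes>\<^bsub>L\<^esub> frac (a i * b) 1 \<in> Idl\<^bsub>L\<^esub> (set (take i xs))"
      using ab 1 by (intro ideal.I_l_closed[OF id]) (simp_all add: lpull_def)
    also have "frac 1 (s i) \<otimes>\<^bsub>L\<^esub> frac (a i * b) 1 = xs ! i \<otimes>\<^bsub>L\<^esub> frac b 1"
      using psi_mult[OF a[OF i] b] xs_a[OF i] bL 1 aL by (simp add: L.m_ac)
    finally show ?thesis using xs i r bL b unfolding regular_sequence_def lpull_def by auto
  qed
  moreover have "\<exists>u\<in>W. \<exists>f\<in>T. u * b - a i * f \<in> lpull (Idl\<^bsub>L\<^esub> (set (take i xs)))"
    if i: "i < r" and b: "b \<in> lpull (Idl\<^bsub>L\<^esub> (set (take (Suc i) xs)))" for i b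
  proof -
    have bT: "b \<in> T" and pb: "frac b 1 \<in> Idl\<^bsub>L\<^esub> (set (take (Suc i) xs))" using b by (simp_all add: lpull_def)
    have "\<exists>w\<in>carrier L. frac b 1 \<ominus>\<^bsub>L\<^esub> xs ! i \<otimes>\<^bsub>L\<^esub> w \<in> Idl\<^bsub>L\<^esub> (set (take i xs))"
      using L.mem_Idl_insert[OF sub xc(1)[OF i]] pb i r by (simp add: set_take_Suc)
    then obtain w where w: "w \<in> carrier L" "frac b 1 \<ominus>\<^bsub>L\<^esub> xs ! i \<otimes>\<^bsub>L\<^esub> w \<in> Idl\<^bsub>L\<^esub> (set (take i xs))" by blast
    obtain f v where f: "f \<in> T" "v \<in> W" "w = frac f v" using frac_onto[OF w(1)] by blast
    define u where "u = s i * v"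
    have u: "u \<in> W" "u \<in> T" using Wm s(1)[OF i] f(2) W_T by (auto simp: u_def)
    have afT: "a i * f \<in> T" using a[OF i] f(1) by (rule Tcl(4))
    have "xs ! i \<otimes>\<^bsub>L\<^esub> w = frac (a i * f) u"
      using frac_mult[OF a[OF i] s(1)[OF i] f(1,2)] xi[OF i] f(3) by (simp add: u_def)
    then have "(xs ! i \<otimes>\<^bsub>L\<^esub> w) \<otimes>\<^bsub>L\<^esub> frac u 1 = frac (a i * f) 1" using frac_cancel(2)[OF afT u(1)] by simp
    moreover have cl: "frac b 1 \<in> carrier L" "xs ! i \<otimes>\<^bsub>L\<^esub> w \<in> carrier L" "frac u 1 \<in> carrier L"
      using frac_closed[OF bT W1] frac_closed[OF u(2) W1] w(1) xc(1)[OF i] by auto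
    moreover have "(frac b 1 \<ominus>\<^bsub>L\<^esub> xs ! i \<otimes>\<^bsub>L\<^esub> w) \<otimes>\<^bsub>L\<^esub> frac u 1 \<in> Idl\<^bsub>L\<^esub> (set (take i xs))"
      using w(2) cl(3) by (rule ideal.I_r_closed[OF id])
    ultimately have "frac u 1 \<otimes>\<^bsub>L\<^esub> frac b 1 \<ominus>\<^bsub>L\<^esub> frac (a i * f) 1 \<in> Idl\<^bsub>L\<^esub> (set (take i xs))"
      by (simp add: a_minus_def L.l_distr L.l_minus L.m_comm[of "frac b 1" "frac u 1"])
    then have "frac (u * b - a i * f) 1 \<in> Idl\<^bsub>L\<^esub> (set (take i xs))"
      using psi_diff[OF Tcl(4)[OF u(2) bT] afT] psi_mult[OF u(2) bT] by simp
    then have "u * b - a i * f \<in> lpull (Idl\<^bsub>L\<^esub> (set (take i xs)))"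
      using Tcl(6)[OF Tcl(4)[OF u(2) bT] afT] by (simp add: lpull_def)
    then show ?thesis using u(1) f(1) by blast
  qed
  moreover have "a i \<notin> W" if i: "i < r" for i
  proof
    assume aW: "a i \<in> W"
    interpret \<nn>: ideal \<nn> L by (rule nn(1))
    have "frac (s i) (a i) \<in> carrier L" by (rule frac_closed[OF s(2)[OF i] aW])
    then have "xs ! i \<otimes>\<^bsub>L\<^esub> frac (s i) (a i) \<in> \<nn>" by (rule \<nn>.I_r_closed[OF xc(2)[OF i]])
    also have "xs ! i \<otimes>\<^bsub>L\<^esub> frac (s i) (a i) = frac (a i * s i) (s i * a i)"
      using frac_mult[OF a[OF i] s(1)[OF i] s(2)[OF i] aW] xi[OF i] by simp
    also have "\<dots> = \<one>\<^bsub>L\<^esub>"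
      using frac_cancel(1)[of 1 "s i * a i"] Wm[OF s(1)[OF i] aW] Tcl(2) by (simp add: L_one mult.commute)
    finally show False using \<nn>.one_imp_carrier nn(2) by blast
  qed
  ultimately have "regular_chain T W ker r a (\<lambda>i. lpull (Idl\<^bsub>L\<^esub> (set (take i xs)))) \<and> (\<forall>i<r. a i \<notin> W)"
    unfolding regular_chain_def using lpull_ideal[OF id] a by auto
  then show ?thesis by blast
qed

text \<open>Extension of an ideal of T to the localization. For a prime disjoint from W,
  \<open>frac_in_lprime\<close> recovers it, which keeps chains strict.\<close>

definition lprime :: "'q set \<Rightarrow> ('b \<times> 'b) set set" where
  "lprime Q = {frac p q | p q. p \<in> Q \<and> q \<in> W}"

lemma frac_in_lprime:
  assumes Q: "ideal_of T Q" "ker \<subseteq> Q" "Q \<inter> W = {}" "\<forall>p\<in>T. \<forall>q\<in>T. p * q \<in> Q \<longrightarrow> p \<in> Q \<or> q \<in> Q"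
    and pq: "p \<in> T" "q \<in> W"
  shows "frac p q \<in> lprime Q \<longleftrightarrow> p \<in> Q"
proof
  assume "frac p q \<in> lprime Q"
  then obtain p' q' where e: "frac p q = frac p' q'" "p' \<in> Q" "q' \<in> W" unfolding lprime_def by blast
  have p'T: "p' \<in> T" using e(2) ideal_ofD(1)[OF Q(1)] by blast
  have "eqv p q p' q'" using frac_eq_iff[OF pq p'T e(3)] e(1) by simp
  then obtain u where u: "u \<in> W" "u * (p * q' - p' * q) \<in> ker" unfolding eqv_def by blast
  have "u * (p * q' - p' * q) + (u * q) * p' \<in> Q"
    using u Q(2) W_T pq(2) by (intro ideal_ofD(3)[OF Q(1)] ideal_ofD(4)[OF Q(1) Tcl(4) e(2)]) auto
  then have "(u * q') * p \<in> Q" by (simp add: algebra_simps)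
  moreover have "u * q' \<in> W" by (rule Wm[OF u(1) e(3)])
  ultimately show "p \<in> Q" using Q(3,4) W_T pq(1) by blast
next
  show "p \<in> Q \<Longrightarrow> frac p q \<in> lprime Q" using pq(2) unfolding lprime_def by blast
qed

lemma lprime_prime:
  assumes Q: "ideal_of T Q" "ker \<subseteq> Q" "Q \<inter> W = {}" "\<forall>p\<in>T. \<forall>q\<in>T. p * q \<in> Q \<longrightarrow> p \<in> Q \<or> q \<in> Q"
  shows "primeideal (lprime Q) L"
proof (rule primeidealI)
  note iff = frac_in_lprime[OF Q]
  have QT: "p \<in> Q \<Longrightarrow> p \<in> T" for p using ideal_ofD(1)[OF Q(1)] by blast
  show "ideal (lprime Q) L"
  proof (rule L.cring_idealI)
    show "lprime Q \<subseteq> carrier L" unfolding lprime_def using QT frac_closed by blast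
    show "\<zero>\<^bsub>L\<^esub> \<in> lprime Q" using iff[OF Tcl(1) W1] ideal_ofD(2)[OF Q(1)] by (simp add: L_zero)
    fix a b assume "a \<in> lprime Q" "b \<in> lprime Q"
    then obtain p q p' q' where e: "a = frac p q" "p \<in> Q" "q \<in> W" "b = frac p' q'" "p' \<in> Q" "q' \<in> W" unfolding lprime_def by blast
    have "p * q' + p' * q \<in> Q" using e W_T by (intro ideal_ofD(3)[OF Q(1)] ideal_ofD(5)[OF Q(1)]) auto
    then show "a \<oplus>\<^bsub>L\<^esub> b \<in> lprime Q"
      using frac_add[OF QT[OF e(2)] e(3) QT[OF e(5)] e(6)] Wm[OF e(3,6)] e(1,4) unfolding lprime_def by auto
  next
    fix a x assume "a \<in> lprime Q" "x \<in> carrier L"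
    then obtain p q p' q' where e: "a = frac p q" "p \<in> Q" "q \<in> W" "x = frac p' q'" "p' \<in> T" "q' \<in> W"
      unfolding lprime_def carrier_L by blast
    have "p' * p \<in> Q" by (rule ideal_ofD(4)[OF Q(1) e(5,2)])
    then show "x \<otimes>\<^bsub>L\<^esub> a \<in> lprime Q"
      using frac_mult[OF e(5,6) QT[OF e(2)] e(3)] Wm[OF e(6,3)] e(1,4) unfolding lprime_def by auto
  qed
  show "cring L" by (rule L_cring)
  have "\<one>\<^bsub>L\<^esub> \<notin> lprime Q" using iff[OF Tcl(2) W1] Q(3) W1 by (auto simp: L_one)
  then show "carrier L \<noteq> lprime Q" using L.one_closed by blast
  fix a b assume "a \<in> carrier L" "b \<in> carrier L" and ab: "a \<otimes>\<^bsub>L\<^esub> b \<in> lprime Q"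
  then obtain p q p' q' where e: "a = frac p q" "p \<in> T" "q \<in> W" "b = frac p' q'" "p' \<in> T" "q' \<in> W" unfolding carrier_L by blast
  have "p * p' \<in> Q"
    using ab frac_mult[OF e(2,3,5,6)] e(1,4) iff[OF Tcl(4)[OF e(2,5)] Wm[OF e(3,6)]] by simp
  then have "p \<in> Q \<or> p' \<in> Q" using Q(4) e(2,5) by blast
  then show "a \<in> lprime Q \<or> b \<in> lprime Q" using iff[OF e(2,3)] iff[OF e(5,6)] e(1,4) by blast
qed

end

section \<open>Fiber cones\<close>

text \<open>The ascending chain condition in the form that supports induction towards larger
  ideals.\<close>

lemma (in noetherian_ring) ideals_wf: "wf {(B, A). ideal A R \<and> ideal B R \<and> A \<subset> B}"
  unfolding wf_iff_no_infinite_down_chain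
proof
  assume "\<exists>f. \<forall>i. (f (Suc i), f i) \<in> {(B, A). ideal A R \<and> ideal B R \<and> A \<subset> B}"
  then obtain f where "\<forall>i. (f (Suc i), f i) \<in> {(B, A). ideal A R \<and> ideal B R \<and> A \<subset> B}" ..
  then have f: "ideal (f i) R" "f i \<subset> f (Suc i)" for i by simp_all
  have mono: "i \<le> j \<Longrightarrow> f i \<subseteq> f j" for i j using lift_Suc_mono_le[of f] f(2) by blast
  have "subset.chain {I. ideal I R} (range f)"
    unfolding subset_chain_def
  proof (intro conjI ballI)
    fix x y assume "x \<in> range f" "y \<in> range f"
    then obtain i j where "x = f i" "y = f j" by blast
    then show "x \<subseteq> y \<or> y \<subseteq> x" using mono[of i j] mono[of j i] linear[of i j] by blast
  qed (use f(1) in auto)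
  then have "\<Union>(range f) \<in> range f" by (intro ideal_chain_is_trivial) simp_all
  then obtain i where "\<Union>(range f) = f i" by blast
  then show False using f(2)[of i] by blast
qed

text \<open>By Noetherian induction: a proper ideal that is not maximal has a larger proper
  one.\<close>

lemma (in noetherian_ring) proper_ideal_in_maximal:
  assumes "ideal A R" "A \<noteq> carrier R"
  shows "\<exists>M. maximalideal M R \<and> A \<subseteq> M"
  using assms
proof (induction A rule: wf_induct_rule[OF ideals_wf])
  case (1 A)
  show ?case
  proof (cases "maximalideal A R")
    case False
    then obtain B where B: "ideal B R" "A \<subseteq> B" "B \<noteq> A" "B \<noteq> carrier R"
      using maximalidealI[OF 1(2)] 1(3) by metis
    then have "\<exists>M. maximalideal M R \<and> B \<subseteq> M" using 1(1)[of B] 1(2) by blast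
    then show ?thesis using B(2) by blast
  qed blast
qed

section \<open>The local ring, its good filtration and finite generation\<close>

locale fiber_setting = presentation UNIV R \<pi>
  for R :: "('a, 'b) ring_scheme" (structure) and \<pi> :: "'p::comm_ring_1 \<Rightarrow> 'a" +
  fixes \<mm> :: "'a set" and I :: "nat \<Rightarrow> 'a set"
  assumes noeth: "noetherian_ring R" and maximal: "maximalideal M R \<longleftrightarrow> M = \<mm>"
    and inf: "infinite (carrier (R Quot \<mm>))" and good: "good_filtration R I"
    and noethF: "noetherian_ring (fiber_cone R \<mm> I)"
begin

lemma mm: "maximalideal \<mm> R" using maximal by simp

lemma mm_ideal: "ideal \<mm> R" by (rule maximalideal.axioms(1)[OF mm])

lemma filt: "ideal (I n) R" "I 0 = carrier R" "I (Suc n) \<subseteq> I n" "I i \<cdot> I j \<subseteq> I (i + j)"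
  using good unfolding good_filtration_def filtration_def by blast+

lemma II_mult: "a \<in> I i \<Longrightarrow> b \<in> I j \<Longrightarrow> a \<otimes> b \<in> I (i + j)"
  using filt(4)[of i j] ideal_prod.prod[of a "I i" b "I j" R] by blast

lemma I_car: "a \<in> I n \<Longrightarrow> a \<in> carrier R"
  by (rule ideal.Icarr[OF filt(1)])

lemma mI_ideal: "ideal (\<mm> \<cdot> I n) R" by (rule ideal_prod_is_ideal[OF mm_ideal filt(1)])

text \<open>A is moved to R, where the inclusion is checked along the construction of the ideal
  product; A is recovered from its image because it contains the kernel.\<close>

lemma pull_mI_le:
  assumes A: "ideal_of UNIV A" "pull {\<zero>} \<subseteq> A" and "\<And>u b. u \<in> pull \<mm> \<Longrightarrow> b \<in> pull (I n) \<Longrightarrow> u * b \<in> A"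
  shows "pull (\<mm> \<cdot> I n) \<subseteq> A"
proof -
  have im: "ideal (\<pi> ` A) R" by (rule image_ideal[OF A(1)])
  have "x \<in> \<pi> ` A" if "x \<in> \<mm> \<cdot> I n" for x
    using that
  proof (induction x rule: ideal_prod.induct)
    case (prod i j)
    obtain u b where ub: "i = \<pi> u" "j = \<pi> b" using h_onto ideal.Icarr[OF mm_ideal prod(1)] I_car[OF prod(2)] by metis
    then have "u * b \<in> A" using prod by (intro assms(3)) (simp_all add: pull_def)
    then have "\<pi> (u * b) \<in> \<pi> ` A" by (rule imageI)
    then show ?case by (simp add: h_mult ub)
  next
    case (sum s1 s2)
    show ?case by (rule additive_subgroup.a_closed[OF ideal.axioms(1)[OF im] sum.IH])
  qed
  then have "pull (\<mm> \<cdot> I n) \<subseteq> pull (\<pi> ` A)" unfolding pull_def by blast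
  then show ?thesis using pull_image[OF A] by blast
qed

sublocale F: graded_presentation R \<pi> I "\<lambda>n. \<mm> \<cdot> I n"
proof (intro graded_presentation.intro graded_presentation_axioms.intro)
  show "presentation UNIV R \<pi>" by (rule presentation_axioms)
  show "ideal (I n) R" "ideal (\<mm> \<cdot> I n) R" for n by (rule filt(1), rule mI_ideal)
  show "\<mm> \<cdot> I n \<subseteq> I n" for n using ideal_prod_inter[OF mm_ideal filt(1)] by blast
  show "I 0 = carrier R" by (rule filt(2))
  show "a \<otimes> b \<in> I (i + j)" if "a \<in> I i" "b \<in> I j" for a b i j by (rule II_mult[OF that])
  show "a \<otimes> b \<in> \<mm> \<cdot> I (i + j)" if a: "a \<in> I i" and b: "b \<in> \<mm> \<cdot> I j" for a b i j
    using b
  proof (induction b rule: ideal_prod.induct)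
    case (prod u v)
    have "a \<otimes> (u \<otimes> v) = u \<otimes> (a \<otimes> v)"
      using I_car[OF a] I_car[OF prod(2)] ideal.Icarr[OF mm_ideal prod(1)] by (simp add: m_lcomm)
    then show ?case using ideal_prod.prod[OF prod(1) II_mult[OF a prod(2)]] by simp
  next
    case (sum s1 s2)
    have "s1 \<in> carrier R" "s2 \<in> carrier R" using sum.hyps ideal.Icarr[OF mI_ideal] by blast+
    then have "a \<otimes> (s1 \<oplus> s2) = a \<otimes> s1 \<oplus> a \<otimes> s2" using I_car[OF a] by (simp add: r_distr)
    then show ?case using ideal_prod.sum[OF sum.IH] by simp
  qed
qed

sublocale gr: graded_presentation R \<pi> I "\<lambda>n. I (Suc n)"
proof (intro graded_presentation.intro graded_presentation_axioms.intro)
  show "presentation UNIV R \<pi>" by (rule presentation_axioms)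
  show "a \<otimes> b \<in> I (Suc (i + j))" if "a \<in> I i" "b \<in> I (Suc j)" for a b i j using II_mult[OF that] by simp
qed (use filt II_mult in auto)

abbreviation "m \<equiv> pull \<mm>"
abbreviation "Z \<equiv> pull {\<zero>}"

lemma Z_ideal: "ideal_of UNIV Z" by (rule pull_ideal[OF zeroideal])

lemma unit_mod:
  assumes "u \<notin> m" shows "\<exists>v. v * u - 1 \<in> Z"
proof -
  have uc: "\<pi> u \<in> carrier R" and u: "\<pi> u \<notin> \<mm>" using assms h_closed by (simp_all add: pull_def)
  have "PIdl (\<pi> u) = carrier R"
  proof (rule ccontr)
    assume "PIdl (\<pi> u) \<noteq> carrier R"
    then have "\<exists>M. maximalideal M R \<and> PIdl (\<pi> u) \<subseteq> M"
      by (rule noetherian_ring.proper_ideal_in_maximal[OF noeth cgenideal_ideal[OF uc]])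
    then have "PIdl (\<pi> u) \<subseteq> \<mm>" by (auto simp: maximal)
    then show False using u cgenideal_self[OF uc] by blast
  qed
  then have "\<one> \<in> PIdl (\<pi> u)" by simp
  then obtain w where w: "w \<in> carrier R" "w \<otimes> \<pi> u = \<one>" by (auto simp: cgenideal_def)
  obtain v where "w = \<pi> v" using w(1) by (rule h_onto)
  then have "\<pi> (v * u - 1) = \<zero>" using w by (simp add: h_diff h_mult h_one a_minus_def r_neg)
  then show ?thesis by (auto simp: pull_def)
qed

lemma maximal_m: "maximal_set m"
  unfolding maximal_set_def
proof (intro conjI allI impI)
  show "ideal_of UNIV m" by (rule pull_ideal[OF mm_ideal])
  show "1 \<notin> m" using maximalideal.I_notcarr[OF mm] ideal.one_imp_carrier[OF mm_ideal] by (auto simp: pull_def h_one)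
  fix u assume "u \<notin> m"
  from unit_mod[OF this] obtain v where "v * u - 1 \<in> Z" ..
  then show "\<exists>v. v * u - 1 \<in> m" using subsetD[OF ker_le_pull[OF mm_ideal]] by (intro exI[of _ v])
qed

text \<open>Makes the sums in \<open>finite_over\<close> available inside the Rees algebra, so that
  their coefficients can be computed by induction.\<close>

lemma rees_monoid: "abelian_monoid (rees_algebra R I)"
proof -
  interpret U: UP_cring R "UP R" by unfold_locales
  show ?thesis
    unfolding rees_algebra_def
    by (rule abelian_monoidI)
      (auto simp: U.P.a_ac additive_subgroup.a_closed[OF ideal.axioms(1)[OF filt(1)]]
        additive_subgroup.zero_closed[OF ideal.axioms(1)[OF filt(1)]])
qed

lemma I1_pow_le: "I 1 [^]\<^bsub>ideals_set R\<^esub> (n::nat) \<subseteq> I n"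
proof (induction n)
  case 0
  show ?case by (simp add: nat_pow_def ideals_set_def filt(2))
next
  case (Suc n)
  have "x \<in> I (Suc n)" if "x \<in> (I 1 [^]\<^bsub>ideals_set R\<^esub> n) \<cdot> I 1" for x
    using that
  proof (induction x rule: ideal_prod.induct)
    case (prod i j)
    then show ?case using Suc II_mult[of i n j 1] by auto
  next
    case (sum s1 s2)
    show ?case by (rule additive_subgroup.a_closed[OF ideal.axioms(1)[OF filt(1)] sum.IH])
  qed
  then show ?case by (auto simp: nat_pow_def ideals_set_def)
qed

text \<open>N0 bounds the degrees of the finitely many module generators. In degree n + 1 > N0, a
  product of c with a generator involves only coefficients of c in degrees i >= 1, which lie in
  I_1^i; one factor from I_1 splits off and the rest lies in I_n.\<close>

lemma good_generation:
  "\<exists>N0. \<forall>n\<ge>N0. \<forall>A. ideal A R \<longrightarrow> (\<forall>u\<in>I 1. \<forall>v\<in>I n. u \<otimes> v \<in> A) \<longrightarrow> I (Suc n) \<subseteq> A"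
proof -
  interpret U: UP_cring R "UP R" by unfold_locales
  let ?S = "rees_algebra R I" and ?C = "\<lambda>p. UnivPoly.coeff (UP R) p"
  interpret S: abelian_monoid ?S by (rule rees_monoid)
  obtain G where G: "G \<subseteq> carrier ?S" "finite G"
    "carrier ?S = {\<Oplus>\<^bsub>?S\<^esub>g\<in>G. c g \<otimes>\<^bsub>?S\<^esub> g | c. c \<in> G \<rightarrow> carrier (rees_algebra R (\<lambda>n. I 1 [^]\<^bsub>ideals_set R\<^esub> n))}"
    using good unfolding good_filtration_def finite_over_def by blast
  have carS: "carrier ?S = {p \<in> carrier (UP R). \<forall>n. ?C p n \<in> I n}" by (simp add: rees_algebra_def)
  obtain N0 where N0: "\<forall>g\<in>G. deg R g \<le> N0" using finite_nat_set_iff_bounded_le[of "deg R ` G"] G(2) by auto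
  have "I (Suc n) \<subseteq> A"
    if n: "n \<ge> N0" and A: "ideal A R" and uv: "\<forall>u\<in>I 1. \<forall>v\<in>I n. u \<otimes> v \<in> A" for n A
  proof
    interpret A: ideal A R by (rule A)
    have pw: "a \<otimes> b \<in> A" if "a \<in> I 1 [^]\<^bsub>ideals_set R\<^esub> (Suc i)" "b \<in> I j" "i + j = n" for a b i j
    proof -
      have "a \<in> (I 1 [^]\<^bsub>ideals_set R\<^esub> i) \<cdot> I 1" using that(1) by (simp add: nat_pow_def ideals_set_def)
      then show ?thesis
      proof (induction a rule: ideal_prod.induct)
        case (prod w u)
        have w: "w \<in> I i" using prod(1) I1_pow_le by blast
        have "w \<otimes> b \<in> I n" using II_mult[OF w that(2)] that(3) by simp
        then have "u \<otimes> (w \<otimes> b) \<in> A" using uv prod(2) by blast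
        moreover have "(w \<otimes> u) \<otimes> b = u \<otimes> (w \<otimes> b)" using I_car[OF w] I_car[OF prod(2)] I_car[OF that(2)] by (simp add: m_ac)
        ultimately show ?case by simp
      next
        case (sum s1 s2)
        have "(I 1 [^]\<^bsub>ideals_set R\<^esub> i) \<cdot> I 1 \<subseteq> carrier R"
          using I1_pow_le[of "Suc i"] I_car by (auto simp: nat_pow_def ideals_set_def)
        then have "s1 \<in> carrier R" "s2 \<in> carrier R" using sum.hyps by blast+
        then show ?case using A.a_closed[OF sum.IH] I_car[OF that(2)] by (simp add: l_distr)
      qed
    qed
    fix a assume a: "a \<in> I (Suc n)"
    let ?p = "UnivPoly.monom (UP R) a (Suc n)"
    have ac: "a \<in> carrier R" by (rule I_car[OF a])
    have "?p \<in> carrier ?S"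
      using ac a additive_subgroup.zero_closed[OF ideal.axioms(1)[OF filt(1)]] by (simp add: carS)
    then obtain c where c: "c \<in> G \<rightarrow> carrier (rees_algebra R (\<lambda>n. I 1 [^]\<^bsub>ideals_set R\<^esub> n))"
      and p: "?p = (\<Oplus>\<^bsub>?S\<^esub>g\<in>G. c g \<otimes>\<^bsub>?S\<^esub> g)" using G(3) by blast
    have prodA: "c g \<otimes>\<^bsub>?S\<^esub> g \<in> carrier ?S \<and> ?C (c g \<otimes>\<^bsub>?S\<^esub> g) (Suc n) \<in> A" if g: "g \<in> G" for g
    proof -
      have cg: "c g \<in> carrier (UP R)" "\<And>k. ?C (c g) k \<in> I 1 [^]\<^bsub>ideals_set R\<^esub> k"
        using c g by (auto simp: rees_algebra_def Pi_iff)
      have gg: "g \<in> carrier (UP R)" "\<And>k. ?C g k \<in> I k" using G(1) g carS by auto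
      have prod: "c g \<otimes>\<^bsub>?S\<^esub> g = c g \<otimes>\<^bsub>UP R\<^esub> g" by (simp add: rees_algebra_def)
      have cI: "?C (c g) i \<in> I i" for i using cg(2) I1_pow_le by blast
      have fs: "(\<Oplus>i\<in>B. f i) \<in> D" if "ideal D R" "finite B" "\<And>i. i \<in> B \<Longrightarrow> f i \<in> D" for D B f
        using that(2,3)
      proof (induction B rule: finite_induct)
        case empty
        then show ?case by (simp add: additive_subgroup.zero_closed[OF ideal.axioms(1)[OF that(1)]])
      next
        case (insert b B)
        then have "f \<in> insert b B \<rightarrow> carrier R" using ideal.Icarr[OF that(1)] by blast
        then show ?case using insert additive_subgroup.a_closed[OF ideal.axioms(1)[OF that(1)]]
          by (subst finsum_insert) auto
      qed
      have "(\<Oplus>i\<in>{..k}. ?C (c g) i \<otimes> ?C g (k - i)) \<in> I k" for k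
      proof (rule fs[OF filt(1)])
        show "?C (c g) i \<otimes> ?C g (k - i) \<in> I k" if "i \<in> {..k}" for i
          using II_mult[OF cI[of i] gg(2)[of "k - i"]] that by simp
      qed simp
      then have "c g \<otimes>\<^bsub>?S\<^esub> g \<in> carrier ?S" using cg(1) gg(1) by (simp add: carS prod)
      moreover have "(\<Oplus>i\<in>{..Suc n}. ?C (c g) i \<otimes> ?C g (Suc n - i)) \<in> A"
      proof (rule fs[OF A])
        fix i assume i: "i \<in> {..Suc n}"
        show "?C (c g) i \<otimes> ?C g (Suc n - i) \<in> A"
        proof (cases i)
          case 0
          \<comment> \<open>The coefficient of c in degree 0 would meet g in degree n + 1, above all
            generators.\<close>
          have "deg R g < Suc n" using N0 g n by fastforce
          then have "?C g (Suc n) = \<zero>" using gg(1) by (rule U.deg_aboveD)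
          then show ?thesis using 0 I_car[OF cI[of 0]] A.zero_closed by simp
        next
          case (Suc k)
          then show ?thesis using pw[OF cg(2)[of "Suc k", unfolded Suc] gg(2)[of "n - k"]] i by simp
        qed
      qed simp
      ultimately show ?thesis using cg(1) gg(1) by (simp add: prod)
    qed
    have "(\<Oplus>\<^bsub>?S\<^esub>g\<in>B. c g \<otimes>\<^bsub>?S\<^esub> g) \<in> carrier ?S \<and> ?C (\<Oplus>\<^bsub>?S\<^esub>g\<in>B. c g \<otimes>\<^bsub>?S\<^esub> g) (Suc n) \<in> A"
      if "finite B" "B \<subseteq> G" for B
      using that
    proof (induction B rule: finite_induct)
      case empty
      have "\<zero>\<^bsub>?S\<^esub> = \<zero>\<^bsub>UP R\<^esub>" by (simp add: rees_algebra_def)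
      then show ?case using S.zero_closed A.zero_closed by simp
    next
      case (insert g B)
      let ?s = "\<Oplus>\<^bsub>?S\<^esub>g\<in>B. c g \<otimes>\<^bsub>?S\<^esub> g"
      have g: "c g \<otimes>\<^bsub>?S\<^esub> g \<in> carrier ?S" "?C (c g \<otimes>\<^bsub>?S\<^esub> g) (Suc n) \<in> A" using prodA insert.prems by auto
      have s: "?s \<in> carrier ?S" "?C ?s (Suc n) \<in> A" using insert by auto
      have "(\<lambda>g. c g \<otimes>\<^bsub>?S\<^esub> g) \<in> B \<rightarrow> carrier ?S" using prodA insert.prems by auto
      then have "(\<Oplus>\<^bsub>?S\<^esub>g\<in>insert g B. c g \<otimes>\<^bsub>?S\<^esub> g) = c g \<otimes>\<^bsub>?S\<^esub> g \<oplus>\<^bsub>?S\<^esub> ?s"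
        using insert.hyps g(1) by (intro S.finsum_insert)
      moreover have "c g \<otimes>\<^bsub>?S\<^esub> g \<oplus>\<^bsub>?S\<^esub> ?s \<in> carrier ?S" using g(1) s(1) by (rule S.a_closed)
      moreover have "c g \<otimes>\<^bsub>?S\<^esub> g \<oplus>\<^bsub>?S\<^esub> ?s = c g \<otimes>\<^bsub>?S\<^esub> g \<oplus>\<^bsub>UP R\<^esub> ?s" by (simp add: rees_algebra_def)
      moreover have "?C (c g \<otimes>\<^bsub>?S\<^esub> g \<oplus>\<^bsub>UP R\<^esub> ?s) (Suc n) \<in> A"
        using g s A.a_closed by (subst U.coeff_add) (simp_all add: carS)
      ultimately show ?case by simp
    qed
    from this[OF G(2) order_refl] have "?C ?p (Suc n) \<in> A" using p by simp
    then show "a \<in> A" using ac by simp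
  qed
  then show ?thesis by (intro exI[of _ N0]) blast
qed

text \<open>R is Noetherian, so the least number in \<open>min_generators\<close> is attained. One
  family of lifts then provides both finite generation and, through the last clause, the bound on
  the number of generators.\<close>

lemma fin_gen_Z: "\<exists>L g. (\<forall>j<L. g j \<in> pull (I n)) \<and> (\<forall>a\<in>pull (I n). \<exists>c. a - (\<Sum>j<(L::nat). c j * g j) \<in> Z) \<and>
    L = min_generators R (I n)"
proof -
  have "\<exists>A\<subseteq>carrier R. finite A \<and> I n = Idl A" by (rule noetherian_ring.finetely_gen[OF noeth filt(1)])
  then have "\<exists>k. \<exists>A\<subseteq>carrier R. finite A \<and> card A = k \<and> I n = Idl A" by blast
  then have "\<exists>A\<subseteq>carrier R. finite A \<and> card A = min_generators R (I n) \<and> I n = Idl A"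
    unfolding min_generators_def by (rule LeastI_ex)
  then obtain A where A: "A \<subseteq> carrier R" "finite A" "card A = min_generators R (I n)" "I n = Idl A" by blast
  define L where "L = card A"
  obtain f where f: "bij_betw f {..<L} A" using ex_bij_betw_nat_finite[OF A(2)] by (auto simp: L_def atLeast0LessThan)
  have fA: "f j \<in> A" if "j < L" for j using f that by (auto simp: bij_betw_def)
  have "\<forall>j. \<exists>q. j < L \<longrightarrow> f j = \<pi> q"
  proof
    fix j show "\<exists>q. j < L \<longrightarrow> f j = \<pi> q" using fA[of j] A(1) h_onto[of "f j"] by blast
  qed
  from choice[OF this] obtain g where g: "\<forall>j. j < L \<longrightarrow> f j = \<pi> (g j)" ..
  define B where "B = {p. \<exists>c. p - (\<Sum>j<L. c j * g j) \<in> Z}"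
  have B: "ideal_of UNIV B"
    unfolding ideal_of_def
  proof (intro conjI ballI)
    show "0 \<in> B" unfolding B_def using ideal_ofD(2)[OF Z_ideal] by (intro CollectI exI[of _ "\<lambda>_. 0"]) simp
    fix a b assume "a \<in> B" "b \<in> B"
    then obtain c d where c: "a - (\<Sum>j<L. c j * g j) \<in> Z" and d: "b - (\<Sum>j<L. d j * g j) \<in> Z" unfolding B_def by blast
    have "(a - (\<Sum>j<L. c j * g j)) + (b - (\<Sum>j<L. d j * g j)) = (a + b) - (\<Sum>j<L. (c j + d j) * g j)"
      by (simp add: algebra_simps sum.distrib)
    with ideal_ofD(3)[OF Z_ideal c d] have "(a + b) - (\<Sum>j<L. (c j + d j) * g j) \<in> Z" by (simp only:)
    then show "a + b \<in> B" unfolding B_def by (intro CollectI exI[of _ "\<lambda>j. c j + d j"])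
  next
    fix u a assume "a \<in> B"
    then obtain c where c: "a - (\<Sum>j<L. c j * g j) \<in> Z" unfolding B_def by blast
    have "u * (a - (\<Sum>j<L. c j * g j)) = u * a - (\<Sum>j<L. (u * c j) * g j)"
      by (simp add: algebra_simps sum_distrib_left)
    with ideal_ofD(4)[OF Z_ideal UNIV_I c, of u] have "u * a - (\<Sum>j<L. (u * c j) * g j) \<in> Z" by (simp only:)
    then show "u * a \<in> B" unfolding B_def by (intro CollectI exI[of _ "\<lambda>j. u * c j"])
  qed simp
  have ZB: "Z \<subseteq> B" unfolding B_def by (intro subsetI CollectI exI[of _ "\<lambda>_. 0"]) simp
  have gB: "g j \<in> B" if "j < L" for j
  proof -
    have "(\<Sum>k<L. (if k = j then 1 else 0) * g k) = (\<Sum>k<L. if k = j then g k else 0)" by (intro sum.cong) auto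
    also have "\<dots> = g j" using that by simp
    finally have "g j - (\<Sum>k<L. (if k = j then 1 else 0) * g k) = 0" by simp
    then have "g j - (\<Sum>k<L. (if k = j then 1 else 0) * g k) \<in> Z" using ideal_ofD(2)[OF Z_ideal] by (simp only:)
    then show ?thesis unfolding B_def by (intro CollectI exI)
  qed
  have "A \<subseteq> \<pi> ` B"
  proof
    fix a assume "a \<in> A"
    then obtain j where j: "j < L" "a = f j" using f by (auto simp: bij_betw_def)
    then show "a \<in> \<pi> ` B" using g gB[OF j(1)] by auto
  qed
  then have "I n \<subseteq> \<pi> ` B" unfolding A(4) by (rule genideal_minimal[OF image_ideal[OF B]])
  then have "pull (I n) \<subseteq> pull (\<pi> ` B)" unfolding pull_def by blast
  then have "pull (I n) \<subseteq> B" using pull_image[OF B ZB] by blast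
  moreover have "g j \<in> pull (I n)" if "j < L" for j
    using g genideal_self[OF A(1)] fA[OF that] that unfolding pull_def A(4) by auto
  ultimately show ?thesis using A(3) unfolding B_def L_def by (intro exI[of _ "card A"] exI[of _ g]) auto
qed

lemma ex_residues: "\<exists>S::'p set. infinite S \<and> (\<forall>s\<in>S. \<forall>t\<in>S. s \<noteq> t \<longrightarrow> s - t \<notin> m)"
proof -
  have "carrier (R Quot \<mm>) = range (\<lambda>p. \<mm> +> \<pi> p)"
    unfolding FactRing_def A_RCOSETS_def' by (auto simp: image[symmetric])
  then have inf': "infinite (range (\<lambda>p. \<mm> +> \<pi> p))" using inf by simp
  define S where "S = inv_into UNIV (\<lambda>p. \<mm> +> \<pi> p) ` range (\<lambda>p. \<mm> +> \<pi> p)"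
  have "inj_on (inv_into UNIV (\<lambda>p. \<mm> +> \<pi> p)) (range (\<lambda>p. \<mm> +> \<pi> p))" by (rule inj_on_inv_into) simp
  then have "infinite S" unfolding S_def using inf' finite_imageD by blast
  moreover have "s - t \<notin> m" if st: "s \<in> S" "t \<in> S" "s \<noteq> t" for s t
  proof
    assume "s - t \<in> m"
    then have "\<pi> s \<ominus> \<pi> t \<in> \<mm>" by (simp add: pull_def h_diff)
    then have "\<mm> +> \<pi> s = \<mm> +> \<pi> t" using quotient_eq_iff_same_a_r_cos[OF mm_ideal] h_closed by blast
    moreover obtain a b where "s = inv_into UNIV (\<lambda>p. \<mm> +> \<pi> p) (\<mm> +> \<pi> a)" "t = inv_into UNIV (\<lambda>p. \<mm> +> \<pi> p) (\<mm> +> \<pi> b)"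
      using st(1,2) unfolding S_def by blast
    moreover have "\<mm> +> \<pi> (inv_into UNIV (\<lambda>p. \<mm> +> \<pi> p) (\<mm> +> \<pi> a)) = \<mm> +> \<pi> a" for a
      using f_inv_into_f[of "\<mm> +> \<pi> a" "\<lambda>p. \<mm> +> \<pi> p" UNIV] by simp
    ultimately show False using st(3) by metis
  qed
  ultimately show ?thesis by blast
qed

end

section \<open>The reduction number\<close>

context filt
begin

definition hset :: "(nat \<Rightarrow> 'p set) \<Rightarrow> 'p poly set" where
  "hset Q = {p. \<forall>n. Polynomial.coeff p n \<in> Q n}"

lemma hset_ideal:
  assumes Q: "hideal Q" shows "ideal_of T (hset Q)" "KK \<subseteq> hset Q"
proof -
  note Qi = hidealD[OF Q]
  show "KK \<subseteq> hset Q" using Qi(2) by (auto simp: KK_def hset_def)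
  show "ideal_of T (hset Q)"
    unfolding ideal_of_def
  proof (intro conjI ballI)
    show "hset Q \<subseteq> T" using Qi(3) by (auto simp: hset_def T_def)
    show "0 \<in> hset Q" using ideal_ofD(2)[OF Qi(1)] by (simp add: hset_def)
    show "a + b \<in> hset Q" if "a \<in> hset Q" "b \<in> hset Q" for a b
      using that ideal_ofD(3)[OF Qi(1)] by (simp add: hset_def)
    fix a b assume a: "a \<in> T" and b: "b \<in> hset Q"
    have "Polynomial.coeff a i * Polynomial.coeff b (n - i) \<in> Q n" if "i \<le> n" for n i
      using Qi(4)[OF TD[OF a, of i], of "Polynomial.coeff b (n - i)" "n - i"] b that by (simp add: hset_def)
    then have "Polynomial.coeff (a * b) n \<in> Q n" for n
      unfolding Polynomial.coeff_mult by (intro ideal_of_sum[OF Qi(1)]) simp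
    then show "a * b \<in> hset Q" by (simp add: hset_def)
  qed
qed

lemma monom_hset:
  assumes Q: "hideal Q" shows "Polynomial.monom a n \<in> hset Q \<longleftrightarrow> a \<in> Q n"
  using ideal_ofD(2)[OF hidealD(1)[OF Q]] by (auto simp: hset_def)

lemma hset_strict:
  assumes Q: "hideal Q" and Q': "hideal Q'" and "Q < Q'" shows "hset Q \<subset> hset Q'"
proof
  show "hset Q \<subseteq> hset Q'" using \<open>Q < Q'\<close> by (auto simp: hset_def less_fun_def le_fun_def)
  obtain n a where "a \<in> Q' n" "a \<notin> Q n" using \<open>Q < Q'\<close> by (auto simp: less_fun_def le_fun_def)
  then show "hset Q \<noteq> hset Q'" using monom_hset[OF Q, of a n] monom_hset[OF Q', of a n] by blast
qed

text \<open>Primality on homogeneous elements suffices: take the lowest coefficients of a and b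
  outside Q, in degrees i and j. In degree i + j of the product every other term contains a lower
  coefficient and lies in Q, so the product of the two would lie in Q as well.\<close>

lemma hset_prime:
  assumes P: "hprime Q" shows "tprime (hset Q)"
  unfolding tprime_def
proof (intro conjI ballI impI)
  note Q = hprimeD(1)[OF P]
  note Qi = hidealD[OF Q]
  show "ideal_of T (hset Q)" "KK \<subseteq> hset Q" by (rule hset_ideal[OF Q])+
  show "1 \<notin> hset Q" using hprimeD(2)[OF P] by (auto simp: hset_def dest: spec[of _ 0])
  fix a b assume a: "a \<in> T" and b: "b \<in> T" and ab: "a * b \<in> hset Q"
  show "a \<in> hset Q \<or> b \<in> hset Q"
  proof (rule ccontr)
    assume "\<not> (a \<in> hset Q \<or> b \<in> hset Q)"
    then have ex: "\<exists>i. Polynomial.coeff a i \<notin> Q i" "\<exists>i. Polynomial.coeff b i \<notin> Q i" by (auto simp: hset_def)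
    define i where "i = (LEAST i. Polynomial.coeff a i \<notin> Q i)"
    define j where "j = (LEAST i. Polynomial.coeff b i \<notin> Q i)"
    have i1: "Polynomial.coeff a i \<notin> Q i" unfolding i_def by (rule LeastI_ex[OF ex(1)])
    have i2: "Polynomial.coeff a k \<in> Q k" if "k < i" for k
      using not_less_Least[OF that[unfolded i_def]] by simp
    note i = i1 i2
    have j1: "Polynomial.coeff b j \<notin> Q j" unfolding j_def by (rule LeastI_ex[OF ex(2)])
    have j2: "Polynomial.coeff b k \<in> Q k" if "k < j" for k
      using not_less_Least[OF that[unfolded j_def]] by simp
    note j = j1 j2
    let ?f = "\<lambda>k. Polynomial.coeff a k * Polynomial.coeff b (i + j - k)"
    have rest: "?f k \<in> Q (i + j)" if "k \<in> {..i + j} - {i}" for k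
    proof (cases "k < i")
      case True
      then show ?thesis using Qi(5)[OF i(2)[OF True] TD[OF b, of "i + j - k"]] by simp
    next
      case False
      then have "i + j - k < j" using that by auto
      then show ?thesis using Qi(4)[OF TD[OF a, of k] j(2)[of "i + j - k"]] that by simp
    qed
    have "Polynomial.coeff (a * b) (i + j) = (\<Sum>k\<le>i + j. ?f k)" by (rule Polynomial.coeff_mult)
    also have "\<dots> = ?f i + (\<Sum>k\<in>{..i + j} - {i}. ?f k)" by (rule sum.remove) simp_all
    finally have eq: "?f i = Polynomial.coeff (a * b) (i + j) - (\<Sum>k\<in>{..i + j} - {i}. ?f k)" by simp
    have "?f i \<in> Q (i + j)"
      unfolding eq
    proof (rule ideal_of_diff[OF subring_UNIV Qi(1)])
      show "Polynomial.coeff (a * b) (i + j) \<in> Q (i + j)" using ab by (simp add: hset_def)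
      show "(\<Sum>k\<in>{..i + j} - {i}. ?f k) \<in> Q (i + j)" by (rule ideal_of_sum[OF Qi(1) rest])
    qed
    then show False using hprimeD(3)[OF P TD[OF a, of i] TD[OF b, of j]] i(1) j(1) by simp
  qed
qed

lemma syz_0: "syz x 0 j"
  unfolding syz_def using ideal_ofD(2)[OF Ipred_ideal] by (intro allI impI exI[of _ "\<lambda>_ _. 0"]) simp

lemma syz_of_regular_chain:
  assumes x: "\<forall>i<r. x i \<in> I 1"
    and red: "\<forall>n\<ge>N. \<forall>a\<in>I n. \<exists>c. (\<forall>i<r. c i \<in> Ipred n) \<and> a - (\<Sum>i<r. c i * x i) \<in> K n"
    and W: "1 \<in> W" "\<forall>u\<in>W. \<forall>v\<in>W. u * v \<in> W" "W \<subseteq> T"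
    and Wunit: "\<forall>u\<in>W. \<exists>v. \<forall>n. \<forall>a\<in>I n. (v * Polynomial.coeff u 0 - 1) * a \<in> K n"
    and chain: "regular_chain T W KK r a J" and a0: "\<forall>i<r. Polynomial.coeff (a i) 0 \<in> K 0"
  shows "syz x r j"
proof (rule syz_if_regular[where W = W and J = J and a = a and N = N, OF x red])
  note ch = chain[unfolded regular_chain_def]
  show "1 \<in> W" "W \<subseteq> T" by (rule W)+
  show "\<And>u v. u \<in> W \<Longrightarrow> v \<in> W \<Longrightarrow> u * v \<in> W" using W(2) by blast
  show "\<And>u. u \<in> W \<Longrightarrow> \<exists>v. \<forall>n. \<forall>a\<in>I n. (v * Polynomial.coeff u 0 - 1) * a \<in> K n" using Wunit by blast
  show "\<And>i. i \<le> r \<Longrightarrow> ideal_of T (J i)" using ch by simp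
  show "\<And>i. i < r \<Longrightarrow> J i \<subseteq> J (Suc i)" using ch by simp
  show "\<And>i. i \<le> r \<Longrightarrow> KK \<subseteq> J i" using ch by simp
  show "\<And>b. b \<in> J 0 \<Longrightarrow> \<exists>u\<in>W. u * b \<in> KK" using ch by simp
  show "\<And>i. i < r \<Longrightarrow> a i \<in> T" "\<And>i. i < r \<Longrightarrow> a i \<in> J (Suc i)" using ch by simp_all
  show "\<And>i. i < r \<Longrightarrow> Polynomial.coeff (a i) 0 \<in> K 0" using a0 by simp
  show "\<And>i b. i < r \<Longrightarrow> b \<in> T \<Longrightarrow> a i * b \<in> J i \<Longrightarrow> b \<in> J i" using ch by simp
  show "\<And>i b. i < r \<Longrightarrow> b \<in> J (Suc i) \<Longrightarrow> \<exists>u\<in>W. \<exists>f\<in>T. u * b - a i * f \<in> J i" using ch by simp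
qed

end

section \<open>Prime ideals under a presentation\<close>

context presentation
begin

lemma image_prime:
  assumes B: "ideal_of T B" "pull {\<zero>} \<subseteq> B" "1 \<notin> B" "\<forall>p\<in>T. \<forall>q\<in>T. p * q \<in> B \<longrightarrow> p \<in> B \<or> q \<in> B"
  shows "primeideal (h ` B) S"
proof (rule primeidealI[OF image_ideal[OF B(1)] is_cring])
  note pi = pull_image[OF B(1,2)]
  have mem: "h p \<in> h ` B \<longleftrightarrow> p \<in> B" if "p \<in> T" for p using pi that unfolding pull_def by blast
  have "\<one> \<notin> h ` B" using mem[OF Tcl(2)] B(3) h_one by simp
  then show "carrier S \<noteq> h ` B" using one_closed by metis
  fix a b assume ab: "a \<in> carrier S" "b \<in> carrier S" "a \<otimes> b \<in> h ` B"
  obtain p where p: "p \<in> T" "a = h p" using ab(1) by (rule h_onto)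
  obtain q where q: "q \<in> T" "b = h q" using ab(2) by (rule h_onto)
  have "h (p * q) \<in> h ` B" using ab(3) p q by (simp add: h_mult)
  then have "p * q \<in> B" using mem[OF Tcl(4)[OF p(1) q(1)]] by simp
  then show "a \<in> h ` B \<or> b \<in> h ` B" using B(4) p q by blast
qed

lemma image_strict:
  assumes "ideal_of T B" "pull {\<zero>} \<subseteq> B" "ideal_of T B'" "pull {\<zero>} \<subseteq> B'" "B \<subset> B'"
  shows "h ` B \<subset> h ` B'"
proof
  show "h ` B \<subseteq> h ` B'" using assms(5) by (intro image_mono) simp
  show "h ` B \<noteq> h ` B'"
  proof
    assume "h ` B = h ` B'"
    then have "pull (h ` B) = pull (h ` B')" by simp
    then show False using pull_image[OF assms(1,2)] pull_image[OF assms(3,4)] assms(5) by simp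
  qed
qed

lemma pull_prime:
  assumes "primeideal A S"
  shows "1 \<notin> pull A" "\<forall>p\<in>T. \<forall>q\<in>T. p * q \<in> pull A \<longrightarrow> p \<in> pull A \<or> q \<in> pull A"
proof -
  interpret A: primeideal A S by fact
  show "1 \<notin> pull A" using A.I_notcarr A.one_imp_carrier by (auto simp: pull_def h_one)
  show "\<forall>p\<in>T. \<forall>q\<in>T. p * q \<in> pull A \<longrightarrow> p \<in> pull A \<or> q \<in> pull A"
    using A.I_prime h_closed by (auto simp: pull_def h_mult)
qed

lemma pull_strict:
  assumes "A \<subset> B" "B \<subseteq> carrier S" shows "pull A \<subset> pull B"
proof
  show "pull A \<subseteq> pull B" using assms(1) by (auto simp: pull_def)
  show "pull A \<noteq> pull B"
  proof
    assume "pull A = pull B"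
    then have "h ` pull A = h ` pull B" by simp
    moreover have "A \<subseteq> carrier S" using assms by blast
    ultimately show False using image_pull[of A] image_pull[of B] assms by simp
  qed
qed

end

text \<open>A supremum in the extended naturals that reaches r > 0 has a member reaching it; for r =
  0 the set might be empty, so that case is treated apart.\<close>

lemma enat_le_Sup_imp:
  assumes "enat r \<le> Sup (enat ` A)" "0 < r" shows "\<exists>k\<in>A. r \<le> k"
proof (rule ccontr)
  assume "\<not> ?thesis"
  then have "Sup (enat ` A) \<le> enat (r - 1)" using \<open>0 < r\<close> by (intro Sup_least) auto
  then have "enat r \<le> enat (r - 1)" using assms(1) by (rule order_trans[rotated])
  then show False using \<open>0 < r\<close> by simp
qed

lemma krull_dim_alt: "krull_dim S = Sup (enat ` {n. \<exists>P. prime_chain S n P})"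
  unfolding krull_dim_def by (intro arg_cong[where f = Sup]) auto

lemma grade_regular_sequence:
  assumes "enat r \<le> grade S J" "0 < r" "J \<noteq> carrier S"
  shows "\<exists>xs. regular_sequence S xs \<and> set xs \<subseteq> J \<and> r \<le> length xs"
proof -
  have "grade S J = Sup (enat ` {n. \<exists>xs. regular_sequence S xs \<and> set xs \<subseteq> J \<and> n = length xs})"
    unfolding grade_def using assms(3) by (simp, intro arg_cong[where f = Sup]) auto
  then show ?thesis using enat_le_Sup_imp[of r "{n. \<exists>xs. regular_sequence S xs \<and> set xs \<subseteq> J \<and> n = length xs}"] assms(1,2)
    by auto
qed

section \<open>Dimension and syzygies of the fiber cone and the associated graded ring\<close>

context fiber_setting
begin

abbreviation "FC \<equiv> fiber_cone R \<mm> I"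
abbreviation "KF \<equiv> \<lambda>n. pull (\<mm> \<cdot> I n)"

lemma FC_def: "FC = graded_quotient R I (\<lambda>n. \<mm> \<cdot> I n)"
  by (simp add: fiber_cone_def)

definition N0 :: nat where
  "N0 = (SOME N0. \<forall>n\<ge>N0. \<forall>A. ideal A R \<longrightarrow> (\<forall>u\<in>I 1. \<forall>v\<in>I n. u \<otimes> v \<in> A) \<longrightarrow> I (Suc n) \<subseteq> A)"

lemma Z_sub: "ideal A R \<Longrightarrow> Z \<subseteq> pull A"
  by (rule ker_le_pull)

text \<open>Strict inclusions of homogeneous ideals become strict inclusions of ideals of the
  Noetherian fiber cone, by way of the Rees algebra.\<close>

lemma acc_F: "wf {(Q', Q). F.G.hideal Q \<and> F.G.hideal Q' \<and> Q < Q'}"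
proof (rule wf_subset[OF wf_inv_image[OF noetherian_ring.ideals_wf[OF noethF]]])
  show "{(Q', Q). F.G.hideal Q \<and> F.G.hideal Q' \<and> Q < Q'}
      \<subseteq> inv_image {(B, A). ideal A FC \<and> ideal B FC \<and> A \<subset> B} (\<lambda>Q. F.mk ` F.G.hset Q)"
    using F.G.image_ideal F.G.image_strict F.G.hset_ideal F.G.hset_strict F.G_ker by (auto simp: FC_def)
qed

sublocale LF: local_filt "\<lambda>n. pull (I n)" KF m N0 Z
proof
  show "maximal_set m" by (rule maximal_m)
  show "pull (\<mm> \<cdot> I 0) = m" by (simp add: filt(2) ideal_prod_one[OF mm_ideal])
  show "u * a \<in> pull (\<mm> \<cdot> I n)" if "u \<in> m" "a \<in> pull (I n)" for u a n
    using that ideal_prod.prod[of "\<pi> u" \<mm> "\<pi> a" "I n" R] by (simp add: pull_def h_mult)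
  have ZK: "Z \<subseteq> pull (\<mm> \<cdot> I n)" for n by (rule Z_sub[OF mI_ideal])
  then show "Z \<subseteq> pull (\<mm> \<cdot> I n)" for n .
  show "\<exists>v. \<forall>n. v * u - 1 \<in> pull (\<mm> \<cdot> I n)" if "u \<notin> m" for u
  proof -
    from unit_mod[OF that] obtain v where "v * u - 1 \<in> Z" ..
    then show ?thesis using ZK by (intro exI[of _ v]) blast
  qed
  show "wf {(Q', Q). F.G.hideal Q \<and> F.G.hideal Q' \<and> Q < Q'}" by (rule acc_F)
  show "pull (I (Suc n)) \<subseteq> A"
    if "N0 \<le> n" "ideal_of UNIV A" "pull (\<mm> \<cdot> I (Suc n)) \<subseteq> A" and uv: "\<And>u v. u \<in> pull (I 1) \<Longrightarrow> v \<in> pull (I n) \<Longrightarrow> u * v \<in> A" for n A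
  proof -
    have ZA: "Z \<subseteq> A" using ZK that(3) by blast
    have N: "\<forall>n\<ge>N0. \<forall>A. ideal A R \<longrightarrow> (\<forall>u\<in>I 1. \<forall>v\<in>I n. u \<otimes> v \<in> A) \<longrightarrow> I (Suc n) \<subseteq> A"
      unfolding N0_def by (rule someI_ex[OF good_generation])
    have "u \<otimes> v \<in> \<pi> ` A" if uI: "u \<in> I 1" and vI: "v \<in> I n" for u v
    proof -
      obtain p where p: "p \<in> UNIV" "u = \<pi> p" by (rule h_onto[OF I_car[OF uI]])
      obtain q where q: "q \<in> UNIV" "v = \<pi> q" by (rule h_onto[OF I_car[OF vI]])
      have "p * q \<in> A" using uI vI by (intro uv) (simp_all add: pull_def p q)
      then have "\<pi> (p * q) \<in> \<pi> ` A" by (rule imageI)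
      then show ?thesis by (simp add: h_mult p q)
    qed
    then have "I (Suc n) \<subseteq> \<pi> ` A" using N that(1) image_ideal[OF that(2)] by blast
    then have "pull (I (Suc n)) \<subseteq> pull (\<pi> ` A)" unfolding pull_def by blast
    then show ?thesis using pull_image[OF that(2) ZA] by blast
  qed
  have fgZ: "\<exists>L g. (\<forall>j<L. g j \<in> pull (I n)) \<and> (\<forall>a\<in>pull (I n). \<exists>c. a - (\<Sum>j<(L::nat). c j * g j) \<in> Z)" for n
    using fin_gen_Z[of n] by (elim exE conjE, intro exI conjI)
  then show "\<exists>L g. (\<forall>j<L. g j \<in> pull (I n)) \<and> (\<forall>a\<in>pull (I n). \<exists>c. a - (\<Sum>j<(L::nat). c j * g j) \<in> Z)" for n .
  show "\<exists>L g. (\<forall>j<L. g j \<in> pull (I n)) \<and> (\<forall>a\<in>pull (I n). \<exists>c. a - (\<Sum>j<(L::nat). c j * g j) \<in> pull (\<mm> \<cdot> I n))" for n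
  proof -
    obtain L g where g: "\<forall>j<L. g j \<in> pull (I n)" "\<forall>a\<in>pull (I n). \<exists>c. a - (\<Sum>j<(L::nat). c j * g j) \<in> Z"
      using fgZ[of n] by (elim exE conjE)
    have "\<forall>a\<in>pull (I n). \<exists>c. a - (\<Sum>j<L. c j * g j) \<in> pull (\<mm> \<cdot> I n)"
    proof
      fix a assume "a \<in> pull (I n)"
      with g(2) have "\<exists>c. a - (\<Sum>j<L. c j * g j) \<in> Z" by (rule bspec)
      then obtain c where "a - (\<Sum>j<L. c j * g j) \<in> Z" ..
      then show "\<exists>c. a - (\<Sum>j<L. c j * g j) \<in> pull (\<mm> \<cdot> I n)" using ZK[of n] by (intro exI[of _ c]) (rule subsetD)
    qed
    with g(1) show ?thesis by (intro exI[of _ L] exI[of _ g] conjI)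
  qed
  show "\<exists>S. infinite S \<and> (\<forall>s\<in>S. \<forall>t\<in>S. s \<noteq> t \<longrightarrow> s - t \<notin> m)" by (rule ex_residues)
  show "ideal_of UNIV Z" by (rule Z_ideal)
  show "\<exists>v. v * u - 1 \<in> Z" if "u \<notin> m" for u by (rule unit_mod[OF that])
  show "pull (\<mm> \<cdot> I n) \<subseteq> A" if "ideal_of UNIV A" "Z \<subseteq> A" "\<And>u b. u \<in> m \<Longrightarrow> b \<in> pull (I n) \<Longrightarrow> u * b \<in> A" for A n
    by (rule pull_mI_le[OF that])
  show "pull (I (Suc n)) \<subseteq> pull (I n)" for n using filt(3)[of n] by (auto simp: pull_def)
qed

text \<open>Generation is asked only modulo \<open>\<mm> \<cdot> I n\<close>;
  \<open>reduces_xI\<close> removes the modulus by Nakayama's lemma.\<close>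

definition reduces :: "nat \<Rightarrow> (nat \<Rightarrow> 'p) \<Rightarrow> bool" where
  "reduces r x \<longleftrightarrow> (\<forall>i<r. x i \<in> pull (I 1)) \<and>
     (\<exists>N. \<forall>n\<ge>N. \<forall>a\<in>pull (I n). \<exists>c. (\<forall>i<r. c i \<in> F.G.Ipred n) \<and> a - (\<Sum>i<r. c i * x i) \<in> KF n)"

lemma tprime_image: "F.G.tprime B \<Longrightarrow> primeideal (F.mk ` B) FC"
  unfolding FC_def by (rule F.G.image_prime) (auto simp: F.G_ker F.G.tprime_def)

lemma tprime_pull: "primeideal A FC \<Longrightarrow> F.G.tprime (F.G.pull A)"
  unfolding FC_def F.G.tprime_def
  using F.G.pull_prime F.G.pull_ideal[OF primeideal.axioms(1)] F.G.ker_le_pull[OF primeideal.axioms(1)] F.G_ker by auto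

lemma prime_chain_bound:
  assumes y: "\<forall>i<s. y i \<in> pull (I 1)"
    and red: "\<forall>n\<ge>N. \<forall>a\<in>pull (I n). \<exists>c. (\<forall>i<s. c i \<in> F.G.Ipred n) \<and> a - (\<Sum>i<s. c i * y i) \<in> KF n"
    and P: "prime_chain FC n P"
  shows "n \<le> s"
proof (rule ccontr)
  assume "\<not> n \<le> s"
  have "F.G.tprime (F.G.pull (P i))" if "i \<le> Suc s" for i
    using P that \<open>\<not> n \<le> s\<close> by (intro tprime_pull) (auto simp: prime_chain_def)
  moreover have "F.G.pull (P i) \<subset> F.G.pull (P (Suc i))" if "i < Suc s" for i
  proof (rule F.G.pull_strict)
    show "P i \<subset> P (Suc i)" using P that \<open>\<not> n \<le> s\<close> by (auto simp: prime_chain_def)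
    have pr: "primeideal (P (Suc i)) FC" using P that \<open>\<not> n \<le> s\<close> by (auto simp: prime_chain_def)
    show "P (Suc i) \<subseteq> carrier (graded_quotient R I (\<lambda>n. \<mm> \<cdot> I n))"
      unfolding FC_def[symmetric] by (rule subsetI, rule ideal.Icarr[OF primeideal.axioms(1)[OF pr]])
  qed
  ultimately have "\<forall>i\<le>Suc s. F.G.tprime (F.G.pull (P i))" "\<forall>i<Suc s. F.G.pull (P i) \<subset> F.G.pull (P (Suc i))" by simp_all
  then show False by (rule LF.no_long_prime_chain[OF y red])
qed

lemma hchain_prime_chain:
  assumes "\<forall>i\<le>s. F.G.hprime (P i)" "\<forall>i<s. P i < P (Suc i)"
  shows "prime_chain FC s (\<lambda>i. F.mk ` F.G.hset (P i))"
  unfolding prime_chain_def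
proof (intro conjI allI impI)
  show "primeideal (F.mk ` F.G.hset (P i)) FC" if "i \<le> s" for i
    using assms(1) that by (intro tprime_image F.G.hset_prime) simp
  show "F.mk ` F.G.hset (P i) \<subset> F.mk ` F.G.hset (P (Suc i))" if "i < s" for i
  proof -
    have h: "F.G.hideal (P i)" "F.G.hideal (P (Suc i))" using assms(1) that by (auto intro: F.G.hprimeD(1))
    show ?thesis
      using F.G.hset_ideal[OF h(1)] F.G.hset_ideal[OF h(2)] F.G.hset_strict[OF h] assms(2) that F.G_ker
      by (intro F.G.image_strict) auto
  qed
qed

lemma ex_reduction:
  assumes "krull_dim FC = enat r"
  shows "\<exists>y. reduces r y"
proof -
  have "\<not> F.G.hchain KF (Suc r)"
  proof
    assume "F.G.hchain KF (Suc r)"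
    then obtain P where "\<forall>i\<le>Suc r. F.G.hprime (P i)" "\<forall>i<Suc r. P i < P (Suc i)" unfolding F.G.hchain_def by blast
    then have "prime_chain FC (Suc r) (\<lambda>i. F.mk ` F.G.hset (P i))" by (rule hchain_prime_chain)
    then have "enat (Suc r) \<le> krull_dim FC" unfolding krull_dim_alt by (intro Sup_upper) blast
    then show False using assms by simp
  qed
  from LF.parameters[OF F.G.hideal_K this] show ?thesis unfolding reduces_def by blast
qed

text \<open>Without such a chain \<open>parameters\<close> would give r - 1 elements, and then every
  chain of primes would have length below r. Being homogeneous, the chain lies below the homogeneous
  maximal ideal and survives localization there.\<close>

lemma ex_hchain:
  assumes "krull_dim FC = enat r" "0 < r"
  shows "\<exists>P. (\<forall>i\<le>r. F.G.hprime (P i)) \<and> (\<forall>i<r. P i < P (Suc i))"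
proof -
  obtain s where s: "r = Suc s" using assms(2) by (cases r) auto
  have "F.G.hchain KF (Suc s)"
  proof (rule ccontr)
    assume "\<not> F.G.hchain KF (Suc s)"
    from LF.parameters[OF F.G.hideal_K this]
    obtain y N where "\<forall>i<s. y i \<in> pull (I 1)"
      "\<forall>n\<ge>N. \<forall>a\<in>pull (I n). \<exists>c. (\<forall>i<s. c i \<in> F.G.Ipred n) \<and> a - (\<Sum>i<s. c i * y i) \<in> KF n" by (elim exE conjE)
    from prime_chain_bound[OF this] have "krull_dim FC \<le> enat s" unfolding krull_dim_alt by (intro Sup_least) auto
    then show False using assms(1) s by simp
  qed
  then show ?thesis unfolding F.G.hchain_def s by blast
qed

text \<open>The complement of the homogeneous maximal ideal, lifted to the Rees algebra.\<close>

definition W :: "'p poly set" where "W = {p \<in> F.G.T. Polynomial.coeff p 0 \<notin> m}"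

definition Mx :: "(nat \<Rightarrow> 'a set) set" where "Mx = F.mk ` F.G.hset LF.M"

lemma mk_Mx: "p \<in> F.G.T \<Longrightarrow> F.mk p \<in> Mx \<longleftrightarrow> Polynomial.coeff p 0 \<in> m"
proof -
  assume p: "p \<in> F.G.T"
  note h = F.G.hset_ideal[OF F.G.hprimeD(1)[OF LF.hprime_M]]
  have "F.G.pull Mx = F.G.hset LF.M" unfolding Mx_def by (rule F.G.pull_image[OF h(1)]) (use h(2) F.G_ker in simp)
  then have "F.mk p \<in> Mx \<longleftrightarrow> p \<in> F.G.hset LF.M" using p unfolding F.G.pull_def by blast
  also have "\<dots> \<longleftrightarrow> Polynomial.coeff p 0 \<in> m"
    using F.G.TD[OF p] by (auto simp: F.G.hset_def LF.M_def)
  finally show ?thesis .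
qed

text \<open>An element outside Mx has a constant term outside m; multiplying by an inverse of it
  modulo m gives 1 modulo Mx.\<close>

lemma Mx_maximal: "maximalideal Mx FC"
proof (rule maximalidealI)
  have pr: "primeideal Mx FC" unfolding Mx_def by (rule tprime_image[OF F.G.hset_prime[OF LF.hprime_M]])
  then show "ideal Mx FC" by (rule primeideal.axioms(1))
  show "carrier FC \<noteq> Mx" using primeideal.I_notcarr[OF pr] .
  fix J assume J: "ideal J FC" "Mx \<subseteq> J" "J \<subseteq> carrier FC"
  show "J = Mx \<or> J = carrier FC"
  proof (cases "J \<subseteq> Mx")
    case False
    then obtain x where x: "x \<in> J" "x \<notin> Mx" by blast
    obtain p where p: "p \<in> F.G.T" "x = F.mk p" using F.G.h_onto[of x] x(1) J(3) by (auto simp: FC_def)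
    have "Polynomial.coeff p 0 \<notin> m" using mk_Mx[OF p(1)] x(2) p(2) by simp
    then obtain v where v: "v * Polynomial.coeff p 0 - 1 \<in> m" using maximal_setD(3)[OF maximal_m] by blast
    have Ji: "ideal_of F.G.T (F.G.pull J)" using J(1) by (intro F.G.pull_ideal) (simp add: FC_def)
    have pJ: "p \<in> F.G.pull J" using p x(1) by (simp add: F.G.pull_def)
    let ?q = "[:v:] * p - 1"
    have qT: "?q \<in> F.G.T"
      by (rule subringD(6)[OF F.G.T_subring subringD(4)[OF F.G.T_subring F.G.const_T p(1)] subringD(2)[OF F.G.T_subring]])
    have "Polynomial.coeff ?q 0 \<in> m" using v by simp
    then have "?q \<in> F.G.pull J" using mk_Mx[OF qT] J(2) qT by (auto simp: F.G.pull_def)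
    then have "[:v:] * p - ?q \<in> F.G.pull J"
      by (rule ideal_of_diff[OF F.G.T_subring Ji ideal_ofD(4)[OF Ji F.G.const_T pJ]])
    then have "1 \<in> F.G.pull J" by simp
    then have "\<one>\<^bsub>FC\<^esub> \<in> J" using F.G.h_one by (simp add: F.G.pull_def FC_def)
    then show ?thesis using ideal.one_imp_carrier[OF J(1)] by blast
  qed (use J(2) in blast)
qed

text \<open>The chain of \<open>ex_hchain\<close> extends to the localization at Mx, whose dimension
  is thus at least r; as grade and dimension agree there, a regular sequence of length at least r
  exists.\<close>

lemma syz_fiber:
  assumes dim: "krull_dim FC = enat r" and cm: "cohen_macaulay FC" and x: "reduces r x"
  shows "F.G.syz x r j"
proof (cases "r = 0")
  case True
  then show ?thesis by (simp add: F.G.syz_0)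
next
  case False
  obtain \<nn> where cml: "cohen_macaulay_local (localization FC Mx) \<nn>"
    using cm Mx_maximal unfolding cohen_macaulay_def by blast
  then have Lc: "cring (localization FC Mx)" and nn: "maximalideal \<nn> (localization FC Mx)"
    and grade: "grade (localization FC Mx) \<nn> = krull_dim (localization FC Mx)"
    by (auto simp: cohen_macaulay_local_def local_ring_def)
  have WT: "W \<subseteq> F.G.T" by (auto simp: W_def)
  have W1: "1 \<in> W" using subringD(2)[OF F.G.T_subring] maximal_setD(2)[OF maximal_m] by (simp add: W_def)
  have Wm: "u * v \<in> W" if "u \<in> W" "v \<in> W" for u v
    using that subringD(4)[OF F.G.T_subring] maximal_set_prime[OF maximal_m] by (auto simp: W_def Polynomial.coeff_mult)
  interpret LP: loc_presentation F.G.T FC F.mk W Mx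
  proof (intro loc_presentation.intro loc_presentation_axioms.intro)
    show "presentation F.G.T FC F.mk" unfolding FC_def by (rule F.G.presentation_axioms)
    show "F.mk p \<notin> Mx \<longleftrightarrow> p \<in> W" if "p \<in> F.G.T" for p using mk_Mx[OF that] that by (simp add: W_def)
  qed (use WT W1 Wm Lc in auto)
  have ker: "LP.ker = F.G.KK" using F.G_ker by (simp add: FC_def)
  obtain P where P: "\<forall>i\<le>r. F.G.hprime (P i)" "\<forall>i<r. P i < P (Suc i)" using ex_hchain[OF dim] False by blast
  have tp: "F.G.tprime (F.G.hset (P i))" if "i \<le> r" for i using P(1) that by (intro F.G.hset_prime) simp
  have disj: "F.G.hset (P i) \<inter> W = {}" if "i \<le> r" for i
    using LF.hprime_0[of "P i"] P(1) that by (auto simp: F.G.hset_def W_def)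
  have tpD: "ideal_of F.G.T (F.G.hset (P i))" "LP.ker \<subseteq> F.G.hset (P i)"
    "\<forall>p\<in>F.G.T. \<forall>q\<in>F.G.T. p * q \<in> F.G.hset (P i) \<longrightarrow> p \<in> F.G.hset (P i) \<or> q \<in> F.G.hset (P i)" if "i \<le> r" for i
    using tp[OF that] ker unfolding F.G.tprime_def by auto
  have "prime_chain LP.L r (\<lambda>i. LP.lprime (F.G.hset (P i)))"
    unfolding prime_chain_def
  proof (intro conjI allI impI)
    show "primeideal (LP.lprime (F.G.hset (P i))) LP.L" if "i \<le> r" for i
      by (rule LP.lprime_prime[OF tpD(1)[OF that] tpD(2)[OF that] disj[OF that] tpD(3)[OF that]])
    fix i assume i: "i < r"
    then have i': "i \<le> r" "Suc i \<le> r" by auto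
    have st: "F.G.hset (P i) \<subset> F.G.hset (P (Suc i))"
      using P i i' by (intro F.G.hset_strict) (auto intro: F.G.hprimeD(1))
    then obtain p where p: "p \<in> F.G.hset (P (Suc i))" "p \<notin> F.G.hset (P i)" by blast
    have pT: "p \<in> F.G.T" using p(1) ideal_ofD(1)[OF tpD(1)[OF i'(2)]] by blast
    note mem = LP.frac_in_lprime[OF tpD(1) tpD(2) disj tpD(3) pT W1]
    have "LP.frac p 1 \<in> LP.lprime (F.G.hset (P (Suc i)))" "LP.frac p 1 \<notin> LP.lprime (F.G.hset (P i))"
      using mem[OF i'(2,2,2,2)] mem[OF i'(1,1,1,1)] p by simp_all
    moreover have "LP.lprime (F.G.hset (P i)) \<subseteq> LP.lprime (F.G.hset (P (Suc i)))"
      using st unfolding LP.lprime_def by blast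
    ultimately show "LP.lprime (F.G.hset (P i)) \<subset> LP.lprime (F.G.hset (P (Suc i)))" by blast
  qed
  then have "enat r \<le> krull_dim LP.L" unfolding krull_dim_alt by (intro Sup_upper) blast
  then have "enat r \<le> grade LP.L \<nn>" using grade by simp
  moreover have nnc: "\<nn> \<noteq> carrier LP.L" using maximalideal.I_notcarr[OF nn] by blast
  ultimately obtain xs where xs: "regular_sequence LP.L xs" "set xs \<subseteq> \<nn>" "r \<le> length xs"
    using grade_regular_sequence False by blast
  obtain a where a: "regular_chain F.G.T W LP.ker r a (\<lambda>i. LP.lpull (Idl\<^bsub>LP.L\<^esub> (set (take i xs))))" "\<forall>i<r. a i \<notin> W"
    using LP.regular_chain_of_localization[OF xs(1,3) maximalideal.axioms(1)[OF nn] nnc xs(2)] by blast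
  have aT: "a i \<in> F.G.T" if "i < r" for i using a(1) that by (simp add: regular_chain_def)
  obtain N where red: "\<forall>n\<ge>N. \<forall>a\<in>pull (I n). \<exists>c. (\<forall>i<r. c i \<in> F.G.Ipred n) \<and> a - (\<Sum>i<r. c i * x i) \<in> KF n"
    using x unfolding reduces_def by blast
  show ?thesis
  proof (rule F.G.syz_of_regular_chain[OF _ red W1 _ WT _ a(1)[unfolded ker]])
    show "\<forall>i<r. x i \<in> pull (I 1)" using x by (simp add: reduces_def)
    show "\<forall>u\<in>W. \<forall>v\<in>W. u * v \<in> W" using Wm by blast
    show "\<forall>u\<in>W. \<exists>v. \<forall>n. \<forall>a\<in>pull (I n). (v * Polynomial.coeff u 0 - 1) * a \<in> KF n"
    proof
      fix u assume "u \<in> W"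
      then obtain v where "\<forall>n. v * Polynomial.coeff u 0 - 1 \<in> KF n" using LF.unit by (auto simp: W_def)
      then show "\<exists>v. \<forall>n. \<forall>a\<in>pull (I n). (v * Polynomial.coeff u 0 - 1) * a \<in> KF n"
        using F.G.Kcl(6) by (intro exI[of _ v]) blast
    qed
    show "\<forall>i<r. Polynomial.coeff (a i) 0 \<in> pull (\<mm> \<cdot> I 0)"
      using a(2) aT LF.K0 by (auto simp: W_def)
  qed
qed

lemma reduces_xI:
  assumes "reduces r x" shows "\<exists>N. \<forall>n\<ge>N. pull (I n) \<subseteq> LF.xI x r n"
  using assms LF.xI_nakayama unfolding reduces_def by blast

text \<open>That x generates the large degrees is known modulo \<open>\<mm> \<cdot> I n\<close>;
  Nakayama's lemma makes it an equality in R, which can then be read modulo I_(n+1).\<close>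

lemma syz_gr:
  assumes grade: "grade (associated_graded R I) (associated_graded_plus R I) \<ge> enat r"
    and I1: "I 1 \<noteq> carrier R" and x: "reduces r x"
  shows "gr.G.syz x r j"
proof (cases "r = 0")
  case True
  then show ?thesis by (simp add: gr.G.syz_0)
next
  case False
  have AG: "associated_graded R I = graded_quotient R I (\<lambda>n. I (Suc n))" by (simp add: associated_graded_def)
  have zero: "\<zero>\<^bsub>associated_graded R I\<^esub> 0 = I 1" by (simp add: AG graded_quotient_def)
  \<comment> \<open>\<open>grade\<close> is infinite by convention for the unit ideal; I_1 /= R
    means that G is not zero in degree 0, which rules this case out.\<close>
  have ne: "associated_graded_plus R I \<noteq> carrier (associated_graded R I)"
  proof
    assume eq: "associated_graded_plus R I = carrier (associated_graded R I)"
    have "gr.mk 1 \<in> carrier (associated_graded R I)"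
      using gr.G.h_closed subringD(2)[OF gr.G.T_subring] by (simp add: AG)
    then have "gr.mk 1 \<in> associated_graded_plus R I" by (simp only: eq)
    then have "gr.mk 1 0 = I 1" by (simp only: associated_graded_plus_def mem_Collect_eq zero)
    then have "I 1 +> \<one> = I 1" by (simp add: gr.mk_def h_one)
    then have "\<one> \<in> I 1" using gr.self_Kcoset[of 1 0] by (simp add: h_one)
    then show False using ideal.one_imp_carrier[OF filt(1)] I1 by blast
  qed
  obtain xs where xs: "regular_sequence (associated_graded R I) xs" "set xs \<subseteq> associated_graded_plus R I" "r \<le> length xs"
    using grade_regular_sequence[OF grade _ ne] False by blast
  have xi: "xs ! i \<in> associated_graded_plus R I" if "i < r" for i using xs(2,3) that by (meson nth_mem order_less_le_trans subsetD)
  have "\<forall>i. \<exists>p. i < r \<longrightarrow> p \<in> gr.G.T \<and> gr.mk p = xs ! i"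
  proof
    fix i
    show "\<exists>p. i < r \<longrightarrow> p \<in> gr.G.T \<and> gr.mk p = xs ! i"
    proof (cases "i < r")
      case True
      have "xs ! i \<in> carrier (graded_quotient R I (\<lambda>n. I (Suc n)))"
        using xi[OF True] by (simp only: associated_graded_plus_def AG mem_Collect_eq)
      then obtain p where "p \<in> gr.G.T" "xs ! i = gr.mk p" by (rule gr.G.h_onto)
      then show ?thesis by (intro exI[of _ p]) simp
    qed simp
  qed
  from choice[OF this] obtain a where a: "\<forall>i. i < r \<longrightarrow> a i \<in> gr.G.T \<and> gr.mk (a i) = xs ! i" ..
  have chain: "regular_chain gr.G.T {1} gr.G.KK r a (\<lambda>i. gr.G.pull (Idl\<^bsub>associated_graded R I\<^esub> (set (take i xs))))"
    using gr.G.regular_chain_of_regular_sequence[OF xs(1)[unfolded AG] xs(3), of a] a gr.G_ker by (simp add: AG)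
  obtain N where N: "\<forall>n\<ge>N. pull (I n) \<subseteq> LF.xI x r n" using reduces_xI[OF x] by blast
  have red: "\<forall>n\<ge>N. \<forall>a\<in>pull (I n). \<exists>c. (\<forall>i<r. c i \<in> gr.G.Ipred n) \<and> a - (\<Sum>i<r. c i * x i) \<in> pull (I (Suc n))"
    using LF.xI_gr N by blast
  show ?thesis
  proof (rule gr.G.syz_of_regular_chain[OF _ red _ _ _ _ chain])
    show "\<forall>i<r. x i \<in> pull (I 1)" using x by (simp add: reduces_def)
    show "1 \<in> {1::'p poly}" "\<forall>u\<in>{1}. \<forall>v\<in>{1}. u * v \<in> {1::'p poly}" by simp_all
    show "{1} \<subseteq> gr.G.T" using subringD(2)[OF gr.G.T_subring] by simp
    show "\<forall>u\<in>{1}. \<exists>v. \<forall>n. \<forall>a\<in>pull (I n). (v * Polynomial.coeff u 0 - 1) * a \<in> pull (I (Suc n))"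
      using gr.G.Kcl(1) by (intro ballI exI[of _ 1]) simp
    show "\<forall>i<r. Polynomial.coeff (a i) 0 \<in> pull (I (Suc 0))"
    proof (intro allI impI)
      fix i assume i: "i < r"
      \<comment> \<open>Membership in G_+ says that the degree 0 component vanishes, so the constant
        term of the lift lies in I_1.\<close>
      have "(xs ! i) 0 = I 1" using xi[OF i] by (simp only: associated_graded_plus_def mem_Collect_eq zero)
      then have "gr.mk (a i) 0 = I 1" using a i by simp
      then have "\<pi> (Polynomial.coeff (a i) 0) \<in> I 1"
        using gr.self_Kcoset[of "Polynomial.coeff (a i) 0" 0] by (simp add: gr.mk_def)
      then show "Polynomial.coeff (a i) 0 \<in> pull (I (Suc 0))" by (simp add: pull_def)
    qed
  qed
qed

theorem core:
  assumes dim: "krull_dim FC = enat r" and cm: "cohen_macaulay FC"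
    and grade: "grade (associated_graded R I) (associated_graded_plus R I) \<ge> enat r"
    and I1: "I 1 \<noteq> carrier R" and x: "reduces r x"
    and n: "n \<ge> 1" "min_generators R (I n) < (n + r) choose r" "k \<ge> n"
  shows "pull (I k) \<subseteq> LF.xI x r k"
proof -
  obtain L g where g: "\<forall>j<L. g j \<in> pull (I n)" "\<forall>a\<in>pull (I n). \<exists>c. a - (\<Sum>j<(L::nat). c j * g j) \<in> Z"
    "L = min_generators R (I n)" using fin_gen_Z[of n] by (elim exE conjE)
  have xI: "\<forall>i<r. x i \<in> pull (I 1)" using x by (simp add: reduces_def)
  show ?thesis
  proof (rule LF.reduction_from_regularity[OF xI _ _ g(1) _ _ n(1,3)])
    show "F.G.regseq x r" by (rule F.G.regseq_if_syz[OF xI syz_fiber[OF dim cm x]])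
    show "gr.G.regseq x r" by (rule gr.G.regseq_if_syz[OF xI syz_gr[OF grade I1 x]])
    show "L < (n + r) choose r" using n(2) g(3) by simp
    show "\<forall>a\<in>pull (I n). \<exists>c. a - (\<Sum>j<L. c j * g j) \<in> KF n"
    proof
      fix a assume "a \<in> pull (I n)"
      with g(2) have "\<exists>c. a - (\<Sum>j<L. c j * g j) \<in> Z" by (rule bspec)
      then obtain c where "a - (\<Sum>j<L. c j * g j) \<in> Z" ..
      then show "\<exists>c. a - (\<Sum>j<L. c j * g j) \<in> KF n" using LF.ZK[of n] by (intro exI[of _ c]) (rule subsetD)
    qed
  qed
qed

end

section \<open>General elements\<close>

text \<open>Multiplication only by variables, as in the constructors of \<^const>\<open>ring.indexed_pset\<close>.\<close>

inductive_set horner_funs :: "'v set \<Rightarrow> (('v \<Rightarrow> 'p::comm_ring_1) \<Rightarrow> 'p) set" for V where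
  const: "(\<lambda>_. c) \<in> horner_funs V"
| add: "f \<in> horner_funs V \<Longrightarrow> g \<in> horner_funs V \<Longrightarrow> (\<lambda>\<xi>. f \<xi> + g \<xi>) \<in> horner_funs V"
| var_mult: "f \<in> horner_funs V \<Longrightarrow> v \<in> V \<Longrightarrow> (\<lambda>\<xi>. f \<xi> * \<xi> v) \<in> horner_funs V"

lemma horner_funs_mult:
  assumes f: "f \<in> horner_funs V" and g: "g \<in> horner_funs V"
  shows "(\<lambda>\<xi>. f \<xi> * g \<xi>) \<in> horner_funs V"
  using g
proof induction
  case (const c)
  show ?case using f
  proof induction
    case (const d)
    show ?case by (rule horner_funs.const)
  next
    case (add f g)
    from horner_funs.add[OF add.IH] show ?case by (simp add: distrib_right)
  next
    case (var_mult f v)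
    from horner_funs.var_mult[OF var_mult.IH var_mult.hyps(2)] show ?case by (simp add: mult_ac)
  qed
next
  case (add g h)
  from horner_funs.add[OF add.IH] show ?case by (simp add: distrib_left)
next
  case (var_mult g v)
  from horner_funs.var_mult[OF var_mult.IH var_mult.hyps(2)] show ?case by (simp add: mult_ac)
qed

text \<open>Renames the variables along E and moves to \<open>horner_funs\<close>, whose closure
  rules match the construction of formal polynomials.\<close>

lemma polyfuns_reindex:
  assumes "\<phi> \<in> polyfuns V" "E ` V \<subseteq> B"
  shows "(\<lambda>\<xi>. \<phi> (\<lambda>v. \<xi> (E v))) \<in> horner_funs B"
  using assms(1)
proof induction
  case (const c)
  show ?case by (rule horner_funs.const)
next
  case (var v)
  have "(\<lambda>\<xi>. 1 * \<xi> (E v)) \<in> horner_funs B" using var assms(2) by (intro horner_funs.var_mult horner_funs.const) auto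
  then show ?case by simp
next
  case (add f g)
  show ?case by (rule horner_funs.add[OF add.IH])
next
  case (mult f g)
  show ?case by (rule horner_funs_mult[OF mult.IH])
qed

lemma prod_count_eq_prod_mset:
  fixes \<xi> :: "'v \<Rightarrow> 'p::comm_ring_1"
  shows "(\<Prod>v\<in>set_mset M. \<xi> v ^ count M v) = prod_mset (image_mset \<xi> M)"
proof -
  \<comment> \<open>The index set is widened to a fixed A, so that adding a variable to M changes
    one factor only.\<close>
  have "(\<Prod>v\<in>A. \<xi> v ^ count M v) = prod_mset (image_mset \<xi> M)" if "finite A" "set_mset M \<subseteq> A" for A
    using that(2)
  proof (induction M)
    case (add x M)
    have "(\<Prod>v\<in>A. \<xi> v ^ count (add_mset x M) v) = (\<Prod>v\<in>A. (\<xi> v ^ count M v) * (if v = x then \<xi> v else 1))"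
      by (intro prod.cong) (auto simp: mult.commute)
    also have "\<dots> = (\<Prod>v\<in>A. \<xi> v ^ count M v) * \<xi> x"
      using that(1) add.prems by (simp add: prod.distrib)
    finally show ?case using add by (simp add: mult.commute)
  qed simp
  then show ?thesis by simp
qed

context presentation
begin

lemma h_pow: "p \<in> T \<Longrightarrow> h (p ^ n) = h p [^] (n::nat)"
  using subring_power[OF T, of p] h_closed
  by (induction n) (simp_all add: h_one h_mult m_comm)

lemma h_prod: "finite A \<Longrightarrow> (\<And>i. i \<in> A \<Longrightarrow> f i \<in> T) \<Longrightarrow> h (prod f A) = (\<Otimes>i\<in>A. h (f i)) \<and> prod f A \<in> T"
proof (induction A rule: finite_induct)
  case (insert a A)
  then have "(\<lambda>i. h (f i)) \<in> A \<rightarrow> carrier S" "h (f a) \<in> carrier S" using h_closed by auto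
  then show ?case using insert Tcl(4) by (simp add: h_mult)
qed (simp add: h_one Tcl)

end

text \<open>The induction carries lifts F of the coefficients and a finite set A of monomials. A may
  exceed the support of f, since h can send a non-zero lift to zero; such terms drop out of the
  evaluation.\<close>

lemma (in presentation) polyfun_poly_eval:
  fixes B :: "'v set" and \<phi> :: "('v \<Rightarrow> 'q) \<Rightarrow> 'q"
  assumes TU: "T = UNIV" and \<phi>: "\<phi> \<in> horner_funs B"
  shows "\<exists>f\<in>indexed_pset B (carrier S). \<forall>\<xi> c. (\<forall>b\<in>B. c b = h (\<xi> b)) \<longrightarrow> poly_eval S f c = h (\<phi> \<xi>)"
proof -
  have hc: "h p \<in> carrier S" for p using h_closed TU by simp
  have "\<exists>f\<in>indexed_pset B (carrier S). \<exists>F A. finite A \<and> (\<forall>M\<in>A. set_mset M \<subseteq> B) \<and> f = (\<lambda>M. h (F M)) \<and>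
      (\<forall>M. M \<notin> A \<longrightarrow> F M = 0) \<and> \<phi> = (\<lambda>\<xi>. \<Sum>M\<in>A. F M * prod_mset (image_mset \<xi> M))"
    using \<phi>
  proof induction
    case (const a)
    have "indexed_const (h a) \<in> indexed_pset B (carrier S)" by (rule indexed_pset.indexed_const[OF hc])
    moreover have "indexed_const (h a) = (\<lambda>M. h (if M = {#} then a else 0))"
      unfolding indexed_const_def by (auto simp: h_zero)
    ultimately show ?case
      by (intro bexI[of _ "indexed_const (h a)"] exI[of _ "\<lambda>M. if M = {#} then a else 0"] exI[of _ "{{#}}"]) auto
  next
    case (add \<phi> \<psi>)
    obtain f F A where f: "f \<in> indexed_pset B (carrier S)" "finite A" "\<forall>M\<in>A. set_mset M \<subseteq> B" "f = (\<lambda>M. h (F M))"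
      "\<forall>M. M \<notin> A \<longrightarrow> F M = 0" "\<phi> = (\<lambda>\<xi>. \<Sum>M\<in>A. F M * prod_mset (image_mset \<xi> M))"
      using add.IH(1) by (elim bexE exE conjE)
    obtain g G C where g: "g \<in> indexed_pset B (carrier S)" "finite C" "\<forall>M\<in>C. set_mset M \<subseteq> B" "g = (\<lambda>M. h (G M))"
      "\<forall>M. M \<notin> C \<longrightarrow> G M = 0" "\<psi> = (\<lambda>\<xi>. \<Sum>M\<in>C. G M * prod_mset (image_mset \<xi> M))"
      using add.IH(2) by (elim bexE exE conjE)
    have "indexed_padd f g \<in> indexed_pset B (carrier S)" by (rule indexed_pset.indexed_padd[OF f(1) g(1)])
    moreover have "indexed_padd f g = (\<lambda>M. h (F M + G M))" by (simp add: indexed_padd_def f(4) g(4) h_add TU)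
    moreover have "(\<Sum>M\<in>A. F M * prod_mset (image_mset \<xi> M)) + (\<Sum>M\<in>C. G M * prod_mset (image_mset \<xi> M)) =
        (\<Sum>M\<in>A \<union> C. (F M + G M) * prod_mset (image_mset \<xi> M))" for \<xi> :: "'v \<Rightarrow> 'q"
    proof -
      have "(\<Sum>M\<in>A. F M * prod_mset (image_mset \<xi> M)) = (\<Sum>M\<in>A \<union> C. F M * prod_mset (image_mset \<xi> M))"
        using f g by (intro sum.mono_neutral_left) auto
      moreover have "(\<Sum>M\<in>C. G M * prod_mset (image_mset \<xi> M)) = (\<Sum>M\<in>A \<union> C. G M * prod_mset (image_mset \<xi> M))"
        using f g by (intro sum.mono_neutral_left) auto
      ultimately show ?thesis by (simp add: distrib_right sum.distrib)
    qed
    ultimately show ?case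
      using f(2,3,5) g(2,3,5) unfolding f(6) g(6)
      by (intro bexI[of _ "indexed_padd f g"] exI[of _ "\<lambda>M. F M + G M"] exI[of _ "A \<union> C"]) auto
  next
    case (var_mult \<phi> b)
    obtain f F A where f: "f \<in> indexed_pset B (carrier S)" "finite A" "\<forall>M\<in>A. set_mset M \<subseteq> B" "f = (\<lambda>M. h (F M))"
      "\<forall>M. M \<notin> A \<longrightarrow> F M = 0" "\<phi> = (\<lambda>\<xi>. \<Sum>M\<in>A. F M * prod_mset (image_mset \<xi> M))"
      using var_mult.IH by (elim bexE exE conjE)
    define G where "G M = (if b \<in># M then F (M - {#b#}) else 0)" for M
    have "indexed_pmult f b \<in> indexed_pset B (carrier S)" by (rule indexed_pset.indexed_pmult[OF f(1) var_mult.hyps(2)])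
    moreover have "indexed_pmult f b = (\<lambda>M. h (G M))" by (auto simp: indexed_pmult_def f(4) G_def h_zero)
    moreover have "(\<Sum>M\<in>A. F M * prod_mset (image_mset \<xi> M)) * \<xi> b =
        (\<Sum>M\<in>add_mset b ` A. G M * prod_mset (image_mset \<xi> M))" for \<xi> :: "'v \<Rightarrow> 'q"
    proof -
      have "(\<Sum>M\<in>add_mset b ` A. G M * prod_mset (image_mset \<xi> M)) = (\<Sum>M\<in>A. G (add_mset b M) * prod_mset (image_mset \<xi> (add_mset b M)))"
        by (subst sum.reindex) (auto simp: inj_on_def)
      then show ?thesis by (simp add: G_def sum_distrib_left mult_ac)
    qed
    moreover have "G M = 0" if "M \<notin> add_mset b ` A" for M
    proof (cases "b \<in># M")
      case True
      then have "M = add_mset b (M - {#b#})" by simp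
      then have "M - {#b#} \<notin> A" using that by (metis imageI)
      then show ?thesis using f(5) True by (simp add: G_def)
    qed (simp add: G_def)
    ultimately show ?case
      using f(2,3) var_mult.hyps(2) unfolding f(6)
      by (intro bexI[of _ "indexed_pmult f b"] exI[of _ G] exI[of _ "add_mset b ` A"]) auto
  qed
  then obtain f F A where f: "f \<in> indexed_pset B (carrier S)" "finite A" "\<forall>M\<in>A. set_mset M \<subseteq> B" "f = (\<lambda>M. h (F M))"
    "\<forall>M. M \<notin> A \<longrightarrow> F M = 0" "\<phi> = (\<lambda>\<xi>. \<Sum>M\<in>A. F M * prod_mset (image_mset \<xi> M))"
    by (elim bexE exE conjE)
  have "poly_eval S f c = h (\<phi> \<xi>)" if c: "\<forall>b\<in>B. c b = h (\<xi> b)" for \<xi> c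
  proof -
    have val: "(\<Otimes>v\<in>set_mset M. c v [^] count M v) = h (prod_mset (image_mset \<xi> M))" if "M \<in> A" for M
    proof -
      have "h (prod_mset (image_mset \<xi> M)) = (\<Otimes>v\<in>set_mset M. h (\<xi> v ^ count M v))"
        unfolding prod_count_eq_prod_mset[symmetric] using h_prod[of "set_mset M" "\<lambda>v. \<xi> v ^ count M v"] TU by simp
      also have "\<dots> = (\<Otimes>v\<in>set_mset M. c v [^] count M v)"
      proof (rule finprod_cong')
        have cv: "c v = h (\<xi> v)" if "v \<in> set_mset M" for v
          using bspec[OF c subsetD[OF bspec[OF f(3) \<open>M \<in> A\<close>] that]] .
        show "h (\<xi> v ^ count M v) = c v [^] count M v" if "v \<in> set_mset M" for v
          using cv[OF that] by (simp add: h_pow TU)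
        show "(\<lambda>v. c v [^] count M v) \<in> set_mset M \<rightarrow> carrier S"
          using cv hc by simp
      qed simp
      finally show ?thesis by simp
    qed
    have "h (\<phi> \<xi>) = (\<Oplus>M\<in>A. h (F M * prod_mset (image_mset \<xi> M)))"
      unfolding f(6) using f(2) TU by (intro h_sum) auto
    also have "\<dots> = (\<Oplus>M\<in>{M. f M \<noteq> \<zero>}. f M \<otimes> (\<Otimes>v\<in>set_mset M. c v [^] count M v))"
    proof (rule add.finprod_mono_neutral_cong_left[symmetric])
      show "finite A" by (rule f(2))
      show sub: "{M. f M \<noteq> \<zero>} \<subseteq> A" using f(4,5) h_zero by auto
      show "h (F M * prod_mset (image_mset \<xi> M)) = \<zero>" if "M \<in> A - {M. f M \<noteq> \<zero>}" for M
        using that f(4) hc by (simp add: h_mult TU)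
      show "f M \<otimes> (\<Otimes>v\<in>set_mset M. c v [^] count M v) = h (F M * prod_mset (image_mset \<xi> M))"
        if "M \<in> {M. f M \<noteq> \<zero>}" for M
        using val[of M] that sub f(4) by (auto simp: h_mult TU)
    qed (use hc in auto)
    finally show ?thesis by (simp add: poly_eval_def)
  qed
  then show ?thesis using f(1) by blast
qed

section \<open>The residue field, powers of the fiber space and general reductions\<close>

context fiber_setting
begin

definition kappa :: "'p \<Rightarrow> 'a set" where "kappa p = \<mm> +> \<pi> p"

lemma kappa_eq_iff: "kappa p = kappa q \<longleftrightarrow> p - q \<in> m"
  using quotient_eq_iff_same_a_r_cos[OF mm_ideal, of "\<pi> p" "\<pi> q"] h_closed by (simp add: kappa_def pull_def h_diff)

sublocale k: presentation UNIV "R Quot \<mm>" kappa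
proof
  interpret \<mm>: ideal \<mm> R by (rule mm_ideal)
  show "range kappa = carrier (R Quot \<mm>)"
    unfolding FactRing_def A_RCOSETS_def' kappa_def by (auto simp: image[symmetric])
  show "kappa (p + q) = kappa p \<oplus>\<^bsub>R Quot \<mm>\<^esub> kappa q" for p q
    using h_closed \<mm>.a_rcos_sum by (simp add: FactRing_def kappa_def h_add)
  show "kappa (p * q) = kappa p \<otimes>\<^bsub>R Quot \<mm>\<^esub> kappa q" for p q
    using h_closed \<mm>.rcoset_mult_add by (simp add: FactRing_def kappa_def h_mult)
  show "kappa 0 = \<zero>\<^bsub>R Quot \<mm>\<^esub>" using \<mm>.a_subset by (simp add: FactRing_def kappa_def h_zero)
  show "kappa 1 = \<one>\<^bsub>R Quot \<mm>\<^esub>" by (simp add: FactRing_def kappa_def h_one)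
qed simp

definition vcos :: "'p \<Rightarrow> 'a set" where "vcos p = \<mm> \<cdot> I 1 +> \<pi> p"

definition V where "V = fiber_space R \<mm> (I 1)"

lemma vcos_eq_iff: "vcos p = vcos q \<longleftrightarrow> p - q \<in> KF 1"
  unfolding vcos_def by (rule F.Kcoset)

lemma V_carrier: "carrier V = vcos ` pull (I 1)"
proof -
  have "x \<in> I 1 \<longleftrightarrow> (\<exists>p\<in>pull (I 1). x = \<pi> p)" for x
  proof
    assume "x \<in> I 1"
    then obtain p where "p \<in> UNIV" "x = \<pi> p" using h_onto[OF I_car] by metis
    then show "\<exists>p\<in>pull (I 1). x = \<pi> p" using \<open>x \<in> I 1\<close> by (auto simp: pull_def)
  qed (auto simp: pull_def)
  then show ?thesis by (auto simp: V_def fiber_space_def vcos_def image_iff)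
qed

lemma V_add: "vcos p \<oplus>\<^bsub>V\<^esub> vcos q = vcos (p + q)"
  using ideal.a_rcos_sum[OF mI_ideal[of 1]] h_closed by (simp add: V_def fiber_space_def vcos_def h_add)

lemma V_zero: "\<zero>\<^bsub>V\<^esub> = vcos 0"
  using F.K_add_zero[of 1] by (simp add: V_def fiber_space_def vcos_def h_zero)

text \<open>The scalar product is a union over representatives of both classes; all give the same
  coset, since \<open>\<mm> \<cdot> I 1\<close> absorbs the changes.\<close>

lemma V_smult:
  assumes p: "p \<in> pull (I 1)" shows "kappa u \<odot>\<^bsub>V\<^esub> vcos p = vcos (u * p)"
proof -
  have key: "\<mm> \<cdot> I 1 +> (a \<otimes> x) = vcos (u * p)" if a: "a \<in> kappa u" and x: "x \<in> vcos p" for a x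
  proof -
    obtain k where k: "k \<in> \<mm>" "a = k \<oplus> \<pi> u" using a unfolding kappa_def a_r_coset_def' by blast
    obtain q where q: "q \<in> UNIV" "k = \<pi> q" by (rule h_onto[OF ideal.Icarr[OF mm_ideal k(1)]])
    obtain s where s: "x = \<pi> s" "s - p \<in> KF 1" using x unfolding vcos_def by (rule F.mem_Kcoset)
    have "(q + u) * (s - p) + q * p \<in> KF 1"
      using LF.mI[OF _ p, of q] k(1) q(2) by (intro F.G.Kcl(2) F.G.Kcl(5)[OF s(2)]) (simp add: pull_def)
    then have "(q + u) * s - u * p \<in> KF 1" by (simp add: algebra_simps)
    then have "vcos ((q + u) * s) = vcos (u * p)" by (simp only: vcos_eq_iff)
    then show ?thesis using k q s by (simp add: vcos_def h_add h_mult)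
  qed
  have "(\<Union>a\<in>kappa u. \<Union>x\<in>vcos p. \<mm> \<cdot> I 1 +> (a \<otimes> x)) = (\<Union>a\<in>kappa u. \<Union>x\<in>vcos p. vcos (u * p))"
    using key by (intro SUP_cong refl) auto
  moreover have "\<pi> u \<in> kappa u"
    using abelian_subgroup.a_rcos_self[OF abelian_subgroupI3[OF ideal.axioms(1)[OF mm_ideal] is_abelian_group], of "\<pi> u"] h_closed
    by (simp add: kappa_def)
  then have "kappa u \<noteq> {}" by blast
  moreover have "vcos p \<noteq> {}" using F.self_Kcoset[of p 1] by (auto simp: vcos_def)
  ultimately have "(\<Union>a\<in>kappa u. \<Union>x\<in>vcos p. \<mm> \<cdot> I 1 +> (a \<otimes> x)) = vcos (u * p)" by (simp only: UN_constant if_False)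
  then show ?thesis by (simp add: V_def fiber_space_def)
qed

definition vec :: "nat \<Rightarrow> (nat \<Rightarrow> 'p) \<Rightarrow> nat \<Rightarrow> 'a set" where
  "vec r Xv = (\<lambda>i\<in>{..<r}. vcos (Xv i))"

abbreviation "Vp r \<equiv> module_power V r"

lemma vec_cong: "(\<And>i. i < r \<Longrightarrow> Xv i = Y i) \<Longrightarrow> vec r Xv = vec r Y"
  unfolding vec_def by (intro restrict_ext) simp

lemma vec_eq_iff: "vec r Xv = vec r Y \<longleftrightarrow> (\<forall>i<r. Xv i - Y i \<in> KF 1)"
proof
  assume "vec r Xv = vec r Y"
  then have "vec r Xv i = vec r Y i" for i by simp
  then have "vcos (Xv i) = vcos (Y i)" if "i < r" for i using that unfolding vec_def by (metis lessThan_iff restrict_apply')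
  then show "\<forall>i<r. Xv i - Y i \<in> KF 1" by (simp add: vcos_eq_iff)
next
  assume "\<forall>i<r. Xv i - Y i \<in> KF 1"
  then show "vec r Xv = vec r Y" unfolding vec_def by (intro restrict_ext) (simp add: vcos_eq_iff)
qed

lemma vec_closed: "\<forall>i<r. Xv i \<in> pull (I 1) \<Longrightarrow> vec r Xv \<in> carrier (Vp r)"
  by (auto simp: module_power_def vec_def V_carrier)

lemma vec_onto:
  assumes "w \<in> carrier (Vp r)" obtains Xv where "\<forall>i<r. Xv i \<in> pull (I 1)" "w = vec r Xv"
proof -
  have w: "w \<in> {..<r} \<rightarrow>\<^sub>E vcos ` pull (I 1)" using assms by (simp add: module_power_def V_carrier)
  have "\<forall>i. \<exists>p. i < r \<longrightarrow> p \<in> pull (I 1) \<and> w i = vcos p" using w by (auto simp: PiE_iff image_iff)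
  from choice[OF this] obtain Xv where Xv: "\<forall>i. i < r \<longrightarrow> Xv i \<in> pull (I 1) \<and> w i = vcos (Xv i)" ..
  have "w = vec r Xv" unfolding vec_def
  proof (rule extensionalityI[of _ "{..<r}"])
    show "w \<in> extensional {..<r}" using w by (simp add: PiE_iff)
  qed (use Xv in auto)
  then show thesis using that Xv by blast
qed

lemma vec_add: "vec r Xv \<oplus>\<^bsub>Vp r\<^esub> vec r Y = vec r (\<lambda>i. Xv i + Y i)"
  unfolding vec_def module_power_def by (auto simp: V_add intro!: restrict_ext)

lemma vec_smult: "\<forall>i<r. Xv i \<in> pull (I 1) \<Longrightarrow> kappa u \<odot>\<^bsub>Vp r\<^esub> vec r Xv = vec r (\<lambda>i. u * Xv i)"
  unfolding vec_def module_power_def by (auto simp: V_smult intro!: restrict_ext)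

lemma vec_zero: "\<zero>\<^bsub>Vp r\<^esub> = vec r (\<lambda>_. 0)"
  unfolding vec_def module_power_def by (simp add: V_zero)

lemma Vp_monoid: "abelian_monoid (Vp r)"
proof (rule abelian_monoidI)
  fix x y z assume "x \<in> carrier (Vp r)" "y \<in> carrier (Vp r)" "z \<in> carrier (Vp r)"
  then obtain Xv Y U where e: "x = vec r Xv" "y = vec r Y" "z = vec r U" by (metis vec_onto)
  show "x \<oplus>\<^bsub>Vp r\<^esub> y \<oplus>\<^bsub>Vp r\<^esub> z = x \<oplus>\<^bsub>Vp r\<^esub> (y \<oplus>\<^bsub>Vp r\<^esub> z)" by (simp add: e vec_add add.assoc)
next
  fix x y assume x: "x \<in> carrier (Vp r)" and y: "y \<in> carrier (Vp r)"
  obtain Xv where Xv: "\<forall>i<r. Xv i \<in> pull (I 1)" "x = vec r Xv" using x by (rule vec_onto)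
  obtain Y where Y: "\<forall>i<r. Y i \<in> pull (I 1)" "y = vec r Y" using y by (rule vec_onto)
  show "x \<oplus>\<^bsub>Vp r\<^esub> y = y \<oplus>\<^bsub>Vp r\<^esub> x" by (simp add: Xv Y vec_add add.commute)
  show "x \<oplus>\<^bsub>Vp r\<^esub> y \<in> carrier (Vp r)" unfolding Xv(2) Y(2) vec_add using Xv(1) Y(1) F.G.Icl(2) by (intro vec_closed) simp
next
  fix x assume "x \<in> carrier (Vp r)"
  then obtain Xv where Xv: "x = vec r Xv" by (metis vec_onto)
  show "\<zero>\<^bsub>Vp r\<^esub> \<oplus>\<^bsub>Vp r\<^esub> x = x" by (simp add: Xv vec_zero vec_add)
next
  show "\<zero>\<^bsub>Vp r\<^esub> \<in> carrier (Vp r)" unfolding vec_zero using F.G.Icl(1) by (intro vec_closed) simp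
qed

lemma lin_comb_vec:
  assumes "finite B" "\<forall>b\<in>B. (\<forall>i<r. Y b i \<in> pull (I 1)) \<and> b = vec r (Y b) \<and> c b = kappa (\<xi> b)"
  shows "lin_comb (Vp r) B c = vec r (\<lambda>i. \<Sum>b\<in>B. \<xi> b * Y b i)"
  using assms
proof (induction B rule: finite_induct)
  case empty
  interpret abelian_monoid "Vp r" by (rule Vp_monoid)
  show ?case by (simp add: lin_comb_def vec_zero)
next
  case (insert a B)
  interpret W: abelian_monoid "Vp r" by (rule Vp_monoid)
  have t: "c b \<odot>\<^bsub>Vp r\<^esub> b = vec r (\<lambda>i. \<xi> b * Y b i)" "vec r (\<lambda>i. \<xi> b * Y b i) \<in> carrier (Vp r)" if "b \<in> insert a B" for b
  proof -
    have b: "\<forall>i<r. Y b i \<in> pull (I 1)" "b = vec r (Y b)" "c b = kappa (\<xi> b)" using insert.prems that by blast+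
    have "c b \<odot>\<^bsub>Vp r\<^esub> b = kappa (\<xi> b) \<odot>\<^bsub>Vp r\<^esub> vec r (Y b)" using b(2,3) by metis
    then show "c b \<odot>\<^bsub>Vp r\<^esub> b = vec r (\<lambda>i. \<xi> b * Y b i)" using vec_smult[OF b(1)] by simp
    show "vec r (\<lambda>i. \<xi> b * Y b i) \<in> carrier (Vp r)" using b(1) F.G.Icl(5) by (intro vec_closed) simp
  qed
  have "(\<lambda>b. c b \<odot>\<^bsub>Vp r\<^esub> b) \<in> B \<rightarrow> carrier (Vp r)" using t by simp
  then have "lin_comb (Vp r) (insert a B) c = (c a \<odot>\<^bsub>Vp r\<^esub> a) \<oplus>\<^bsub>Vp r\<^esub> lin_comb (Vp r) B c"
    unfolding lin_comb_def using insert.hyps t[of a] by (intro W.finsum_insert) auto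
  also have "lin_comb (Vp r) B c = vec r (\<lambda>i. \<Sum>b\<in>B. \<xi> b * Y b i)" using insert by simp
  finally show ?case using t(1)[of a] insert.hyps by (simp add: vec_add)
qed

text \<open>Z is the kernel of \<pi>, so \<open>sub\<close> becomes one inclusion in R; the other is
  multiplicativity of the filtration.\<close>

lemma reduction_equality:
  assumes x: "\<forall>i<r. Xv i \<in> pull (I 1)" "\<forall>i<r. x i = \<pi> (Xv i)"
    and sub: "pull (I (Suc k)) \<subseteq> LF.xI Xv r (Suc k)"
  shows "I (Suc k) = (Idl (x ` {..<r})) \<cdot> I k"
proof
  have xI: "x ` {..<r} \<subseteq> I 1" using x by (auto simp: pull_def)
  then have xR: "x ` {..<r} \<subseteq> carrier R" using I_car by blast
  have idI: "Idl (x ` {..<r}) \<subseteq> I 1" by (rule genideal_minimal[OF filt(1) xI])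
  show "(Idl (x ` {..<r})) \<cdot> I k \<subseteq> I (Suc k)"
  proof
    fix a assume "a \<in> (Idl (x ` {..<r})) \<cdot> I k"
    then show "a \<in> I (Suc k)"
    proof (induction a rule: ideal_prod.induct)
      case (prod i j)
      then show ?case using II_mult[of i 1 j k] idI by auto
    next
      case (sum s1 s2)
      show ?case by (rule additive_subgroup.a_closed[OF ideal.axioms(1)[OF filt(1)] sum.IH])
    qed
  qed
  have D: "ideal ((Idl (x ` {..<r})) \<cdot> I k) R" by (rule ideal_prod_is_ideal[OF genideal_ideal[OF xR] filt(1)])
  note Di = pull_ideal[OF D]
  show "I (Suc k) \<subseteq> (Idl (x ` {..<r})) \<cdot> I k"
  proof
    fix a assume a: "a \<in> I (Suc k)"
    obtain p where p: "p \<in> UNIV" "a = \<pi> p" by (rule h_onto[OF I_car[OF a]])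
    have "p \<in> LF.xI Xv r (Suc k)" using a sub p(2) by (auto simp: pull_def)
    then obtain c where c: "\<forall>i<r. c i \<in> F.G.Ipred (Suc k)" "p - (\<Sum>i<r. c i * Xv i) \<in> Z" unfolding LF.xI_def by (elim CollectE exE conjE)
    have "c i * Xv i \<in> pull ((Idl (x ` {..<r})) \<cdot> I k)" if i: "i < r" for i
    proof -
      have "x i \<in> Idl (x ` {..<r})" using genideal_self[OF xR] i by blast
      moreover have "c i \<in> pull (I k)" using c(1) i by simp
      then have "\<pi> (c i) \<in> I k" by (simp add: pull_def)
      ultimately have "x i \<otimes> \<pi> (c i) \<in> (Idl (x ` {..<r})) \<cdot> I k" by (rule ideal_prod.prod)
      moreover have "x i \<otimes> \<pi> (c i) = \<pi> (c i * Xv i)" using x(2) i by (simp add: h_mult m_comm h_closed)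
      ultimately show ?thesis by (simp add: pull_def)
    qed
    then have "(\<Sum>i<r. c i * Xv i) \<in> pull ((Idl (x ` {..<r})) \<cdot> I k)" by (intro ideal_of_sum[OF Di]) simp
    moreover have "p - (\<Sum>i<r. c i * Xv i) \<in> pull ((Idl (x ` {..<r})) \<cdot> I k)" using Z_sub[OF D] c(2) by blast
    ultimately have "(p - (\<Sum>i<r. c i * Xv i)) + (\<Sum>i<r. c i * Xv i) \<in> pull ((Idl (x ` {..<r})) \<cdot> I k)"
      by (intro ideal_ofD(3)[OF Di])
    then show "a \<in> (Idl (x ` {..<r})) \<cdot> I k" using p by (simp add: pull_def)
  qed
qed

text \<open>The basis consists of the vectors \<open>E (i, t)\<close> with the generator
  \<open>g t\<close> at place i and zero elsewhere. Coordinates in it are the \<xi> of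
  \<open>reduction_open\<close>, and a single polynomial, not vanishing at the coordinates of y,
  defines the open set.\<close>

theorem general_reductions:
  assumes y: "reduces r y"
    and Q: "\<And>x Xv. \<forall>i<r. x i = \<pi> (Xv i) \<Longrightarrow> reduces r Xv \<Longrightarrow> Q x"
  shows "general_elements R \<mm> (I 1) r Q"
proof -
  obtain J :: "nat set" and g where J: "finite J" and g: "\<forall>j\<in>J. g j \<in> pull (I 1)"
    and ggen: "\<forall>a\<in>pull (I 1). \<exists>c. a - (\<Sum>j\<in>J. c j * g j) \<in> KF 1"
    and gind: "\<forall>c. (\<Sum>j\<in>J. c j * g j) \<in> KF 1 \<longrightarrow> (\<forall>j\<in>J. c j \<in> m)"
    by (rule LF.minimal_generators)
  have yI: "\<forall>i<r. y i \<in> pull (I 1)" using y by (simp add: reduces_def)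
  have coords: "\<exists>\<eta>. \<forall>i<r. Xv i - (\<Sum>t\<in>J. \<eta> (i, t) * g t) \<in> KF 1" if Xv: "\<forall>i<r. Xv i \<in> pull (I 1)" for Xv
  proof -
    have "\<forall>i. \<exists>c. i < r \<longrightarrow> Xv i - (\<Sum>t\<in>J. c t * g t) \<in> KF 1" using ggen Xv by simp
    from choice[OF this] obtain c where "\<forall>i. i < r \<longrightarrow> Xv i - (\<Sum>t\<in>J. c i t * g t) \<in> KF 1" ..
    then show ?thesis by (intro exI[of _ "\<lambda>(i, t). c i t"]) simp
  qed
  obtain \<eta> where \<eta>: "\<forall>i<r. y i - (\<Sum>t\<in>J. \<eta> (i, t) * g t) \<in> KF 1" using coords[OF yI] ..
  obtain N where N: "\<forall>n\<ge>N. \<forall>a\<in>pull (I n). \<exists>c. (\<forall>i<r. c i \<in> F.G.Ipred n) \<and> a - (\<Sum>i<r. c i * y i) \<in> KF n"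
    using y unfolding reduces_def by blast
  from LF.reduction_open[OF J g yI \<eta> N]
  obtain \<phi> where \<phi>: "\<phi> \<in> polyfuns ({..<r} \<times> J)" "\<phi> \<eta> \<notin> m"
    and open': "\<forall>\<xi> x. \<phi> \<xi> \<notin> m \<longrightarrow> (\<forall>i<r. x i \<in> pull (I 1)) \<longrightarrow> (\<forall>i<r. x i - (\<Sum>t\<in>J. \<xi> (i, t) * g t) \<in> KF 1) \<longrightarrow>
      (\<exists>N. \<forall>n\<ge>N. \<forall>a\<in>pull (I n). \<exists>c. (\<forall>i<r. c i \<in> F.G.Ipred n) \<and> a - (\<Sum>i<r. c i * x i) \<in> KF n)"
    by (elim bexE conjE)
  define E0 where "E0 v i = (if i = fst v then g (snd v) else 0)" for v :: "nat \<times> nat" and i :: nat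
  define E where "E v = vec r (E0 v)" for v
  define D where "D = {..<r} \<times> J"
  define B where "B = E ` D"
  have E0I: "\<forall>i<r. E0 v i \<in> pull (I 1)" if "v \<in> D" for v using g that F.G.Icl(1) by (auto simp: E0_def D_def)
  have sumE0: "(\<Sum>v\<in>D. \<xi> v * E0 v i) = (\<Sum>t\<in>J. \<xi> (i, t) * g t)" if "i < r" for \<xi> :: "nat \<times> nat \<Rightarrow> 'p" and i
  proof -
    have "(\<Sum>v\<in>D. \<xi> v * E0 v i) = (\<Sum>i'<r. \<Sum>t\<in>J. \<xi> (i', t) * E0 (i', t) i)"
      unfolding D_def using J by (simp add: sum.cartesian_product split_def)
    also have "\<dots> = (\<Sum>i'<r. if i' = i then \<Sum>t\<in>J. \<xi> (i, t) * g t else 0)"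
      by (intro sum.cong) (auto simp: E0_def)
    also have "\<dots> = (\<Sum>t\<in>J. \<xi> (i, t) * g t)" using that by simp
    finally show ?thesis .
  qed
  have indep: "\<forall>v\<in>D. \<xi> v - \<zeta> v \<in> m"
    if eq: "\<forall>i<r. (\<Sum>t\<in>J. \<xi> (i, t) * g t) - (\<Sum>t\<in>J. \<zeta> (i, t) * g t) \<in> KF 1" for \<xi> \<zeta> :: "nat \<times> nat \<Rightarrow> 'p"
  proof
    fix v assume "v \<in> D"
    then obtain i t where v: "v = (i, t)" "i < r" "t \<in> J" by (auto simp: D_def)
    have "(\<Sum>t\<in>J. (\<xi> (i, t) - \<zeta> (i, t)) * g t) \<in> KF 1" using eq v(2) by (simp add: left_diff_distrib sum_subtractf)
    with gind have "\<forall>t\<in>J. \<xi> (i, t) - \<zeta> (i, t) \<in> m" by (elim allE[of _ "\<lambda>t. \<xi> (i, t) - \<zeta> (i, t)"]) simp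
    then show "\<xi> v - \<zeta> v \<in> m" using v by simp
  qed
  have finD: "finite D" using J by (simp add: D_def)
  \<comment> \<open>The basis is a set, so index pairs must be recoverable from vectors; two equal
    vectors would contradict independence modulo m.\<close>
  have injE: "inj_on E D"
  proof (rule inj_onI, rule ccontr)
    fix v w assume vw: "v \<in> D" "w \<in> D" "E v = E w" "v \<noteq> w"
    have delta: "(\<Sum>u\<in>D. (if u = v then 1 else 0) * E0 u i) = E0 v i" if "v \<in> D" for v i
    proof -
      have "(\<Sum>u\<in>D. (if u = v then 1 else 0) * E0 u i) = (\<Sum>u\<in>D. if u = v then E0 u i else 0)" by (intro sum.cong) auto
      also have "\<dots> = E0 v i" using that finD by simp
      finally show ?thesis .
    qed
    have "\<forall>i<r. E0 v i - E0 w i \<in> KF 1" using vw(3) by (simp only: E_def vec_eq_iff)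
    then have "\<forall>i<r. (\<Sum>t\<in>J. (if (i, t) = v then 1 else 0) * g t) - (\<Sum>t\<in>J. (if (i, t) = w then 1 else 0) * g t) \<in> KF 1"
      using sumE0[of _ "\<lambda>u. if u = v then 1 else 0"] sumE0[of _ "\<lambda>u. if u = w then 1 else 0"] delta[OF vw(1)] delta[OF vw(2)] by simp
    from indep[OF this] vw(1) have "(if v = v then 1 else 0) - (if v = w then 1 else 0) \<in> m" by (rule bspec)
    then show False using vw(4) maximal_setD(2)[OF maximal_m] by simp
  qed
  have finB: "finite B" using finD by (simp add: B_def)
  have lin: "lin_comb (Vp r) B c = vec r (\<lambda>i. \<Sum>t\<in>J. \<xi> (E (i, t)) * g t)" if c: "\<forall>b\<in>B. c b = kappa (\<xi> b)" for c \<xi>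
  proof -
    define Y where "Y b = E0 (the_inv_into D E b)" for b
    have Y: "Y (E v) = E0 v" if "v \<in> D" for v using the_inv_into_f_f[OF injE that] by (simp add: Y_def)
    have "\<forall>b\<in>B. (\<forall>i<r. Y b i \<in> pull (I 1)) \<and> b = vec r (Y b) \<and> c b = kappa (\<xi> b)"
    proof
      fix b assume b: "b \<in> B"
      then obtain v where v: "v \<in> D" "b = E v" by (auto simp: B_def)
      show "(\<forall>i<r. Y b i \<in> pull (I 1)) \<and> b = vec r (Y b) \<and> c b = kappa (\<xi> b)"
        using E0I[OF v(1)] Y[OF v(1)] c b v(2) by (simp add: E_def)
    qed
    then have "lin_comb (Vp r) B c = vec r (\<lambda>i. \<Sum>b\<in>B. \<xi> b * Y b i)" by (rule lin_comb_vec[OF finB])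
    also have "\<dots> = vec r (\<lambda>i. \<Sum>t\<in>J. \<xi> (E (i, t)) * g t)"
    proof (rule vec_cong)
      fix i assume i: "i < r"
      have "(\<Sum>b\<in>B. \<xi> b * Y b i) = (\<Sum>v\<in>D. \<xi> (E v) * E0 v i)"
        unfolding B_def by (subst sum.reindex[OF injE]) (simp add: Y)
      then show "(\<Sum>b\<in>B. \<xi> b * Y b i) = (\<Sum>t\<in>J. \<xi> (E (i, t)) * g t)" using sumE0[OF i, of "\<lambda>v. \<xi> (E v)"] by simp
    qed
    finally show ?thesis .
  qed
  have lift: "\<exists>\<xi>. \<forall>b\<in>B. c b = kappa (\<xi> b)" if "c \<in> B \<rightarrow>\<^sub>E carrier (R Quot \<mm>)" for c
  proof -
    have "\<forall>b. \<exists>q. b \<in> B \<longrightarrow> c b = kappa q"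
    proof
      fix b show "\<exists>q. b \<in> B \<longrightarrow> c b = kappa q" using that k.image by (metis PiE_mem imageE)
    qed
    from choice[OF this] show ?thesis by blast
  qed
  have basis: "module_basis (R Quot \<mm>) (Vp r) B"
    unfolding module_basis_def
  proof (intro conjI ballI)
    show "finite B" by (rule finB)
    show "B \<subseteq> carrier (Vp r)" unfolding B_def E_def using vec_closed[OF E0I] by blast
    fix w assume "w \<in> carrier (Vp r)"
    then obtain Xv where Xv: "\<forall>i<r. Xv i \<in> pull (I 1)" "w = vec r Xv" by (rule vec_onto)
    obtain \<xi> where \<xi>: "\<forall>i<r. Xv i - (\<Sum>t\<in>J. \<xi> (i, t) * g t) \<in> KF 1" using coords[OF Xv(1)] ..
    define c where "c = (\<lambda>b\<in>B. kappa (\<xi> (the_inv_into D E b)))"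
    have c: "c \<in> B \<rightarrow>\<^sub>E carrier (R Quot \<mm>)" unfolding c_def using k.h_closed by simp
    have "lin_comb (Vp r) B c = vec r (\<lambda>i. \<Sum>t\<in>J. \<xi> (the_inv_into D E (E (i, t))) * g t)"
      by (rule lin) (simp add: c_def)
    also have "\<dots> = vec r (\<lambda>i. \<Sum>t\<in>J. \<xi> (i, t) * g t)"
      using the_inv_into_f_f[OF injE] by (intro vec_cong sum.cong refl) (simp add: D_def)
    also have "\<dots> = w" unfolding Xv(2) using \<xi> by (subst eq_commute) (simp only: vec_eq_iff)
    finally have wc: "w = lin_comb (Vp r) B c" by simp
    show "\<exists>!c. c \<in> B \<rightarrow>\<^sub>E carrier (R Quot \<mm>) \<and> w = lin_comb (Vp r) B c"
    proof (rule ex1I[of _ c])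
      show "c \<in> B \<rightarrow>\<^sub>E carrier (R Quot \<mm>) \<and> w = lin_comb (Vp r) B c" using c wc by blast
      fix d assume d: "d \<in> B \<rightarrow>\<^sub>E carrier (R Quot \<mm>) \<and> w = lin_comb (Vp r) B d"
      obtain \<xi>1 where 1: "\<forall>b\<in>B. c b = kappa (\<xi>1 b)" using lift[OF c] ..
      obtain \<xi>2 where 2: "\<forall>b\<in>B. d b = kappa (\<xi>2 b)" using lift[of d] d by blast
      have "vec r (\<lambda>i. \<Sum>t\<in>J. \<xi>2 (E (i, t)) * g t) = vec r (\<lambda>i. \<Sum>t\<in>J. \<xi>1 (E (i, t)) * g t)"
        using lin[OF 1] lin[OF 2] wc d by simp
      then have "\<forall>v\<in>D. \<xi>2 (E v) - \<xi>1 (E v) \<in> m"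
        by (intro indep[of "\<lambda>v. \<xi>2 (E v)" "\<lambda>v. \<xi>1 (E v)"]) (simp only: vec_eq_iff)
      then have "d b = c b" if b: "b \<in> B" for b
      proof -
        obtain v where "v \<in> D" "b = E v" using b by (auto simp: B_def)
        then have "kappa (\<xi>2 b) = kappa (\<xi>1 b)" using \<open>\<forall>v\<in>D. _\<close> by (simp only: kappa_eq_iff)
        then show ?thesis using bspec[OF 1 b] bspec[OF 2 b] by (simp only:)
      qed
      then show "d = c" using c d by (intro PiE_ext[of d B _ c]) auto
    qed
  qed
  have "E ` ({..<r} \<times> J) \<subseteq> B" by (simp add: B_def D_def)
  from k.polyfun_poly_eval[OF refl polyfuns_reindex[OF \<phi>(1) this]]
  obtain f where f: "f \<in> ring.indexed_pset (R Quot \<mm>) B (carrier (R Quot \<mm>))"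
    and feval: "\<forall>\<xi> c. (\<forall>b\<in>B. c b = kappa (\<xi> b)) \<longrightarrow> poly_eval (R Quot \<mm>) f c = kappa (\<phi> (\<lambda>v. \<xi> (E v)))" by blast
  have kz: "kappa p = \<zero>\<^bsub>R Quot \<mm>\<^esub> \<longleftrightarrow> p \<in> m" for p using kappa_eq_iff[of p 0] k.h_zero by simp
  \<comment> \<open>The value of f at the coordinates of y is not zero, so f cannot be the zero
    polynomial.\<close>
  have "f \<noteq> (\<lambda>M. \<zero>\<^bsub>R Quot \<mm>\<^esub>)"
  proof
    assume f0: "f = (\<lambda>M. \<zero>\<^bsub>R Quot \<mm>\<^esub>)"
    define \<xi> where "\<xi> b = \<eta> (the_inv_into D E b)" for b
    have \<xi>: "\<xi> (E v) = \<eta> v" if "v \<in> D" for v using the_inv_into_f_f[OF injE that] by (simp add: \<xi>_def)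
    \<comment> \<open>The assignments agree on D only, which is enough since \<phi> involves no
      other variables.\<close>
    have dep: "\<phi> \<xi>1 = \<phi> \<xi>2" if "\<forall>v\<in>D. \<xi>1 v = \<xi>2 v" for \<xi>1 \<xi>2
      using \<phi>(1) that by (induction rule: polyfuns.induct) (auto simp: D_def)
    have "poly_eval (R Quot \<mm>) f (\<lambda>b. kappa (\<xi> b)) = \<zero>\<^bsub>R Quot \<mm>\<^esub>" unfolding poly_eval_def f0 by simp
    moreover have "poly_eval (R Quot \<mm>) f (\<lambda>b. kappa (\<xi> b)) = kappa (\<phi> (\<lambda>v. \<xi> (E v)))" using feval by simp
    moreover have "\<phi> (\<lambda>v. \<xi> (E v)) = \<phi> \<eta>" using \<xi> by (intro dep) simp
    ultimately show False using kz[of "\<phi> \<eta>"] \<phi>(2) by simp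
  qed
  define U where "U = {w \<in> carrier (Vp r). poly_eval (R Quot \<mm>) f (coordinates (R Quot \<mm>) (Vp r) B w) \<noteq> \<zero>\<^bsub>R Quot \<mm>\<^esub>}"
  have "nonempty_zariski_open (R Quot \<mm>) (Vp r) U"
    unfolding nonempty_zariski_open_def
    using basis f \<open>f \<noteq> _\<close> by (intro exI[of _ B] exI[of _ "{f}"]) (simp add: U_def)
  moreover have "Q x" if x: "\<forall>i<r. x i \<in> I 1" and xU: "(\<lambda>i\<in>{..<r}. \<mm> \<cdot> I 1 +> x i) \<in> U" for x
  proof -
    have "\<forall>i. \<exists>p. i < r \<longrightarrow> x i = \<pi> p"
    proof
      fix i show "\<exists>p. i < r \<longrightarrow> x i = \<pi> p" using x I_car[of "x i" 1] image by (metis imageE)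
    qed
    from choice[OF this] obtain Xv where Xv: "\<forall>i. i < r \<longrightarrow> x i = \<pi> (Xv i)" ..
    have XI: "\<forall>i<r. Xv i \<in> pull (I 1)" using Xv x by (simp add: pull_def)
    have w: "(\<lambda>i\<in>{..<r}. \<mm> \<cdot> I 1 +> x i) = vec r Xv" unfolding vec_def vcos_def using Xv by (intro restrict_ext) simp
    let ?c = "coordinates (R Quot \<mm>) (Vp r) B (vec r Xv)"
    have "\<exists>!c. c \<in> B \<rightarrow>\<^sub>E carrier (R Quot \<mm>) \<and> vec r Xv = lin_comb (Vp r) B c"
      using basis vec_closed[OF XI] unfolding module_basis_def by blast
    from theI'[OF this] have c: "?c \<in> B \<rightarrow>\<^sub>E carrier (R Quot \<mm>)" "vec r Xv = lin_comb (Vp r) B ?c"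
      unfolding coordinates_def by (rule conjunct1, rule conjunct2)
    obtain \<xi> where \<xi>: "\<forall>b\<in>B. ?c b = kappa (\<xi> b)" using lift[OF c(1)] ..
    have "poly_eval (R Quot \<mm>) f ?c = kappa (\<phi> (\<lambda>v. \<xi> (E v)))" using feval \<xi> by blast
    then have "kappa (\<phi> (\<lambda>v. \<xi> (E v))) \<noteq> \<zero>\<^bsub>R Quot \<mm>\<^esub>" using xU unfolding w U_def by simp
    then have "\<phi> (\<lambda>v. \<xi> (E v)) \<notin> m" by (simp add: kz)
    moreover have "\<forall>i<r. Xv i - (\<Sum>t\<in>J. \<xi> (E (i, t)) * g t) \<in> KF 1"
      using c(2) lin[OF \<xi>] by (simp only: vec_eq_iff)
    ultimately have "reduces r Xv" unfolding reduces_def using open' XI by simp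
    then show "Q x" using Q Xv by blast
  qed
  ultimately show ?thesis unfolding general_elements_def V_def by blast
qed

end

theorem theorem1p6:
  fixes R :: "('a, 'b) ring_scheme" and \<mm> :: "'a set" and I :: "nat \<Rightarrow> 'a set" and r n :: nat
  assumes "cohen_macaulay_local R \<mm>"
    and "infinite (carrier (R Quot \<mm>))"
    and "good_filtration R I"
    and "equimultiple R \<mm> I"
    and "analytic_spread R \<mm> I = enat r"
    and "grade (associated_graded R I) (associated_graded_plus R I) \<ge> enat r"
    and "cohen_macaulay (fiber_cone R \<mm> I)"
    and "n \<ge> 1"
    and "min_generators R (I n) < (n + r) choose r"
  shows "general_elements R \<mm> (I 1) r
           (\<lambda>x. \<forall>m\<ge>n. I m = (Idl\<^bsub>R\<^esub> (x ` {..<r})) \<cdot>\<^bsub>R\<^esub> I (m - 1))"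
proof -
  have loc: "cring R" "noetherian_ring R" "\<And>M. maximalideal M R \<longleftrightarrow> M = \<mm>"
    using assms(1) by (auto simp: cohen_macaulay_local_def local_ring_def)
  obtain \<pi> :: "'a free_cring \<Rightarrow> 'a" where \<pi>: "presentation UNIV R \<pi>" using presentation_ev[OF loc(1)] ..
  interpret fiber_setting R \<pi> \<mm> I
  proof (intro fiber_setting.intro fiber_setting_axioms.intro \<pi> loc assms(2,3))
    show "noetherian_ring (fiber_cone R \<mm> I)" using assms(7) by (simp add: cohen_macaulay_def)
  qed
  have dim: "krull_dim FC = enat r" using assms(5) by (simp add: analytic_spread_def)
  \<comment> \<open>If I_1 = R, no prime contains it and its height is infinite, while by
    equimultiplicity the height is r.\<close>
  have I1: "I 1 \<noteq> carrier R"
  proof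
    assume eq: "I 1 = carrier R"
    have "\<not> (primeideal P R \<and> I 1 \<subseteq> P)" for P
      using eq primeideal.I_notcarr[of P R] ideal.Icarr[OF primeideal.axioms(1), of P R] by blast
    then have "height R (I 1) = Inf {}" unfolding height_def by (intro arg_cong[where f = Inf]) blast
    then show False using assms(4,5) by (simp add: equimultiple_def top_enat_def)
  qed
  obtain y where y: "reduces r y" using ex_reduction[OF dim] ..
  show ?thesis
  proof (rule general_reductions[OF y], intro allI impI)
    fix x Xv k assume Xv: "\<forall>i<r. x i = \<pi> (Xv i)" "reduces r Xv" and k: "n \<le> k"
    \<comment> \<open>\<open>k - 1\<close> is truncated subtraction; n >= 1 makes k a
      successor.\<close>
    obtain l where l: "k = Suc l" using k assms(8) by (cases k) auto
    have "pull (I k) \<subseteq> LF.xI Xv r k" by (rule core[OF dim assms(7,6) I1 Xv(2) assms(8,9) k])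
    then show "I k = (Idl\<^bsub>R\<^esub> (x ` {..<r})) \<cdot>\<^bsub>R\<^esub> I (k - 1)"
      unfolding l using reduction_equality[OF _ Xv(1)] Xv(2) by (simp add: reduces_def)
  qed
qed

end
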